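(* Let $k$ be a field, $Q$ a finite quiver, and let $\Lambda=kQ/I$ with $I\subseteq J^2$ be a Koszul algebra. Let $\{f^n_i\}_{i=0}^{t_n}$ ($n\ge 0$) be uniform elements of $kQ$ defining a minimal projective resolution of $\Lambda_0$ over $\Lambda$, with comultiplicative structure constants $c_{pq}(n,i,r)\in k$, and let $(\mathbb{P},\delta)$ be the associated minimal projective $\Lambda^e$-resolution of $\Lambda$. Suppose that $\Lambda^e$-homomorphisms $\eta\colon P^n\to\Lambda$ and $\theta\colon P^m\to\Lambda$ represent elements in $\mathrm{HH}^*(\Lambda)$ and that they are given by $\eta(\varepsilon^n_i)=\lambda_i$ for $i=0,1,\ldots,t_n$ and $\theta(\varepsilon^m_i)=\lambda'_i$ for $i=0,1,\ldots,t_m$. Then the product $\eta\ast\theta$ in $\mathrm{HH}^{*}(\Lambda)$ is represented by the $\Lambda^e$-homomorphism $P^{m+n}\to\Lambda$ given by \[(\eta\ast\theta)(\varepsilon^{m+n}_i)=\sum_{p=0}^{t_n}\sum_{q=0}^{t_m}c_{pq}(n+m,i,n)\,\lambda_p\lambda'_q\] for all $i=0,1,\ldots,t_{m+n}$.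
   Context: Setting. $R=kQ$ is the path algebra of the finite quiver $Q$ (paths are composed left to right), $J$ is the ideal of $kQ$ generated by the arrows, $I\subseteq J^2$ is an ideal, $\Lambda=kQ/I$, $\mathfrak r=J/I$, $\Lambda_0=\Lambda/\mathfrak r$ (identified with the subalgebra of $\Lambda$ spanned by the vertices). $\Lambda$ is Koszul: $I$ is homogeneous for path length, and in the minimal graded projective resolution of $\Lambda_0$ the $n$-th term is generated in degree $n$. Modules are right modules. $\Lambda^e=\Lambda^{\mathrm{op}}\otimes_k\Lambda$, and right $\Lambda^e$-modules are $\Lambda$-bimodules. A nonzero $x\in kQ$ is uniform if $x=uxv$ for vertices $u,v$; then $\mathfrak o(x)=u$ and $\mathfrak t(x)=v$. The set $\{f^n_i\}$ defines a minimal projective resolution of $\Lambda_0$ as a right $\Lambda$-module if: the $f^n_i$ ($n\ge0$, $0\le i\le t_n$) are uniform elements of $R$; for each $n$ the sum $\sum_i f^n_iR$ is direct, written $\amalg_{i=0}^{t_n} f^n_iR$; there is a chain of right ideals $\cdots\subseteq\amalg_{i=0}^{t_n}f^n_iR\subseteq\amalg_{i=0}^{t_{n-1}}f^{n-1}_iR\subseteq\cdots\subseteq\amalg_{i=0}^{t_0}f^0_iR=R$; and the modules $F^n=\amalg_{i=0}^{t_n} f^n_iR/\amalg_{i=0}^{t_n} f^n_iI$ with differentials induced by the inclusions form a minimal projective resolution of $\Lambda_0$. Here $\{f^0_i\}$ is the set of vertices, $\{f^1_i\}$ the set of arrows, $\{f^2_i\}$ a minimal set of homogeneous degree-two generators of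 $I$, and each $f^n_i$ is a linear combination of paths of length $n$. (The index set is empty if $F^n=0$.) It is known that such sets exist and that there are elements $c_{pq}(n,i,r)\in k$ with \[f^n_i=\sum_{p=0}^{t_r}\sum_{q=0}^{t_{n-r}}c_{pq}(n,i,r)f^r_pf^{n-r}_q\] for all $n\ge1$, $0\le i\le t_n$, $0\le r\le n$ (comultiplicative structure). The minimal projective $\Lambda^e$-resolution $(\mathbb P,\delta)$ of $\Lambda$ (known): $P^n=\amalg_{i=0}^{t_n}\Lambda\mathfrak o(f^n_i)\otimes_k\mathfrak t(f^n_i)\Lambda$; $\varepsilon^n_i\in P^n$ is the element with $\mathfrak o(f^n_i)\otimes\mathfrak t(f^n_i)$ in the $i$-th component and zeros elsewhere; \[\delta^n(\varepsilon^n_i)=\sum_{j=0}^{t_{n-1}}\Big(\sum_{p=0}^{t_1}c_{pj}(n,i,1)\overline{f^1_p}\,\varepsilon^{n-1}_j+(-1)^n\sum_{q=0}^{t_1}c_{jq}(n,i,n-1)\varepsilon^{n-1}_j\overline{f^1_q}\Big)\quad(n\ge1),\] where $\overline{f^1_p}$ is the image of the arrow $f^1_p$ in $\Lambda$, and $\delta^0\colon P^0\to\Lambda$ is multiplication. $\mathrm{HH}^n(\Lambda)=\mathrm{Ext}^n_{\Lambda^e}(\Lambda,\Lambda)$ is the $n$-th cohomology of $\mathrm{Hom}_{\Lambda^e}(\mathbb P,\Lambda)$; $\eta\colon P^n\to\Lambda$ represents an element iff $\eta\delta^{n+1}=0$. The product $\ast$ is the Yoneda product: if $\theta^i\colon P^{m+i}\to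 P^i$ ($i\ge0$) are $\Lambda^e$-homomorphisms with $\delta^0\theta^0=\theta$ and $\theta^{i-1}\delta^{m+i}=\delta^i\theta^i$ for $i\ge1$, then $\eta\ast\theta$ is the class of $\eta\theta^n$ (this agrees with the usual cup product).
   Formalization: The comultiplicative identity for the constants c_pq(n,i,r) is required also for n = 0, since otherwise the constants c_pq(0,i,0) in the product formula for m = n = 0 are undetermined. *)

theory Defs
  imports
    "Graph_Theory.Arc_Walk"
    "HOL-Library.Poly_Mapping"
    "HOL-Algebra.Module"
    "HOL-Algebra.QuotRing"
    "HOL-Algebra.Ideal_Product"
begin

section \<open>Right modules, bimodules and projective resolutions\<close>

text \<open>HOL-Algebra only has modules over commutative rings. As there, module records extend the
  ring record, of which only carrier, zero and addition are meaningful.\<close>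

record ('a, 'm) rmod = "'m ring" +
  rsmult :: "'m \<Rightarrow> 'a \<Rightarrow> 'm"  (infixl \<open>\<triangleleft>\<index>\<close> 70)

record ('a, 'm) bimod = "('a, 'm) rmod" +
  lsmult :: "'a \<Rightarrow> 'm \<Rightarrow> 'm"  (infixr \<open>\<triangleright>\<index>\<close> 70)

locale right_module = A?: ring A + M?: abelian_group M
  for A :: "('a, 'r) ring_scheme" (structure) and M :: "('a, 'm, 's) rmod_scheme" (structure) +
  assumes rsmult_closed: "x \<in> carrier M \<Longrightarrow> a \<in> carrier A \<Longrightarrow> x \<triangleleft>\<^bsub>M\<^esub> a \<in> carrier M"
    and rsmult_add: "x \<in> carrier M \<Longrightarrow> y \<in> carrier M \<Longrightarrow> a \<in> carrier A \<Longrightarrow>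
          (x \<oplus>\<^bsub>M\<^esub> y) \<triangleleft>\<^bsub>M\<^esub> a = (x \<triangleleft>\<^bsub>M\<^esub> a) \<oplus>\<^bsub>M\<^esub> (y \<triangleleft>\<^bsub>M\<^esub> a)"
    and add_rsmult: "x \<in> carrier M \<Longrightarrow> a \<in> carrier A \<Longrightarrow> b \<in> carrier A \<Longrightarrow>
          x \<triangleleft>\<^bsub>M\<^esub> (a \<oplus>\<^bsub>A\<^esub> b) = (x \<triangleleft>\<^bsub>M\<^esub> a) \<oplus>\<^bsub>M\<^esub> (x \<triangleleft>\<^bsub>M\<^esub> b)"
    and rsmult_assoc: "x \<in> carrier M \<Longrightarrow> a \<in> carrier A \<Longrightarrow> b \<in> carrier A \<Longrightarrow>
          x \<triangleleft>\<^bsub>M\<^esub> (a \<otimes>\<^bsub>A\<^esub> b) = (x \<triangleleft>\<^bsub>M\<^esub> a) \<triangleleft>\<^bsub>M\<^esub> b"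
    and rsmult_one: "x \<in> carrier M \<Longrightarrow> x \<triangleleft>\<^bsub>M\<^esub> \<one>\<^bsub>A\<^esub> = x"

definition right_hom ::
  "('a, 'r) ring_scheme \<Rightarrow> ('a, 'm, 's) rmod_scheme \<Rightarrow> ('a, 'n, 't) rmod_scheme \<Rightarrow> ('m \<Rightarrow> 'n) set" where
  "right_hom A M M' = {h \<in> carrier M \<rightarrow> carrier M'.
     (\<forall>x\<in>carrier M. \<forall>y\<in>carrier M. h (x \<oplus>\<^bsub>M\<^esub> y) = h x \<oplus>\<^bsub>M'\<^esub> h y) \<and>
     (\<forall>x\<in>carrier M. \<forall>a\<in>carrier A. h (x \<triangleleft>\<^bsub>M\<^esub> a) = h x \<triangleleft>\<^bsub>M'\<^esub> a)}"

definition right_submodule :: "('a, 'r) ring_scheme \<Rightarrow> ('a, 'm, 's) rmod_scheme \<Rightarrow> 'm set \<Rightarrow> bool" where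
  "right_submodule A M S \<longleftrightarrow> additive_subgroup S M \<and> (\<forall>x\<in>S. \<forall>a\<in>carrier A. x \<triangleleft>\<^bsub>M\<^esub> a \<in> S)"

definition right_span :: "('a, 'r) ring_scheme \<Rightarrow> ('a, 'm, 's) rmod_scheme \<Rightarrow> 'm set \<Rightarrow> 'm set" where
  "right_span A M S = \<Inter>{T. right_submodule A M T \<and> S \<subseteq> T}"

definition free_right_module :: "('a, 'r) ring_scheme \<Rightarrow> 'x set \<Rightarrow> ('a, 'x \<Rightarrow> 'a) rmod" where
  "free_right_module A X =
     \<lparr>carrier = {h. (\<forall>x. h x \<in> carrier A) \<and> (\<forall>x. x \<notin> X \<longrightarrow> h x = \<zero>\<^bsub>A\<^esub>) \<and> finite {x. h x \<noteq> \<zero>\<^bsub>A\<^esub>}},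
      mult = undefined, one = undefined,
      zero = (\<lambda>x. \<zero>\<^bsub>A\<^esub>), add = (\<lambda>g h x. g x \<oplus>\<^bsub>A\<^esub> h x), rsmult = (\<lambda>h a x. h x \<otimes>\<^bsub>A\<^esub> a)\<rparr>"

text \<open>Projective = direct summand of a free module; a basis indexed by elements of the module
  itself is always enough.\<close>

definition projective_right_module :: "('a, 'r) ring_scheme \<Rightarrow> ('a, 'm, 's) rmod_scheme \<Rightarrow> bool" where
  "projective_right_module A M \<longleftrightarrow> right_module A M \<and>
     (\<exists>(X :: 'm set) s p. s \<in> right_hom A M (free_right_module A X) \<and>
        p \<in> right_hom A (free_right_module A X) M \<and> (\<forall>x\<in>carrier M. p (s x) = x))"

text \<open>Here the differential \<open>d n\<close> goes from \<open>D (Suc n)\<close> to \<open>D n\<close>.\<close>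

definition projective_resolution ::
  "('a, 'r) ring_scheme \<Rightarrow> ('a, 'n, 't) rmod_scheme \<Rightarrow> (nat \<Rightarrow> ('a, 'm, 's) rmod_scheme) \<Rightarrow>
   (nat \<Rightarrow> 'm \<Rightarrow> 'm) \<Rightarrow> ('m \<Rightarrow> 'n) \<Rightarrow> bool" where
  "projective_resolution A M D d e \<longleftrightarrow>
     (\<forall>n. projective_right_module A (D n)) \<and>
     (\<forall>n. d n \<in> right_hom A (D (Suc n)) (D n)) \<and>
     e \<in> right_hom A (D 0) M \<and>
     e ` carrier (D 0) = carrier M \<and>
     {x \<in> carrier (D 0). e x = \<zero>\<^bsub>M\<^esub>} = d 0 ` carrier (D 1) \<and>
     (\<forall>n. {x \<in> carrier (D (Suc n)). d n x = \<zero>\<^bsub>D n\<^esub>} = d (Suc n) ` carrier (D (Suc (Suc n))))"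

text \<open>Minimality relative to the ideal \<open>rad\<close>: every differential has image in \<open>D n \<cdot> rad\<close>.\<close>

definition minimal_projective_resolution ::
  "('a, 'r) ring_scheme \<Rightarrow> 'a set \<Rightarrow> ('a, 'n, 't) rmod_scheme \<Rightarrow> (nat \<Rightarrow> ('a, 'm, 's) rmod_scheme) \<Rightarrow>
   (nat \<Rightarrow> 'm \<Rightarrow> 'm) \<Rightarrow> ('m \<Rightarrow> 'n) \<Rightarrow> bool" where
  "minimal_projective_resolution A rad M D d e \<longleftrightarrow>
     projective_resolution A M D d e \<and>
     (\<forall>n. d n ` carrier (D (Suc n)) \<subseteq>
        right_span A (D n) {x \<triangleleft>\<^bsub>D n\<^esub> r | x r. x \<in> carrier (D n) \<and> r \<in> rad})"

definition graded_right_module ::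
  "('a, 'r) ring_scheme \<Rightarrow> (nat \<Rightarrow> 'a set) \<Rightarrow> ('a, 'm, 's) rmod_scheme \<Rightarrow> (nat \<Rightarrow> 'm set) \<Rightarrow> bool" where
  "graded_right_module A Ag M Mg \<longleftrightarrow> right_module A M \<and>
     (\<forall>i. additive_subgroup (Mg i) M) \<and>
     (\<forall>x\<in>carrier M. \<exists>!h. (\<forall>i. h i \<in> Mg i) \<and> finite {i. h i \<noteq> \<zero>\<^bsub>M\<^esub>} \<and>
        x = finsum M h {i. h i \<noteq> \<zero>\<^bsub>M\<^esub>}) \<and>
     (\<forall>i j. \<forall>x\<in>Mg i. \<forall>a\<in>Ag j. x \<triangleleft>\<^bsub>M\<^esub> a \<in> Mg (i + j))"

definition bimod_hom ::
  "('a, 'r) ring_scheme \<Rightarrow> ('a, 'm, 's) bimod_scheme \<Rightarrow> ('a, 'n, 't) bimod_scheme \<Rightarrow> ('m \<Rightarrow> 'n) set" where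
  "bimod_hom A M M' = {h \<in> carrier M \<rightarrow>\<^sub>E carrier M'.
     (\<forall>x\<in>carrier M. \<forall>y\<in>carrier M. h (x \<oplus>\<^bsub>M\<^esub> y) = h x \<oplus>\<^bsub>M'\<^esub> h y) \<and>
     (\<forall>x\<in>carrier M. \<forall>a\<in>carrier A. h (x \<triangleleft>\<^bsub>M\<^esub> a) = h x \<triangleleft>\<^bsub>M'\<^esub> a) \<and>
     (\<forall>x\<in>carrier M. \<forall>a\<in>carrier A. h (a \<triangleright>\<^bsub>M\<^esub> x) = a \<triangleright>\<^bsub>M'\<^esub> h x)}"

definition bimod_hom_group ::
  "('a, 'r) ring_scheme \<Rightarrow> ('a, 'm, 's) bimod_scheme \<Rightarrow> ('a, 'n, 't) bimod_scheme \<Rightarrow> ('m \<Rightarrow> 'n) ring" where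
  "bimod_hom_group A M M' =
     \<lparr>carrier = bimod_hom A M M', mult = undefined, one = undefined,
      zero = (\<lambda>x\<in>carrier M. \<zero>\<^bsub>M'\<^esub>), add = (\<lambda>g h. \<lambda>x\<in>carrier M. g x \<oplus>\<^bsub>M'\<^esub> h x)\<rparr>"

definition regular_bimod :: "('a, 'r) ring_scheme \<Rightarrow> ('a, 'a) bimod" where
  "regular_bimod A =
     \<lparr>carrier = carrier A, mult = undefined, one = undefined, zero = \<zero>\<^bsub>A\<^esub>, add = add A,
      rsmult = mult A, lsmult = mult A\<rparr>"

definition direct_sum_bimod :: "'i set \<Rightarrow> ('i \<Rightarrow> ('a, 'm) bimod) \<Rightarrow> ('a, 'i \<Rightarrow> 'm) bimod" where
  "direct_sum_bimod X M =  \<comment> \<open>only used for finite \<open>X\<close>\<close>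
     \<lparr>carrier = (\<Pi>\<^sub>E i\<in>X. carrier (M i)), mult = undefined, one = undefined,
      zero = (\<lambda>i\<in>X. \<zero>\<^bsub>M i\<^esub>), add = (\<lambda>x y. \<lambda>i\<in>X. x i \<oplus>\<^bsub>M i\<^esub> y i),
      rsmult = (\<lambda>x a. \<lambda>i\<in>X. x i \<triangleleft>\<^bsub>M i\<^esub> a), lsmult = (\<lambda>a x. \<lambda>i\<in>X. a \<triangleright>\<^bsub>M i\<^esub> x i)\<rparr>"

definition direct_sum_inj :: "'i set \<Rightarrow> ('i \<Rightarrow> ('a, 'm) bimod) \<Rightarrow> 'i \<Rightarrow> 'm \<Rightarrow> 'i \<Rightarrow> 'm" where
  "direct_sum_inj X M i z = (\<lambda>j\<in>X. if j = i then z else \<zero>\<^bsub>M j\<^esub>)"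


section \<open>Tensor products over the ground field\<close>

definition pm_scale :: "'k::field \<Rightarrow> ('x \<Rightarrow>\<^sub>0 'k) \<Rightarrow> ('x \<Rightarrow>\<^sub>0 'k)" where
  "pm_scale a x = Poly_Mapping.map ((*) a) x"

text \<open>A \<open>k\<close>-algebra is a ring \<open>A\<close> with a map \<open>\<kappa>\<close> from \<open>k\<close> to the centre of \<open>A\<close>. For a left ideal
  \<open>U\<close> and a right ideal \<open>V\<close> of \<open>A\<close>, the bimodule \<open>U \<otimes>\<^sub>k V\<close> is the quotient of the vector space with
  basis \<open>U \<times> V\<close> by the span of the bilinearity relations.\<close>

definition tensor_null ::
  "('a, 'r) ring_scheme \<Rightarrow> ('k::field \<Rightarrow> 'a) \<Rightarrow> 'a set \<Rightarrow> 'a set \<Rightarrow> (('a \<times> 'a) \<Rightarrow>\<^sub>0 'k) set" where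
  "tensor_null A \<kappa> U V = module.span pm_scale
    ({Poly_Mapping.single (u \<oplus>\<^bsub>A\<^esub> u', v) 1 - Poly_Mapping.single (u, v) 1 - Poly_Mapping.single (u', v) 1
        | u u' v. u \<in> U \<and> u' \<in> U \<and> v \<in> V} \<union>
     {Poly_Mapping.single (u, v \<oplus>\<^bsub>A\<^esub> v') 1 - Poly_Mapping.single (u, v) 1 - Poly_Mapping.single (u, v') 1
        | u v v'. u \<in> U \<and> v \<in> V \<and> v' \<in> V} \<union>
     {Poly_Mapping.single (\<kappa> a \<otimes>\<^bsub>A\<^esub> u, v) 1 - Poly_Mapping.single (u, v) a
        | a u v. u \<in> U \<and> v \<in> V} \<union>
     {Poly_Mapping.single (u, \<kappa> a \<otimes>\<^bsub>A\<^esub> v) 1 - Poly_Mapping.single (u, v) a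
        | a u v. u \<in> U \<and> v \<in> V})"

definition tensor_class ::
  "('a, 'r) ring_scheme \<Rightarrow> ('k::field \<Rightarrow> 'a) \<Rightarrow> 'a set \<Rightarrow> 'a set \<Rightarrow>
   (('a \<times> 'a) \<Rightarrow>\<^sub>0 'k) \<Rightarrow> (('a \<times> 'a) \<Rightarrow>\<^sub>0 'k) set" where
  "tensor_class A \<kappa> U V x = {x + z | z. z \<in> tensor_null A \<kappa> U V}"

definition tensor_bimod ::
  "('a, 'r) ring_scheme \<Rightarrow> ('k::field \<Rightarrow> 'a) \<Rightarrow> 'a set \<Rightarrow> 'a set \<Rightarrow> ('a, (('a \<times> 'a) \<Rightarrow>\<^sub>0 'k) set) bimod" where
  "tensor_bimod A \<kappa> U V =
     \<lparr>carrier = {tensor_class A \<kappa> U V x | x. Poly_Mapping.keys x \<subseteq> U \<times> V},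
      mult = undefined, one = undefined,
      zero = tensor_null A \<kappa> U V,
      add = (\<lambda>X Y. {x + y | x y. x \<in> X \<and> y \<in> Y}),
      rsmult = (\<lambda>X a. \<Union>x\<in>X. tensor_class A \<kappa> U V
         (\<Sum>(u, v)\<in>Poly_Mapping.keys x. Poly_Mapping.single (u, v \<otimes>\<^bsub>A\<^esub> a) (Poly_Mapping.lookup x (u, v)))),
      lsmult = (\<lambda>a X. \<Union>x\<in>X. tensor_class A \<kappa> U V
         (\<Sum>(u, v)\<in>Poly_Mapping.keys x. Poly_Mapping.single (a \<otimes>\<^bsub>A\<^esub> u, v) (Poly_Mapping.lookup x (u, v))))\<rparr>"

definition pure_tensor ::
  "('a, 'r) ring_scheme \<Rightarrow> ('k::field \<Rightarrow> 'a) \<Rightarrow> 'a set \<Rightarrow> 'a set \<Rightarrow> 'a \<Rightarrow> 'a \<Rightarrow> (('a \<times> 'a) \<Rightarrow>\<^sub>0 'k) set" where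
  "pure_tensor A \<kappa> U V u v = tensor_class A \<kappa> U V (Poly_Mapping.single (u, v) 1)"


section \<open>Path algebras and their quotients\<close>

text \<open>A path is a pair of its starting vertex and its list of arrows, from left to right.\<close>

type_synonym ('v, 'b) qpath = "'v \<times> 'b list"
type_synonym ('v, 'b, 'k) path_comb = "('v \<times> 'b list) \<Rightarrow>\<^sub>0 'k"

definition qpaths :: "('v, 'b) pre_digraph \<Rightarrow> ('v, 'b) qpath set" where
  "qpaths Q = {(u, p). \<exists>v. pre_digraph.awalk Q u p v}"

definition qpath_end :: "('v, 'b) pre_digraph \<Rightarrow> ('v, 'b) qpath \<Rightarrow> 'v" where
  "qpath_end Q w = last (pre_digraph.awalk_verts Q (fst w) (snd w))"

definition vertex_elt :: "'v \<Rightarrow> ('v, 'b, 'k::field) path_comb" where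
  "vertex_elt v = Poly_Mapping.single (v, []) 1"

definition arrow_elt :: "('v, 'b) pre_digraph \<Rightarrow> 'b \<Rightarrow> ('v, 'b, 'k::field) path_comb" where
  "arrow_elt Q b = Poly_Mapping.single (tail Q b, [b]) 1"

definition path_algebra :: "('v, 'b) pre_digraph \<Rightarrow> ('v, 'b, 'k::field) path_comb ring" where
  "path_algebra Q =
     \<lparr>carrier = {x. Poly_Mapping.keys x \<subseteq> qpaths Q},
      mult = (\<lambda>x y. \<Sum>w\<in>Poly_Mapping.keys x. \<Sum>w'\<in>Poly_Mapping.keys y.
         if qpath_end Q w = fst w'
         then Poly_Mapping.single (fst w, snd w @ snd w') (Poly_Mapping.lookup x w * Poly_Mapping.lookup y w')
         else 0),
      one = (\<Sum>v\<in>verts Q. vertex_elt v),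
      zero = 0, add = (+)\<rparr>"

definition homogeneous_elts :: "('v, 'b) pre_digraph \<Rightarrow> nat \<Rightarrow> ('v, 'b, 'k::field) path_comb set" where
  "homogeneous_elts Q n = {x. Poly_Mapping.keys x \<subseteq> {w \<in> qpaths Q. length (snd w) = n}}"

definition homogeneous_part :: "nat \<Rightarrow> ('v, 'b, 'k::field) path_comb \<Rightarrow> ('v, 'b, 'k) path_comb" where
  "homogeneous_part n x =
     (\<Sum>w\<in>{w \<in> Poly_Mapping.keys x. length (snd w) = n}. Poly_Mapping.single w (Poly_Mapping.lookup x w))"

definition arrow_ideal :: "('v, 'b) pre_digraph \<Rightarrow> ('v, 'b, 'k::field) path_comb set" where
  "arrow_ideal Q = Idl\<^bsub>path_algebra Q\<^esub> (arrow_elt Q ` arcs Q)"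

definition quot_alg ::
  "('v, 'b) pre_digraph \<Rightarrow> ('v, 'b, 'k::field) path_comb set \<Rightarrow> ('v, 'b, 'k) path_comb set ring" where
  "quot_alg Q I = path_algebra Q Quot I"

definition quot_map ::
  "('v, 'b) pre_digraph \<Rightarrow> ('v, 'b, 'k::field) path_comb set \<Rightarrow> ('v, 'b, 'k) path_comb \<Rightarrow>
   ('v, 'b, 'k) path_comb set" where
  "quot_map Q I x = I +>\<^bsub>path_algebra Q\<^esub> x"

definition quot_scalar ::
  "('v, 'b) pre_digraph \<Rightarrow> ('v, 'b, 'k::field) path_comb set \<Rightarrow> 'k \<Rightarrow> ('v, 'b, 'k) path_comb set" where
  "quot_scalar Q I a = quot_map Q I (pm_scale a \<one>\<^bsub>path_algebra Q\<^esub>)"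

definition quot_rad ::
  "('v, 'b) pre_digraph \<Rightarrow> ('v, 'b, 'k::field) path_comb set \<Rightarrow> ('v, 'b, 'k) path_comb set set" where
  "quot_rad Q I = quot_map Q I ` arrow_ideal Q"

text \<open>\<open>\<Lambda>\<^sub>0 = \<Lambda>/\<rr>\<close> as a right \<open>\<Lambda>\<close>-module, with the canonical projection.\<close>

definition quot_top ::
  "('v, 'b) pre_digraph \<Rightarrow> ('v, 'b, 'k::field) path_comb set \<Rightarrow>
   (('v, 'b, 'k) path_comb set, ('v, 'b, 'k) path_comb set set) rmod" where
  "quot_top Q I = (let S = quot_alg Q I Quot quot_rad Q I in
     \<lparr>carrier = carrier S, mult = undefined, one = undefined, zero = \<zero>\<^bsub>S\<^esub>, add = add S,
      rsmult = (\<lambda>X a. X \<otimes>\<^bsub>S\<^esub> (quot_rad Q I +>\<^bsub>quot_alg Q I\<^esub> a))\<rparr>)"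

definition top_proj ::
  "('v, 'b) pre_digraph \<Rightarrow> ('v, 'b, 'k::field) path_comb set \<Rightarrow>
   ('v, 'b, 'k) path_comb set \<Rightarrow> ('v, 'b, 'k) path_comb set set" where
  "top_proj Q I a = quot_rad Q I +>\<^bsub>quot_alg Q I\<^esub> a"

definition quot_grade ::
  "('v, 'b) pre_digraph \<Rightarrow> ('v, 'b, 'k::field) path_comb set \<Rightarrow> nat \<Rightarrow> ('v, 'b, 'k) path_comb set set" where
  "quot_grade Q I i = quot_map Q I ` homogeneous_elts Q i"

definition homogeneous_ideal :: "('v, 'b, 'k::field) path_comb set \<Rightarrow> bool" where
  "homogeneous_ideal I \<longleftrightarrow> (\<forall>x\<in>I. \<forall>i. homogeneous_part i x \<in> I)"

text \<open>\<open>I\<close> is homogeneous and the minimal graded projective resolution of \<open>\<Lambda>\<^sub>0\<close> (which is unique up to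
  isomorphism) has its \<open>n\<close>-th term generated in degree \<open>n\<close>. Since \<open>Q\<close> is finite, the terms of that
  resolution are countably generated, so up to isomorphism they are found among modules whose
  elements are sequences in \<open>\<Lambda>\<close>; this explains the type of \<open>D\<close>.\<close>

definition koszul :: "('v, 'b) pre_digraph \<Rightarrow> ('v, 'b, 'k::field) path_comb set \<Rightarrow> bool" where
  "koszul Q I \<longleftrightarrow> homogeneous_ideal I \<and>
     (\<exists>(D :: nat \<Rightarrow> (('v, 'b, 'k) path_comb set, nat \<Rightarrow> ('v, 'b, 'k) path_comb set) rmod) Dg d e.
        minimal_projective_resolution (quot_alg Q I) (quot_rad Q I) (quot_top Q I) D d e \<and>
        (\<forall>n. graded_right_module (quot_alg Q I) (quot_grade Q I) (D n) (Dg n)) \<and>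
        (\<forall>n i. d n ` Dg (Suc n) i \<subseteq> Dg n i) \<and>
        (\<forall>i>0. \<forall>x\<in>Dg 0 i. e x = \<zero>\<^bsub>quot_top Q I\<^esub>) \<and>
        (\<forall>n. carrier (D n) = right_span (quot_alg Q I) (D n) (Dg n n)))"

definition uniform :: "('v, 'b) pre_digraph \<Rightarrow> ('v, 'b, 'k::field) path_comb \<Rightarrow> bool" where
  "uniform Q x \<longleftrightarrow> x \<in> carrier (path_algebra Q) \<and> x \<noteq> 0 \<and>
     (\<exists>u\<in>verts Q. \<exists>v\<in>verts Q.
        x = vertex_elt u \<otimes>\<^bsub>path_algebra Q\<^esub> x \<otimes>\<^bsub>path_algebra Q\<^esub> vertex_elt v)"

definition uorigin :: "('v, 'b) pre_digraph \<Rightarrow> ('v, 'b, 'k::field) path_comb \<Rightarrow> 'v" where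
  "uorigin Q x = (THE u. u \<in> verts Q \<and> (\<exists>v\<in>verts Q.
     x = vertex_elt u \<otimes>\<^bsub>path_algebra Q\<^esub> x \<otimes>\<^bsub>path_algebra Q\<^esub> vertex_elt v))"

definition uterminus :: "('v, 'b) pre_digraph \<Rightarrow> ('v, 'b, 'k::field) path_comb \<Rightarrow> 'v" where
  "uterminus Q x = (THE v. v \<in> verts Q \<and> (\<exists>u\<in>verts Q.
     x = vertex_elt u \<otimes>\<^bsub>path_algebra Q\<^esub> x \<otimes>\<^bsub>path_algebra Q\<^esub> vertex_elt v))"


section \<open>Resolutions given by elements of the path algebra\<close>

text \<open>The family \<open>f\<^sup>n\<^sub>i\<close> is \<open>f n i\<close> with \<open>i < N n\<close>; so \<open>N n\<close> is \<open>t\<^sub>n + 1\<close>, or \<open>0\<close> if the index set is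
  empty. For a right ideal \<open>S\<close> the following set is \<open>\<Sum>\<^sub>i f\<^sup>n\<^sub>i S\<close>.\<close>

definition res_sum ::
  "('v, 'b) pre_digraph \<Rightarrow> (nat \<Rightarrow> nat) \<Rightarrow> (nat \<Rightarrow> nat \<Rightarrow> ('v, 'b, 'k::field) path_comb) \<Rightarrow>
   ('v, 'b, 'k) path_comb set \<Rightarrow> nat \<Rightarrow> ('v, 'b, 'k) path_comb set" where
  "res_sum Q N f S n = {\<Sum>i<N n. f n i \<otimes>\<^bsub>path_algebra Q\<^esub> r i | r. \<forall>i<N n. r i \<in> S}"

text \<open>\<open>F\<^sup>n = \<Sum>\<^sub>i f\<^sup>n\<^sub>i R / \<Sum>\<^sub>i f\<^sup>n\<^sub>i I\<close>, whose elements are cosets in \<open>R = kQ\<close>.\<close>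

definition res_mod ::
  "('v, 'b) pre_digraph \<Rightarrow> ('v, 'b, 'k::field) path_comb set \<Rightarrow> (nat \<Rightarrow> nat) \<Rightarrow>
   (nat \<Rightarrow> nat \<Rightarrow> ('v, 'b, 'k) path_comb) \<Rightarrow> nat \<Rightarrow>
   (('v, 'b, 'k) path_comb set, ('v, 'b, 'k) path_comb set) rmod" where
  "res_mod Q I N f n = (let R = path_algebra Q; B = res_sum Q N f I n in
     \<lparr>carrier = {B +>\<^bsub>R\<^esub> x | x. x \<in> res_sum Q N f (carrier R) n},
      mult = undefined, one = undefined, zero = B, add = set_add R, rsmult = rcoset_mult R B\<rparr>)"

text \<open>Induced by the inclusion: maps a coset \<open>B\<^sub>n\<^sub>+\<^sub>1 + x\<close> to \<open>B\<^sub>n + x\<close>.\<close>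

definition res_diff ::
  "('v, 'b) pre_digraph \<Rightarrow> ('v, 'b, 'k::field) path_comb set \<Rightarrow> (nat \<Rightarrow> nat) \<Rightarrow>
   (nat \<Rightarrow> nat \<Rightarrow> ('v, 'b, 'k) path_comb) \<Rightarrow> nat \<Rightarrow>
   ('v, 'b, 'k) path_comb set \<Rightarrow> ('v, 'b, 'k) path_comb set" where
  "res_diff Q I N f n X = res_sum Q N f I n <+>\<^bsub>path_algebra Q\<^esub> X"

text \<open>Since \<open>f\<^sup>0\<close> enumerates the vertices, \<open>F\<^sup>0\<close> consists of the same cosets as \<open>\<Lambda>\<close>, so \<open>top_proj\<close> is
  the augmentation.\<close>

definition defines_minimal_resolution ::
  "('v, 'b) pre_digraph \<Rightarrow> ('v, 'b, 'k::field) path_comb set \<Rightarrow> (nat \<Rightarrow> nat) \<Rightarrow>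
   (nat \<Rightarrow> nat \<Rightarrow> ('v, 'b, 'k) path_comb) \<Rightarrow> bool" where
  "defines_minimal_resolution Q I N f \<longleftrightarrow> (let R = path_algebra Q in
     (\<forall>n. \<forall>i<N n. uniform Q (f n i) \<and> f n i \<in> homogeneous_elts Q n) \<and>
     (\<forall>n r. (\<forall>i<N n. r i \<in> carrier R) \<longrightarrow> (\<Sum>i<N n. f n i \<otimes>\<^bsub>R\<^esub> r i) = 0 \<longrightarrow>
        (\<forall>i<N n. f n i \<otimes>\<^bsub>R\<^esub> r i = 0)) \<and>
     res_sum Q N f (carrier R) 0 = carrier R \<and>
     (\<forall>n. res_sum Q N f (carrier R) (Suc n) \<subseteq> res_sum Q N f (carrier R) n) \<and>
     bij_betw (f 0) {..<N 0} (vertex_elt ` verts Q) \<and>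
     bij_betw (f 1) {..<N 1} (arrow_elt Q ` arcs Q) \<and>
     inj_on (f 2) {..<N 2} \<and>
     Idl\<^bsub>R\<^esub> (f 2 ` {..<N 2}) = I \<and>
     (\<forall>S. S \<subset> f 2 ` {..<N 2} \<longrightarrow> Idl\<^bsub>R\<^esub> S \<noteq> I) \<and>
     minimal_projective_resolution (quot_alg Q I) (quot_rad Q I) (quot_top Q I)
       (res_mod Q I N f) (res_diff Q I N f) (top_proj Q I))"

text \<open>\<open>c n i r p q\<close> is \<open>c\<^sub>p\<^sub>q(n,i,r)\<close>. The case \<open>n = 0\<close> is included, so that also the constants
  \<open>c\<^sub>p\<^sub>q(0,i,0)\<close> are determined.\<close>

definition comultiplicative_structure ::
  "('v, 'b) pre_digraph \<Rightarrow> (nat \<Rightarrow> nat) \<Rightarrow> (nat \<Rightarrow> nat \<Rightarrow> ('v, 'b, 'k::field) path_comb) \<Rightarrow>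
   (nat \<Rightarrow> nat \<Rightarrow> nat \<Rightarrow> nat \<Rightarrow> nat \<Rightarrow> 'k) \<Rightarrow> bool" where
  "comultiplicative_structure Q N f c \<longleftrightarrow>
     (\<forall>n. \<forall>i<N n. \<forall>r\<le>n.
        f n i = (\<Sum>p<N r. \<Sum>q<N (n - r). pm_scale (c n i r p q) (f r p \<otimes>\<^bsub>path_algebra Q\<^esub> f (n - r) q)))"


section \<open>The bimodule resolution\<close>

definition left_proj ::
  "('v, 'b) pre_digraph \<Rightarrow> ('v, 'b, 'k::field) path_comb set \<Rightarrow> 'v \<Rightarrow> ('v, 'b, 'k) path_comb set set" where
  "left_proj Q I v = {a \<otimes>\<^bsub>quot_alg Q I\<^esub> quot_map Q I (vertex_elt v) | a. a \<in> carrier (quot_alg Q I)}"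

definition right_proj ::
  "('v, 'b) pre_digraph \<Rightarrow> ('v, 'b, 'k::field) path_comb set \<Rightarrow> 'v \<Rightarrow> ('v, 'b, 'k) path_comb set set" where
  "right_proj Q I v = {quot_map Q I (vertex_elt v) \<otimes>\<^bsub>quot_alg Q I\<^esub> a | a. a \<in> carrier (quot_alg Q I)}"

type_synonym ('v, 'b, 'k) res_elt =
  "nat \<Rightarrow> ((('v, 'b, 'k) path_comb set \<times> ('v, 'b, 'k) path_comb set) \<Rightarrow>\<^sub>0 'k) set"

definition bires_summand ::
  "('v, 'b) pre_digraph \<Rightarrow> ('v, 'b, 'k::field) path_comb set \<Rightarrow>
   (nat \<Rightarrow> nat \<Rightarrow> ('v, 'b, 'k) path_comb) \<Rightarrow> nat \<Rightarrow> nat \<Rightarrow>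
   (('v, 'b, 'k) path_comb set,
    ((('v, 'b, 'k) path_comb set \<times> ('v, 'b, 'k) path_comb set) \<Rightarrow>\<^sub>0 'k) set) bimod" where
  "bires_summand Q I f n i = tensor_bimod (quot_alg Q I) (quot_scalar Q I)
     (left_proj Q I (uorigin Q (f n i))) (right_proj Q I (uterminus Q (f n i)))"

definition bires ::
  "('v, 'b) pre_digraph \<Rightarrow> ('v, 'b, 'k::field) path_comb set \<Rightarrow> (nat \<Rightarrow> nat) \<Rightarrow>
   (nat \<Rightarrow> nat \<Rightarrow> ('v, 'b, 'k) path_comb) \<Rightarrow> nat \<Rightarrow>
   (('v, 'b, 'k) path_comb set, ('v, 'b, 'k) res_elt) bimod" where
  "bires Q I N f n = direct_sum_bimod {..<N n} (bires_summand Q I f n)"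

text \<open>The element \<open>a \<otimes> b\<close> of the \<open>i\<close>-th summand.\<close>

definition bires_tensor ::
  "('v, 'b) pre_digraph \<Rightarrow> ('v, 'b, 'k::field) path_comb set \<Rightarrow> (nat \<Rightarrow> nat) \<Rightarrow>
   (nat \<Rightarrow> nat \<Rightarrow> ('v, 'b, 'k) path_comb) \<Rightarrow> nat \<Rightarrow> nat \<Rightarrow>
   ('v, 'b, 'k) path_comb set \<Rightarrow> ('v, 'b, 'k) path_comb set \<Rightarrow> ('v, 'b, 'k) res_elt" where
  "bires_tensor Q I N f n i a b = direct_sum_inj {..<N n} (bires_summand Q I f n) i
     (pure_tensor (quot_alg Q I) (quot_scalar Q I)
        (left_proj Q I (uorigin Q (f n i))) (right_proj Q I (uterminus Q (f n i))) a b)"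

definition bires_gen ::
  "('v, 'b) pre_digraph \<Rightarrow> ('v, 'b, 'k::field) path_comb set \<Rightarrow> (nat \<Rightarrow> nat) \<Rightarrow>
   (nat \<Rightarrow> nat \<Rightarrow> ('v, 'b, 'k) path_comb) \<Rightarrow> nat \<Rightarrow> nat \<Rightarrow> ('v, 'b, 'k) res_elt" where
  "bires_gen Q I N f n i = bires_tensor Q I N f n i
     (quot_map Q I (vertex_elt (uorigin Q (f n i)))) (quot_map Q I (vertex_elt (uterminus Q (f n i))))"

text \<open>The differential \<open>\<delta>\<^sup>n : P\<^sup>n \<rightarrow> P\<^sup>n\<^sup>-\<^sup>1\<close>, for \<open>n \<ge> 1\<close> only. Scalars act through \<open>quot_scalar\<close>.\<close>

definition bires_diff ::
  "('v, 'b) pre_digraph \<Rightarrow> ('v, 'b, 'k::field) path_comb set \<Rightarrow> (nat \<Rightarrow> nat) \<Rightarrow>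
   (nat \<Rightarrow> nat \<Rightarrow> ('v, 'b, 'k) path_comb) \<Rightarrow> (nat \<Rightarrow> nat \<Rightarrow> nat \<Rightarrow> nat \<Rightarrow> nat \<Rightarrow> 'k) \<Rightarrow> nat \<Rightarrow>
   ('v, 'b, 'k) res_elt \<Rightarrow> ('v, 'b, 'k) res_elt" where
  "bires_diff Q I N f c n =
     (let P' = bires Q I N f (n - 1); \<epsilon>' = bires_gen Q I N f (n - 1);
          \<kappa> = quot_scalar Q I; arr = (\<lambda>p. quot_map Q I (f 1 p)) in
      THE h. h \<in> bimod_hom (quot_alg Q I) (bires Q I N f n) P' \<and>
        (\<forall>i<N n. h (bires_gen Q I N f n i) =
           (\<Oplus>\<^bsub>P'\<^esub>j\<in>{..<N (n - 1)}.
              (\<Oplus>\<^bsub>P'\<^esub>p\<in>{..<N 1}. \<kappa> (c n i 1 p j) \<triangleright>\<^bsub>P'\<^esub> (arr p \<triangleright>\<^bsub>P'\<^esub> \<epsilon>' j))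
              \<oplus>\<^bsub>P'\<^esub>
              \<kappa> ((- 1) ^ n) \<triangleright>\<^bsub>P'\<^esub>
                (\<Oplus>\<^bsub>P'\<^esub>q\<in>{..<N 1}. \<kappa> (c n i (n - 1) j q) \<triangleright>\<^bsub>P'\<^esub> (\<epsilon>' j \<triangleleft>\<^bsub>P'\<^esub> arr q)))))"

text \<open>The multiplication map \<open>\<delta>\<^sup>0 : P\<^sup>0 \<rightarrow> \<Lambda>\<close>.\<close>

definition bires_aug ::
  "('v, 'b) pre_digraph \<Rightarrow> ('v, 'b, 'k::field) path_comb set \<Rightarrow> (nat \<Rightarrow> nat) \<Rightarrow>
   (nat \<Rightarrow> nat \<Rightarrow> ('v, 'b, 'k) path_comb) \<Rightarrow> ('v, 'b, 'k) res_elt \<Rightarrow> ('v, 'b, 'k) path_comb set" where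
  "bires_aug Q I N f =
     (THE h. h \<in> bimod_hom (quot_alg Q I) (bires Q I N f 0) (regular_bimod (quot_alg Q I)) \<and>
        (\<forall>i<N 0. \<forall>a\<in>left_proj Q I (uorigin Q (f 0 i)). \<forall>b\<in>right_proj Q I (uterminus Q (f 0 i)).
           h (bires_tensor Q I N f 0 i a b) = a \<otimes>\<^bsub>quot_alg Q I\<^esub> b))"


section \<open>Hochschild cohomology and the Yoneda product\<close>

text \<open>In this section \<open>(P, \<delta>)\<close> with augmentation \<open>\<delta>0\<close> is a projective bimodule resolution of \<open>A\<close>,
  \<open>\<delta> n\<close> (for \<open>n \<ge> 1\<close>) being a map from \<open>P n\<close> to \<open>P (n - 1)\<close>.\<close>

definition HH_cocycles ::
  "('a, 'r) ring_scheme \<Rightarrow> (nat \<Rightarrow> ('a, 'm) bimod) \<Rightarrow> (nat \<Rightarrow> 'm \<Rightarrow> 'm) \<Rightarrow> nat \<Rightarrow> ('m \<Rightarrow> 'a) set" where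
  "HH_cocycles A P \<delta> n = {\<eta> \<in> bimod_hom A (P n) (regular_bimod A).
     \<forall>x\<in>carrier (P (n + 1)). \<eta> (\<delta> (n + 1) x) = \<zero>\<^bsub>A\<^esub>}"

definition HH_coboundaries ::
  "('a, 'r) ring_scheme \<Rightarrow> (nat \<Rightarrow> ('a, 'm) bimod) \<Rightarrow> (nat \<Rightarrow> 'm \<Rightarrow> 'm) \<Rightarrow> nat \<Rightarrow> ('m \<Rightarrow> 'a) set" where
  "HH_coboundaries A P \<delta> n =
     (if n = 0 then {\<lambda>x\<in>carrier (P 0). \<zero>\<^bsub>A\<^esub>}
      else {compose (carrier (P n)) \<xi> (\<delta> n) | \<xi>. \<xi> \<in> bimod_hom A (P (n - 1)) (regular_bimod A)})"

definition HH_class ::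
  "('a, 'r) ring_scheme \<Rightarrow> (nat \<Rightarrow> ('a, 'm) bimod) \<Rightarrow> (nat \<Rightarrow> 'm \<Rightarrow> 'm) \<Rightarrow> nat \<Rightarrow>
   ('m \<Rightarrow> 'a) \<Rightarrow> ('m \<Rightarrow> 'a) set" where
  "HH_class A P \<delta> n \<eta> = HH_coboundaries A P \<delta> n +>\<^bsub>bimod_hom_group A (P n) (regular_bimod A)\<^esub> \<eta>"

definition HH ::
  "('a, 'r) ring_scheme \<Rightarrow> (nat \<Rightarrow> ('a, 'm) bimod) \<Rightarrow> (nat \<Rightarrow> 'm \<Rightarrow> 'm) \<Rightarrow> nat \<Rightarrow> ('m \<Rightarrow> 'a) set set" where
  "HH A P \<delta> n = HH_class A P \<delta> n ` HH_cocycles A P \<delta> n"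

definition chain_lifting ::
  "('a, 'r) ring_scheme \<Rightarrow> (nat \<Rightarrow> ('a, 'm) bimod) \<Rightarrow> (nat \<Rightarrow> 'm \<Rightarrow> 'm) \<Rightarrow> ('m \<Rightarrow> 'a) \<Rightarrow> nat \<Rightarrow>
   ('m \<Rightarrow> 'a) \<Rightarrow> (nat \<Rightarrow> 'm \<Rightarrow> 'm) \<Rightarrow> bool" where
  "chain_lifting A P \<delta> \<delta>0 m \<theta> \<Theta> \<longleftrightarrow>
     (\<forall>i. \<Theta> i \<in> bimod_hom A (P (m + i)) (P i)) \<and>
     (\<forall>x\<in>carrier (P m). \<delta>0 (\<Theta> 0 x) = \<theta> x) \<and>
     (\<forall>i\<ge>1. \<forall>x\<in>carrier (P (m + i)). \<Theta> (i - 1) (\<delta> (m + i) x) = \<delta> i (\<Theta> i x))"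

text \<open>The product of \<open>a \<in> HH\<^sup>n\<close> and \<open>b \<in> HH\<^sup>m\<close>: the class of \<open>\<eta> \<circ> \<Theta>\<^sup>n\<close>, which does not depend on the
  choice of the representatives \<open>\<eta>\<close>, \<open>\<theta>\<close> and of the lifting \<open>\<Theta>\<close> of \<open>\<theta>\<close>.\<close>

definition yoneda_product ::
  "('a, 'r) ring_scheme \<Rightarrow> (nat \<Rightarrow> ('a, 'm) bimod) \<Rightarrow> (nat \<Rightarrow> 'm \<Rightarrow> 'm) \<Rightarrow> ('m \<Rightarrow> 'a) \<Rightarrow> nat \<Rightarrow> nat \<Rightarrow>
   ('m \<Rightarrow> 'a) set \<Rightarrow> ('m \<Rightarrow> 'a) set \<Rightarrow> ('m \<Rightarrow> 'a) set" where
  "yoneda_product A P \<delta> \<delta>0 n m a b =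
     (THE z. \<exists>\<eta>\<in>a. \<exists>\<theta>\<in>b. \<exists>\<Theta>. chain_lifting A P \<delta> \<delta>0 m \<theta> \<Theta> \<and>
        z = HH_class A P \<delta> (m + n) (compose (carrier (P (m + n))) \<eta> (\<Theta> n)))"

end

theory Submission
  imports Defs
begin

text \<open>
  The Yoneda product is computed with the lifting \<open>\<Theta>\<^sup>i(\<epsilon>\<^sup>m\<^sup>+\<^sup>i\<^sub>l) = \<Sum> c\<^sub>p\<^sub>q(m+i,l,i) \<epsilon>\<^sup>i\<^sub>p \<lambda>'\<^sub>q\<close> of \<open>\<theta>\<close>. It commutes with the
  differentials because the structure constants are coassociative on composable triples, and because the cocycle
  condition turns a left multiplication by arrows into a right multiplication up to the sign \<open>(-1)\<^sup>m\<close>; then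
  \<open>\<eta> \<Theta>\<^sup>n\<close> has the asserted values. That the product does not depend on the lifting needs the exactness of the bimodule
  resolution. In positive degrees, write an element as a finite sum of terms \<open>s \<otimes> b\<close> with \<open>s\<close> in a homogeneous basis of
  paths: the terms of a cycle with \<open>s\<close> of lowest degree form a cycle of the right resolution of \<open>\<Lambda>\<^sub>0\<close>, so that they can be
  removed by subtracting a boundary, and a bound on the total degree makes this procedure stop.
\<close>

section \<open>Finitely supported functions\<close>

text \<open>A product of \<open>f\<close>s whose vertices do not match is zero, so structure
  constants at non-composable indices are arbitrary. Identities between them hold only inside sums
  whose terms vanish at such indices, and every use of coassociativity carries a proof of that
  vanishing. The algebra may be infinite dimensional, so nilpotence of the radical cannot end the
  procedure for exactness. The differential is instead a left half plus a sign times a right half: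
  the left half lengthens the left basis path by exactly one, the right half keeps it. Hence in the
  lowest left length a cycle is killed by the right half alone, which on right factors is the
  differential of the right resolution. Lifting through it lowers the degree bound of the right
  factors by one, just as much as the left half then adds on the left. Homogeneity of
  \<open>I\<close> makes both degrees meaningful in the quotient. In degree 0 exactness has another
  reason: modulo boundaries all arrows move to the left of the tensor sign. In the lifting no extra
  sign appears because the \<open>(-1)^m\<close> of the cocycle condition is exactly the quotient of
  the signs \<open>(-1)^(m+i+1)\<close> and \<open>(-1)^(i+1)\<close> of the two
  differentials.\<close>

lemma lookup_pm_scale [simp]: "Poly_Mapping.lookup (pm_scale a x) w = a * Poly_Mapping.lookup x w"
  by (simp add: pm_scale_def Poly_Mapping.map.rep_eq when_def)

text \<open>Makes spans, subspaces and bases available for formal combinations: the relations of a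
  tensor product are a span, and normal forms modulo \<open>I\<close> come from extending a
  basis.\<close>

interpretation pm: vector_space "pm_scale :: 'k::field \<Rightarrow> ('x \<Rightarrow>\<^sub>0 'k) \<Rightarrow> ('x \<Rightarrow>\<^sub>0 'k)"
  by unfold_locales (auto intro!: poly_mapping_eqI simp: lookup_add algebra_simps)

lemma pm_scale_single [simp]: "pm_scale a (Poly_Mapping.single w b) = Poly_Mapping.single w (a * b)"
  by (auto intro!: poly_mapping_eqI simp: lookup_single when_def)

lemma subspace_keys: "pm.subspace {x. Poly_Mapping.keys x \<subseteq> W}"
  unfolding pm.subspace_def by (auto simp: in_keys_iff lookup_add) (metis add.right_neutral in_keys_iff subsetD)

lemma keys_pm_scale: "Poly_Mapping.keys (pm_scale a x) \<subseteq> Poly_Mapping.keys x"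
  by (auto simp: in_keys_iff)

lemma keys_add_subset: "Poly_Mapping.keys x \<subseteq> W \<Longrightarrow> Poly_Mapping.keys y \<subseteq> W \<Longrightarrow> Poly_Mapping.keys (x + y) \<subseteq> W"
  using keys_add[of x y] by blast

lemma keys_sum_subset:
  fixes f :: "'i \<Rightarrow> ('x \<Rightarrow>\<^sub>0 'k::field)"
  shows "(\<And>i. i \<in> X \<Longrightarrow> Poly_Mapping.keys (f i) \<subseteq> W) \<Longrightarrow> Poly_Mapping.keys (sum f X) \<subseteq> W"
  using pm.subspace_sum[OF subspace_keys[of W], of X f] by simp

text \<open>The linear extension of a map on basis elements; the actions on tensor products and the
  multiplication of paths are both instances of it.\<close>

definition pm_ext :: "('x \<Rightarrow> ('y \<Rightarrow>\<^sub>0 'k::field)) \<Rightarrow> ('x \<Rightarrow>\<^sub>0 'k) \<Rightarrow> ('y \<Rightarrow>\<^sub>0 'k)" where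
  "pm_ext g x = (\<Sum>w\<in>Poly_Mapping.keys x. pm_scale (Poly_Mapping.lookup x w) (g w))"

text \<open>Cancellation can make the support of a sum smaller than the union of the supports, so
  additivity is checked over a common finite superset.\<close>

lemma pm_ext_superset:
  assumes "finite F" "Poly_Mapping.keys x \<subseteq> F"
  shows "pm_ext g x = (\<Sum>w\<in>F. pm_scale (Poly_Mapping.lookup x w) (g w))"
  unfolding pm_ext_def by (rule sum.mono_neutral_left) (use assms in \<open>auto simp: in_keys_iff\<close>)

lemma pm_ext_add: "pm_ext g (x + y) = pm_ext g x + pm_ext g y"
proof -
  let ?F = "Poly_Mapping.keys x \<union> Poly_Mapping.keys y"
  have "pm_ext g (x + y) = (\<Sum>w\<in>?F. pm_scale (Poly_Mapping.lookup (x + y) w) (g w))"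
    by (rule pm_ext_superset) (auto simp: keys_add)
  also have "\<dots> = pm_ext g x + pm_ext g y"
    by (simp add: pm_ext_superset[of ?F] lookup_add pm.scale_left_distrib sum.distrib)
  finally show ?thesis .
qed

lemma pm_ext_scale: "pm_ext g (pm_scale a x) = pm_scale a (pm_ext g x)"
proof -
  have "pm_ext g (pm_scale a x) = (\<Sum>w\<in>Poly_Mapping.keys x. pm_scale (Poly_Mapping.lookup (pm_scale a x) w) (g w))"
    by (rule pm_ext_superset) (auto simp: keys_pm_scale)
  then show ?thesis
    by (simp add: pm_ext_def pm.scale_sum_right)
qed

lemma pm_ext_single [simp]: "pm_ext g (Poly_Mapping.single w a) = pm_scale a (g w)"
  by (subst pm_ext_superset[of "{w}"]) auto

lemma pm_expand: "x = (\<Sum>w\<in>Poly_Mapping.keys x. Poly_Mapping.single w (Poly_Mapping.lookup x w))"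
proof (rule poly_mapping_eqI)
  fix v
  have "(\<Sum>w\<in>Poly_Mapping.keys x. Poly_Mapping.lookup (Poly_Mapping.single w (Poly_Mapping.lookup x w)) v)
      = (\<Sum>w\<in>Poly_Mapping.keys x. if v = w then Poly_Mapping.lookup x w else 0)"
    by (intro sum.cong) (auto simp: lookup_single when_def)
  also have "\<dots> = Poly_Mapping.lookup x v"
    by (simp add: sum.delta' in_keys_iff)
  finally show "Poly_Mapping.lookup x v =
      Poly_Mapping.lookup (\<Sum>w\<in>Poly_Mapping.keys x. Poly_Mapping.single w (Poly_Mapping.lookup x w)) v"
    by (simp add: lookup_sum)
qed

text \<open>Singletons carry an arbitrary coefficient, so no case for scalar multiples arises, and
  both summands keep their support inside \<open>W\<close>.\<close>

lemma pm_induct [consumes 1, case_names zero single add]: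
  fixes x :: "'x \<Rightarrow>\<^sub>0 'k::field"
  assumes "Poly_Mapping.keys x \<subseteq> W"
    and "P 0" and "\<And>w a. w \<in> W \<Longrightarrow> P (Poly_Mapping.single w a)"
    and "\<And>x y. Poly_Mapping.keys x \<subseteq> W \<Longrightarrow> Poly_Mapping.keys y \<subseteq> W \<Longrightarrow> P x \<Longrightarrow> P y \<Longrightarrow> P (x + y)"
  shows "P x"
proof -
  have "finite F \<Longrightarrow> F \<subseteq> W \<Longrightarrow> P (\<Sum>w\<in>F. Poly_Mapping.single w (Poly_Mapping.lookup x w))" for F
  proof (induction F rule: finite_induct)
    case (insert w F)
    have "Poly_Mapping.keys (\<Sum>w\<in>F. Poly_Mapping.single w (Poly_Mapping.lookup x w)) \<subseteq> W"
      by (rule keys_sum_subset) (use insert.prems in \<open>auto split: if_splits\<close>)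
    then show ?case using insert by (auto intro!: assms(3,4) split: if_splits)
  qed (use assms(2) in simp)
  from this[OF finite_keys assms(1)] show ?thesis using pm_expand[of x] by metis
qed

section \<open>Sums in abelian groups\<close>

text \<open>Bimodule homomorphisms, the actions as functions of either argument and the coordinate
  functions used for exactness have only additivity in common, so zero, negatives and sums are
  treated for additive maps between abelian groups.\<close>

lemma additive_map_zero:
  assumes "abelian_group M" "abelian_group M'" "h \<in> carrier M \<rightarrow> carrier M'"
    and "\<And>x y. x \<in> carrier M \<Longrightarrow> y \<in> carrier M \<Longrightarrow> h (x \<oplus>\<^bsub>M\<^esub> y) = h x \<oplus>\<^bsub>M'\<^esub> h y"
  shows "h \<zero>\<^bsub>M\<^esub> = \<zero>\<^bsub>M'\<^esub>"
proof -
  interpret M: abelian_group M by fact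
  interpret M': abelian_group M' by fact
  have "h \<zero>\<^bsub>M\<^esub> \<oplus>\<^bsub>M'\<^esub> h \<zero>\<^bsub>M\<^esub> = h \<zero>\<^bsub>M\<^esub>" using assms(4)[of "\<zero>\<^bsub>M\<^esub>" "\<zero>\<^bsub>M\<^esub>"] by simp
  moreover have "h \<zero>\<^bsub>M\<^esub> \<in> carrier M'" using assms(3) by auto
  ultimately show ?thesis using M'.add.r_cancel_one by blast
qed

lemma additive_map_minus:
  assumes "abelian_group M" "abelian_group M'" "h \<in> carrier M \<rightarrow> carrier M'"
    and "\<And>x y. x \<in> carrier M \<Longrightarrow> y \<in> carrier M \<Longrightarrow> h (x \<oplus>\<^bsub>M\<^esub> y) = h x \<oplus>\<^bsub>M'\<^esub> h y"
    and x: "x \<in> carrier M"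
  shows "h (\<ominus>\<^bsub>M\<^esub> x) = \<ominus>\<^bsub>M'\<^esub> h x"
proof -
  interpret M: abelian_group M by fact
  interpret M': abelian_group M' by fact
  have "h (\<ominus>\<^bsub>M\<^esub> x) \<oplus>\<^bsub>M'\<^esub> h x = \<zero>\<^bsub>M'\<^esub>"
    using assms(4)[of "\<ominus>\<^bsub>M\<^esub> x" x] x additive_map_zero[OF assms(1-4)] by (simp add: M.l_neg)
  moreover have "h (\<ominus>\<^bsub>M\<^esub> x) \<in> carrier M'" "h x \<in> carrier M'" using assms(3) x by auto
  ultimately show ?thesis using M'.minus_equality by metis
qed

lemma additive_map_finsum:
  assumes "abelian_group M" "abelian_group M'" "h \<in> carrier M \<rightarrow> carrier M'"
    and "\<And>x y. x \<in> carrier M \<Longrightarrow> y \<in> carrier M \<Longrightarrow> h (x \<oplus>\<^bsub>M\<^esub> y) = h x \<oplus>\<^bsub>M'\<^esub> h y"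
    and "f \<in> X \<rightarrow> carrier M"
  shows "h (finsum M f X) = finsum M' (\<lambda>i. h (f i)) X"
proof -
  interpret M: abelian_group M by fact
  interpret M': abelian_group M' by fact
  show ?thesis using assms(5)
  proof (induction X rule: infinite_finite_induct)
    case (insert i X)
    then have "finsum M f X \<in> carrier M" by (intro M.finsum_closed) auto
    moreover have "(\<lambda>i. h (f i)) \<in> insert i X \<rightarrow> carrier M'" using insert.prems assms(3) by auto
    ultimately show ?case using insert by (simp add: M.finsum_insert M'.finsum_insert assms(4))
  qed (simp_all add: additive_map_zero[OF assms(1-4)])
qed

context abelian_monoid
begin

lemma finsum_swap:
  assumes "finite X" "finite Y" "\<And>x y. x \<in> X \<Longrightarrow> y \<in> Y \<Longrightarrow> f x y \<in> carrier G"
  shows "(\<Oplus>x\<in>X. \<Oplus>y\<in>Y. f x y) = (\<Oplus>y\<in>Y. \<Oplus>x\<in>X. f x y)"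
  using assms(1,3)
proof (induction X rule: finite_induct)
  case (insert a X)
  then have "(\<Oplus>x\<in>insert a X. \<Oplus>y\<in>Y. f x y) = (\<Oplus>y\<in>Y. f a y) \<oplus> (\<Oplus>y\<in>Y. \<Oplus>x\<in>X. f x y)"
    by (subst finsum_insert) (auto intro!: finsum_closed)
  also have "\<dots> = (\<Oplus>y\<in>Y. f a y \<oplus> (\<Oplus>x\<in>X. f x y))"
    using insert by (subst finsum_addf) (auto intro!: finsum_closed)
  also have "\<dots> = (\<Oplus>y\<in>Y. \<Oplus>x\<in>insert a X. f x y)"
    using insert by (intro finsum_cong) (auto simp: finsum_insert simp_implies_def intro!: finsum_closed)
  finally show ?case .
qed simp

lemma finsum_all_zero: "(\<And>x. x \<in> X \<Longrightarrow> f x = \<zero>) \<Longrightarrow> finsum G f X = \<zero>"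
  by (rule add.finprod_one_eqI)

lemma finsum_delta:
  assumes "finite X" "i \<in> X" "f i \<in> carrier G"
  shows "(\<Oplus>x\<in>X. if x = i then f x else \<zero>) = f i"
proof -
  have "(\<Oplus>x\<in>X. if x = i then f x else \<zero>) = (\<Oplus>x\<in>X. if i = x then f i else \<zero>)"
    by (rule finsum_cong') (use assms in auto)
  also have "\<dots> = f i"
    by (rule finsum_singleton) (use assms in auto)
  finally show ?thesis .
qed

end

section \<open>Bimodules over an algebra\<close>

locale k_algebra = ring A for A :: "('a, 'r) ring_scheme" (structure) +
  fixes \<kappa> :: "'k::field \<Rightarrow> 'a"
  assumes \<kappa>_closed [simp, intro]: "\<kappa> a \<in> carrier A"
    and \<kappa>_add: "\<kappa> (a + b) = \<kappa> a \<oplus> \<kappa> b"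
    and \<kappa>_mult: "\<kappa> (a * b) = \<kappa> a \<otimes> \<kappa> b"
    and \<kappa>_one [simp]: "\<kappa> 1 = \<one>"
    and \<kappa>_comm: "x \<in> carrier A \<Longrightarrow> \<kappa> a \<otimes> x = x \<otimes> \<kappa> a"
begin

lemma \<kappa>_zero [simp]: "\<kappa> 0 = \<zero>"
  using \<kappa>_add[of 0 0] by (metis add.r_cancel_one \<kappa>_closed add_0)

lemma \<kappa>_uminus: "\<kappa> (- a) = \<ominus> \<kappa> a"
  using \<kappa>_add[of "- a" a] by (metis \<kappa>_closed \<kappa>_zero minus_equality left_minus)

end

text \<open>The axiom \<open>\<kappa>_central\<close> is what turns a pair of commuting actions into
  a module over the enveloping algebra formed over \<open>k\<close> instead of over the
  integers.\<close>

locale k_bimodule = k_algebra A \<kappa> + M: abelian_group M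
  for A :: "('a, 'r) ring_scheme" (structure) and \<kappa> :: "'k::field \<Rightarrow> 'a" and M :: "('a, 'm) bimod" +
  assumes r_closed [simp, intro]: "x \<in> carrier M \<Longrightarrow> a \<in> carrier A \<Longrightarrow> x \<triangleleft>\<^bsub>M\<^esub> a \<in> carrier M"
    and l_closed [simp, intro]: "x \<in> carrier M \<Longrightarrow> a \<in> carrier A \<Longrightarrow> a \<triangleright>\<^bsub>M\<^esub> x \<in> carrier M"
    and add_rs: "x \<in> carrier M \<Longrightarrow> y \<in> carrier M \<Longrightarrow> a \<in> carrier A \<Longrightarrow>
          (x \<oplus>\<^bsub>M\<^esub> y) \<triangleleft>\<^bsub>M\<^esub> a = (x \<triangleleft>\<^bsub>M\<^esub> a) \<oplus>\<^bsub>M\<^esub> (y \<triangleleft>\<^bsub>M\<^esub> a)"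
    and ls_add: "x \<in> carrier M \<Longrightarrow> y \<in> carrier M \<Longrightarrow> a \<in> carrier A \<Longrightarrow>
          a \<triangleright>\<^bsub>M\<^esub> (x \<oplus>\<^bsub>M\<^esub> y) = (a \<triangleright>\<^bsub>M\<^esub> x) \<oplus>\<^bsub>M\<^esub> (a \<triangleright>\<^bsub>M\<^esub> y)"
    and rs_add: "x \<in> carrier M \<Longrightarrow> a \<in> carrier A \<Longrightarrow> b \<in> carrier A \<Longrightarrow>
          x \<triangleleft>\<^bsub>M\<^esub> (a \<oplus> b) = (x \<triangleleft>\<^bsub>M\<^esub> a) \<oplus>\<^bsub>M\<^esub> (x \<triangleleft>\<^bsub>M\<^esub> b)"
    and add_ls: "x \<in> carrier M \<Longrightarrow> a \<in> carrier A \<Longrightarrow> b \<in> carrier A \<Longrightarrow>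
          (a \<oplus> b) \<triangleright>\<^bsub>M\<^esub> x = (a \<triangleright>\<^bsub>M\<^esub> x) \<oplus>\<^bsub>M\<^esub> (b \<triangleright>\<^bsub>M\<^esub> x)"
    and rs_assoc: "x \<in> carrier M \<Longrightarrow> a \<in> carrier A \<Longrightarrow> b \<in> carrier A \<Longrightarrow>
          x \<triangleleft>\<^bsub>M\<^esub> (a \<otimes> b) = (x \<triangleleft>\<^bsub>M\<^esub> a) \<triangleleft>\<^bsub>M\<^esub> b"
    and ls_assoc: "x \<in> carrier M \<Longrightarrow> a \<in> carrier A \<Longrightarrow> b \<in> carrier A \<Longrightarrow>
          (a \<otimes> b) \<triangleright>\<^bsub>M\<^esub> x = a \<triangleright>\<^bsub>M\<^esub> (b \<triangleright>\<^bsub>M\<^esub> x)"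
    and rs_one [simp]: "x \<in> carrier M \<Longrightarrow> x \<triangleleft>\<^bsub>M\<^esub> \<one> = x"
    and ls_one [simp]: "x \<in> carrier M \<Longrightarrow> \<one> \<triangleright>\<^bsub>M\<^esub> x = x"
    and ls_rs: "x \<in> carrier M \<Longrightarrow> a \<in> carrier A \<Longrightarrow> b \<in> carrier A \<Longrightarrow>
          (a \<triangleright>\<^bsub>M\<^esub> x) \<triangleleft>\<^bsub>M\<^esub> b = a \<triangleright>\<^bsub>M\<^esub> (x \<triangleleft>\<^bsub>M\<^esub> b)"
    and \<kappa>_central: "x \<in> carrier M \<Longrightarrow> \<kappa> c \<triangleright>\<^bsub>M\<^esub> x = x \<triangleleft>\<^bsub>M\<^esub> \<kappa> c"
begin

lemma ls_finsum:
  "a \<in> carrier A \<Longrightarrow> f \<in> X \<rightarrow> carrier M \<Longrightarrow> a \<triangleright>\<^bsub>M\<^esub> finsum M f X = (\<Oplus>\<^bsub>M\<^esub>i\<in>X. a \<triangleright>\<^bsub>M\<^esub> f i)"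
  by (rule additive_map_finsum) (auto simp: ls_add M.abelian_group_axioms)

lemma rs_finsum:
  "a \<in> carrier A \<Longrightarrow> f \<in> X \<rightarrow> carrier M \<Longrightarrow> finsum M f X \<triangleleft>\<^bsub>M\<^esub> a = (\<Oplus>\<^bsub>M\<^esub>i\<in>X. f i \<triangleleft>\<^bsub>M\<^esub> a)"
  by (rule additive_map_finsum[where h = "\<lambda>x. x \<triangleleft>\<^bsub>M\<^esub> a"]) (auto simp: add_rs M.abelian_group_axioms)

lemma ls_zero [simp]: "a \<in> carrier A \<Longrightarrow> a \<triangleright>\<^bsub>M\<^esub> \<zero>\<^bsub>M\<^esub> = \<zero>\<^bsub>M\<^esub>"
  using ls_finsum[of a undefined "{}"] by simp

lemma zero_rs [simp]: "a \<in> carrier A \<Longrightarrow> \<zero>\<^bsub>M\<^esub> \<triangleleft>\<^bsub>M\<^esub> a = \<zero>\<^bsub>M\<^esub>"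
  using rs_finsum[of a undefined "{}"] by simp

lemma zero_ls [simp]: "x \<in> carrier M \<Longrightarrow> \<zero> \<triangleright>\<^bsub>M\<^esub> x = \<zero>\<^bsub>M\<^esub>"
  by (rule additive_map_zero[where M = A and h = "\<lambda>a. a \<triangleright>\<^bsub>M\<^esub> x"])
    (auto simp: add_ls M.abelian_group_axioms abelian_group_axioms)

lemma rs_zero [simp]: "x \<in> carrier M \<Longrightarrow> x \<triangleleft>\<^bsub>M\<^esub> \<zero> = \<zero>\<^bsub>M\<^esub>"
  by (rule additive_map_zero[where M = A and h = "\<lambda>a. x \<triangleleft>\<^bsub>M\<^esub> a"])
    (auto simp: rs_add M.abelian_group_axioms abelian_group_axioms)

lemma minus_ls: "x \<in> carrier M \<Longrightarrow> a \<in> carrier A \<Longrightarrow> (\<ominus> a) \<triangleright>\<^bsub>M\<^esub> x = \<ominus>\<^bsub>M\<^esub> (a \<triangleright>\<^bsub>M\<^esub> x)"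
  by (rule additive_map_minus[where M = A and h = "\<lambda>a. a \<triangleright>\<^bsub>M\<^esub> x"])
    (auto simp: add_ls M.abelian_group_axioms abelian_group_axioms)

lemma ls_minus: "x \<in> carrier M \<Longrightarrow> a \<in> carrier A \<Longrightarrow> a \<triangleright>\<^bsub>M\<^esub> (\<ominus>\<^bsub>M\<^esub> x) = \<ominus>\<^bsub>M\<^esub> (a \<triangleright>\<^bsub>M\<^esub> x)"
  by (rule additive_map_minus[where h = "\<lambda>x. a \<triangleright>\<^bsub>M\<^esub> x"]) (auto simp: ls_add M.abelian_group_axioms)

lemma minus_rs: "x \<in> carrier M \<Longrightarrow> a \<in> carrier A \<Longrightarrow> (\<ominus>\<^bsub>M\<^esub> x) \<triangleleft>\<^bsub>M\<^esub> a = \<ominus>\<^bsub>M\<^esub> (x \<triangleleft>\<^bsub>M\<^esub> a)"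
  by (rule additive_map_minus[where h = "\<lambda>x. x \<triangleleft>\<^bsub>M\<^esub> a"]) (auto simp: add_rs M.abelian_group_axioms)

lemma \<kappa>_ls_comm:
  "x \<in> carrier M \<Longrightarrow> a \<in> carrier A \<Longrightarrow> a \<triangleright>\<^bsub>M\<^esub> (\<kappa> c \<triangleright>\<^bsub>M\<^esub> x) = \<kappa> c \<triangleright>\<^bsub>M\<^esub> (a \<triangleright>\<^bsub>M\<^esub> x)"
  by (simp flip: ls_assoc add: \<kappa>_comm)

text \<open>The coefficients \<open>w\<close> are kept apart from the terms \<open>B\<close>, so
  that identities between structure constants can be proved in \<open>k\<close> and then transported
  to a bimodule.\<close>

definition lc :: "'i set \<Rightarrow> ('i \<Rightarrow> 'k) \<Rightarrow> ('i \<Rightarrow> 'm) \<Rightarrow> 'm" where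
  "lc X w B = (\<Oplus>\<^bsub>M\<^esub>x\<in>X. \<kappa> (w x) \<triangleright>\<^bsub>M\<^esub> B x)"

lemma lc_closed [intro, simp]: "(\<And>x. x \<in> X \<Longrightarrow> B x \<in> carrier M) \<Longrightarrow> lc X w B \<in> carrier M"
  unfolding lc_def by (intro M.finsum_closed) auto

text \<open>Only coefficient times term is compared: terms may differ wherever the coefficient
  vanishes, and coefficients wherever the term does. This is how undetermined structure constants
  are absorbed.\<close>

lemma lc_cong:
  "X = Y \<Longrightarrow> (\<And>x. x \<in> Y \<Longrightarrow> B' x \<in> carrier M) \<Longrightarrow>
   (\<And>x. x \<in> Y \<Longrightarrow> \<kappa> (w x) \<triangleright>\<^bsub>M\<^esub> B x = \<kappa> (w' x) \<triangleright>\<^bsub>M\<^esub> B' x) \<Longrightarrow> lc X w B = lc Y w' B'"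
  unfolding lc_def by (rule M.finsum_cong') auto

lemma lc_ls:
  assumes "a \<in> carrier A" "\<And>x. x \<in> X \<Longrightarrow> B x \<in> carrier M"
  shows "a \<triangleright>\<^bsub>M\<^esub> lc X w B = lc X w (\<lambda>x. a \<triangleright>\<^bsub>M\<^esub> B x)"
  unfolding lc_def using assms
  by (subst ls_finsum) (auto simp: \<kappa>_ls_comm intro!: M.finsum_cong')

lemma lc_rs:
  assumes "a \<in> carrier A" "\<And>x. x \<in> X \<Longrightarrow> B x \<in> carrier M"
  shows "lc X w B \<triangleleft>\<^bsub>M\<^esub> a = lc X w (\<lambda>x. B x \<triangleleft>\<^bsub>M\<^esub> a)"
  unfolding lc_def using assms
  by (subst rs_finsum) (auto simp: ls_rs intro!: M.finsum_cong')

text \<open>All coefficients sit in the inner sum and the outer sum has coefficient 1, a form that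
  is preserved when the sums are exchanged.\<close>

lemma lc_swap:
  assumes "finite X" "finite Y" "\<And>x y. x \<in> X \<Longrightarrow> y \<in> Y \<Longrightarrow> B x y \<in> carrier M"
  shows "lc X (\<lambda>_. 1) (\<lambda>x. lc Y (v x) (B x)) = lc Y (\<lambda>_. 1) (\<lambda>y. lc X (\<lambda>x. v x y) (\<lambda>x. B x y))"
proof -
  have "lc X (\<lambda>_. 1) (\<lambda>x. lc Y (v x) (B x)) = (\<Oplus>\<^bsub>M\<^esub>x\<in>X. \<Oplus>\<^bsub>M\<^esub>y\<in>Y. \<kappa> (v x y) \<triangleright>\<^bsub>M\<^esub> B x y)"
    unfolding lc_def using assms by (intro M.finsum_cong') (auto intro!: M.finsum_closed)
  also have "\<dots> = (\<Oplus>\<^bsub>M\<^esub>y\<in>Y. \<Oplus>\<^bsub>M\<^esub>x\<in>X. \<kappa> (v x y) \<triangleright>\<^bsub>M\<^esub> B x y)"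
    using assms by (intro M.finsum_swap) auto
  also have "\<dots> = lc Y (\<lambda>_. 1) (\<lambda>y. lc X (\<lambda>x. v x y) (\<lambda>x. B x y))"
    unfolding lc_def using assms by (intro M.finsum_cong') (auto intro!: M.finsum_closed)
  finally show ?thesis .
qed

lemma lc_sum_coeff:
  assumes "finite X" "B \<in> carrier M"
  shows "lc X w (\<lambda>_. B) = \<kappa> (sum w X) \<triangleright>\<^bsub>M\<^esub> B"
  using assms(1)
proof (induction X rule: finite_induct)
  case (insert x X)
  then show ?case using assms(2)
    by (auto simp: lc_def M.finsum_insert Pi_def \<kappa>_add add_ls)
qed (use assms(2) in \<open>simp add: lc_def\<close>)

lemma lc_zero: "(\<And>x. x \<in> X \<Longrightarrow> \<kappa> (w x) \<triangleright>\<^bsub>M\<^esub> B x = \<zero>\<^bsub>M\<^esub>) \<Longrightarrow> lc X w B = \<zero>\<^bsub>M\<^esub>"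
  unfolding lc_def by (rule M.finsum_all_zero)

lemma lc_delta:
  assumes "finite X" "i \<in> X" "B i \<in> carrier M" "\<And>x. x \<in> X \<Longrightarrow> x \<noteq> i \<Longrightarrow> \<kappa> (w x) \<triangleright>\<^bsub>M\<^esub> B x = \<zero>\<^bsub>M\<^esub>"
  shows "lc X w B = \<kappa> (w i) \<triangleright>\<^bsub>M\<^esub> B i"
proof -
  have "lc X w B = (\<Oplus>\<^bsub>M\<^esub>x\<in>X. if i = x then \<kappa> (w i) \<triangleright>\<^bsub>M\<^esub> B i else \<zero>\<^bsub>M\<^esub>)"
    unfolding lc_def by (rule M.finsum_cong') (use assms in auto)
  also have "\<dots> = \<kappa> (w i) \<triangleright>\<^bsub>M\<^esub> B i"
    using assms by (intro M.finsum_singleton) auto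
  finally show ?thesis .
qed

end

lemma (in k_algebra) k_bimodule_regular: "k_bimodule A \<kappa> (regular_bimod A)"
proof -
  have "abelian_group (regular_bimod A)"
    by (rule abelian_groupI) (auto simp: regular_bimod_def a_ac intro: add.m_assoc dest: add.l_inv_ex)
  then show ?thesis
    unfolding k_bimodule_def k_bimodule_axioms_def
    by (auto simp: regular_bimod_def k_algebra_axioms l_distr r_distr m_assoc \<kappa>_comm)
qed

lemma bimod_homD:
  assumes "h \<in> bimod_hom A M M'"
  shows "h \<in> carrier M \<rightarrow> carrier M'" "x \<in> carrier M \<Longrightarrow> h x \<in> carrier M'"
    "x \<in> carrier M \<Longrightarrow> y \<in> carrier M \<Longrightarrow> h (x \<oplus>\<^bsub>M\<^esub> y) = h x \<oplus>\<^bsub>M'\<^esub> h y"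
    "x \<in> carrier M \<Longrightarrow> a \<in> carrier A \<Longrightarrow> h (x \<triangleleft>\<^bsub>M\<^esub> a) = h x \<triangleleft>\<^bsub>M'\<^esub> a"
    "x \<in> carrier M \<Longrightarrow> a \<in> carrier A \<Longrightarrow> h (a \<triangleright>\<^bsub>M\<^esub> x) = a \<triangleright>\<^bsub>M'\<^esub> h x"
    "h \<in> extensional (carrier M)"
  using assms by (auto simp: bimod_hom_def PiE_def)

lemma bimod_hom_zero:
  assumes "k_bimodule A \<kappa> M" "k_bimodule A \<kappa> M'" "h \<in> bimod_hom A M M'"
  shows "h \<zero>\<^bsub>M\<^esub> = \<zero>\<^bsub>M'\<^esub>"
  using assms by (intro additive_map_zero) (auto simp: k_bimodule_def bimod_homD)

lemma bimod_hom_minus: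
  assumes "k_bimodule A \<kappa> M" "k_bimodule A \<kappa> M'" "h \<in> bimod_hom A M M'" "x \<in> carrier M"
  shows "h (\<ominus>\<^bsub>M\<^esub> x) = \<ominus>\<^bsub>M'\<^esub> h x"
  using assms by (intro additive_map_minus) (auto simp: k_bimodule_def bimod_homD)

lemma bimod_hom_finsum:
  assumes "k_bimodule A \<kappa> M" "k_bimodule A \<kappa> M'" "h \<in> bimod_hom A M M'" "f \<in> X \<rightarrow> carrier M"
  shows "h (finsum M f X) = finsum M' (\<lambda>i. h (f i)) X"
  using assms by (intro additive_map_finsum) (auto simp: k_bimodule_def bimod_homD)

lemma bimod_hom_lc:
  assumes "k_bimodule A \<kappa> M" "k_bimodule A \<kappa> M'" "h \<in> bimod_hom A M M'" "\<And>x. x \<in> X \<Longrightarrow> B x \<in> carrier M"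
  shows "h (k_bimodule.lc \<kappa> M X w B) = k_bimodule.lc \<kappa> M' X w (\<lambda>x. h (B x))"
proof -
  interpret M: k_bimodule A \<kappa> M by fact
  interpret M': k_bimodule A \<kappa> M' by fact
  show ?thesis unfolding M.lc_def M'.lc_def using assms(4)
    by (subst bimod_hom_finsum[OF assms(1-3)])
      (auto intro!: M'.M.finsum_cong' simp: bimod_homD[OF assms(3)] Pi_def)
qed

lemma pm_ext_diff: "pm_ext g (x - y) = pm_ext g x - pm_ext g y"
proof -
  have "pm_ext g (x - y) + pm_ext g y = pm_ext g x" by (simp flip: pm_ext_add)
  then show ?thesis by (simp add: algebra_simps eq_diff_eq)
qed

section \<open>Tensor products\<close>

text \<open>\<open>U\<close> is a left ideal and \<open>V\<close> a right ideal: from nonemptiness,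
  multiplication by zero and by minus one yields zero and negatives.\<close>

locale tensor_product = k_algebra A \<kappa> for A :: "('a, 'r) ring_scheme" (structure) and \<kappa> :: "'k::field \<Rightarrow> 'a" +
  fixes U V :: "'a set"
  assumes U_carrier: "u \<in> U \<Longrightarrow> u \<in> carrier A" and V_carrier: "v \<in> V \<Longrightarrow> v \<in> carrier A"
    and U_nonempty: "U \<noteq> {}" and V_nonempty: "V \<noteq> {}"
    and U_add: "u \<in> U \<Longrightarrow> u' \<in> U \<Longrightarrow> u \<oplus> u' \<in> U" and V_add: "v \<in> V \<Longrightarrow> v' \<in> V \<Longrightarrow> v \<oplus> v' \<in> V"
    and U_mult: "a \<in> carrier A \<Longrightarrow> u \<in> U \<Longrightarrow> a \<otimes> u \<in> U"
    and V_mult: "a \<in> carrier A \<Longrightarrow> v \<in> V \<Longrightarrow> v \<otimes> a \<in> V"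
begin

abbreviation "\<N> \<equiv> tensor_null A \<kappa> U V"
abbreviation "cls \<equiv> tensor_class A \<kappa> U V"
abbreviation "T \<equiv> tensor_bimod A \<kappa> U V"
abbreviation "pure \<equiv> pure_tensor A \<kappa> U V"

lemma \<kappa>_V: "v \<in> V \<Longrightarrow> \<kappa> c \<otimes> v \<in> V"
  using V_mult[of "\<kappa> c" v] by (simp add: \<kappa>_comm V_carrier)

lemma null_subspace: "pm.subspace \<N>"
  unfolding tensor_null_def by (rule pm.subspace_span)

lemma null_add_left: "u \<in> U \<Longrightarrow> u' \<in> U \<Longrightarrow> v \<in> V \<Longrightarrow>
    Poly_Mapping.single (u \<oplus> u', v) 1 - Poly_Mapping.single (u, v) 1 - Poly_Mapping.single (u', v) 1 \<in> \<N>"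
  unfolding tensor_null_def by (rule pm.span_base) blast

lemma null_add_right: "u \<in> U \<Longrightarrow> v \<in> V \<Longrightarrow> v' \<in> V \<Longrightarrow>
    Poly_Mapping.single (u, v \<oplus> v') 1 - Poly_Mapping.single (u, v) 1 - Poly_Mapping.single (u, v') 1 \<in> \<N>"
  unfolding tensor_null_def by (rule pm.span_base) blast

lemma null_scale_left: "u \<in> U \<Longrightarrow> v \<in> V \<Longrightarrow>
    Poly_Mapping.single (\<kappa> c \<otimes> u, v) 1 - Poly_Mapping.single (u, v) c \<in> \<N>"
  unfolding tensor_null_def by (rule pm.span_base) blast

lemma null_scale_right: "u \<in> U \<Longrightarrow> v \<in> V \<Longrightarrow>
    Poly_Mapping.single (u, \<kappa> c \<otimes> v) 1 - Poly_Mapping.single (u, v) c \<in> \<N>"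
  unfolding tensor_null_def by (rule pm.span_base) blast

lemma null_minimal:
  assumes "pm.subspace S"
    and "\<And>u u' v. u \<in> U \<Longrightarrow> u' \<in> U \<Longrightarrow> v \<in> V \<Longrightarrow>
      Poly_Mapping.single (u \<oplus> u', v) 1 - Poly_Mapping.single (u, v) 1 - Poly_Mapping.single (u', v) 1 \<in> S"
    and "\<And>u v v'. u \<in> U \<Longrightarrow> v \<in> V \<Longrightarrow> v' \<in> V \<Longrightarrow>
      Poly_Mapping.single (u, v \<oplus> v') 1 - Poly_Mapping.single (u, v) 1 - Poly_Mapping.single (u, v') 1 \<in> S"
    and "\<And>c u v. u \<in> U \<Longrightarrow> v \<in> V \<Longrightarrow>
      Poly_Mapping.single (\<kappa> c \<otimes> u, v) 1 - Poly_Mapping.single (u, v) c \<in> S"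
    and "\<And>c u v. u \<in> U \<Longrightarrow> v \<in> V \<Longrightarrow>
      Poly_Mapping.single (u, \<kappa> c \<otimes> v) 1 - Poly_Mapping.single (u, v) c \<in> S"
  shows "\<N> \<subseteq> S"
  unfolding tensor_null_def by (rule pm.span_minimal) (use assms in auto)

text \<open>Each bimodule law is an equality modulo the relations. The difference \<open>D\<close>
  of its two sides is linear, so it suffices to see on single pairs that it lands in the
  relations.\<close>

lemma null_induct:
  assumes "Poly_Mapping.keys x \<subseteq> U \<times> V"
    and "\<And>x y. D (x + y) = D x + D y" and "\<And>x c. D (pm_scale c x) = pm_scale c (D x)"
    and "\<And>u v. u \<in> U \<Longrightarrow> v \<in> V \<Longrightarrow> D (Poly_Mapping.single (u, v) 1) \<in> \<N>"
  shows "D x \<in> \<N>"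
  using assms(1)
proof (induction x rule: pm_induct)
  case zero
  show ?case using assms(3)[of 0 0] pm.subspace_0[OF null_subspace] by simp
next
  case (single w a)
  obtain u v where w: "w = (u, v)" "u \<in> U" "v \<in> V" using single by auto
  have "D (Poly_Mapping.single w a) = pm_scale a (D (Poly_Mapping.single (u, v) 1))"
    by (simp add: w flip: assms(3))
  then show ?case using assms(4)[OF w(2,3)] pm.subspace_scale[OF null_subspace] by simp
next
  case (add x y)
  then show ?case by (simp add: assms(2) pm.subspace_add[OF null_subspace])
qed

lemma cls_eq_iff: "cls x = cls y \<longleftrightarrow> x - y \<in> \<N>"
proof
  assume "cls x = cls y"
  then have "x + 0 \<in> cls y" using pm.subspace_0[OF null_subspace] unfolding tensor_class_def by blast
  then show "x - y \<in> \<N>" unfolding tensor_class_def by auto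
next
  assume *: "x - y \<in> \<N>"
  have "\<exists>z'. x + z = y + z' \<and> z' \<in> \<N>" if "z \<in> \<N>" for z
    using pm.subspace_add[OF null_subspace * that] by (intro exI[of _ "x - y + z"]) simp
  moreover have "\<exists>z'. y + z = x + z' \<and> z' \<in> \<N>" if "z \<in> \<N>" for z
    using pm.subspace_diff[OF null_subspace that *] by (intro exI[of _ "z - (x - y)"]) simp
  ultimately show "cls x = cls y" unfolding tensor_class_def by auto
qed

lemma cls_carrier [intro]: "Poly_Mapping.keys x \<subseteq> U \<times> V \<Longrightarrow> cls x \<in> carrier T"
  by (auto simp: tensor_bimod_def)

lemma carrier_cls: 
  assumes "X \<in> carrier T" obtains x where "X = cls x" "Poly_Mapping.keys x \<subseteq> U \<times> V"
  using assms by (auto simp: tensor_bimod_def)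

lemma zero_cls: "\<zero>\<^bsub>T\<^esub> = cls 0"
  by (auto simp: tensor_bimod_def tensor_class_def)

lemma add_cls: "cls x \<oplus>\<^bsub>T\<^esub> cls y = cls (x + y)"
proof -
  have "\<exists>z''. (x + z) + (y + z') = x + y + z'' \<and> z'' \<in> \<N>" if "z \<in> \<N>" "z' \<in> \<N>" for z z'
    using pm.subspace_add[OF null_subspace that] by (intro exI[of _ "z + z'"]) (simp add: algebra_simps)
  moreover have "\<exists>a b. x + y + z = a + b \<and> (\<exists>z. a = x + z \<and> z \<in> \<N>) \<and> (\<exists>z. b = y + z \<and> z \<in> \<N>)" if "z \<in> \<N>" for z
    using that pm.subspace_0[OF null_subspace] by (intro exI[of _ "x + 0"] exI[of _ "y + z"]) (auto simp: algebra_simps)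
  ultimately show ?thesis by (auto simp: tensor_bimod_def tensor_class_def)
qed

definition "ract a = pm_ext (\<lambda>(u, v). Poly_Mapping.single (u, v \<otimes> a) (1::'k))"
definition "lact a = pm_ext (\<lambda>(u, v). Poly_Mapping.single (a \<otimes> u, v) (1::'k))"

lemma ract_single [simp]: "ract a (Poly_Mapping.single (u, v) c) = Poly_Mapping.single (u, v \<otimes> a) c"
  by (simp add: ract_def)

lemma lact_single [simp]: "lact a (Poly_Mapping.single (u, v) c) = Poly_Mapping.single (a \<otimes> u, v) c"
  by (simp add: lact_def)

lemma act_linear:
  "ract a (x + y) = ract a x + ract a y" "ract a (pm_scale c x) = pm_scale c (ract a x)" "ract a (x - y) = ract a x - ract a y"
  "lact a (x + y) = lact a x + lact a y" "lact a (pm_scale c x) = pm_scale c (lact a x)" "lact a (x - y) = lact a x - lact a y"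
  by (simp_all add: ract_def lact_def pm_ext_add pm_ext_scale pm_ext_diff)

lemma act_zero [simp]: "ract a 0 = 0" "lact a 0 = 0"
  by (simp_all add: ract_def lact_def pm_ext_def)

lemma subspace_vimage:
  assumes "\<And>x y. D (x + y) = D x + D y" and "\<And>x c. D (pm_scale c x) = pm_scale c (D x)"
  shows "pm.subspace {x. D x \<in> \<N>}"
proof -
  have "D 0 = 0" using assms(2)[of 0 0] by simp
  then show ?thesis using null_subspace unfolding pm.subspace_def by (auto simp: assms)
qed

text \<open>Acting on a factor sends each generating relation to a relation of the same kind, hence
  preserves their span.\<close>

lemma ract_null: "a \<in> carrier A \<Longrightarrow> z \<in> \<N> \<Longrightarrow> ract a z \<in> \<N>"
proof -
  assume a: "a \<in> carrier A"
  have "\<N> \<subseteq> {x. ract a x \<in> \<N>}"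
    by (rule null_minimal[OF subspace_vimage])
      (auto simp: act_linear a l_distr V_carrier V_mult m_assoc null_add_left null_add_right null_scale_left null_scale_right)
  then show "z \<in> \<N> \<Longrightarrow> ract a z \<in> \<N>" by auto
qed

lemma lact_null: "a \<in> carrier A \<Longrightarrow> z \<in> \<N> \<Longrightarrow> lact a z \<in> \<N>"
proof -
  assume a: "a \<in> carrier A"
  \<comment> \<open>The scalar has to be moved past \<open>a\<close> before the image of a scalar
    relation is again one; this uses that \<open>\<kappa>\<close> is central.\<close>
  have *: "a \<otimes> (\<kappa> c \<otimes> u) = \<kappa> c \<otimes> (a \<otimes> u)" if "u \<in> carrier A" for c u
    using a that by (metis \<kappa>_closed \<kappa>_comm m_assoc)
  have "\<N> \<subseteq> {x. lact a x \<in> \<N>}"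
    by (rule null_minimal[OF subspace_vimage])
      (auto simp: act_linear a r_distr U_carrier U_mult * null_add_left null_add_right null_scale_left null_scale_right)
  then show "z \<in> \<N> \<Longrightarrow> lact a z \<in> \<N>" by auto
qed

lemma act_keys:
  assumes "a \<in> carrier A" "Poly_Mapping.keys x \<subseteq> U \<times> V"
  shows "Poly_Mapping.keys (ract a x) \<subseteq> U \<times> V" "Poly_Mapping.keys (lact a x) \<subseteq> U \<times> V"
  using assms(2)
  by (induction x rule: pm_induct)
    (auto simp: act_linear U_mult V_mult assms(1) split: if_splits dest!: keys_add[THEN subsetD])

text \<open>The record unites the results over all representatives of a class. Two representatives
  differ by a relation and relations are stable under the action, so every member of the union is
  the same coset.\<close>

lemma rs_cls:
  assumes "a \<in> carrier A" shows "cls x \<triangleleft>\<^bsub>T\<^esub> a = cls (ract a x)"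
proof -
  have "cls x \<triangleleft>\<^bsub>T\<^esub> a = (\<Union>y\<in>cls x. cls (ract a y))"
    by (simp add: tensor_bimod_def ract_def pm_ext_def case_prod_unfold)
  also have "\<dots> = (\<Union>y\<in>cls x. cls (ract a x))"
  proof (intro SUP_cong refl)
    fix y assume "y \<in> cls x"
    then have "y - x \<in> \<N>" by (auto simp: tensor_class_def)
    then show "cls (ract a y) = cls (ract a x)"
      using ract_null[OF assms, of "y - x"] by (simp add: cls_eq_iff act_linear)
  qed
  also have "\<dots> = cls (ract a x)" using pm.subspace_0[OF null_subspace] by (auto simp: tensor_class_def)
  finally show ?thesis .
qed

lemma ls_cls:
  assumes "a \<in> carrier A" shows "a \<triangleright>\<^bsub>T\<^esub> cls x = cls (lact a x)"
proof -
  have "a \<triangleright>\<^bsub>T\<^esub> cls x = (\<Union>y\<in>cls x. cls (lact a y))"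
    by (simp add: tensor_bimod_def lact_def pm_ext_def case_prod_unfold)
  also have "\<dots> = (\<Union>y\<in>cls x. cls (lact a x))"
  proof (intro SUP_cong refl)
    fix y assume "y \<in> cls x"
    then have "y - x \<in> \<N>" by (auto simp: tensor_class_def)
    then show "cls (lact a y) = cls (lact a x)"
      using lact_null[OF assms, of "y - x"] by (simp add: cls_eq_iff act_linear)
  qed
  also have "\<dots> = cls (lact a x)" using pm.subspace_0[OF null_subspace] by (auto simp: tensor_class_def)
  finally show ?thesis .
qed

lemma abelian_group_tensor: "abelian_group T"
proof (rule abelian_groupI)
  fix X Y assume "X \<in> carrier T" "Y \<in> carrier T"
  then obtain x y where "X = cls x" "Poly_Mapping.keys x \<subseteq> U \<times> V" "Y = cls y" "Poly_Mapping.keys y \<subseteq> U \<times> V"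
    by (auto elim!: carrier_cls)
  then show "X \<oplus>\<^bsub>T\<^esub> Y \<in> carrier T" "X \<oplus>\<^bsub>T\<^esub> Y = Y \<oplus>\<^bsub>T\<^esub> X"
    by (simp_all add: add_cls cls_carrier keys_add_subset add.commute)
next
  fix X Y Z assume "X \<in> carrier T" "Y \<in> carrier T" "Z \<in> carrier T"
  then show "X \<oplus>\<^bsub>T\<^esub> Y \<oplus>\<^bsub>T\<^esub> Z = X \<oplus>\<^bsub>T\<^esub> (Y \<oplus>\<^bsub>T\<^esub> Z)"
    by (auto elim!: carrier_cls simp: add_cls algebra_simps)
next
  fix X assume "X \<in> carrier T"
  then obtain x where x: "X = cls x" "Poly_Mapping.keys x \<subseteq> U \<times> V" by (rule carrier_cls)
  then have "cls (- x) \<in> carrier T" using pm.subspace_neg[OF subspace_keys, of x] by (simp add: cls_carrier)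
  moreover have "cls (- x) \<oplus>\<^bsub>T\<^esub> X = \<zero>\<^bsub>T\<^esub>" by (simp add: x add_cls zero_cls)
  ultimately show "\<exists>Y\<in>carrier T. Y \<oplus>\<^bsub>T\<^esub> X = \<zero>\<^bsub>T\<^esub>" by blast
qed (auto elim!: carrier_cls simp: zero_cls add_cls)

lemma k_bimodule_tensor: "k_bimodule A \<kappa> T"
proof -
  note defs = rs_cls ls_cls add_cls act_linear cls_eq_iff pm.scale_right_distrib pm.scale_right_diff_distrib
  have rs_add: "cls x \<triangleleft>\<^bsub>T\<^esub> (a \<oplus> b) = (cls x \<triangleleft>\<^bsub>T\<^esub> a) \<oplus>\<^bsub>T\<^esub> (cls x \<triangleleft>\<^bsub>T\<^esub> b)"
    and add_ls: "(a \<oplus> b) \<triangleright>\<^bsub>T\<^esub> cls x = (a \<triangleright>\<^bsub>T\<^esub> cls x) \<oplus>\<^bsub>T\<^esub> (b \<triangleright>\<^bsub>T\<^esub> cls x)"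
    and rs_assoc: "cls x \<triangleleft>\<^bsub>T\<^esub> (a \<otimes> b) = (cls x \<triangleleft>\<^bsub>T\<^esub> a) \<triangleleft>\<^bsub>T\<^esub> b"
    and ls_assoc: "(a \<otimes> b) \<triangleright>\<^bsub>T\<^esub> cls x = a \<triangleright>\<^bsub>T\<^esub> (b \<triangleright>\<^bsub>T\<^esub> cls x)"
    and ls_rs: "(a \<triangleright>\<^bsub>T\<^esub> cls x) \<triangleleft>\<^bsub>T\<^esub> b = a \<triangleright>\<^bsub>T\<^esub> (cls x \<triangleleft>\<^bsub>T\<^esub> b)"
    if x: "Poly_Mapping.keys x \<subseteq> U \<times> V" and ab: "a \<in> carrier A" "b \<in> carrier A" for x a b
  proof -
    have "ract (a \<oplus> b) x - (ract a x + ract b x) \<in> \<N>"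
      using x by (rule null_induct) (use ab in \<open>auto simp: defs r_distr V_carrier V_mult null_add_right diff_diff_add[symmetric]\<close>)
    then show "cls x \<triangleleft>\<^bsub>T\<^esub> (a \<oplus> b) = (cls x \<triangleleft>\<^bsub>T\<^esub> a) \<oplus>\<^bsub>T\<^esub> (cls x \<triangleleft>\<^bsub>T\<^esub> b)"
      using ab by (simp add: defs)
    have "lact (a \<oplus> b) x - (lact a x + lact b x) \<in> \<N>"
      using x by (rule null_induct) (use ab in \<open>auto simp: defs l_distr U_carrier U_mult null_add_left diff_diff_add[symmetric]\<close>)
    then show "(a \<oplus> b) \<triangleright>\<^bsub>T\<^esub> cls x = (a \<triangleright>\<^bsub>T\<^esub> cls x) \<oplus>\<^bsub>T\<^esub> (b \<triangleright>\<^bsub>T\<^esub> cls x)"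
      using ab by (simp add: defs)
    note 0 = pm.subspace_0[OF null_subspace]
    have "ract (a \<otimes> b) x - ract b (ract a x) \<in> \<N>"
      using x by (rule null_induct) (use ab 0 in \<open>auto simp: defs m_assoc V_carrier\<close>)
    then show "cls x \<triangleleft>\<^bsub>T\<^esub> (a \<otimes> b) = (cls x \<triangleleft>\<^bsub>T\<^esub> a) \<triangleleft>\<^bsub>T\<^esub> b"
      using ab by (simp add: defs)
    have "lact (a \<otimes> b) x - lact a (lact b x) \<in> \<N>"
      using x by (rule null_induct) (use ab 0 in \<open>auto simp: defs m_assoc U_carrier\<close>)
    then show "(a \<otimes> b) \<triangleright>\<^bsub>T\<^esub> cls x = a \<triangleright>\<^bsub>T\<^esub> (b \<triangleright>\<^bsub>T\<^esub> cls x)"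
      using ab by (simp add: defs)
    have "ract b (lact a x) - lact a (ract b x) \<in> \<N>"
      using x by (rule null_induct) (use ab 0 in \<open>auto simp: defs\<close>)
    then show "(a \<triangleright>\<^bsub>T\<^esub> cls x) \<triangleleft>\<^bsub>T\<^esub> b = a \<triangleright>\<^bsub>T\<^esub> (cls x \<triangleleft>\<^bsub>T\<^esub> b)"
      using ab by (simp add: defs)
  qed
  have one: "cls x \<triangleleft>\<^bsub>T\<^esub> \<one> = cls x" "\<one> \<triangleright>\<^bsub>T\<^esub> cls x = cls x"
    and central: "\<kappa> c \<triangleright>\<^bsub>T\<^esub> cls x = cls x \<triangleleft>\<^bsub>T\<^esub> \<kappa> c" if x: "Poly_Mapping.keys x \<subseteq> U \<times> V" for x c
  proof -
    note 0 = pm.subspace_0[OF null_subspace]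
    have "ract \<one> x - x \<in> \<N>" "lact \<one> x - x \<in> \<N>"
      by (use x in \<open>rule null_induct\<close>; use 0 in \<open>auto simp: defs U_carrier V_carrier\<close>)+
    then show "cls x \<triangleleft>\<^bsub>T\<^esub> \<one> = cls x" "\<one> \<triangleright>\<^bsub>T\<^esub> cls x = cls x" by (simp_all add: defs)
    have "lact (\<kappa> c) x - ract (\<kappa> c) x \<in> \<N>"
      using x
    proof (rule null_induct)
      fix u v assume uv: "u \<in> U" "v \<in> V"
      \<comment> \<open>Both scalar relations compare with the same
        \<open>Poly_Mapping.single (u, v) c\<close>, so their difference moves the scalar across the
        tensor sign.\<close>
      from pm.subspace_diff[OF null_subspace null_scale_left[OF uv, of c] null_scale_right[OF uv, of c]]
      show "lact (\<kappa> c) (Poly_Mapping.single (u, v) 1) - ract (\<kappa> c) (Poly_Mapping.single (u, v) 1) \<in> \<N>"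
        by (simp add: \<kappa>_comm V_carrier uv)
    qed (auto simp: defs)
    then show "\<kappa> c \<triangleright>\<^bsub>T\<^esub> cls x = cls x \<triangleleft>\<^bsub>T\<^esub> \<kappa> c" by (simp add: defs)
  qed
  show ?thesis
    by (intro k_bimodule.intro k_bimodule_axioms.intro k_algebra_axioms abelian_group_tensor; elim carrier_cls; hypsubst)
      (simp add: rs_cls ls_cls act_keys cls_carrier; fail | simp add: rs_cls ls_cls add_cls act_linear; fail
        | (rule rs_add add_ls rs_assoc ls_assoc ls_rs one central; assumption))+
qed

lemma pure_closed [intro, simp]: "u \<in> U \<Longrightarrow> v \<in> V \<Longrightarrow> pure u v \<in> carrier T"
  unfolding pure_tensor_def by (rule cls_carrier) (auto split: if_splits)

lemma pure_ls: "a \<in> carrier A \<Longrightarrow> a \<triangleright>\<^bsub>T\<^esub> pure u v = pure (a \<otimes> u) v"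
  by (simp add: pure_tensor_def ls_cls)

lemma pure_rs: "a \<in> carrier A \<Longrightarrow> pure u v \<triangleleft>\<^bsub>T\<^esub> a = pure u (v \<otimes> a)"
  by (simp add: pure_tensor_def rs_cls)

text \<open>The coefficient is absorbed into the left factor, so every element of the tensor product
  is a sum of pure tensors without coefficients.\<close>

lemma cls_single: "u \<in> U \<Longrightarrow> v \<in> V \<Longrightarrow> cls (Poly_Mapping.single (u, v) c) = pure (\<kappa> c \<otimes> u) v"
  using null_scale_left[of u v c] pm.subspace_neg[OF null_subspace null_scale_left[of u v c]]
  by (simp add: pure_tensor_def cls_eq_iff)

lemma tensor_induct [consumes 1, case_names zero pure add]:
  assumes "X \<in> carrier T" "P \<zero>\<^bsub>T\<^esub>" "\<And>u v. u \<in> U \<Longrightarrow> v \<in> V \<Longrightarrow> P (pure u v)"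
    and add: "\<And>X Y. X \<in> carrier T \<Longrightarrow> Y \<in> carrier T \<Longrightarrow> P X \<Longrightarrow> P Y \<Longrightarrow> P (X \<oplus>\<^bsub>T\<^esub> Y)"
  shows "P X"
proof -
  obtain x where x: "X = cls x" "Poly_Mapping.keys x \<subseteq> U \<times> V" using assms(1) by (rule carrier_cls)
  show ?thesis unfolding x(1) using x(2)
  proof (induction x rule: pm_induct)
    case zero
    show ?case using assms(2) by (simp add: zero_cls)
  next
    case (single w a)
    then show ?case using assms(3) by (cases w) (auto simp: cls_single U_mult)
  next
    case (add x y)
    then show ?case by (auto simp: assms(4) cls_carrier simp flip: add_cls)
  qed
qed

text \<open>The universal property: the linear extension \<open>L\<close> of a balanced biadditive
  map kills the generating relations and so descends to classes. Compatibility with the outer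
  actions is left to the caller, since it depends on \<open>\<beta>\<close>.\<close>

lemma tensor_lift:
  fixes M :: "('a, 'm) bimod"
  assumes "k_bimodule A \<kappa> M"
    and closed: "\<And>u v. u \<in> U \<Longrightarrow> v \<in> V \<Longrightarrow> \<beta> u v \<in> carrier M"
    and add1: "\<And>u u' v. u \<in> U \<Longrightarrow> u' \<in> U \<Longrightarrow> v \<in> V \<Longrightarrow> \<beta> (u \<oplus> u') v = \<beta> u v \<oplus>\<^bsub>M\<^esub> \<beta> u' v"
    and add2: "\<And>u v v'. u \<in> U \<Longrightarrow> v \<in> V \<Longrightarrow> v' \<in> V \<Longrightarrow> \<beta> u (v \<oplus> v') = \<beta> u v \<oplus>\<^bsub>M\<^esub> \<beta> u v'"
    and scale: "\<And>u v c. u \<in> U \<Longrightarrow> v \<in> V \<Longrightarrow> \<beta> (\<kappa> c \<otimes> u) v = \<kappa> c \<triangleright>\<^bsub>M\<^esub> \<beta> u v"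
      "\<And>u v c. u \<in> U \<Longrightarrow> v \<in> V \<Longrightarrow> \<beta> u (\<kappa> c \<otimes> v) = \<kappa> c \<triangleright>\<^bsub>M\<^esub> \<beta> u v"
  obtains h where "h \<in> carrier T \<rightarrow> carrier M"
    "\<And>X Y. X \<in> carrier T \<Longrightarrow> Y \<in> carrier T \<Longrightarrow> h (X \<oplus>\<^bsub>T\<^esub> Y) = h X \<oplus>\<^bsub>M\<^esub> h Y"
    "\<And>u v. u \<in> U \<Longrightarrow> v \<in> V \<Longrightarrow> h (pure u v) = \<beta> u v"
proof -
  interpret M: k_bimodule A \<kappa> M by fact
  define b where "b w = \<beta> (fst w) (snd w)" for w
  have b_closed: "b w \<in> carrier M" if "w \<in> U \<times> V" for w using that closed by (auto simp: b_def)
  define L where "L x = M.lc (Poly_Mapping.keys x) (Poly_Mapping.lookup x) b" for x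
  have L_superset: "L x = M.lc F (Poly_Mapping.lookup x) b"
    if "finite F" "Poly_Mapping.keys x \<subseteq> F" "F \<subseteq> U \<times> V" for x F
    unfolding L_def M.lc_def using that b_closed
    by (intro M.M.add.finprod_mono_neutral_cong_left) (auto simp: in_keys_iff Pi_def subset_iff)
  have L_closed: "L x \<in> carrier M" if "Poly_Mapping.keys x \<subseteq> U \<times> V" for x
    unfolding L_def using that b_closed by auto
  have L_add: "L (x + y) = L x \<oplus>\<^bsub>M\<^esub> L y"
    if "Poly_Mapping.keys x \<subseteq> U \<times> V" "Poly_Mapping.keys y \<subseteq> U \<times> V" for x y
  proof -
    let ?F = "Poly_Mapping.keys x \<union> Poly_Mapping.keys y"
    have F: "finite ?F" "?F \<subseteq> U \<times> V" using that by auto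
    have "L (x + y) = M.lc ?F (Poly_Mapping.lookup (x + y)) b"
      using F by (intro L_superset keys_add) auto
    also have "\<dots> = M.lc ?F (Poly_Mapping.lookup x) b \<oplus>\<^bsub>M\<^esub> M.lc ?F (Poly_Mapping.lookup y) b"
      unfolding M.lc_def using F b_closed
      by (subst M.M.finsum_addf[symmetric])
        (auto intro!: M.M.finsum_cong' simp: lookup_add \<kappa>_add M.add_ls subset_iff)
    also have "\<dots> = L x \<oplus>\<^bsub>M\<^esub> L y" using F by (simp add: L_superset[of ?F])
    finally show ?thesis .
  qed
  have L_single: "L (Poly_Mapping.single (u, v) c) = \<kappa> c \<triangleright>\<^bsub>M\<^esub> \<beta> u v" if "u \<in> U" "v \<in> V" for u v c
    using that closed L_superset[of "{(u, v)}" "Poly_Mapping.single (u, v) c"]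
    by (auto simp: M.lc_def b_def M.M.finsum_insert)
  have L_scale: "L (pm_scale c x) = \<kappa> c \<triangleright>\<^bsub>M\<^esub> L x" if "Poly_Mapping.keys x \<subseteq> U \<times> V" for x c
    using that
  proof (induction x rule: pm_induct)
    case (single w a)
    then show ?case by (cases w) (auto simp: L_single closed \<kappa>_mult M.ls_assoc)
  next
    case (add x y)
    then show ?case by (simp add: pm.scale_right_distrib L_add L_closed M.ls_add subset_trans[OF keys_pm_scale])
  qed (simp add: L_def M.lc_def)
  \<comment> \<open>The support condition belongs to the subspace because \<open>L\<close> is
    controlled only for combinations supported in \<open>U \<times> V\<close>; outside of it
    \<open>b\<close> may leave the module.\<close>
  have "pm.subspace {x. Poly_Mapping.keys x \<subseteq> U \<times> V \<and> L x = \<zero>\<^bsub>M\<^esub>}"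
    unfolding pm.subspace_def
    by (auto simp: L_add L_scale subset_trans[OF keys_pm_scale] keys_add_subset) (simp add: L_def M.lc_def)
  moreover have diff: "L (x - y) = L x \<oplus>\<^bsub>M\<^esub> \<ominus>\<^bsub>M\<^esub> L y" "Poly_Mapping.keys (x - y) \<subseteq> U \<times> V"
    if "Poly_Mapping.keys x \<subseteq> U \<times> V" "Poly_Mapping.keys y \<subseteq> U \<times> V" for x y
  proof -
    show k: "Poly_Mapping.keys (x - y) \<subseteq> U \<times> V" using pm.subspace_diff[OF subspace_keys, of x "U \<times> V" y] that by simp
    have "L (x - y) \<oplus>\<^bsub>M\<^esub> L y = L x" using that k by (simp flip: L_add)
    then show "L (x - y) = L x \<oplus>\<^bsub>M\<^esub> \<ominus>\<^bsub>M\<^esub> L y" using L_closed[OF that(1)] L_closed[OF that(2)] L_closed[OF k]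
      by (metis M.M.add.inv_solve_right)
  qed
  have single_keys: "Poly_Mapping.keys (Poly_Mapping.single (u, v) c) \<subseteq> U \<times> V" if "u \<in> U" "v \<in> V" for u v and c :: 'k
    using that by auto
  have cancel: "x \<oplus>\<^bsub>M\<^esub> y \<oplus>\<^bsub>M\<^esub> \<ominus>\<^bsub>M\<^esub> x \<oplus>\<^bsub>M\<^esub> \<ominus>\<^bsub>M\<^esub> y = \<zero>\<^bsub>M\<^esub>" if "x \<in> carrier M" "y \<in> carrier M" for x y
    using that by (metis M.M.a_comm M.M.add.m_assoc M.M.add.inv_closed M.M.r_neg M.M.r_neg1 M.M.a_closed)
  have null: "\<N> \<subseteq> {x. Poly_Mapping.keys x \<subseteq> U \<times> V \<and> L x = \<zero>\<^bsub>M\<^esub>}"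
    by (rule null_minimal[OF \<open>pm.subspace {x. Poly_Mapping.keys x \<subseteq> U \<times> V \<and> L x = \<zero>\<^bsub>M\<^esub>}\<close>])
      (simp_all add: diff single_keys L_single U_add V_add U_mult \<kappa>_V closed add1 add2 scale cancel M.M.r_neg)
  \<comment> \<open>A representative supported in \<open>U \<times> V\<close> is chosen; by
    \<open>null\<close> its choice does not affect the value.\<close>
  define h where "h X = L (SOME x. X = cls x \<and> Poly_Mapping.keys x \<subseteq> U \<times> V)" for X
  have h_cls: "h (cls x) = L x" if x: "Poly_Mapping.keys x \<subseteq> U \<times> V" for x
  proof -
    define y where "y = (SOME y. cls x = cls y \<and> Poly_Mapping.keys y \<subseteq> U \<times> V)"
    have "cls x = cls y \<and> Poly_Mapping.keys y \<subseteq> U \<times> V" unfolding y_def by (rule someI[of _ x]) (use x in simp)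
    then have y: "x - y \<in> \<N>" "Poly_Mapping.keys y \<subseteq> U \<times> V" by (auto simp: cls_eq_iff)
    then have "L ((x - y) + y) = L (x - y) \<oplus>\<^bsub>M\<^esub> L y" using x by (intro L_add diff) auto
    then have "L x = L (x - y) \<oplus>\<^bsub>M\<^esub> L y" by simp
    also have "\<dots> = L y" using null y L_closed by auto
    finally show ?thesis by (simp add: h_def y_def)
  qed
  show thesis
  proof (rule that[of h])
    show "h \<in> carrier T \<rightarrow> carrier M" by (auto elim!: carrier_cls simp: h_cls L_closed)
    show "h (X \<oplus>\<^bsub>T\<^esub> Y) = h X \<oplus>\<^bsub>M\<^esub> h Y" if "X \<in> carrier T" "Y \<in> carrier T" for X Y
      using that by (auto elim!: carrier_cls simp: h_cls L_add add_cls keys_add_subset)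
    show "h (pure u v) = \<beta> u v" if "u \<in> U" "v \<in> V" for u v
      using that single_keys[of u v 1] by (simp add: pure_tensor_def h_cls L_single closed)
  qed
qed

end

section \<open>Bimodules generated by pairs of idempotents\<close>

lemma (in k_algebra) k_bimodule_direct_sum:
  assumes "\<And>i. i \<in> X \<Longrightarrow> k_bimodule A \<kappa> (M i)"
  shows "k_bimodule A \<kappa> (direct_sum_bimod X M)"
proof -
  note grp = assms[unfolded k_bimodule_def, THEN conjunct2, THEN conjunct1]
  have ab: "abelian_group (direct_sum_bimod X M)"
  proof (rule abelian_groupI)
    fix x assume "x \<in> carrier (direct_sum_bimod X M)"
    then have x: "x i \<in> carrier (M i)" if "i \<in> X" for i using that by (auto simp: direct_sum_bimod_def)
    then show "\<exists>y\<in>carrier (direct_sum_bimod X M). y \<oplus>\<^bsub>direct_sum_bimod X M\<^esub> x = \<zero>\<^bsub>direct_sum_bimod X M\<^esub>"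
      by (intro bexI[of _ "\<lambda>i\<in>X. \<ominus>\<^bsub>M i\<^esub> x i"])
        (auto simp: direct_sum_bimod_def abelian_group.l_neg[OF grp] abelian_group.a_inv_closed[OF grp])
  qed (auto simp: direct_sum_bimod_def fun_eq_iff PiE_def Pi_def extensional_def
        abelian_monoid.a_closed[OF abelian_group.axioms(1)[OF grp]] abelian_monoid.zero_closed[OF abelian_group.axioms(1)[OF grp]]
        abelian_monoid.a_assoc[OF abelian_group.axioms(1)[OF grp]] abelian_monoid.a_comm[OF abelian_group.axioms(1)[OF grp]]
        abelian_monoid.l_zero[OF abelian_group.axioms(1)[OF grp]]
        abelian_monoid.r_zero[OF abelian_group.axioms(1)[OF grp]] abelian_monoid.a_lcomm[OF abelian_group.axioms(1)[OF grp]])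
  show ?thesis
    by (intro k_bimodule.intro k_bimodule_axioms.intro k_algebra_axioms ab)
      (auto simp: direct_sum_bimod_def fun_eq_iff PiE_def Pi_def extensional_def
        k_bimodule.r_closed[OF assms] k_bimodule.l_closed[OF assms] k_bimodule.add_rs[OF assms] k_bimodule.ls_add[OF assms]
        k_bimodule.rs_add[OF assms] k_bimodule.add_ls[OF assms] k_bimodule.rs_assoc[OF assms] k_bimodule.ls_assoc[OF assms]
        k_bimodule.rs_one[OF assms] k_bimodule.ls_one[OF assms] k_bimodule.ls_rs[OF assms] k_bimodule.\<kappa>_central[OF assms])
qed

lemma direct_sum_induct [consumes 3, case_names zero inj add]:
  assumes "finite X" "\<And>i. i \<in> X \<Longrightarrow> abelian_group (M i)" "x \<in> carrier (direct_sum_bimod X M)"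
    and "P \<zero>\<^bsub>direct_sum_bimod X M\<^esub>"
    and "\<And>i z. i \<in> X \<Longrightarrow> z \<in> carrier (M i) \<Longrightarrow> P (direct_sum_inj X M i z)"
    and "\<And>x y. x \<in> carrier (direct_sum_bimod X M) \<Longrightarrow> y \<in> carrier (direct_sum_bimod X M) \<Longrightarrow> P x \<Longrightarrow> P y \<Longrightarrow>
      P (x \<oplus>\<^bsub>direct_sum_bimod X M\<^esub> y)"
  shows "P x"
proof -
  note grp = assms(2)[THEN abelian_group.axioms(1)]
  have x: "x i \<in> carrier (M i)" if "i \<in> X" for i using that assms(3) by (auto simp: direct_sum_bimod_def)
  \<comment> \<open>The vector is rebuilt one coordinate at a time: \<open>F\<close> collects the
    coordinates already set, the others are zero.\<close>
  have "finite F \<Longrightarrow> F \<subseteq> X \<Longrightarrow> P (\<lambda>j\<in>X. if j \<in> F then x j else \<zero>\<^bsub>M j\<^esub>)" for F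
  proof (induction F rule: finite_induct)
    case empty
    then show ?case using assms(4) by (simp add: direct_sum_bimod_def restrict_def)
  next
    case (insert i F)
    have "(\<lambda>j\<in>X. if j \<in> insert i F then x j else \<zero>\<^bsub>M j\<^esub>) =
        direct_sum_inj X M i (x i) \<oplus>\<^bsub>direct_sum_bimod X M\<^esub> (\<lambda>j\<in>X. if j \<in> F then x j else \<zero>\<^bsub>M j\<^esub>)"
      using insert.hyps insert.prems x
      by (auto simp: direct_sum_bimod_def direct_sum_inj_def fun_eq_iff abelian_monoid.l_zero[OF grp] abelian_monoid.r_zero[OF grp] abelian_monoid.zero_closed[OF grp])
    moreover have "P \<dots>"
    proof (rule assms(6))
      show "P (direct_sum_inj X M i (x i))" using insert.prems x by (intro assms(5)) auto
      show "P (\<lambda>j\<in>X. if j \<in> F then x j else \<zero>\<^bsub>M j\<^esub>)" by (rule insert.IH) (use insert.prems in auto)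
    qed (use x in \<open>auto simp: direct_sum_bimod_def direct_sum_inj_def abelian_monoid.zero_closed[OF grp]\<close>)
    ultimately show ?case by simp
  qed
  moreover have "(\<lambda>j\<in>X. if j \<in> X then x j else \<zero>\<^bsub>M j\<^esub>) = x"
    using assms(3) by (auto simp: direct_sum_bimod_def fun_eq_iff PiE_def extensional_def)
  ultimately show ?thesis using assms(1) by (metis subset_refl)
qed

text \<open>One term of the bimodule resolution in abstract form, the sum over \<open>i\<close> of
  \<open>A (l i)\<close> tensor \<open>(r i) A\<close>; later \<open>l i\<close> and
  \<open>r i\<close> are the vertices at which an \<open>f\<close> starts and ends.\<close>

locale idempotent_pairs = k_algebra A \<kappa> for A :: "('a, 'r) ring_scheme" (structure) and \<kappa> :: "'k::field \<Rightarrow> 'a" +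
  fixes X :: "'i set" and l r :: "'i \<Rightarrow> 'a"
  assumes finite_X [simp]: "finite X"
    and l_closed [simp]: "i \<in> X \<Longrightarrow> l i \<in> carrier A" and l_idem [simp]: "i \<in> X \<Longrightarrow> l i \<otimes> l i = l i"
    and r_closed [simp]: "i \<in> X \<Longrightarrow> r i \<in> carrier A" and r_idem [simp]: "i \<in> X \<Longrightarrow> r i \<otimes> r i = r i"
begin

definition "LU i = {a \<otimes> l i | a. a \<in> carrier A}"
definition "RV i = {r i \<otimes> a | a. a \<in> carrier A}"
abbreviation "TT i \<equiv> tensor_bimod A \<kappa> (LU i) (RV i)"
definition "D = direct_sum_bimod X TT"
definition "ten i a b = direct_sum_inj X TT i (pure_tensor A \<kappa> (LU i) (RV i) a b)"
definition "gen i = ten i (l i) (r i)"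

lemma LU_closed: "i \<in> X \<Longrightarrow> u \<in> LU i \<Longrightarrow> u \<in> carrier A" and RV_closed: "i \<in> X \<Longrightarrow> v \<in> RV i \<Longrightarrow> v \<in> carrier A"
  by (auto simp: LU_def RV_def)

lemma LU_l: "i \<in> X \<Longrightarrow> u \<in> LU i \<Longrightarrow> u \<otimes> l i = u" and RV_r: "i \<in> X \<Longrightarrow> v \<in> RV i \<Longrightarrow> r i \<otimes> v = v"
  by (auto simp: LU_def RV_def m_assoc) (simp flip: m_assoc)

lemma l_LU: "i \<in> X \<Longrightarrow> l i \<in> LU i" and r_RV: "i \<in> X \<Longrightarrow> r i \<in> RV i"
  unfolding LU_def RV_def using l_idem l_closed r_idem r_closed by force+

lemma LU_I: "a \<in> carrier A \<Longrightarrow> a \<otimes> l i \<in> LU i" and RV_I: "a \<in> carrier A \<Longrightarrow> r i \<otimes> a \<in> RV i"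
  by (auto simp: LU_def RV_def)

text \<open>Membership as a fixed point equation of an idempotent makes closure under sums and
  products immediate.\<close>

lemma LU_iff: "i \<in> X \<Longrightarrow> u \<in> LU i \<longleftrightarrow> u \<in> carrier A \<and> u \<otimes> l i = u"
  by (metis (mono_tags, lifting) LU_closed LU_def LU_l mem_Collect_eq)

lemma RV_iff: "i \<in> X \<Longrightarrow> v \<in> RV i \<longleftrightarrow> v \<in> carrier A \<and> r i \<otimes> v = v"
  by (metis (mono_tags, lifting) RV_closed RV_def RV_r mem_Collect_eq)

lemma tensor_product_pair: "i \<in> X \<Longrightarrow> tensor_product A \<kappa> (LU i) (RV i)"
proof unfold_locales
  assume i: "i \<in> X"
  show "LU i \<noteq> {}" "RV i \<noteq> {}" using l_LU[OF i] r_RV[OF i] by auto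
  show "v \<otimes> a \<in> RV i" if "a \<in> carrier A" "v \<in> RV i" for a v
    using that i by (auto simp: RV_iff simp flip: m_assoc)
qed (auto simp: LU_iff RV_iff l_distr r_distr m_assoc)

lemma k_bimodule_TT: "i \<in> X \<Longrightarrow> k_bimodule A \<kappa> (TT i)"
  by (rule tensor_product.k_bimodule_tensor[OF tensor_product_pair])

lemma k_bimodule_D: "k_bimodule A \<kappa> D"
  unfolding D_def by (rule k_bimodule_direct_sum) (rule k_bimodule_TT)

sublocale D: k_bimodule A \<kappa> D by (rule k_bimodule_D)

lemma inj_closed: "i \<in> X \<Longrightarrow> z \<in> carrier (TT i) \<Longrightarrow> direct_sum_inj X TT i z \<in> carrier D"
  using k_bimodule_TT by (auto simp: D_def direct_sum_bimod_def direct_sum_inj_def k_bimodule_def abelian_group_def abelian_monoid.zero_closed)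

lemma inj_zero: "direct_sum_inj X TT i \<zero>\<^bsub>TT i\<^esub> = \<zero>\<^bsub>D\<^esub>"
  by (auto simp: D_def direct_sum_bimod_def direct_sum_inj_def fun_eq_iff)

lemma inj_add:
  assumes "i \<in> X"
  shows "direct_sum_inj X TT i (x \<oplus>\<^bsub>TT i\<^esub> y) = direct_sum_inj X TT i x \<oplus>\<^bsub>D\<^esub> direct_sum_inj X TT i y"
proof -
  have "\<zero>\<^bsub>TT j\<^esub> \<oplus>\<^bsub>TT j\<^esub> \<zero>\<^bsub>TT j\<^esub> = \<zero>\<^bsub>TT j\<^esub>" if "j \<in> X" for j
    using k_bimodule_TT[OF that] by (simp add: k_bimodule_def abelian_group_def abelian_monoid.l_zero abelian_monoid.zero_closed)
  then show ?thesis by (auto simp: D_def direct_sum_bimod_def direct_sum_inj_def fun_eq_iff)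
qed

lemma inj_act:
  assumes "i \<in> X" "a \<in> carrier A"
  shows "a \<triangleright>\<^bsub>D\<^esub> direct_sum_inj X TT i x = direct_sum_inj X TT i (a \<triangleright>\<^bsub>TT i\<^esub> x)"
    "direct_sum_inj X TT i x \<triangleleft>\<^bsub>D\<^esub> a = direct_sum_inj X TT i (x \<triangleleft>\<^bsub>TT i\<^esub> a)"
  using assms by (auto simp: D_def direct_sum_bimod_def direct_sum_inj_def fun_eq_iff
      k_bimodule.ls_zero[OF k_bimodule_TT] k_bimodule.zero_rs[OF k_bimodule_TT])

lemma ten_closed: "i \<in> X \<Longrightarrow> a \<in> LU i \<Longrightarrow> b \<in> RV i \<Longrightarrow> ten i a b \<in> carrier D"
  unfolding ten_def by (intro inj_closed tensor_product.pure_closed[OF tensor_product_pair])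

lemma gen_closed [simp]: "i \<in> X \<Longrightarrow> gen i \<in> carrier D"
  unfolding gen_def by (intro ten_closed l_LU r_RV)

lemma ls_ten: "i \<in> X \<Longrightarrow> a \<in> carrier A \<Longrightarrow> a \<triangleright>\<^bsub>D\<^esub> ten i u v = ten i (a \<otimes> u) v"
  by (simp add: ten_def inj_act tensor_product.pure_ls[OF tensor_product_pair])

lemma ten_rs: "i \<in> X \<Longrightarrow> a \<in> carrier A \<Longrightarrow> ten i u v \<triangleleft>\<^bsub>D\<^esub> a = ten i u (v \<otimes> a)"
  by (simp add: ten_def inj_act tensor_product.pure_rs[OF tensor_product_pair])

lemma l_gen [simp]: "i \<in> X \<Longrightarrow> l i \<triangleright>\<^bsub>D\<^esub> gen i = gen i"
  by (simp add: gen_def ls_ten)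

lemma gen_r [simp]: "i \<in> X \<Longrightarrow> gen i \<triangleleft>\<^bsub>D\<^esub> r i = gen i"
  by (simp add: gen_def ten_rs)

lemma ten_gen:
  assumes "i \<in> X" "a \<in> LU i" "b \<in> RV i"
  shows "ten i a b = a \<triangleright>\<^bsub>D\<^esub> (gen i \<triangleleft>\<^bsub>D\<^esub> b)"
  using assms by (simp add: gen_def ten_rs ls_ten LU_closed RV_closed LU_l RV_r)

lemma gen_ten:
  assumes "i \<in> X" "a \<in> carrier A" "b \<in> carrier A"
  shows "a \<triangleright>\<^bsub>D\<^esub> (gen i \<triangleleft>\<^bsub>D\<^esub> b) = ten i (a \<otimes> l i) (r i \<otimes> b)"
  using assms by (simp add: gen_def ten_rs ls_ten)

text \<open>A pure tensor in the summand \<open>i\<close> is \<open>gen i\<close> multiplied by its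
  two factors, so products of generators with unrestricted \<open>a\<close> and \<open>b\<close>
  span everything additively.\<close>

lemma gen_induct [consumes 1, case_names zero gen add]:
  assumes "x \<in> carrier D" "P \<zero>\<^bsub>D\<^esub>"
    and "\<And>i a b. i \<in> X \<Longrightarrow> a \<in> carrier A \<Longrightarrow> b \<in> carrier A \<Longrightarrow> P (a \<triangleright>\<^bsub>D\<^esub> (gen i \<triangleleft>\<^bsub>D\<^esub> b))"
    and "\<And>x y. x \<in> carrier D \<Longrightarrow> y \<in> carrier D \<Longrightarrow> P x \<Longrightarrow> P y \<Longrightarrow> P (x \<oplus>\<^bsub>D\<^esub> y)"
  shows "P x"
proof (rule direct_sum_induct[of X TT x P, folded D_def])
  fix i z assume i: "i \<in> X" and z: "z \<in> carrier (TT i)"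
  interpret t: tensor_product A \<kappa> "LU i" "RV i" using i by (rule tensor_product_pair)
  show "P (direct_sum_inj X TT i z)" using z
  proof (induction z rule: t.tensor_induct)
    case zero then show ?case using assms(2) by (simp add: inj_zero)
  next
    case (pure u v)
    then show ?case using assms(3)[OF i, of u v] by (simp add: ten_gen[OF i, symmetric] ten_def[symmetric] LU_closed[OF i] RV_closed[OF i])
  next
    case (add x y)
    then show ?case using i assms(4) by (simp add: inj_add inj_closed)
  qed
qed (use assms(1,2,4) k_bimodule_TT in \<open>auto simp: k_bimodule_def\<close>)

text \<open>The universal properties of the summands are glued by adding the values on the finitely
  many coordinates.\<close>

lemma balanced_lift:
  fixes M :: "('a, 'm) bimod"
  assumes "k_bimodule A \<kappa> M"
    and closed: "\<And>i u v. i \<in> X \<Longrightarrow> u \<in> LU i \<Longrightarrow> v \<in> RV i \<Longrightarrow> \<beta> i u v \<in> carrier M"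
    and "\<And>i u u' v. i \<in> X \<Longrightarrow> u \<in> LU i \<Longrightarrow> u' \<in> LU i \<Longrightarrow> v \<in> RV i \<Longrightarrow> \<beta> i (u \<oplus> u') v = \<beta> i u v \<oplus>\<^bsub>M\<^esub> \<beta> i u' v"
    and "\<And>i u v v'. i \<in> X \<Longrightarrow> u \<in> LU i \<Longrightarrow> v \<in> RV i \<Longrightarrow> v' \<in> RV i \<Longrightarrow> \<beta> i u (v \<oplus> v') = \<beta> i u v \<oplus>\<^bsub>M\<^esub> \<beta> i u v'"
    and "\<And>i u v c. i \<in> X \<Longrightarrow> u \<in> LU i \<Longrightarrow> v \<in> RV i \<Longrightarrow> \<beta> i (\<kappa> c \<otimes> u) v = \<kappa> c \<triangleright>\<^bsub>M\<^esub> \<beta> i u v"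
    and "\<And>i u v c. i \<in> X \<Longrightarrow> u \<in> LU i \<Longrightarrow> v \<in> RV i \<Longrightarrow> \<beta> i u (\<kappa> c \<otimes> v) = \<kappa> c \<triangleright>\<^bsub>M\<^esub> \<beta> i u v"
  obtains h where "h \<in> carrier D \<rightarrow> carrier M"
    "\<And>x y. x \<in> carrier D \<Longrightarrow> y \<in> carrier D \<Longrightarrow> h (x \<oplus>\<^bsub>D\<^esub> y) = h x \<oplus>\<^bsub>M\<^esub> h y"
    "\<And>i u v. i \<in> X \<Longrightarrow> u \<in> LU i \<Longrightarrow> v \<in> RV i \<Longrightarrow> h (ten i u v) = \<beta> i u v"
proof -
  interpret M: k_bimodule A \<kappa> M by fact
  have "\<exists>h. h \<in> carrier (TT i) \<rightarrow> carrier M \<and>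
    (\<forall>x\<in>carrier (TT i). \<forall>y\<in>carrier (TT i). h (x \<oplus>\<^bsub>TT i\<^esub> y) = h x \<oplus>\<^bsub>M\<^esub> h y) \<and>
    (\<forall>u\<in>LU i. \<forall>v\<in>RV i. h (pure_tensor A \<kappa> (LU i) (RV i) u v) = \<beta> i u v)" if i: "i \<in> X" for i
    by (rule tensor_product.tensor_lift[OF tensor_product_pair[OF i] assms(1), of "\<beta> i"]) (use i assms(2-) in auto)
  then obtain h where h: "\<And>i. i \<in> X \<Longrightarrow> h i \<in> carrier (TT i) \<rightarrow> carrier M"
    "\<And>i x y. i \<in> X \<Longrightarrow> x \<in> carrier (TT i) \<Longrightarrow> y \<in> carrier (TT i) \<Longrightarrow> h i (x \<oplus>\<^bsub>TT i\<^esub> y) = h i x \<oplus>\<^bsub>M\<^esub> h i y"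
    "\<And>i u v. i \<in> X \<Longrightarrow> u \<in> LU i \<Longrightarrow> v \<in> RV i \<Longrightarrow> h i (pure_tensor A \<kappa> (LU i) (RV i) u v) = \<beta> i u v"
    by metis
  have h0: "h i \<zero>\<^bsub>TT i\<^esub> = \<zero>\<^bsub>M\<^esub>" if "i \<in> X" for i
    using k_bimodule_TT[OF that] assms(1) h(1,2)[OF that] by (intro additive_map_zero) (auto simp: k_bimodule_def)
  define H where "H x = (\<Oplus>\<^bsub>M\<^esub>i\<in>X. h i (x i))" for x
  have mem: "x i \<in> carrier (TT i)" if "x \<in> carrier D" "i \<in> X" for x i
    using that by (auto simp: D_def direct_sum_bimod_def)
  show thesis
  proof (rule that[of H])
    show "H \<in> carrier D \<rightarrow> carrier M"
      using h(1) mem unfolding H_def by (auto intro!: M.M.finsum_closed)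
    show "H (x \<oplus>\<^bsub>D\<^esub> y) = H x \<oplus>\<^bsub>M\<^esub> H y" if xy: "x \<in> carrier D" "y \<in> carrier D" for x y
    proof -
      have "H (x \<oplus>\<^bsub>D\<^esub> y) = (\<Oplus>\<^bsub>M\<^esub>i\<in>X. h i (x i) \<oplus>\<^bsub>M\<^esub> h i (y i))"
        unfolding H_def using xy mem h(1) h(2)
        by (intro M.M.finsum_cong') (auto simp: D_def direct_sum_bimod_def Pi_def)
      also have "\<dots> = H x \<oplus>\<^bsub>M\<^esub> H y"
        unfolding H_def using xy mem h(1) by (intro M.M.finsum_addf) (auto simp: Pi_def)
      finally show ?thesis .
    qed
    show "H (ten i u v) = \<beta> i u v" if "i \<in> X" "u \<in> LU i" "v \<in> RV i" for i u v
    proof -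
      have "H (ten i u v) = (\<Oplus>\<^bsub>M\<^esub>j\<in>X. if i = j then \<beta> i u v else \<zero>\<^bsub>M\<^esub>)"
        unfolding H_def using that closed
        by (intro M.M.finsum_cong') (auto simp: ten_def direct_sum_inj_def h(3) h0)
      then show ?thesis using that closed by (simp add: M.M.finsum_singleton Pi_def)
    qed
  qed
qed

lemma hom_eqI:
  assumes "h \<in> bimod_hom A D M" "h' \<in> bimod_hom A D M" "k_bimodule A \<kappa> M"
    and "\<And>i. i \<in> X \<Longrightarrow> h (gen i) = h' (gen i)"
  shows "h = h'"
proof (rule extensionalityI[OF bimod_homD(6)[OF assms(1)] bimod_homD(6)[OF assms(2)]])
  fix x assume "x \<in> carrier D"
  then show "h x = h' x"
  proof (induction x rule: gen_induct)
    case zero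
    then show ?case using assms k_bimodule_D by (simp add: bimod_hom_zero)
  qed (simp_all add: bimod_homD[OF assms(1)] bimod_homD[OF assms(2)] assms(4))
qed

text \<open>Projectivity of \<open>D\<close> in explicit form: homomorphisms to \<open>M\<close>
  correspond to families with \<open>m i\<close> fixed by \<open>l i\<close> on the left and by
  \<open>r i\<close> on the right, the condition that the idempotents force on images of the
  generators.\<close>

lemma hom_exists:
  fixes M :: "('a, 'm) bimod"
  assumes M: "k_bimodule A \<kappa> M" and m: "\<And>i. i \<in> X \<Longrightarrow> m i \<in> carrier M"
    "\<And>i. i \<in> X \<Longrightarrow> l i \<triangleright>\<^bsub>M\<^esub> m i = m i" "\<And>i. i \<in> X \<Longrightarrow> m i \<triangleleft>\<^bsub>M\<^esub> r i = m i"
  obtains h where "h \<in> bimod_hom A D M" "\<And>i. i \<in> X \<Longrightarrow> h (gen i) = m i"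
proof -
  interpret M: k_bimodule A \<kappa> M by fact
  obtain h where h: "h \<in> carrier D \<rightarrow> carrier M"
    "\<And>x y. x \<in> carrier D \<Longrightarrow> y \<in> carrier D \<Longrightarrow> h (x \<oplus>\<^bsub>D\<^esub> y) = h x \<oplus>\<^bsub>M\<^esub> h y"
    "\<And>i u v. i \<in> X \<Longrightarrow> u \<in> LU i \<Longrightarrow> v \<in> RV i \<Longrightarrow> h (ten i u v) = u \<triangleright>\<^bsub>M\<^esub> (m i \<triangleleft>\<^bsub>M\<^esub> v)"
  proof (rule balanced_lift[OF M, of "\<lambda>i u v. u \<triangleright>\<^bsub>M\<^esub> (m i \<triangleleft>\<^bsub>M\<^esub> v)"])
    fix i u v c assume *: "i \<in> X" "u \<in> LU i" "v \<in> RV i"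
    then show "u \<triangleright>\<^bsub>M\<^esub> (m i \<triangleleft>\<^bsub>M\<^esub> (\<kappa> c \<otimes> v)) = \<kappa> c \<triangleright>\<^bsub>M\<^esub> u \<triangleright>\<^bsub>M\<^esub> (m i \<triangleleft>\<^bsub>M\<^esub> v)"
      by (simp add: M.rs_assoc LU_closed RV_closed m flip: M.\<kappa>_central)
        (simp add: M.ls_rs M.\<kappa>_ls_comm LU_closed RV_closed m)
  qed (auto simp: LU_closed RV_closed m M.add_ls M.rs_add M.ls_add M.ls_assoc)
  have 0: "h \<zero>\<^bsub>D\<^esub> = \<zero>\<^bsub>M\<^esub>"
    by (intro additive_map_zero[OF D.M.abelian_group_axioms M.M.abelian_group_axioms h(1)] h(2))
  have hg: "h (a \<triangleright>\<^bsub>D\<^esub> (gen i \<triangleleft>\<^bsub>D\<^esub> b)) = a \<triangleright>\<^bsub>M\<^esub> (m i \<triangleleft>\<^bsub>M\<^esub> b)" if "i \<in> X" "a \<in> carrier A" "b \<in> carrier A" for i a b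
  proof -
    \<comment> \<open>An arbitrary \<open>a\<close> need not be a multiple of \<open>l i\<close>;
      the generator supplies the idempotents, and \<open>m i\<close> absorbs them again.\<close>
    have "h (a \<triangleright>\<^bsub>D\<^esub> (gen i \<triangleleft>\<^bsub>D\<^esub> b)) = (a \<otimes> l i) \<triangleright>\<^bsub>M\<^esub> (m i \<triangleleft>\<^bsub>M\<^esub> (r i \<otimes> b))"
      using that by (simp add: gen_ten LU_I RV_I h(3))
    also have "\<dots> = a \<triangleright>\<^bsub>M\<^esub> (l i \<triangleright>\<^bsub>M\<^esub> ((m i \<triangleleft>\<^bsub>M\<^esub> r i) \<triangleleft>\<^bsub>M\<^esub> b))"
      using that m(1) by (simp add: M.ls_assoc M.rs_assoc)
    also have "\<dots> = a \<triangleright>\<^bsub>M\<^esub> (m i \<triangleleft>\<^bsub>M\<^esub> b)"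
      using that m by (simp flip: M.ls_rs)
    finally show ?thesis .
  qed
  have "h (x \<triangleleft>\<^bsub>D\<^esub> a) = h x \<triangleleft>\<^bsub>M\<^esub> a \<and> h (a \<triangleright>\<^bsub>D\<^esub> x) = a \<triangleright>\<^bsub>M\<^esub> h x" if "x \<in> carrier D" and a: "a \<in> carrier A" for x a
    using that(1)
  proof (induction x rule: gen_induct)
    case (gen i b c)
    then have "(b \<triangleright>\<^bsub>D\<^esub> (gen i \<triangleleft>\<^bsub>D\<^esub> c)) \<triangleleft>\<^bsub>D\<^esub> a = b \<triangleright>\<^bsub>D\<^esub> (gen i \<triangleleft>\<^bsub>D\<^esub> (c \<otimes> a))"
      "a \<triangleright>\<^bsub>D\<^esub> b \<triangleright>\<^bsub>D\<^esub> (gen i \<triangleleft>\<^bsub>D\<^esub> c) = (a \<otimes> b) \<triangleright>\<^bsub>D\<^esub> (gen i \<triangleleft>\<^bsub>D\<^esub> c)"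
      using a by (simp_all add: D.ls_rs D.rs_assoc D.ls_assoc)
    then show ?case using gen a m by (simp add: hg M.ls_rs M.rs_assoc M.ls_assoc)
  next
    case (add x y)
    then show ?case using a h(1) by (auto simp: D.add_rs D.ls_add h(2) M.add_rs M.ls_add Pi_def)
  qed (use a in \<open>simp add: 0\<close>)
  then have "restrict h (carrier D) \<in> bimod_hom A D M"
    using h(1,2) by (auto simp: bimod_hom_def)
  moreover have "restrict h (carrier D) (gen i) = m i" if "i \<in> X" for i
    using hg[of i \<one> \<one>] that m(1) by simp
  ultimately show thesis by (rule that)
qed

text \<open>The map \<open>\<phi>\<close> tensor identity on the summand \<open>i\<close>, extended
  by zero. It is additive but not left linear, as \<open>\<phi>\<close> is linear over
  \<open>k\<close> only; with \<open>\<phi>\<close> the coefficient of a basis path it extracts the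
  right factor standing behind that path.\<close>

lemma coordinate_exists:
  assumes \<phi>: "\<And>a b. a \<in> carrier A \<Longrightarrow> b \<in> carrier A \<Longrightarrow> \<phi> (a \<oplus> b) = \<phi> a + \<phi> b"
    "\<And>a c. a \<in> carrier A \<Longrightarrow> \<phi> (\<kappa> c \<otimes> a) = c * \<phi> a" and i: "i \<in> X"
  obtains \<Phi> where "\<Phi> \<in> carrier D \<rightarrow> carrier A"
    "\<And>x y. x \<in> carrier D \<Longrightarrow> y \<in> carrier D \<Longrightarrow> \<Phi> (x \<oplus>\<^bsub>D\<^esub> y) = \<Phi> x \<oplus> \<Phi> y"
    "\<And>j a b. j \<in> X \<Longrightarrow> a \<in> carrier A \<Longrightarrow> b \<in> carrier A \<Longrightarrow>
      \<Phi> (a \<triangleright>\<^bsub>D\<^esub> (gen j \<triangleleft>\<^bsub>D\<^esub> b)) = (if j = i then \<kappa> (\<phi> (a \<otimes> l i)) \<otimes> (r i \<otimes> b) else \<zero>)"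
proof -
  have reg: "carrier (regular_bimod A) = carrier A" "x \<oplus>\<^bsub>regular_bimod A\<^esub> y = x \<oplus> y" "a \<triangleright>\<^bsub>regular_bimod A\<^esub> x = a \<otimes> x" for x y a
    by (simp_all add: regular_bimod_def)
  obtain h where h: "h \<in> carrier D \<rightarrow> carrier A"
    "\<And>x y. x \<in> carrier D \<Longrightarrow> y \<in> carrier D \<Longrightarrow> h (x \<oplus>\<^bsub>D\<^esub> y) = h x \<oplus> h y"
    "\<And>j u v. j \<in> X \<Longrightarrow> u \<in> LU j \<Longrightarrow> v \<in> RV j \<Longrightarrow> h (ten j u v) = (if j = i then \<kappa> (\<phi> u) \<otimes> v else \<zero>)"
  proof (rule balanced_lift[OF k_bimodule_regular, of "\<lambda>j u v. if j = i then \<kappa> (\<phi> u) \<otimes> v else \<zero>", unfolded reg])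
    fix j u v c assume *: "j \<in> X" "u \<in> LU j" "v \<in> RV j"
    then have "v \<in> carrier A" by (simp add: RV_closed[of j])
    then show "(if j = i then \<kappa> (\<phi> u) \<otimes> (\<kappa> c \<otimes> v) else \<zero>) = \<kappa> c \<otimes> (if j = i then \<kappa> (\<phi> u) \<otimes> v else \<zero>)"
      by (simp add: mult.commute flip: m_assoc \<kappa>_mult)
  qed (auto simp: LU_closed RV_closed \<phi> \<kappa>_add \<kappa>_mult l_distr r_distr m_assoc)
  show thesis
    by (rule that[of h]) (use i in \<open>auto simp: h gen_ten LU_I RV_I\<close>)
qed

end

section \<open>Well-definedness of the Yoneda product\<close>

lemma bimod_homI:
  assumes "\<And>x. x \<in> carrier M \<Longrightarrow> h x \<in> carrier M'"
    "\<And>x y. x \<in> carrier M \<Longrightarrow> y \<in> carrier M \<Longrightarrow> h (x \<oplus>\<^bsub>M\<^esub> y) = h x \<oplus>\<^bsub>M'\<^esub> h y"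
    "\<And>x a. x \<in> carrier M \<Longrightarrow> a \<in> carrier A \<Longrightarrow> h (x \<triangleleft>\<^bsub>M\<^esub> a) = h x \<triangleleft>\<^bsub>M'\<^esub> a"
    "\<And>x a. x \<in> carrier M \<Longrightarrow> a \<in> carrier A \<Longrightarrow> h (a \<triangleright>\<^bsub>M\<^esub> x) = a \<triangleright>\<^bsub>M'\<^esub> h x"
    "k_bimodule A \<kappa> M"
  shows "(\<lambda>x\<in>carrier M. h x) \<in> bimod_hom A M M'"
proof -
  interpret M: k_bimodule A \<kappa> M by fact
  show ?thesis using assms(1-4) by (auto simp: bimod_hom_def)
qed

lemma bimod_hom_compose:
  assumes "k_bimodule A \<kappa> M" "f \<in> bimod_hom A M M'" "g \<in> bimod_hom A M' M''"
  shows "(\<lambda>x\<in>carrier M. g (f x)) \<in> bimod_hom A M M''"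
  using assms(1) by (intro bimod_homI) (auto simp: bimod_homD[OF assms(2)] bimod_homD[OF assms(3)])

lemma bimod_hom_add:
  assumes "k_bimodule A \<kappa> M" "k_bimodule A \<kappa> M'" "f \<in> bimod_hom A M M'" "g \<in> bimod_hom A M M'"
  shows "(\<lambda>x\<in>carrier M. f x \<oplus>\<^bsub>M'\<^esub> g x) \<in> bimod_hom A M M'"
proof -
  interpret M': k_bimodule A \<kappa> M' by fact
  show ?thesis using assms(1)
    by (intro bimod_homI) (auto simp: bimod_homD[OF assms(3)] bimod_homD[OF assms(4)] M'.add_rs M'.ls_add M'.M.a_ac)
qed

lemma bimod_hom_uminus:
  assumes "k_bimodule A \<kappa> M" "k_bimodule A \<kappa> M'" "f \<in> bimod_hom A M M'"
  shows "(\<lambda>x\<in>carrier M. \<ominus>\<^bsub>M'\<^esub> f x) \<in> bimod_hom A M M'"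
proof -
  interpret M': k_bimodule A \<kappa> M' by fact
  show ?thesis using assms(1)
    by (intro bimod_homI) (auto simp: bimod_homD[OF assms(3)] M'.M.minus_add M'.minus_rs M'.ls_minus)
qed

lemma bimod_hom_zero_map:
  assumes "k_bimodule A \<kappa> M" "k_bimodule A \<kappa> M'"
  shows "(\<lambda>x\<in>carrier M. \<zero>\<^bsub>M'\<^esub>) \<in> bimod_hom A M M'"
proof -
  interpret M': k_bimodule A \<kappa> M' by fact
  show ?thesis using assms(1) by (intro bimod_homI) auto
qed

text \<open>Projectivity appears as the lifting property that homotopies use. It is stated twice
  because maps into another term and maps into the algebra have values of different types.\<close>

locale projective_bimod_resolution = k_algebra A \<kappa>
  for A :: "('a, 'r) ring_scheme" (structure) and \<kappa> :: "'k::field \<Rightarrow> 'a" +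
  fixes P :: "nat \<Rightarrow> ('a, 'm) bimod" and \<delta> :: "nat \<Rightarrow> 'm \<Rightarrow> 'm" and \<delta>0 :: "'m \<Rightarrow> 'a"
  assumes P: "k_bimodule A \<kappa> (P n)"
    and \<delta>_hom: "\<delta> (Suc n) \<in> bimod_hom A (P (Suc n)) (P n)"
    and \<delta>0_hom: "\<delta>0 \<in> bimod_hom A (P 0) (regular_bimod A)"
    and \<delta>_\<delta>: "x \<in> carrier (P (Suc (Suc n))) \<Longrightarrow> \<delta> (Suc n) (\<delta> (Suc (Suc n)) x) = \<zero>\<^bsub>P n\<^esub>"
    and \<delta>0_\<delta>: "x \<in> carrier (P 1) \<Longrightarrow> \<delta>0 (\<delta> 1 x) = \<zero>"
    and exact: "x \<in> carrier (P (Suc n)) \<Longrightarrow> \<delta> (Suc n) x = \<zero>\<^bsub>P n\<^esub> \<Longrightarrow> x \<in> \<delta> (Suc (Suc n)) ` carrier (P (Suc (Suc n)))"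
    and exact0: "x \<in> carrier (P 0) \<Longrightarrow> \<delta>0 x = \<zero> \<Longrightarrow> x \<in> \<delta> 1 ` carrier (P 1)"
    and surj: "\<delta>0 ` carrier (P 0) = carrier A"
    and lift: "g \<in> bimod_hom A (P n) (P j) \<Longrightarrow> d \<in> bimod_hom A (P i) (P j) \<Longrightarrow>
      g ` carrier (P n) \<subseteq> d ` carrier (P i) \<Longrightarrow> \<exists>h \<in> bimod_hom A (P n) (P i). \<forall>x\<in>carrier (P n). d (h x) = g x"
    and lift0: "g0 \<in> bimod_hom A (P n) (regular_bimod A) \<Longrightarrow> d0 \<in> bimod_hom A (P i) (regular_bimod A) \<Longrightarrow>
      g0 ` carrier (P n) \<subseteq> d0 ` carrier (P i) \<Longrightarrow> \<exists>h \<in> bimod_hom A (P n) (P i). \<forall>x\<in>carrier (P n). d0 (h x) = g0 x"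
begin

abbreviation "reg \<equiv> regular_bimod A"
abbreviation "Hom0 n \<equiv> bimod_hom A (P n) reg"
abbreviation "cob \<equiv> HH_coboundaries A P \<delta>"

lemma reg_simps [simp]: "carrier reg = carrier A" "\<zero>\<^bsub>reg\<^esub> = \<zero>" "x \<oplus>\<^bsub>reg\<^esub> y = x \<oplus> y"
  by (simp_all add: regular_bimod_def)

lemma reg_minus [simp]: "x \<in> carrier A \<Longrightarrow> \<ominus>\<^bsub>reg\<^esub> x = \<ominus> x"
proof -
  interpret R: k_bimodule A \<kappa> reg by (rule k_bimodule_regular)
  assume x: "x \<in> carrier A"
  then have "\<ominus> x \<oplus>\<^bsub>reg\<^esub> x = \<zero>\<^bsub>reg\<^esub>" by (simp add: l_neg)
  then show ?thesis using x R.M.minus_equality[of "\<ominus> x" x] by simp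
qed

text \<open>Cochains are extensional functions, so equality with a composite is pointwise agreement
  on the carrier. Degree 0, where only zero is a coboundary, is treated together with the other
  degrees.\<close>

lemma cob_iff: "h \<in> cob n \<longleftrightarrow> h \<in> extensional (carrier (P n)) \<and>
    (if n = 0 then \<forall>x\<in>carrier (P n). h x = \<zero>
     else \<exists>\<xi>\<in>Hom0 (n - 1). \<forall>x\<in>carrier (P n). h x = \<xi> (\<delta> n x))"
proof (cases n)
  case 0
  then show ?thesis by (auto simp: HH_coboundaries_def extensional_def fun_eq_iff)
next
  case (Suc n')
  have "h \<in> cob n \<longleftrightarrow> (\<exists>\<xi>\<in>Hom0 n'. h = compose (carrier (P n)) \<xi> (\<delta> n))"
    by (auto simp: HH_coboundaries_def Suc)
  moreover have "h = compose (carrier (P n)) \<xi> (\<delta> n) \<longleftrightarrow>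
      h \<in> extensional (carrier (P n)) \<and> (\<forall>x\<in>carrier (P n). h x = \<xi> (\<delta> n x))" for \<xi>
    by (auto simp: compose_def intro: extensionalityI)
  ultimately show ?thesis by (auto simp: Suc)
qed

lemma cob_hom: "h \<in> cob n \<Longrightarrow> h \<in> Hom0 n"
proof -
  assume h: "h \<in> cob n"
  show ?thesis
  proof (cases n)
    case 0
    then have "h = (\<lambda>x\<in>carrier (P n). \<zero>\<^bsub>reg\<^esub>)" using h by (auto simp: HH_coboundaries_def)
    then show ?thesis using bimod_hom_zero_map[OF P[of n] k_bimodule_regular] by simp
  next
    case (Suc n')
    then obtain \<xi> where "\<xi> \<in> Hom0 n'" "h = compose (carrier (P n)) \<xi> (\<delta> n)" using h by (auto simp: HH_coboundaries_def)
    then show ?thesis using bimod_hom_compose[OF P, of "\<delta> n" n "P n'" \<xi> reg] \<delta>_hom[of n'] by (simp add: compose_def Suc)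
  qed
qed

lemma cob_zero: "(\<lambda>x\<in>carrier (P n). \<zero>) \<in> cob n"
  unfolding cob_iff using bimod_hom_zero_map[OF P k_bimodule_regular, of "n - 1"] bimod_homD(2)[OF \<delta>_hom[of "n - 1"]]
  by (auto intro!: bexI[of _ "\<lambda>x\<in>carrier (P (n - 1)). \<zero>"])

lemma cob_add:
  assumes "h \<in> cob n" "h' \<in> cob n"
  shows "(\<lambda>x\<in>carrier (P n). h x \<oplus> h' x) \<in> cob n"
proof (cases n)
  case (Suc n')
  from assms obtain \<xi> \<xi>' where "\<xi> \<in> Hom0 n'" "\<xi>' \<in> Hom0 n'" "\<forall>x\<in>carrier (P n). h x = \<xi> (\<delta> n x)" "\<forall>x\<in>carrier (P n). h' x = \<xi>' (\<delta> n x)"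
    by (auto simp: cob_iff Suc)
  then show ?thesis using bimod_hom_add[OF P k_bimodule_regular, of \<xi> n' \<xi>'] bimod_homD(2)[OF \<delta>_hom[of n']]
    by (auto simp: cob_iff Suc intro!: bexI[of _ "\<lambda>x\<in>carrier (P n'). \<xi> x \<oplus> \<xi>' x"])
qed (use assms in \<open>auto simp: cob_iff\<close>)

lemma cob_uminus:
  assumes "h \<in> cob n"
  shows "(\<lambda>x\<in>carrier (P n). \<ominus> h x) \<in> cob n"
proof (cases n)
  case (Suc n')
  from assms obtain \<xi> where \<xi>: "\<xi> \<in> Hom0 n'" "\<forall>x\<in>carrier (P n). h x = \<xi> (\<delta> n x)"
    by (auto simp: cob_iff Suc)
  then show ?thesis using bimod_hom_uminus[OF P k_bimodule_regular, of \<xi> n'] bimod_homD(2)[OF \<delta>_hom[of n']] bimod_homD(2)[OF \<xi>(1)]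
    by (auto simp: cob_iff Suc intro!: bexI[of _ "\<lambda>x\<in>carrier (P n'). \<ominus>\<^bsub>reg\<^esub> \<xi> x"])
qed (use assms in \<open>auto simp: cob_iff\<close>)

lemma HH_class_iff: "g \<in> HH_class A P \<delta> n \<eta> \<longleftrightarrow> (\<exists>h\<in>cob n. g = (\<lambda>x\<in>carrier (P n). h x \<oplus> \<eta> x))"
  by (simp add: HH_class_def a_r_coset_def' bimod_hom_group_def)

lemma HH_class_self: "\<eta> \<in> Hom0 n \<Longrightarrow> \<eta> \<in> HH_class A P \<delta> n \<eta>"
  unfolding HH_class_iff using bimod_homD(2)[of \<eta> A "P n" reg] bimod_homD(6)[of \<eta> A "P n" reg]
  by (intro bexI[OF _ cob_zero]) (auto intro!: extensionalityI[of _ "carrier (P n)"])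

lemma HH_class_eqI:
  assumes "g \<in> Hom0 n" "g' \<in> Hom0 n" "h \<in> cob n" "\<And>x. x \<in> carrier (P n) \<Longrightarrow> g x = h x \<oplus> g' x"
  shows "HH_class A P \<delta> n g = HH_class A P \<delta> n g'"
proof -
  have closed: "g x \<in> carrier A" "g' x \<in> carrier A" if "x \<in> carrier (P n)" for x
    using bimod_homD(2)[OF assms(1)] bimod_homD(2)[OF assms(2)] that by auto
  \<comment> \<open>Applied in both directions, the second time with the negative of the
    coboundary.\<close>
  have sub: "HH_class A P \<delta> n g \<subseteq> HH_class A P \<delta> n g'"
    if "h \<in> cob n" "\<And>x. x \<in> carrier (P n) \<Longrightarrow> g x = h x \<oplus> g' x" and g': "g' \<in> Hom0 n" for h g g'
  proof
    fix f assume "f \<in> HH_class A P \<delta> n g"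
    then obtain b where b: "b \<in> cob n" "f = (\<lambda>x\<in>carrier (P n). b x \<oplus> g x)" by (auto simp: HH_class_iff)
    have "f = (\<lambda>x\<in>carrier (P n). (\<lambda>x\<in>carrier (P n). b x \<oplus> h x) x \<oplus> g' x)"
      using that(2) bimod_homD(2)[OF cob_hom[OF b(1)]] bimod_homD(2)[OF cob_hom[OF that(1)]] bimod_homD(2)[OF g']
      by (auto simp: b(2) fun_eq_iff a_assoc)
    then show "f \<in> HH_class A P \<delta> n g'" unfolding HH_class_iff
      by (intro bexI[where x = "\<lambda>x\<in>carrier (P n). b x \<oplus> h x"] cob_add[OF b(1) that(1)])
  qed
  have "g' x = (\<lambda>x\<in>carrier (P n). \<ominus> h x) x \<oplus> g x" if "x \<in> carrier (P n)" for x
    using closed[OF that] assms(4)[OF that] bimod_homD(2)[OF cob_hom[OF assms(3)] that] that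
    by (simp add: a_assoc[symmetric] l_neg)
  with sub[OF assms(3,4,2)] sub[OF cob_uminus[OF assms(3)] _ assms(1)] show ?thesis by blast
qed

text \<open>The summand of a homotopy formula that passes through the differential of the source. It
  vanishes on boundaries, and composing it with a cochain gives a coboundary; in degree 0 there is
  no such differential and the summand is zero.\<close>

definition null_through :: "nat \<Rightarrow> nat \<Rightarrow> ('m \<Rightarrow> 'm) \<Rightarrow> bool" where
  "null_through k i K \<longleftrightarrow> K \<in> bimod_hom A (P k) (P i) \<and>
     (if k = 0 then \<forall>x\<in>carrier (P 0). K x = \<zero>\<^bsub>P i\<^esub>
      else \<exists>H\<in>bimod_hom A (P (k - 1)) (P i). \<forall>x\<in>carrier (P k). K x = H (\<delta> k x))"

lemma null_through_\<delta>:
  assumes "null_through k i K" "x \<in> carrier (P (Suc k))"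
  shows "K (\<delta> (Suc k) x) = \<zero>\<^bsub>P i\<^esub>"
proof (cases k)
  case 0
  then show ?thesis using assms bimod_homD(2)[OF \<delta>_hom] by (simp add: null_through_def)
next
  case (Suc k')
  then obtain H where "H\<in>bimod_hom A (P k') (P i)" "\<forall>x\<in>carrier (P k). K x = H (\<delta> k x)"
    using assms by (auto simp: null_through_def)
  then show ?thesis using assms(2) bimod_homD(2)[OF \<delta>_hom] bimod_hom_zero[OF P P]
    by (simp add: Suc \<delta>_\<delta>)
qed

lemma null_through_cob:
  assumes "null_through k i K" "\<eta> \<in> Hom0 i"
  shows "(\<lambda>x\<in>carrier (P k). \<eta> (K x)) \<in> cob k"
proof (cases k)
  case 0
  then show ?thesis using assms bimod_hom_zero[OF P k_bimodule_regular assms(2)] by (auto simp: null_through_def cob_iff)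
next
  case (Suc k')
  then obtain H where "H\<in>bimod_hom A (P k') (P i)" "\<forall>x\<in>carrier (P k). K x = H (\<delta> k x)"
    using assms by (auto simp: null_through_def)
  then show ?thesis using bimod_hom_compose[OF P _ assms(2), of H k'] bimod_homD(2)[OF \<delta>_hom[of k']]
    by (auto simp: cob_iff Suc intro!: bexI[of _ "\<lambda>x\<in>carrier (P k'). \<eta> (H x)"])
qed

text \<open>The sum type lets the augmentation, with values in the algebra, and the differentials,
  with values in \<open>P\<close>, be handled by one induction.\<close>

definition \<delta>' :: "nat \<Rightarrow> 'm \<Rightarrow> 'm + 'a" where
  "\<delta>' i x = (if i = 0 then Inr (\<delta>0 x) else Inl (\<delta> i x))"

text \<open>The usual inductive construction of a null homotopy; \<open>K\<close> is the composite of the homotopy with the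
  differential of the source, and \<open>H\<close> is the next component of the homotopy.\<close>

lemma homotopy_step:
  assumes K: "null_through k i K" and D: "D \<in> bimod_hom A (P k) (P i)"
    and eq: "\<And>x. x \<in> carrier (P k) \<Longrightarrow> \<delta>' i (D x) = \<delta>' i (K x)"
  obtains H where "H \<in> bimod_hom A (P k) (P (Suc i))"
    "\<And>x. x \<in> carrier (P k) \<Longrightarrow> D x = \<delta> (Suc i) (H x) \<oplus>\<^bsub>P i\<^esub> K x"
proof -
  interpret Pi: k_bimodule A \<kappa> "P i" by (rule P)
  have K': "K \<in> bimod_hom A (P k) (P i)" using K by (simp add: null_through_def)
  define g where "g = (\<lambda>x\<in>carrier (P k). D x \<oplus>\<^bsub>P i\<^esub> (\<lambda>x\<in>carrier (P k). \<ominus>\<^bsub>P i\<^esub> K x) x)"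
  have g: "g \<in> bimod_hom A (P k) (P i)"
    unfolding g_def using bimod_hom_add[OF P P D bimod_hom_uminus[OF P P K']] .
  note Dx = bimod_homD(2)[OF D] and Kx = bimod_homD(2)[OF K']
  \<comment> \<open>\<open>D\<close> and \<open>K\<close> agree under the differential, so the
    values of \<open>g\<close> are cycles; exactness makes them boundaries, and projectivity of the
    source then lifts \<open>g\<close>.\<close>
  have "g x \<in> \<delta> (Suc i) ` carrier (P (Suc i))" if x: "x \<in> carrier (P k)" for x
  proof (cases i)
    case 0
    interpret R: k_bimodule A \<kappa> reg by (rule k_bimodule_regular)
    have "\<delta>0 (g x) = \<zero>"
      using x eq[OF x] Dx[OF x] Kx[OF x] bimod_homD(2)[OF \<delta>0_hom, of "K x"] unfolding 0 g_def
      by (simp add: bimod_homD(3)[OF \<delta>0_hom] bimod_hom_minus[OF P k_bimodule_regular \<delta>0_hom]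
          \<delta>'_def 0 Pi.M.a_inv_closed[unfolded 0] r_neg)
    then show ?thesis using exact0[of "g x"] bimod_homD(2)[OF g x] by (simp add: 0)
  next
    case (Suc i')
    interpret P': k_bimodule A \<kappa> "P i'" by (rule P)
    have "\<delta> i (g x) = \<zero>\<^bsub>P i'\<^esub>"
      using x eq[OF x] Dx[OF x] Kx[OF x] bimod_homD(2)[OF \<delta>_hom[of i'], of "K x"] unfolding Suc g_def
      by (simp add: bimod_homD(3)[OF \<delta>_hom] bimod_hom_minus[OF P P \<delta>_hom]
          \<delta>'_def Pi.M.a_inv_closed[unfolded Suc] P'.M.r_neg)
    then show ?thesis using exact[of "g x" i'] bimod_homD(2)[OF g x] by (simp add: Suc)
  qed
  then obtain H where H: "H \<in> bimod_hom A (P k) (P (Suc i))" "\<forall>x\<in>carrier (P k). \<delta> (Suc i) (H x) = g x"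
    using lift[OF g \<delta>_hom] by blast
  have "D x = \<delta> (Suc i) (H x) \<oplus>\<^bsub>P i\<^esub> K x" if "x \<in> carrier (P k)" for x
    using that H(2) Dx[OF that] Kx[OF that] by (simp add: g_def Pi.M.a_assoc Pi.M.l_neg)
  with H(1) show thesis by (rule that)
qed

text \<open>\<open>D\<close> will be the difference of two liftings. It starts with
  \<open>K0\<close> instead of zero because the lifted maps may themselves differ by a
  coboundary.\<close>

lemma homotopy:
  assumes D: "\<And>i. D i \<in> bimod_hom A (P (m + i)) (P i)"
    and chain: "\<And>i x. x \<in> carrier (P (m + Suc i)) \<Longrightarrow> D i (\<delta> (m + Suc i) x) = \<delta> (Suc i) (D (Suc i) x)"
    and K0: "null_through m 0 K0" "\<And>x. x \<in> carrier (P m) \<Longrightarrow> \<delta>0 (D 0 x) = \<delta>0 (K0 x)"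
  shows "\<exists>K. null_through (m + i) i K \<and> (\<forall>x\<in>carrier (P (m + i)). \<delta>' i (D i x) = \<delta>' i (K x))"
proof (induction i)
  case 0
  then show ?case using K0 by (auto simp: \<delta>'_def intro!: exI[of _ K0])
next
  case (Suc i)
  then obtain K where K: "null_through (m + i) i K" "\<And>x. x \<in> carrier (P (m + i)) \<Longrightarrow> \<delta>' i (D i x) = \<delta>' i (K x)" by blast
  interpret Pi: k_bimodule A \<kappa> "P i" by (rule P)
  obtain H where H: "H \<in> bimod_hom A (P (m + i)) (P (Suc i))"
    "\<And>x. x \<in> carrier (P (m + i)) \<Longrightarrow> D i x = \<delta> (Suc i) (H x) \<oplus>\<^bsub>P i\<^esub> K x"
    using homotopy_step[OF K(1) D K(2)] by metis
  define K' where "K' = (\<lambda>x\<in>carrier (P (Suc (m + i))). H (\<delta> (Suc (m + i)) x))"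
  have "K' \<in> bimod_hom A (P (Suc (m + i))) (P (Suc i))"
    unfolding K'_def by (rule bimod_hom_compose[OF P \<delta>_hom H(1)])
  then have "null_through (m + Suc i) (Suc i) K'"
    using H(1) by (auto simp: null_through_def K'_def)
  \<comment> \<open>\<open>D i\<close> is a boundary plus \<open>K\<close>, and \<open>K\<close>
    vanishes on boundaries, so after the differential of the source only the part of
    \<open>D i\<close> through \<open>H\<close> is left.\<close>
  moreover have "\<delta>' (Suc i) (D (Suc i) x) = \<delta>' (Suc i) (K' x)" if x: "x \<in> carrier (P (m + Suc i))" for x
  proof -
    have dx: "\<delta> (Suc (m + i)) x \<in> carrier (P (m + i))" using x bimod_homD(2)[OF \<delta>_hom] by simp
    have "\<delta> (Suc i) (D (Suc i) x) = D i (\<delta> (Suc (m + i)) x)" using chain[OF x] by simp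
    also have "\<dots> = \<delta> (Suc i) (H (\<delta> (Suc (m + i)) x))"
      using null_through_\<delta>[OF K(1)] x bimod_homD(2)[OF \<delta>_hom bimod_homD(2)[OF H(1) dx]] by (simp add: H(2)[OF dx])
    finally show ?thesis using x by (simp add: \<delta>'_def K'_def)
  qed
  ultimately show ?case by blast
qed

text \<open>Independence of both representatives and of the lifting at once. The two liftings differ
  by a boundary plus a map through the differential of the source: \<open>\<eta>\<close> kills the
  first as a cocycle and makes a coboundary of the second. Changing \<open>\<eta>\<close> by a
  coboundary adds another coboundary, since \<open>\<Theta>1\<close> is a chain map.\<close>

lemma HH_class_lifting:
  assumes \<eta>: "\<eta> \<in> HH_cocycles A P \<delta> n" and \<theta>: "\<theta> \<in> Hom0 m"
    and \<eta>1: "\<eta>1 \<in> HH_class A P \<delta> n \<eta>" and \<theta>1: "\<theta>1 \<in> HH_class A P \<delta> m \<theta>"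
    and \<Theta>: "chain_lifting A P \<delta> \<delta>0 m \<theta> \<Theta>" and \<Theta>1: "chain_lifting A P \<delta> \<delta>0 m \<theta>1 \<Theta>1"
  shows "HH_class A P \<delta> (m + n) (compose (carrier (P (m + n))) \<eta>1 (\<Theta>1 n)) =
    HH_class A P \<delta> (m + n) (compose (carrier (P (m + n))) \<eta> (\<Theta> n))"
proof -
  obtain b where b: "b \<in> cob n" "\<eta>1 = (\<lambda>x\<in>carrier (P n). b x \<oplus> \<eta> x)" using \<eta>1 by (auto simp: HH_class_iff)
  obtain b' where b': "b' \<in> cob m" "\<theta>1 = (\<lambda>x\<in>carrier (P m). b' x \<oplus> \<theta> x)" using \<theta>1 by (auto simp: HH_class_iff)
  have \<eta>_hom: "\<eta> \<in> Hom0 n" and \<eta>_cocycle: "\<And>x. x \<in> carrier (P (Suc n)) \<Longrightarrow> \<eta> (\<delta> (Suc n) x) = \<zero>"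
    using \<eta> by (auto simp: HH_cocycles_def)
  have \<Theta>_hom: "\<Theta> i \<in> bimod_hom A (P (m + i)) (P i)" "\<Theta>1 i \<in> bimod_hom A (P (m + i)) (P i)" for i
    using \<Theta> \<Theta>1 by (auto simp: chain_lifting_def)
  have \<Theta>_chain: "\<Theta> i (\<delta> (m + Suc i) x) = \<delta> (Suc i) (\<Theta> (Suc i) x)" "\<Theta>1 i (\<delta> (m + Suc i) x) = \<delta> (Suc i) (\<Theta>1 (Suc i) x)"
    if "x \<in> carrier (P (m + Suc i))" for i x
    using \<Theta> \<Theta>1 that unfolding chain_lifting_def by (metis diff_Suc_1 le_add1 plus_1_eq_Suc)+
  define D where "D i = (\<lambda>x\<in>carrier (P (m + i)). \<Theta>1 i x \<oplus>\<^bsub>P i\<^esub> (\<lambda>x\<in>carrier (P (m + i)). \<ominus>\<^bsub>P i\<^esub> \<Theta> i x) x)" for i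
  have D_hom: "D i \<in> bimod_hom A (P (m + i)) (P i)" for i
    unfolding D_def using bimod_hom_add[OF P P \<Theta>_hom(2) bimod_hom_uminus[OF P P \<Theta>_hom(1)]] .
  have \<Theta>_D: "\<Theta>1 i x = D i x \<oplus>\<^bsub>P i\<^esub> \<Theta> i x" if "x \<in> carrier (P (m + i))" for i x
  proof -
    interpret Pi: k_bimodule A \<kappa> "P i" by (rule P)
    show ?thesis using that bimod_homD(2)[OF \<Theta>_hom(1) that] bimod_homD(2)[OF \<Theta>_hom(2) that]
      by (simp add: D_def Pi.M.a_assoc Pi.M.l_neg)
  qed
  have D_chain: "D i (\<delta> (m + Suc i) x) = \<delta> (Suc i) (D (Suc i) x)" if x: "x \<in> carrier (P (m + Suc i))" for i x
  proof -
    interpret S: k_bimodule A \<kappa> "P (Suc i)" by (rule P)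
    have "\<delta> (m + Suc i) x \<in> carrier (P (m + i))" using x bimod_homD(2)[OF \<delta>_hom] by simp
    then show ?thesis using x bimod_homD(2)[OF \<Theta>_hom(1) x] bimod_homD(2)[OF \<Theta>_hom(2) x] \<Theta>_chain[OF x]
      by (simp add: D_def bimod_homD(3)[OF \<delta>_hom] bimod_hom_minus[OF P P \<delta>_hom])
  qed
  have D0: "\<delta>0 (D 0 x) = b' x" if x: "x \<in> carrier (P m)" for x
  proof -
    interpret P0: k_bimodule A \<kappa> "P 0" by (rule P)
    have c: "b' x \<in> carrier A" "\<theta> x \<in> carrier A" "\<Theta> 0 x \<in> carrier (P 0)" "\<Theta>1 0 x \<in> carrier (P 0)"
      using bimod_homD(2)[OF cob_hom[OF b'(1)] x] bimod_homD(2)[OF \<theta> x] bimod_homD(2)[OF \<Theta>_hom(1)[of 0]] bimod_homD(2)[OF \<Theta>_hom(2)[of 0]] x by auto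
    have "\<delta>0 (\<Theta> 0 x) = \<theta> x" "\<delta>0 (\<Theta>1 0 x) = b' x \<oplus> \<theta> x"
      using \<Theta> \<Theta>1 x by (auto simp: chain_lifting_def b'(2))
    then show ?thesis using x c
      by (simp add: D_def bimod_homD(3)[OF \<delta>0_hom] bimod_hom_minus[OF P k_bimodule_regular \<delta>0_hom] a_assoc r_neg)
  qed
  \<comment> \<open>\<open>b'\<close> is the change of \<open>\<theta>\<close>. For positive
    \<open>m\<close> it is some \<open>\<xi>\<close> after the differential, and lifting
    \<open>\<xi>\<close> through the surjection \<open>\<delta>0\<close> starts the homotopy; for
    \<open>m = 0\<close> it is zero.\<close>
  obtain K0 where K0: "null_through m 0 K0" "\<And>x. x \<in> carrier (P m) \<Longrightarrow> \<delta>0 (K0 x) = b' x"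
  proof (cases m)
    case 0
    have "null_through m 0 (\<lambda>x\<in>carrier (P m). \<zero>\<^bsub>P 0\<^esub>)"
      using bimod_hom_zero_map[OF P P] by (auto simp: null_through_def 0)
    moreover have "\<delta>0 \<zero>\<^bsub>P 0\<^esub> = \<zero>" using bimod_hom_zero[OF P k_bimodule_regular \<delta>0_hom] by simp
    ultimately show thesis using b'(1)
      by (intro that[of "\<lambda>x\<in>carrier (P m). \<zero>\<^bsub>P 0\<^esub>"]) (auto simp: cob_iff 0)
  next
    case (Suc m')
    then obtain \<xi> where \<xi>: "\<xi> \<in> Hom0 m'" "\<forall>x\<in>carrier (P m). b' x = \<xi> (\<delta> m x)" using b'(1) by (auto simp: cob_iff)
    have "\<xi> ` carrier (P m') \<subseteq> \<delta>0 ` carrier (P 0)" using bimod_homD(2)[OF \<xi>(1)] surj by auto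
    then obtain H where H: "H \<in> bimod_hom A (P m') (P 0)" "\<forall>x\<in>carrier (P m'). \<delta>0 (H x) = \<xi> x"
      using lift0[OF \<xi>(1) \<delta>0_hom] by blast
    have "null_through m 0 (\<lambda>x\<in>carrier (P m). H (\<delta> m x))"
      using bimod_hom_compose[OF P \<delta>_hom H(1)] H(1) by (auto simp: null_through_def Suc)
    then show thesis using H(2) \<xi>(2) bimod_homD(2)[OF \<delta>_hom[of m']] by (intro that) (auto simp: Suc)
  qed
  obtain K where K: "null_through (m + n) n K" "\<And>x. x \<in> carrier (P (m + n)) \<Longrightarrow> \<delta>' n (D n x) = \<delta>' n (K x)"
    using homotopy[of D m K0 n] D_hom D_chain K0 D0 by auto
  obtain H where H: "H \<in> bimod_hom A (P (m + n)) (P (Suc n))"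
    "\<And>x. x \<in> carrier (P (m + n)) \<Longrightarrow> D n x = \<delta> (Suc n) (H x) \<oplus>\<^bsub>P n\<^esub> K x"
    using homotopy_step[OF K(1) D_hom K(2)] by metis
  have K_hom: "K \<in> bimod_hom A (P (m + n)) (P n)" using K(1) by (simp add: null_through_def)
  \<comment> \<open>The contribution of replacing \<open>\<eta>\<close> by
    \<open>\<eta>1\<close>.\<close>
  define c where "c = (\<lambda>x\<in>carrier (P (m + n)). b (\<Theta>1 n x))"
  have c: "c \<in> cob (m + n)"
  proof (cases n)
    case 0
    have "c = (\<lambda>x\<in>carrier (P (m + n)). \<zero>)"
      using b(1) bimod_homD(2)[OF \<Theta>_hom(2)[of n]] by (auto simp: c_def cob_iff 0 fun_eq_iff)
    then show ?thesis using cob_zero by simp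
  next
    case (Suc n')
    then obtain \<xi> where \<xi>: "\<xi> \<in> Hom0 n'" "\<forall>x\<in>carrier (P n). b x = \<xi> (\<delta> n x)" using b(1) by (auto simp: cob_iff)
    have "(\<lambda>x\<in>carrier (P (m + n')). \<xi> (\<Theta>1 n' x)) \<in> Hom0 (m + n')"
      by (rule bimod_hom_compose[OF P \<Theta>_hom(2) \<xi>(1)])
    moreover have "c x = \<xi> (\<Theta>1 n' (\<delta> (m + n) x))" if x: "x \<in> carrier (P (m + n))" for x
      using x \<xi>(2) bimod_homD(2)[OF \<Theta>_hom(2) x] \<Theta>_chain(2)[of x n'] by (simp add: c_def Suc)
    ultimately show ?thesis
      using bimod_homD(2)[OF \<delta>_hom[of "m + n'"]]
      by (auto simp: cob_iff Suc c_def intro!: bexI[of _ "\<lambda>x\<in>carrier (P (m + n')). \<xi> (\<Theta>1 n' x)"])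
  qed
  have \<eta>1_hom: "\<eta>1 \<in> Hom0 n"
    using bimod_hom_add[OF P k_bimodule_regular cob_hom[OF b(1)] \<eta>_hom] by (simp add: b(2))
  show ?thesis
  proof (rule HH_class_eqI)
    show "compose (carrier (P (m + n))) \<eta>1 (\<Theta>1 n) \<in> Hom0 (m + n)" "compose (carrier (P (m + n))) \<eta> (\<Theta> n) \<in> Hom0 (m + n)"
      unfolding compose_def by (rule bimod_hom_compose[OF P \<Theta>_hom(2) \<eta>1_hom] bimod_hom_compose[OF P \<Theta>_hom(1) \<eta>_hom])+
    show "(\<lambda>x\<in>carrier (P (m + n)). c x \<oplus> (\<lambda>x\<in>carrier (P (m + n)). \<eta> (K x)) x) \<in> cob (m + n)"
      by (rule cob_add[OF c null_through_cob[OF K(1) \<eta>_hom]])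
    fix x assume x: "x \<in> carrier (P (m + n))"
    interpret Pn: k_bimodule A \<kappa> "P n" by (rule P)
    note cl = bimod_homD(2)[OF \<Theta>_hom(1) x] bimod_homD(2)[OF \<Theta>_hom(2) x] bimod_homD(2)[OF K_hom x]
      bimod_homD(2)[OF \<delta>_hom bimod_homD(2)[OF H(1) x]] bimod_homD(2)[OF H(1) x]
    have "\<eta> (\<Theta>1 n x) = \<eta> (K x) \<oplus> \<eta> (\<Theta> n x)"
      using cl bimod_homD(2)[OF \<eta>_hom cl(3)] by (simp add: \<Theta>_D[OF x] H(2)[OF x] bimod_homD(3)[OF \<eta>_hom] \<eta>_cocycle)
    then show "compose (carrier (P (m + n))) \<eta>1 (\<Theta>1 n) x =
        (\<lambda>x\<in>carrier (P (m + n)). c x \<oplus> (\<lambda>x\<in>carrier (P (m + n)). \<eta> (K x)) x) x \<oplus> compose (carrier (P (m + n))) \<eta> (\<Theta> n) x"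
      using x cl bimod_homD(2)[OF \<eta>_hom] bimod_homD(2)[OF cob_hom[OF b(1)]]
      by (simp add: compose_def b(2) c_def a_assoc)
  qed
qed

text \<open>A lifting of one representative satisfies the definite description, and
  \<open>HH_class_lifting\<close> shows that every other choice gives the same class.\<close>

lemma yoneda_product_eq:
  assumes "\<eta> \<in> HH_cocycles A P \<delta> n" "\<theta> \<in> HH_cocycles A P \<delta> m" "chain_lifting A P \<delta> \<delta>0 m \<theta> \<Theta>"
  shows "yoneda_product A P \<delta> \<delta>0 n m (HH_class A P \<delta> n \<eta>) (HH_class A P \<delta> m \<theta>) =
    HH_class A P \<delta> (m + n) (compose (carrier (P (m + n))) \<eta> (\<Theta> n))"
proof -
  have "\<eta> \<in> Hom0 n" "\<theta> \<in> Hom0 m" using assms by (auto simp: HH_cocycles_def)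
  then show ?thesis
    unfolding yoneda_product_def using assms HH_class_self HH_class_lifting
    by (intro the_equality) blast+
qed

lemma cocycle_compose:
  assumes "\<eta> \<in> HH_cocycles A P \<delta> n" "chain_lifting A P \<delta> \<delta>0 m \<theta> \<Theta>"
  shows "compose (carrier (P (m + n))) \<eta> (\<Theta> n) \<in> HH_cocycles A P \<delta> (m + n)"
proof -
  have \<eta>: "\<eta> \<in> Hom0 n" "\<And>x. x \<in> carrier (P (Suc n)) \<Longrightarrow> \<eta> (\<delta> (Suc n) x) = \<zero>"
    using assms(1) by (auto simp: HH_cocycles_def)
  have \<Theta>: "\<Theta> i \<in> bimod_hom A (P (m + i)) (P i)" for i using assms(2) by (auto simp: chain_lifting_def)
  have "\<eta> (\<Theta> n (\<delta> (Suc (m + n)) x)) = \<zero>" if x: "x \<in> carrier (P (m + Suc n))" for x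
  proof -
    have "\<Theta> n (\<delta> (m + Suc n) x) = \<delta> (Suc n) (\<Theta> (Suc n) x)"
      using assms(2) x unfolding chain_lifting_def by (metis diff_Suc_1 le_add1 plus_1_eq_Suc)
    then show ?thesis using \<eta>(2) bimod_homD(2)[OF \<Theta> x] by simp
  qed
  then show ?thesis
    using bimod_hom_compose[OF P \<Theta>[of n] \<eta>(1)] bimod_homD(2)[OF \<delta>_hom]
    by (auto simp: HH_cocycles_def compose_def)
qed

end

section \<open>Path algebras\<close>

lemma path_algebra_simps [simp]:
  "carrier (path_algebra Q) = {x. Poly_Mapping.keys x \<subseteq> qpaths Q}"
  "\<zero>\<^bsub>path_algebra Q\<^esub> = 0" "x \<oplus>\<^bsub>path_algebra Q\<^esub> y = x + y"
  by (simp_all add: path_algebra_def)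

text \<open>As an iterated linear extension of concatenation the product is visibly bilinear, which
  the sums over supports in its definition hide.\<close>

lemma mult_pm_ext:
  "x \<otimes>\<^bsub>path_algebra Q\<^esub> y = pm_ext (\<lambda>w. pm_ext (\<lambda>w'.
     if qpath_end Q w = fst w' then Poly_Mapping.single (fst w, snd w @ snd w') 1 else 0) y) x"
  by (simp add: path_algebra_def pm_ext_def pm.scale_sum_right if_distrib[of "pm_scale _"] cong: if_cong)

lemma mult_single:
  "Poly_Mapping.single w a \<otimes>\<^bsub>path_algebra Q\<^esub> Poly_Mapping.single w' b =
     (if qpath_end Q w = fst w' then Poly_Mapping.single (fst w, snd w @ snd w') (a * b) else 0)"
  by (simp add: mult_pm_ext)

lemma mult_linear:
  "(x + x') \<otimes>\<^bsub>path_algebra Q\<^esub> y = x \<otimes>\<^bsub>path_algebra Q\<^esub> y + x' \<otimes>\<^bsub>path_algebra Q\<^esub> y"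
  "x \<otimes>\<^bsub>path_algebra Q\<^esub> (y + y') = x \<otimes>\<^bsub>path_algebra Q\<^esub> y + x \<otimes>\<^bsub>path_algebra Q\<^esub> y'"
  "pm_scale c x \<otimes>\<^bsub>path_algebra Q\<^esub> y = pm_scale c (x \<otimes>\<^bsub>path_algebra Q\<^esub> y)"
  "x \<otimes>\<^bsub>path_algebra Q\<^esub> pm_scale c y = pm_scale c (x \<otimes>\<^bsub>path_algebra Q\<^esub> y)"
  "(x - x') \<otimes>\<^bsub>path_algebra Q\<^esub> y = x \<otimes>\<^bsub>path_algebra Q\<^esub> y - x' \<otimes>\<^bsub>path_algebra Q\<^esub> y"
  "x \<otimes>\<^bsub>path_algebra Q\<^esub> (y - y') = x \<otimes>\<^bsub>path_algebra Q\<^esub> y - x \<otimes>\<^bsub>path_algebra Q\<^esub> y'"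
  "0 \<otimes>\<^bsub>path_algebra Q\<^esub> y = 0" "x \<otimes>\<^bsub>path_algebra Q\<^esub> 0 = 0"
proof -
  show add: "x \<otimes>\<^bsub>path_algebra Q\<^esub> (y + y') = x \<otimes>\<^bsub>path_algebra Q\<^esub> y + x \<otimes>\<^bsub>path_algebra Q\<^esub> y'" for x y y'
    by (simp add: mult_pm_ext pm_ext_add[of _ y y']) (simp add: pm_ext_def pm.scale_right_distrib sum.distrib)
  show "x \<otimes>\<^bsub>path_algebra Q\<^esub> pm_scale c y = pm_scale c (x \<otimes>\<^bsub>path_algebra Q\<^esub> y)"
    by (simp add: mult_pm_ext pm_ext_scale[of _ c y]) (simp add: pm_ext_def pm.scale_sum_right mult.left_commute)
  show "(x + x') \<otimes>\<^bsub>path_algebra Q\<^esub> y = x \<otimes>\<^bsub>path_algebra Q\<^esub> y + x' \<otimes>\<^bsub>path_algebra Q\<^esub> y"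
    "pm_scale c x \<otimes>\<^bsub>path_algebra Q\<^esub> y = pm_scale c (x \<otimes>\<^bsub>path_algebra Q\<^esub> y)"
    "(x - x') \<otimes>\<^bsub>path_algebra Q\<^esub> y = x \<otimes>\<^bsub>path_algebra Q\<^esub> y - x' \<otimes>\<^bsub>path_algebra Q\<^esub> y"
    "0 \<otimes>\<^bsub>path_algebra Q\<^esub> y = 0"
    by (simp_all add: mult_pm_ext pm_ext_add[of _ x x'] pm_ext_scale pm_ext_diff[of _ x x']) (simp add: pm_ext_def)
  have "x \<otimes>\<^bsub>path_algebra Q\<^esub> (y - y') + x \<otimes>\<^bsub>path_algebra Q\<^esub> y' = x \<otimes>\<^bsub>path_algebra Q\<^esub> y"
    by (simp flip: add)
  then show "x \<otimes>\<^bsub>path_algebra Q\<^esub> (y - y') = x \<otimes>\<^bsub>path_algebra Q\<^esub> y - x \<otimes>\<^bsub>path_algebra Q\<^esub> y'"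
    by (simp add: eq_diff_eq)
  show "x \<otimes>\<^bsub>path_algebra Q\<^esub> 0 = 0" using add[of x 0 0] by simp
qed

lemma mult_sum_left: "sum f X \<otimes>\<^bsub>path_algebra Q\<^esub> y = (\<Sum>i\<in>X. f i \<otimes>\<^bsub>path_algebra Q\<^esub> y)"
  by (induction X rule: infinite_finite_induct) (simp_all add: mult_linear)

lemma mult_sum_right: "x \<otimes>\<^bsub>path_algebra Q\<^esub> sum f X = (\<Sum>i\<in>X. x \<otimes>\<^bsub>path_algebra Q\<^esub> f i)"
  by (induction X rule: infinite_finite_induct) (simp_all add: mult_linear)

lemma lookup_vertex_mult:
  "Poly_Mapping.lookup (vertex_elt v \<otimes>\<^bsub>path_algebra Q\<^esub> x) w = (if fst w = v then Poly_Mapping.lookup x w else 0)"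
  using subset_UNIV[of "Poly_Mapping.keys x"]
  by (induction x rule: pm_induct)
    (auto simp: mult_linear vertex_elt_def mult_single qpath_end_def lookup_add lookup_single when_def pre_digraph.awalk_verts.simps)

lemma lookup_mult_vertex:
  "Poly_Mapping.lookup (x \<otimes>\<^bsub>path_algebra Q\<^esub> vertex_elt v) w = (if qpath_end Q w = v then Poly_Mapping.lookup x w else 0)"
  using subset_UNIV[of "Poly_Mapping.keys x"]
  by (induction x rule: pm_induct)
    (auto simp: mult_linear vertex_elt_def mult_single lookup_add lookup_single when_def)

text \<open>A path has at most one initial segment of a given length.\<close>

lemma lookup_homogeneous_mult:
  assumes "Poly_Mapping.keys x \<subseteq> {w. length (snd w) = n}" "length p = n"
  shows "Poly_Mapping.lookup (x \<otimes>\<^bsub>path_algebra Q\<^esub> y) (u, p @ p') =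
    Poly_Mapping.lookup x (u, p) * Poly_Mapping.lookup y (qpath_end Q (u, p), p')"
  using assms(1)
proof (induction x rule: pm_induct)
  case (single w a)
  show ?case
    using subset_UNIV[of "Poly_Mapping.keys y"]
  proof (induction y rule: pm_induct)
    case (single w' b)
    then show ?case using \<open>w \<in> {w. length (snd w) = n}\<close> assms(2)
      by (cases w; cases w') (auto simp: mult_single lookup_single when_def)
  qed (simp_all add: mult_linear lookup_add algebra_simps)
qed (simp_all add: mult_linear lookup_add algebra_simps)

text \<open>Written as a sum of homogeneous parts because a homogeneous ideal is then stable under
  it directly by definition.\<close>

definition truncate :: "nat \<Rightarrow> ('v, 'b, 'k::field) path_comb \<Rightarrow> ('v, 'b, 'k) path_comb" where
  "truncate d x = (\<Sum>n<d. homogeneous_part n x)"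

lemma lookup_homogeneous_part:
  "Poly_Mapping.lookup (homogeneous_part n x) w = (if length (snd w) = n then Poly_Mapping.lookup x w else 0)"
proof -
  have "Poly_Mapping.lookup (homogeneous_part n x) w =
      (\<Sum>w'\<in>{w \<in> Poly_Mapping.keys x. length (snd w) = n}. if w = w' then Poly_Mapping.lookup x w' else 0)"
    by (auto simp: homogeneous_part_def lookup_sum lookup_single when_def intro!: sum.cong)
  then show ?thesis by (auto simp: in_keys_iff)
qed

lemma lookup_truncate:
  "Poly_Mapping.lookup (truncate d x) w = (if length (snd w) < d then Poly_Mapping.lookup x w else 0)"
proof -
  have "Poly_Mapping.lookup (truncate d x) w = (\<Sum>n<d. if length (snd w) = n then Poly_Mapping.lookup x w else 0)"
    by (simp add: truncate_def lookup_sum lookup_homogeneous_part)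
  then show ?thesis by simp
qed

lemma truncate_linear:
  "truncate d (x + y) = truncate d x + truncate d y" "truncate d (x - y) = truncate d x - truncate d y"
  "truncate d (pm_scale c x) = pm_scale c (truncate d x)" "truncate d 0 = 0"
  by (auto intro!: poly_mapping_eqI simp: lookup_truncate lookup_add lookup_minus)

lemma truncate_sum: "truncate d (sum f X) = (\<Sum>i\<in>X. truncate d (f i))"
  by (induction X rule: infinite_finite_induct) (simp_all add: truncate_linear)

lemma truncate_vertex_mult:
  "truncate d (vertex_elt v \<otimes>\<^bsub>path_algebra Q\<^esub> x) = vertex_elt v \<otimes>\<^bsub>path_algebra Q\<^esub> truncate d x"
  by (auto intro!: poly_mapping_eqI simp: lookup_truncate lookup_vertex_mult)

lemma truncate_id: "Poly_Mapping.keys x \<subseteq> {w. length (snd w) < d} \<Longrightarrow> truncate d x = x"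
  by (rule poly_mapping_eqI) (fastforce simp: lookup_truncate in_keys_iff subset_iff)

lemma keys_truncate: "Poly_Mapping.keys (truncate d x) \<subseteq> {w \<in> Poly_Mapping.keys x. length (snd w) < d}"
  by (auto simp: in_keys_iff lookup_truncate split: if_splits)

text \<open>A homogeneous left factor shifts every length by the same \<open>n\<close>, so cutting
  the product amounts to cutting the right factor.\<close>

lemma truncate_homogeneous_mult:
  fixes x y :: "('v, 'b, 'k::field) path_comb"
  assumes "Poly_Mapping.keys x \<subseteq> {w. length (snd w) = n}"
  shows "truncate (n + d) (x \<otimes>\<^bsub>path_algebra Q\<^esub> y) = x \<otimes>\<^bsub>path_algebra Q\<^esub> truncate d y"
  using assms
proof (induction x rule: pm_induct)
  case (single w a)
  show ?case
    using subset_UNIV[of "Poly_Mapping.keys y"]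
  proof (induction y rule: pm_induct)
    case (single w' b)
    have "truncate d (Poly_Mapping.single w c) = (if length (snd w) < d then Poly_Mapping.single w c else 0)" for d and w :: "'v \<times> 'b list" and c :: 'k
      by (auto intro!: poly_mapping_eqI simp: lookup_truncate lookup_single when_def)
    then show ?case using \<open>w \<in> {w. length (snd w) = n}\<close>
      by (auto simp: mult_single mult_linear truncate_linear)
  qed (simp_all add: mult_linear truncate_linear)
qed (simp_all add: mult_linear truncate_linear)

lemma homogeneous_mult:
  assumes "Poly_Mapping.keys x \<subseteq> {w. length (snd w) = m}" "Poly_Mapping.keys y \<subseteq> {w. length (snd w) = n}"
  shows "Poly_Mapping.keys (x \<otimes>\<^bsub>path_algebra Q\<^esub> y) \<subseteq> {w. length (snd w) = m + n}"
  using assms(1)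
proof (induction x rule: pm_induct)
  case (single w a)
  show ?case
    using assms(2)
  proof (induction y rule: pm_induct)
    case (single w' b)
    then show ?case using \<open>w \<in> {w. length (snd w) = m}\<close> by (auto simp: mult_single split: if_splits)
  qed (auto simp add: mult_linear dest!: keys_add[THEN subsetD])
qed (auto simp add: mult_linear dest!: keys_add[THEN subsetD])

lemma truncate_in_ideal:
  assumes "homogeneous_ideal I" "pm.subspace I" "x \<in> I"
  shows "truncate d x \<in> I"
  unfolding truncate_def using assms by (intro pm.subspace_sum) (auto simp: homogeneous_ideal_def)

lemma keys_nonempty: "x \<noteq> 0 \<Longrightarrow> \<exists>w. w \<in> Poly_Mapping.keys x"
  by (metis in_keys_iff lookup_zero poly_mapping_eqI)

text \<open>A nonzero element contains some path, and one path already determines both vertices;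
  hence the definite descriptions are well defined and all paths of the element agree at both
  ends.\<close>

lemma uniform_vertices:
  assumes "uniform Q x"
  shows "uorigin Q x \<in> verts Q" "uterminus Q x \<in> verts Q" "x \<noteq> 0" "Poly_Mapping.keys x \<subseteq> qpaths Q"
    and "\<And>w. w \<in> Poly_Mapping.keys x \<Longrightarrow> fst w = uorigin Q x"
    and "\<And>w. w \<in> Poly_Mapping.keys x \<Longrightarrow> qpath_end Q w = uterminus Q x"
proof -
  let ?U = "\<lambda>u v. x = vertex_elt u \<otimes>\<^bsub>path_algebra Q\<^esub> x \<otimes>\<^bsub>path_algebra Q\<^esub> vertex_elt v"
  have key: "fst w = u \<and> qpath_end Q w = v" if "?U u v" "w \<in> Poly_Mapping.keys x" for u v w
  proof -
    have "Poly_Mapping.lookup x w \<noteq> 0" using that(2) by (simp add: in_keys_iff)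
    then have "Poly_Mapping.lookup (vertex_elt u \<otimes>\<^bsub>path_algebra Q\<^esub> x \<otimes>\<^bsub>path_algebra Q\<^esub> vertex_elt v) w \<noteq> 0"
      using that(1) by simp
    then show ?thesis by (simp add: lookup_mult_vertex lookup_vertex_mult split: if_splits)
  qed
  show x: "x \<noteq> 0" "Poly_Mapping.keys x \<subseteq> qpaths Q" using assms by (auto simp: uniform_def)
  then obtain w where w: "w \<in> Poly_Mapping.keys x" using keys_nonempty by blast
  obtain u v where uv: "u \<in> verts Q" "v \<in> verts Q" "?U u v" using assms by (auto simp: uniform_def)
  have "uorigin Q x = u" unfolding uorigin_def
    by (rule the_equality) (use uv key[OF _ w] in blast)+
  moreover have "uterminus Q x = v" unfolding uterminus_def
    by (rule the_equality) (use uv key[OF _ w] in blast)+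
  ultimately show "uorigin Q x \<in> verts Q" "uterminus Q x \<in> verts Q"
    "\<And>w. w \<in> Poly_Mapping.keys x \<Longrightarrow> fst w = uorigin Q x"
    "\<And>w. w \<in> Poly_Mapping.keys x \<Longrightarrow> qpath_end Q w = uterminus Q x"
    using uv key[OF uv(3)] by auto
qed

lemma uniform_vertex_mult:
  assumes "uniform Q x"
  shows "vertex_elt v \<otimes>\<^bsub>path_algebra Q\<^esub> x = (if v = uorigin Q x then x else 0)"
    "x \<otimes>\<^bsub>path_algebra Q\<^esub> vertex_elt v = (if v = uterminus Q x then x else 0)"
proof -
  have "Poly_Mapping.lookup x w = 0 \<or> fst w = uorigin Q x \<and> qpath_end Q w = uterminus Q x" for w
    using uniform_vertices(5,6)[OF assms, of w] by (auto simp: in_keys_iff)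
  then show "vertex_elt v \<otimes>\<^bsub>path_algebra Q\<^esub> x = (if v = uorigin Q x then x else 0)"
    "x \<otimes>\<^bsub>path_algebra Q\<^esub> vertex_elt v = (if v = uterminus Q x then x else 0)"
    by (intro poly_mapping_eqI; force simp: lookup_vertex_mult lookup_mult_vertex)+
qed

text \<open>Left cancellation. Fix one path \<open>w\<close> of \<open>x\<close>: all paths of
  \<open>x\<close> have the same length, so a path beginning with \<open>w\<close> arises in the
  product in only one way, and its coefficient is a product of two coefficients. Nothing can
  cancel.\<close>

lemma uniform_mult_eq_zero:
  fixes x y :: "('v, 'b, 'k::field) path_comb"
  assumes "uniform Q x" "Poly_Mapping.keys x \<subseteq> {w. length (snd w) = n}" "x \<otimes>\<^bsub>path_algebra Q\<^esub> y = 0"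
  shows "vertex_elt (uterminus Q x) \<otimes>\<^bsub>path_algebra Q\<^esub> y = 0"
proof (rule poly_mapping_eqI)
  fix w' :: "'v \<times> 'b list"
  obtain w where w: "w \<in> Poly_Mapping.keys x" using keys_nonempty[OF uniform_vertices(3)[OF assms(1)]] by blast
  then have "length (snd w) = n" using assms(2) by auto
  then have "Poly_Mapping.lookup (x \<otimes>\<^bsub>path_algebra Q\<^esub> y) (fst w, snd w @ snd w') =
      Poly_Mapping.lookup x w * Poly_Mapping.lookup y (qpath_end Q w, snd w')"
    using lookup_homogeneous_mult[OF assms(2), of "snd w" Q y "fst w" "snd w'"] by simp
  then have "Poly_Mapping.lookup y (uterminus Q x, snd w') = 0"
    using w assms(3) uniform_vertices(6)[OF assms(1) w] by (simp add: in_keys_iff)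
  then show "Poly_Mapping.lookup (vertex_elt (uterminus Q x) \<otimes>\<^bsub>path_algebra Q\<^esub> y) w' = Poly_Mapping.lookup 0 w'"
    by (cases w') (auto simp: lookup_vertex_mult)
qed

section \<open>The quotient of a path algebra and normal forms modulo the ideal\<close>

locale quiver_quotient = fin_digraph Q + I: ideal I "path_algebra Q"
  for Q :: "('v, 'b) pre_digraph" and I :: "('v, 'b, 'k::field) path_comb set"
begin

abbreviation "R \<equiv> path_algebra Q :: ('v, 'b, 'k) path_comb ring"
abbreviation "\<Lambda> \<equiv> quot_alg Q I"
abbreviation "\<pi> \<equiv> quot_map Q I"
abbreviation "\<kappa> \<equiv> quot_scalar Q I"
abbreviation vertex :: "'v \<Rightarrow> ('v, 'b, 'k) path_comb" where "vertex \<equiv> vertex_elt"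

lemma vertex_closed [simp]: "v \<in> verts Q \<Longrightarrow> vertex v \<in> carrier R"
  by (auto simp: vertex_elt_def qpaths_def awalk_Nil_iff split: if_splits)

lemma scale_closed: "x \<in> carrier R \<Longrightarrow> pm_scale c x \<in> carrier R"
  using keys_pm_scale[of c x] by auto

lemma scale_one_mult: "x \<in> carrier R \<Longrightarrow> pm_scale c \<one>\<^bsub>R\<^esub> \<otimes>\<^bsub>R\<^esub> x = pm_scale c x"
  using I.l_one[of x] by (simp add: mult_linear)

lemma mult_scale_one: "x \<in> carrier R \<Longrightarrow> x \<otimes>\<^bsub>R\<^esub> pm_scale c \<one>\<^bsub>R\<^esub> = pm_scale c x"
  using I.r_one[of x] by (simp add: mult_linear)

lemma carrier_subspace: "pm.subspace (carrier R)"
  by (simp add: subspace_keys)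

lemma I_carrier: "x \<in> I \<Longrightarrow> x \<in> carrier R"
  by (rule I.a_Hcarr)

lemma I_subspace: "pm.subspace I"
  unfolding pm.subspace_def
proof (intro conjI ballI allI)
  show "0 \<in> I" using additive_subgroup.zero_closed[OF I.additive_subgroup_axioms] by simp
  show "x + y \<in> I" if "x \<in> I" "y \<in> I" for x y using additive_subgroup.a_closed[OF I.additive_subgroup_axioms that] by simp
  show "pm_scale c x \<in> I" if "x \<in> I" for c x
    using I.I_l_closed[OF that scale_closed[OF I.one_closed, of c]] I_carrier[OF that] by (simp add: scale_one_mult del: path_algebra_simps)
qed

lemma R_minus: "x \<in> carrier R \<Longrightarrow> \<ominus>\<^bsub>R\<^esub> x = - x"
proof -
  assume x: "x \<in> carrier R"
  have "- x \<in> carrier R" using pm.subspace_neg[OF carrier_subspace x] .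
  then show ?thesis using x I.minus_equality[of "- x" x] by simp
qed

lemma quot_ring_hom: "\<pi> \<in> ring_hom R \<Lambda>"
  using I.rcos_ring_hom by (simp add: quot_alg_def quot_map_def[abs_def])

lemma quot_ring: "ring \<Lambda>"
  using I.quotient_is_ring by (simp add: quot_alg_def)

sublocale \<Lambda>: ring \<Lambda> by (rule quot_ring)

lemma \<pi>_closed [simp]: "x \<in> carrier R \<Longrightarrow> \<pi> x \<in> carrier \<Lambda>"
  using quot_ring_hom by (rule ring_hom_closed)

lemma \<pi>_add: "x \<in> carrier R \<Longrightarrow> y \<in> carrier R \<Longrightarrow> \<pi> (x + y) = \<pi> x \<oplus>\<^bsub>\<Lambda>\<^esub> \<pi> y"
  using ring_hom_add[OF quot_ring_hom, of x y] by simp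

lemma \<pi>_mult: "x \<in> carrier R \<Longrightarrow> y \<in> carrier R \<Longrightarrow> \<pi> (x \<otimes>\<^bsub>R\<^esub> y) = \<pi> x \<otimes>\<^bsub>\<Lambda>\<^esub> \<pi> y"
  using quot_ring_hom by (rule ring_hom_mult)

lemma \<pi>_one: "\<pi> \<one>\<^bsub>R\<^esub> = \<one>\<^bsub>\<Lambda>\<^esub>"
  using quot_ring_hom by (rule ring_hom_one)

lemma \<pi>_surj: 
  assumes "a \<in> carrier \<Lambda>" obtains x where "x \<in> carrier R" "a = \<pi> x"
  using assms unfolding quot_alg_def FactRing_def A_RCOSETS_def' quot_map_def
  by (auto simp: A_RCOSETS_def' )

lemma \<pi>_eq_iff: "x \<in> carrier R \<Longrightarrow> y \<in> carrier R \<Longrightarrow> \<pi> x = \<pi> y \<longleftrightarrow> x - y \<in> I"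
proof -
  assume xy: "x \<in> carrier R" "y \<in> carrier R"
  have "\<pi> x = \<pi> y \<longleftrightarrow> x \<in> I +>\<^bsub>R\<^esub> y"
    unfolding quot_map_def using xy I.a_rcos_self I.a_repr_independence[of x I y] I.a_subgroup by metis
  also have "\<dots> \<longleftrightarrow> x \<ominus>\<^bsub>R\<^esub> y \<in> I" using xy by (simp add: I.a_rcos_module_minus[OF I.ring_axioms] del: path_algebra_simps)
  also have "x \<ominus>\<^bsub>R\<^esub> y = x - y" using xy by (simp add: a_minus_def R_minus)
  finally show ?thesis .
qed

lemma \<pi>_zero_iff: "x \<in> carrier R \<Longrightarrow> \<pi> x = \<zero>\<^bsub>\<Lambda>\<^esub> \<longleftrightarrow> x \<in> I"
  using \<pi>_eq_iff[of x 0] ring_hom_zero[OF quot_ring_hom I.ring_axioms quot_ring] by simp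

lemma \<pi>_zero [simp]: "\<pi> 0 = \<zero>\<^bsub>\<Lambda>\<^esub>"
  using ring_hom_zero[OF quot_ring_hom I.ring_axioms quot_ring] by simp

lemma \<pi>_sum: "(\<And>i. i \<in> X \<Longrightarrow> f i \<in> carrier R) \<Longrightarrow> \<pi> (sum f X) = (\<Oplus>\<^bsub>\<Lambda>\<^esub>i\<in>X. \<pi> (f i))"
proof (induction X rule: infinite_finite_induct)
  case (insert i X)
  have "sum f X \<in> carrier R" using insert.prems by (intro pm.subspace_sum[OF carrier_subspace]) auto
  then show ?case using insert by (simp add: \<pi>_add \<Lambda>.finsum_insert Pi_def)
qed simp_all

lemma quot_k_algebra: "k_algebra \<Lambda> \<kappa>"
proof unfold_locales
  note s = scale_closed[OF I.one_closed]
  show "\<kappa> a \<in> carrier \<Lambda>" for a unfolding quot_scalar_def by (rule \<pi>_closed[OF s])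
  show "\<kappa> (a + b) = \<kappa> a \<oplus>\<^bsub>\<Lambda>\<^esub> \<kappa> b" for a b
    unfolding quot_scalar_def by (simp add: pm.scale_left_distrib \<pi>_add s del: path_algebra_simps)
  show "\<kappa> (a * b) = \<kappa> a \<otimes>\<^bsub>\<Lambda>\<^esub> \<kappa> b" for a b
    unfolding quot_scalar_def by (simp add: scale_one_mult s flip: \<pi>_mult del: path_algebra_simps)
  show "\<kappa> 1 = \<one>\<^bsub>\<Lambda>\<^esub>" by (simp add: quot_scalar_def \<pi>_one)
  show "\<kappa> a \<otimes>\<^bsub>\<Lambda>\<^esub> x = x \<otimes>\<^bsub>\<Lambda>\<^esub> \<kappa> a" if "x \<in> carrier \<Lambda>" for a x
    using that by (auto elim!: \<pi>_surj simp: quot_scalar_def s scale_one_mult mult_scale_one simp flip: \<pi>_mult simp del: path_algebra_simps)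
qed

sublocale \<Lambda>: k_algebra \<Lambda> \<kappa> by (rule quot_k_algebra)

lemma \<kappa>_\<pi>: "x \<in> carrier R \<Longrightarrow> \<kappa> c \<otimes>\<^bsub>\<Lambda>\<^esub> \<pi> x = \<pi> (pm_scale c x)"
  unfolding quot_scalar_def by (simp add: scale_one_mult scale_closed flip: \<pi>_mult del: path_algebra_simps)

text \<open>The paths in \<open>S\<close> are normal forms modulo the ideal, and \<open>\<phi> s\<close> reads off the coefficient of \<open>s\<close>.\<close>

lemma path_basis_exists:
  assumes "homogeneous_ideal I"
  obtains S and \<phi> :: "'v \<times> 'b list \<Rightarrow> ('v, 'b, 'k) path_comb \<Rightarrow> 'k" where
    "S \<subseteq> qpaths Q"
    "\<And>s x y. x \<in> carrier R \<Longrightarrow> y \<in> carrier R \<Longrightarrow> \<phi> s (x + y) = \<phi> s x + \<phi> s y"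
    "\<And>s x c. x \<in> carrier R \<Longrightarrow> \<phi> s (pm_scale c x) = c * \<phi> s x"
    "\<And>s x. s \<in> S \<Longrightarrow> x \<in> I \<Longrightarrow> \<phi> s x = 0"
    "\<And>s s'. s \<in> S \<Longrightarrow> s' \<in> S \<Longrightarrow> \<phi> s (Poly_Mapping.single s' 1) = (if s = s' then 1 else 0)"
    "\<And>x. x \<in> carrier R \<Longrightarrow> finite {s \<in> S. \<phi> s x \<noteq> 0}"
    "\<And>x. x \<in> carrier R \<Longrightarrow> x - (\<Sum>s\<in>{s \<in> S. \<phi> s x \<noteq> 0}. Poly_Mapping.single s (\<phi> s x)) \<in> I"
    "\<And>s x d. s \<in> S \<Longrightarrow> x \<in> homogeneous_elts Q d \<Longrightarrow> length (snd s) \<noteq> d \<Longrightarrow> \<phi> s x = 0"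
proof -
  define e where "e w = Poly_Mapping.single w (1::'k)" for w :: "'v \<times> 'b list"
  \<comment> \<open>A basis of \<open>I\<close> is extended by paths to a basis of the path algebra.
    The added paths are the normal forms \<open>S\<close>, and their coefficients vanish on
    \<open>I\<close>.\<close>
  obtain B0 where B0: "B0 \<subseteq> I" "pm.independent B0" "I \<subseteq> pm.span B0" using pm.maximal_independent_subset by blast
  then have I_span: "pm.span B0 = I" using pm.span_minimal[OF B0(1) I_subspace] by blast
  obtain B where B: "B0 \<subseteq> B" "B \<subseteq> B0 \<union> e ` qpaths Q" "pm.independent B" "B0 \<union> e ` qpaths Q \<subseteq> pm.span B"
    using pm.maximal_independent_subset_extend[OF _ B0(2), of "B0 \<union> e ` qpaths Q"] by blast
  have span: "x \<in> pm.span B" if "x \<in> carrier R" for x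
    using that[simplified]
  proof (induction x rule: pm_induct)
    case (single w a)
    then have "pm_scale a (e w) \<in> pm.span B" using B(4) by (intro pm.span_scale) auto
    then show ?case by (simp add: e_def)
  qed (auto intro: pm.span_zero pm.span_add)
  define S where "S = {w \<in> qpaths Q. e w \<in> B - B0}"
  define \<phi> where "\<phi> s x = pm.representation B x (e s)" for s x
  have e_inj: "e w = e w' \<longleftrightarrow> w = w'" for w w'
    unfolding e_def by (metis lookup_single_eq lookup_single_not_eq zero_neq_one)
  have add: "\<phi> s (x + y) = \<phi> s x + \<phi> s y" if "x \<in> carrier R" "y \<in> carrier R" for s x y
    using pm.representation_add[OF B(3) span[OF that(2)] span[OF that(1)]] by (simp add: \<phi>_def)
  have scale: "\<phi> s (pm_scale c x) = c * \<phi> s x" if "x \<in> carrier R" for s x c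
    using pm.representation_scale[OF B(3) span[OF that]] by (simp add: \<phi>_def)
  have I0: "\<phi> s x = 0" if "s \<in> S" "x \<in> I" for s x
  proof -
    have "pm.representation B x = pm.representation B0 x"
      using that(2) I_span by (intro pm.representation_extend[OF B(3) _ B(1)]) simp
    moreover have "e s \<notin> B0" using that(1) by (simp add: S_def)
    ultimately show ?thesis unfolding \<phi>_def using pm.representation_ne_zero by metis
  qed
  have delta: "\<phi> s (Poly_Mapping.single s' 1) = (if s = s' then 1 else 0)" if "s \<in> S" "s' \<in> S" for s s'
    using pm.representation_basis[OF B(3), of "e s'"] that e_inj by (simp add: \<phi>_def S_def e_def)
  have fin: "finite {s \<in> S. \<phi> s x \<noteq> 0}" for x
  proof (rule finite_imageD)
    show "finite (e ` {s \<in> S. \<phi> s x \<noteq> 0})"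
      by (rule finite_subset[OF _ pm.finite_representation[of B x]]) (auto simp: \<phi>_def)
  qed (auto simp: inj_on_def e_inj)
  have expand: "x - (\<Sum>s\<in>{s \<in> S. \<phi> s x \<noteq> 0}. Poly_Mapping.single s (\<phi> s x)) \<in> I" if x: "x \<in> carrier R" for x
  proof -
    let ?r = "pm.representation B x"
    let ?F = "{b. ?r b \<noteq> 0}"
    have F: "finite ?F" by (rule pm.finite_representation)
    have FB: "?F \<subseteq> B" using pm.representation_ne_zero by blast
    have "?F - B0 = e ` {s \<in> S. \<phi> s x \<noteq> 0}"
      using FB B(2) by (auto simp: S_def \<phi>_def)
    then have 1: "(\<Sum>b\<in>?F - B0. pm_scale (?r b) b) = (\<Sum>s\<in>{s \<in> S. \<phi> s x \<noteq> 0}. Poly_Mapping.single s (\<phi> s x))"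
      by (simp add: sum.reindex inj_on_def e_inj \<phi>_def) (simp add: e_def)
    have 2: "(\<Sum>b\<in>?F. pm_scale (?r b) b) = (\<Sum>b\<in>?F \<inter> B0. pm_scale (?r b) b) + (\<Sum>b\<in>?F - B0. pm_scale (?r b) b)"
      by (rule sum.Int_Diff[OF F])
    have "x = (\<Sum>b\<in>?F. pm_scale (?r b) b)"
      using pm.sum_nonzero_representation_eq[OF B(3) span[OF x]] by (rule sym)
    then have "x = (\<Sum>b\<in>?F \<inter> B0. pm_scale (?r b) b) + (\<Sum>s\<in>{s \<in> S. \<phi> s x \<noteq> 0}. Poly_Mapping.single s (\<phi> s x))"
      unfolding 1 2 .
    then have "x - (\<Sum>s\<in>{s \<in> S. \<phi> s x \<noteq> 0}. Poly_Mapping.single s (\<phi> s x)) = (\<Sum>b\<in>?F \<inter> B0. pm_scale (?r b) b)"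
      by (rule iffD2[OF diff_eq_eq])
    moreover have "\<dots> \<in> I"
      using B0(1) by (intro pm.subspace_sum[OF I_subspace] pm.subspace_scale[OF I_subspace]) auto
    ultimately show ?thesis by (simp only:)
  qed
  have graded: "\<phi> s x = 0" if s: "s \<in> S" and x: "x \<in> homogeneous_elts Q d" and d: "length (snd s) \<noteq> d" for s x d
  proof -
    have xR: "x \<in> carrier R" using x by (auto simp: homogeneous_elts_def)
    let ?F = "{s \<in> S. \<phi> s x \<noteq> 0}" and ?y = "\<Sum>s\<in>{s \<in> S. \<phi> s x \<noteq> 0}. Poly_Mapping.single s (\<phi> s x)"
    have hd: "homogeneous_part d (x - ?y) \<in> I" using expand[OF xR] assms by (simp add: homogeneous_ideal_def)
    have y_carrier: "(\<Sum>s\<in>F. Poly_Mapping.single s (\<phi> s x)) \<in> carrier R" if "F \<subseteq> S" for F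
      using that by (intro pm.subspace_sum[OF carrier_subspace]) (auto simp: S_def split: if_splits)
    have lookup_sum_single: "Poly_Mapping.lookup (\<Sum>s\<in>F. Poly_Mapping.single s (\<phi> s x)) w = (if w \<in> F then \<phi> w x else 0)"
      if "finite F" for F w
      using that by (simp add: lookup_sum lookup_single when_def)
    \<comment> \<open>The part of the normal form of \<open>x\<close> in length \<open>d\<close>. As
      \<open>I\<close> is homogeneous, \<open>x - z\<close> already lies in \<open>I\<close>, so
      \<open>\<phi> s\<close> takes the same value at \<open>x\<close> and \<open>z\<close>, and
      \<open>z\<close> contains no path of the length of \<open>s\<close>.\<close>
    define z where "z = (\<Sum>s\<in>{s \<in> ?F. length (snd s) = d}. Poly_Mapping.single s (\<phi> s x))"
    have z: "z \<in> carrier R" unfolding z_def by (rule y_carrier) auto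
    have "x - z = homogeneous_part d (x - ?y)"
    proof (rule poly_mapping_eqI)
      fix w
      have "Poly_Mapping.lookup x w = 0" if "length (snd w) \<noteq> d"
        using x that by (auto simp: homogeneous_elts_def in_keys_iff)
      moreover have "Poly_Mapping.lookup z w = (if length (snd w) = d then Poly_Mapping.lookup ?y w else 0)"
        unfolding z_def lookup_sum_single[OF fin] lookup_sum_single[OF finite_subset[OF Collect_restrict fin]] by auto
      ultimately show "Poly_Mapping.lookup (x - z) w = Poly_Mapping.lookup (homogeneous_part d (x - ?y)) w"
        by (simp add: lookup_homogeneous_part lookup_minus)
    qed
    then have "x - z \<in> I" using hd by simp
    then have "\<phi> s x = \<phi> s ((x - z) + z) \<and> \<phi> s (x - z) = 0" using I0[OF s] by simp
    then have eq: "\<phi> s x = \<phi> s z" using add[OF I_carrier[OF \<open>x - z \<in> I\<close>] z] by simp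
    have sum_zero: "\<phi> s (\<Sum>s\<in>F. Poly_Mapping.single s (\<phi> s x)) = 0" if "finite F" "F \<subseteq> S" "s \<notin> F" for F
      using that
    proof (induction F rule: finite_induct)
      case (insert s' F)
      then have s': "s' \<in> S" "s \<noteq> s'" by auto
      then have "\<phi> s (Poly_Mapping.single s' (\<phi> s' x)) = \<phi> s' x * \<phi> s (Poly_Mapping.single s' 1)"
        using scale[of "Poly_Mapping.single s' 1" s "\<phi> s' x"] by (auto simp: S_def)
      then have "\<phi> s (Poly_Mapping.single s' (\<phi> s' x)) = 0" using delta[OF s s'(1)] s' by simp
      moreover have "Poly_Mapping.single s' (\<phi> s' x) \<in> carrier R" using s' by (auto simp: S_def split: if_splits)
      moreover have "\<phi> s (\<Sum>s\<in>F. Poly_Mapping.single s (\<phi> s x)) = 0" "F \<subseteq> S" using insert.IH insert.prems by auto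
      ultimately show ?case
        unfolding sum.insert[OF insert.hyps] using add[OF _ y_carrier[of F]] by (simp del: path_algebra_simps)
    qed (use scale[of 0 s 0] in simp)
    have "\<phi> s z = 0" unfolding z_def
    proof (rule sum_zero)
      show "finite {s \<in> ?F. length (snd s) = d}" by (rule finite_subset[OF Collect_restrict fin])
    qed (use d in auto)
    then show ?thesis unfolding eq .
  qed
  show thesis
  proof (rule that[of S \<phi>])
    show "S \<subseteq> qpaths Q" by (auto simp: S_def)
  qed (rule add scale I0 delta fin expand graded; assumption)+
qed

end

section \<open>The right resolution\<close>

lemma sum_rotate: "(\<Sum>q\<in>A. \<Sum>s\<in>B. \<Sum>t\<in>C. g q s t) = (\<Sum>s\<in>B. \<Sum>t\<in>C. \<Sum>q\<in>A. g q s t)"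
  by (subst sum.swap) (rule sum.cong[OF refl], rule sum.swap)

locale resolution_family = quiver_quotient Q I
  for Q :: "('v, 'b) pre_digraph" and I :: "('v, 'b, 'k::field) path_comb set" +
  fixes N :: "nat \<Rightarrow> nat" and f :: "nat \<Rightarrow> nat \<Rightarrow> ('v, 'b, 'k) path_comb"
    and c :: "nat \<Rightarrow> nat \<Rightarrow> nat \<Rightarrow> nat \<Rightarrow> nat \<Rightarrow> 'k"
  assumes homogeneous: "homogeneous_ideal I"
    and resolution: "defines_minimal_resolution Q I N f"
    and comult: "comultiplicative_structure Q N f c"
begin

abbreviation "org n i \<equiv> uorigin Q (f n i)"
abbreviation "trm n i \<equiv> uterminus Q (f n i)"

lemmas resolution_conjs = resolution[unfolded defines_minimal_resolution_def Let_def]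

lemma f_uniform: "i < N n \<Longrightarrow> uniform Q (f n i)"
  and f_homogeneous: "i < N n \<Longrightarrow> f n i \<in> homogeneous_elts Q n"
  using conjunct1[OF resolution_conjs] by simp_all

lemma direct:
  "(\<And>i. i < N n \<Longrightarrow> r i \<in> carrier R) \<Longrightarrow> (\<Sum>i<N n. f n i \<otimes>\<^bsub>R\<^esub> r i) = 0 \<Longrightarrow> i < N n \<Longrightarrow> f n i \<otimes>\<^bsub>R\<^esub> r i = 0"
  using conjunct1[OF conjunct2[OF resolution_conjs], rule_format, of n r i] by simp

lemma f_0: "bij_betw (f 0) {..<N 0} (vertex_elt ` verts Q)"
  using resolution_conjs by (elim conjE)

lemma f_1: "bij_betw (f 1) {..<N 1} (arrow_elt Q ` arcs Q)"
  using resolution_conjs by (elim conjE)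

lemma min_res: "minimal_projective_resolution \<Lambda> (quot_rad Q I) (quot_top Q I) (res_mod Q I N f) (res_diff Q I N f) (top_proj Q I)"
  using resolution_conjs by (elim conjE)

lemma f_keys: "i < N n \<Longrightarrow> Poly_Mapping.keys (f n i) \<subseteq> {w. length (snd w) = n}"
  using f_homogeneous by (auto simp: homogeneous_elts_def)

lemma f_closed [simp]: "i < N n \<Longrightarrow> f n i \<in> carrier R"
  using f_homogeneous by (auto simp: homogeneous_elts_def)

lemma f_keys_qpaths: "i < N n \<Longrightarrow> Poly_Mapping.keys (f n i) \<subseteq> qpaths Q"
  using f_closed by simp

lemma org_verts [simp]: "i < N n \<Longrightarrow> org n i \<in> verts Q" and trm_verts [simp]: "i < N n \<Longrightarrow> trm n i \<in> verts Q"
  using uniform_vertices[OF f_uniform] by auto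

lemma vertex_f: "i < N n \<Longrightarrow> vertex v \<otimes>\<^bsub>R\<^esub> f n i = (if v = org n i then f n i else 0)"
  and f_vertex: "i < N n \<Longrightarrow> f n i \<otimes>\<^bsub>R\<^esub> vertex v = (if v = trm n i then f n i else 0)"
  using uniform_vertex_mult[OF f_uniform] by auto

lemma f_mult_eq_zero: "i < N n \<Longrightarrow> f n i \<otimes>\<^bsub>R\<^esub> y = 0 \<Longrightarrow> vertex (trm n i) \<otimes>\<^bsub>R\<^esub> y = 0"
  by (rule uniform_mult_eq_zero[OF f_uniform f_keys])

lemma f_mult_vertex: 
  assumes "i < N n" "y \<in> carrier R" shows "f n i \<otimes>\<^bsub>R\<^esub> (vertex (trm n i) \<otimes>\<^bsub>R\<^esub> y) = f n i \<otimes>\<^bsub>R\<^esub> y"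
  using I.m_assoc[of "f n i" "vertex (trm n i)" y] assms f_vertex[of i n "trm n i"] f_closed vertex_closed trm_verts by metis

text \<open>Directness makes every single product zero, and cancelling the uniform homogeneous
  factor leaves the part of \<open>r i\<close> that starts at its terminus. The rest of
  \<open>r i\<close> is invisible to the sum.\<close>

lemma direct_vertex:
  assumes "\<And>i. i < N n \<Longrightarrow> r i \<in> carrier R" "(\<Sum>i<N n. f n i \<otimes>\<^bsub>R\<^esub> r i) = 0" "i < N n"
  shows "vertex (trm n i) \<otimes>\<^bsub>R\<^esub> r i = 0"
  using direct[OF assms] f_mult_eq_zero[OF assms(3)] by blast

lemma comult_eq:
  "i < N n \<Longrightarrow> r \<le> n \<Longrightarrow> f n i = (\<Sum>p<N r. \<Sum>q<N (n - r). pm_scale (c n i r p q) (f r p \<otimes>\<^bsub>R\<^esub> f (n - r) q))"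
  using comult unfolding comultiplicative_structure_def by blast

lemma closed_sum: "(\<And>i. i \<in> X \<Longrightarrow> g i \<in> carrier R) \<Longrightarrow> sum g X \<in> carrier R"
  by (rule pm.subspace_sum[OF carrier_subspace])

lemma closed_scale: "x \<in> carrier R \<Longrightarrow> pm_scale a x \<in> carrier R"
  by (rule pm.subspace_scale[OF carrier_subspace])

lemma mult_closed: "x \<in> carrier R \<Longrightarrow> y \<in> carrier R \<Longrightarrow> x \<otimes>\<^bsub>R\<^esub> y \<in> carrier R"
  by (rule I.m_closed)

lemmas closed = closed_sum closed_scale mult_closed f_closed vertex_closed

section \<open>Uniqueness of the structure constants at composable indices\<close>

lemma independent1:
  assumes "(\<Sum>q<N s. pm_scale (a q) (f s q)) = 0" "q < N s"
  shows "a q = 0"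
proof -
  have one: "f s q \<otimes>\<^bsub>R\<^esub> pm_scale (a q) \<one>\<^bsub>R\<^esub> = pm_scale (a q) (f s q)" if "q < N s" for q
    using that by (simp add: mult_scale_one f_keys_qpaths)
  have "f s q \<otimes>\<^bsub>R\<^esub> pm_scale (a q) \<one>\<^bsub>R\<^esub> = 0"
    by (rule direct) (use assms in \<open>auto intro!: closed I.one_closed simp: one simp del: path_algebra_simps\<close>)
  then show ?thesis using one[OF assms(2)] uniform_vertices(3)[OF f_uniform[OF assms(2)]] by (simp add: pm.scale_eq_0_iff)
qed

text \<open>Directness is applied first to the leftmost factors and then to what stands behind one
  of them. If \<open>trm r p\<close> differs from \<open>org s q\<close>, the product is zero and
  \<open>a p q\<close> is unconstrained.\<close>

lemma independent2:
  assumes "(\<Sum>p<N r. \<Sum>q<N s. pm_scale (a p q) (f r p \<otimes>\<^bsub>R\<^esub> f s q)) = 0" "p < N r" "q < N s" "trm r p = org s q"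
  shows "a p q = 0"
proof -
  have "vertex (trm r p) \<otimes>\<^bsub>R\<^esub> (\<Sum>q<N s. pm_scale (a p q) (f s q)) = 0"
    by (rule direct_vertex) (use assms in \<open>auto intro!: closed simp: mult_sum_right mult_linear simp del: path_algebra_simps\<close>)
  then have "(\<Sum>q<N s. pm_scale (if trm r p = org s q then a p q else 0) (f s q)) = 0"
    by (simp add: mult_sum_right mult_linear vertex_f if_distrib[of "pm_scale _"] if_distrib[of "\<lambda>a. pm_scale a _"] cong: if_cong)
  from independent1[OF this assms(3)] show ?thesis using assms(4) by simp
qed

lemma independent3:
  assumes "(\<Sum>p<N r. \<Sum>q<N s. \<Sum>u<N t. pm_scale (a p q u) (f r p \<otimes>\<^bsub>R\<^esub> (f s q \<otimes>\<^bsub>R\<^esub> f t u))) = 0"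
    "p < N r" "q < N s" "u < N t" "trm r p = org s q" "trm s q = org t u"
  shows "a p q u = 0"
proof -
  have "vertex (trm r p) \<otimes>\<^bsub>R\<^esub> (\<Sum>q<N s. \<Sum>u<N t. pm_scale (a p q u) (f s q \<otimes>\<^bsub>R\<^esub> f t u)) = 0"
    by (rule direct_vertex) (use assms in \<open>auto intro!: closed simp: mult_sum_right mult_linear simp del: path_algebra_simps\<close>)
  moreover have "vertex (trm r p) \<otimes>\<^bsub>R\<^esub> (f s q \<otimes>\<^bsub>R\<^esub> f t u) = (if trm r p = org s q then f s q \<otimes>\<^bsub>R\<^esub> f t u else 0)"
    if "q < N s" "u < N t" for q u
    using that assms(2) I.m_assoc[of "vertex (trm r p)" "f s q" "f t u", symmetric]
    by (simp add: vertex_f mult_linear del: path_algebra_simps)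
  ultimately have "(\<Sum>q<N s. \<Sum>u<N t. pm_scale (if trm r p = org s q then a p q u else 0) (f s q \<otimes>\<^bsub>R\<^esub> f t u)) = 0"
    by (simp add: mult_sum_right mult_linear if_distrib[of "pm_scale _"] if_distrib[of "\<lambda>a. pm_scale a _"] cong: if_cong)
  from independent2[OF this assms(3,4,6)] show ?thesis using assms(5) by simp
qed

text \<open>Both sums are the coefficient of the same triple product in
  \<open>f (a + b + d) i\<close>, split as \<open>a\<close> and \<open>b + d\<close> or as
  \<open>a + b\<close> and \<open>d\<close>; products over composable triples are
  independent.\<close>

lemma coassoc:
  assumes i: "i < N (a + b + d)" and psu: "p < N a" "s < N b" "u < N d" "trm a p = org b s" "trm b s = org d u"
  shows "(\<Sum>q<N (b + d). c (a + b + d) i a p q * c (b + d) q b s u) =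
    (\<Sum>q<N (a + b). c (a + b + d) i (a + b) q u * c (a + b) q a p s)"
proof -
  let ?n = "a + b + d"
  let ?g = "\<lambda>p s u. f a p \<otimes>\<^bsub>R\<^esub> (f b s \<otimes>\<^bsub>R\<^esub> f d u)"
  have "f ?n i = (\<Sum>p<N a. \<Sum>q<N (b + d). pm_scale (c ?n i a p q) (f a p \<otimes>\<^bsub>R\<^esub>
      (\<Sum>s<N b. \<Sum>u<N d. pm_scale (c (b + d) q b s u) (f b s \<otimes>\<^bsub>R\<^esub> f d u))))"
    using comult_eq[OF i, of a] comult_eq[of _ "b + d" b] by simp
  also have "\<dots> = (\<Sum>p<N a. \<Sum>q<N (b + d). \<Sum>s<N b. \<Sum>u<N d. pm_scale (c ?n i a p q * c (b + d) q b s u) (?g p s u))"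
    by (simp add: mult_sum_right mult_linear pm.scale_sum_right)
  also have "\<dots> = (\<Sum>p<N a. \<Sum>s<N b. \<Sum>u<N d. pm_scale (\<Sum>q<N (b + d). c ?n i a p q * c (b + d) q b s u) (?g p s u))"
    by (subst sum_rotate) (simp add: pm.scale_sum_left)
  finally have 1: "f ?n i = \<dots>" .
  have "f ?n i = (\<Sum>q<N (a + b). \<Sum>u<N d. pm_scale (c ?n i (a + b) q u) (
      (\<Sum>p<N a. \<Sum>s<N b. pm_scale (c (a + b) q a p s) (f a p \<otimes>\<^bsub>R\<^esub> f b s)) \<otimes>\<^bsub>R\<^esub> f d u))"
    using comult_eq[OF i, of "a + b"] comult_eq[of _ "a + b" a] by simp
  also have "\<dots> = (\<Sum>q<N (a + b). \<Sum>u<N d. \<Sum>p<N a. \<Sum>s<N b. pm_scale (c ?n i (a + b) q u * c (a + b) q a p s) (?g p s u))"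
    by (intro sum.cong refl)
      (auto simp: mult_sum_left mult_linear pm.scale_sum_right I.m_assoc simp del: path_algebra_simps intro!: sum.cong)
  also have "\<dots> = (\<Sum>u<N d. \<Sum>p<N a. \<Sum>s<N b. \<Sum>q<N (a + b). pm_scale (c ?n i (a + b) q u * c (a + b) q a p s) (?g p s u))"
    by (subst sum.swap) (rule sum.cong[OF refl], rule sum_rotate)
  also have "\<dots> = (\<Sum>p<N a. \<Sum>s<N b. \<Sum>u<N d. pm_scale (\<Sum>q<N (a + b). c ?n i (a + b) q u * c (a + b) q a p s) (?g p s u))"
    by (subst sum_rotate) (simp add: pm.scale_sum_left)
  finally have "(\<Sum>p<N a. \<Sum>s<N b. \<Sum>u<N d. pm_scale ((\<Sum>q<N (b + d). c ?n i a p q * c (b + d) q b s u) -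
      (\<Sum>q<N (a + b). c ?n i (a + b) q u * c (a + b) q a p s)) (?g p s u)) = 0"
    using 1 by (simp add: pm.scale_left_diff_distrib sum_subtractf)
  from independent3[OF this psu] show ?thesis by simp
qed

text \<open>Multiplying by the end vertices of \<open>f n i\<close> leaves \<open>f n i\<close>
  unchanged but deletes the products with other ends from its expansion; coefficients at composable
  pairs are unique.\<close>

lemma comult_support:
  assumes i: "i < N n" and "r \<le> n" and pq: "p < N r" "q < N (n - r)" "trm r p = org (n - r) q" and "c n i r p q \<noteq> 0"
  shows "org r p = org n i" "trm (n - r) q = trm n i"
proof -
  let ?g = "\<lambda>p q. f r p \<otimes>\<^bsub>R\<^esub> f (n - r) q"
  have vg: "vertex v \<otimes>\<^bsub>R\<^esub> ?g p q = (if v = org r p then ?g p q else 0)" "?g p q \<otimes>\<^bsub>R\<^esub> vertex v = (if v = trm (n - r) q then ?g p q else 0)"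
    if "p < N r" "q < N (n - r)" "v \<in> verts Q" for p q v
    using that I.m_assoc[of "vertex v" "f r p" "f (n - r) q", symmetric] I.m_assoc[of "f r p" "f (n - r) q" "vertex v"]
    by (simp_all add: vertex_f f_vertex mult_linear del: path_algebra_simps)
  have "f n i = vertex (org n i) \<otimes>\<^bsub>R\<^esub> f n i" using i by (simp add: vertex_f)
  also have "\<dots> = (\<Sum>p<N r. \<Sum>q<N (n - r). pm_scale (c n i r p q) (vertex (org n i) \<otimes>\<^bsub>R\<^esub> ?g p q))"
    by (subst comult_eq[OF assms(1,2)]) (simp add: mult_sum_right mult_linear)
  also have "\<dots> = (\<Sum>p<N r. \<Sum>q<N (n - r). pm_scale (if org n i = org r p then c n i r p q else 0) (?g p q))"
    by (intro sum.cong refl) (use i in \<open>auto simp: vg simp del: path_algebra_simps\<close>)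
  finally have "(\<Sum>p<N r. \<Sum>q<N (n - r). pm_scale (c n i r p q - (if org n i = org r p then c n i r p q else 0)) (?g p q)) = 0"
    using comult_eq[OF assms(1,2)] by (simp add: pm.scale_left_diff_distrib sum_subtractf)
  from independent2[OF this pq] show "org r p = org n i" using assms(6) by (auto split: if_splits)
  have "f n i = f n i \<otimes>\<^bsub>R\<^esub> vertex (trm n i)" using i by (simp add: f_vertex)
  also have "\<dots> = (\<Sum>p<N r. \<Sum>q<N (n - r). pm_scale (c n i r p q) (?g p q \<otimes>\<^bsub>R\<^esub> vertex (trm n i)))"
    by (subst (1) comult_eq[OF assms(1,2)]) (simp add: mult_sum_left mult_linear)
  also have "\<dots> = (\<Sum>p<N r. \<Sum>q<N (n - r). pm_scale (if trm n i = trm (n - r) q then c n i r p q else 0) (?g p q))"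
    by (intro sum.cong refl) (use i in \<open>auto simp: vg simp del: path_algebra_simps\<close>)
  finally have "(\<Sum>p<N r. \<Sum>q<N (n - r). pm_scale (c n i r p q - (if trm n i = trm (n - r) q then c n i r p q else 0)) (?g p q)) = 0"
    using comult_eq[OF assms(1,2)] by (simp add: pm.scale_left_diff_distrib sum_subtractf)
  from independent2[OF this pq] show "trm (n - r) q = trm n i" using assms(6) by (auto split: if_splits)
qed

lemma f_0_vertex: "p < N 0 \<Longrightarrow> f 0 p = vertex (org 0 p)" "p < N 0 \<Longrightarrow> trm 0 p = org 0 p"
proof -
  assume p: "p < N 0"
  then obtain v where v: "v \<in> verts Q" "f 0 p = vertex v" using f_0 by (auto simp: bij_betw_def)
  then have key: "(v, []) \<in> Poly_Mapping.keys (f 0 p)" by (simp add: vertex_elt_def)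
  have "org 0 p = v" "trm 0 p = v"
    using uniform_vertices(5,6)[OF f_uniform[OF p] key] by (simp_all add: qpath_end_def)
  with v show "f 0 p = vertex (org 0 p)" "trm 0 p = org 0 p" by auto
qed

lemma vertex_idx:
  assumes "v \<in> verts Q" obtains p where "p < N 0" "org 0 p = v" "\<And>p'. p' < N 0 \<Longrightarrow> org 0 p' = v \<longleftrightarrow> p' = p"
proof -
  have "vertex v \<in> f 0 ` {..<N 0}" using f_0 assms by (simp add: bij_betw_def)
  then obtain p where p: "p < N 0" "f 0 p = vertex v" by (metis imageE lessThan_iff)
  have v: "org 0 p' = v \<longleftrightarrow> f 0 p' = vertex v" if "p' < N 0" for p'
    using f_0_vertex(1)[OF that] by (auto simp: vertex_elt_def) (metis inj_single lookup_single_eq lookup_single_not_eq prod.inject zero_neq_one)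
  show thesis
  proof (rule that[of p])
    show "org 0 p = v" using v[OF p(1)] p(2) by blast
    show "org 0 p' = v \<longleftrightarrow> p' = p" if "p' < N 0" for p'
      using v[OF that] p f_0 that unfolding bij_betw_def inj_on_def by (metis lessThan_iff)
  qed (fact p(1))
qed

text \<open>The origin vertex times \<open>f n i\<close> is one expansion with \<open>r = 0\<close>,
  and coefficients at composable pairs are unique.\<close>

lemma comult_0:
  assumes i: "i < N n" and pq: "p < N 0" "q < N n" "org 0 p = org n q"
  shows "c n i 0 p q = (if q = i then 1 else 0)"
proof -
  have g: "f 0 p \<otimes>\<^bsub>R\<^esub> f n q = (if org 0 p = org n q then f n q else 0)" if "p < N 0" "q < N n" for p q
    using that by (subst f_0_vertex(1)) (auto simp: vertex_f)
  obtain p0 where p0: "p0 < N 0" "org 0 p0 = org n i" "\<And>p'. p' < N 0 \<Longrightarrow> org 0 p' = org n i \<longleftrightarrow> p' = p0"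
    using vertex_idx[of "org n i"] i by auto
  have "(\<Sum>p<N 0. \<Sum>q<N n. pm_scale (if p = p0 \<and> q = i then 1 else 0) (f 0 p \<otimes>\<^bsub>R\<^esub> f n q))
      = (\<Sum>p<N 0. if p = p0 then (\<Sum>q<N n. if q = i then f 0 p0 \<otimes>\<^bsub>R\<^esub> f n i else 0) else 0)"
    by (intro sum.cong refl, rename_tac p, case_tac "p = p0")
      (use i in \<open>simp_all add: if_distrib[of "\<lambda>a. pm_scale a _"] cong: if_cong\<close>)
  also have "\<dots> = f n i" using p0 i by (simp add: g)
  finally have e: "(\<Sum>p<N 0. \<Sum>q<N n. pm_scale (if p = p0 \<and> q = i then 1 else 0) (f 0 p \<otimes>\<^bsub>R\<^esub> f n q)) = f n i" .
  have "(\<Sum>p<N 0. \<Sum>q<N n. pm_scale (c n i 0 p q - (if p = p0 \<and> q = i then 1 else 0)) (f 0 p \<otimes>\<^bsub>R\<^esub> f n q)) = 0"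
    unfolding pm.scale_left_diff_distrib sum_subtractf e
    using comult_eq[OF i le0, unfolded diff_zero] by (rule iffD2[OF right_minus_eq sym])
  then have "c n i 0 p q - (if p = p0 \<and> q = i then 1 else 0) = 0"
    by (rule independent2[OF _ pq(1,2)]) (use pq f_0_vertex(2) in simp)
  then have "c n i 0 p q = (if p = p0 \<and> q = i then 1 else 0)" by (rule iffD2[OF eq_iff_diff_eq_0])
  moreover have "p = p0" if "q = i" using p0(3)[OF pq(1)] pq(3) that by simp
  ultimately show ?thesis by auto
qed

lemma comult_n:
  assumes i: "i < N n" and pq: "p < N n" "q < N 0" "trm n p = org 0 q"
  shows "c n i n p q = (if p = i then 1 else 0)"
proof -
  have g: "f n p \<otimes>\<^bsub>R\<^esub> f 0 q = (if trm n p = org 0 q then f n p else 0)" if "p < N n" "q < N 0" for p q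
    using that by (subst f_0_vertex(1)) (auto simp: f_vertex)
  obtain q0 where q0: "q0 < N 0" "org 0 q0 = trm n i" "\<And>p'. p' < N 0 \<Longrightarrow> org 0 p' = trm n i \<longleftrightarrow> p' = q0"
    using vertex_idx[of "trm n i"] i by auto
  have "(\<Sum>p<N n. \<Sum>q<N 0. pm_scale (if p = i \<and> q = q0 then 1 else 0) (f n p \<otimes>\<^bsub>R\<^esub> f 0 q))
      = (\<Sum>p<N n. if p = i then (\<Sum>q<N 0. if q = q0 then f n i \<otimes>\<^bsub>R\<^esub> f 0 q0 else 0) else 0)"
    by (intro sum.cong refl, rename_tac p, case_tac "p = i")
      (use q0 in \<open>simp_all add: if_distrib[of "\<lambda>a. pm_scale a _"] cong: if_cong\<close>)
  also have "\<dots> = f n i" using q0(1,2) i by (simp add: g)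
  finally have e: "(\<Sum>p<N n. \<Sum>q<N 0. pm_scale (if p = i \<and> q = q0 then 1 else 0) (f n p \<otimes>\<^bsub>R\<^esub> f 0 q)) = f n i" .
  have "(\<Sum>p<N n. \<Sum>q<N 0. pm_scale (c n i n p q - (if p = i \<and> q = q0 then 1 else 0)) (f n p \<otimes>\<^bsub>R\<^esub> f 0 q)) = 0"
    unfolding pm.scale_left_diff_distrib sum_subtractf e
    using comult_eq[OF i order_refl, unfolded diff_self_eq_0] by (rule iffD2[OF right_minus_eq sym])
  from independent2[OF this pq] have "c n i n p q = (if p = i \<and> q = q0 then 1 else 0)"
    by (rule iffD2[OF eq_iff_diff_eq_0])
  moreover have "q = q0" if "p = i" using q0(3)[OF pq(2)] pq(3) that by simp
  ultimately show ?thesis by auto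
qed

text \<open>The differential of the right resolution in terms of coordinates.\<close>

definition rdiff :: "nat \<Rightarrow> (nat \<Rightarrow> ('v, 'b, 'k) path_comb) \<Rightarrow> nat \<Rightarrow> ('v, 'b, 'k) path_comb" where
  "rdiff n r j = (\<Sum>i<N (Suc n). \<Sum>q<N 1. pm_scale (c (Suc n) i n j q) (f 1 q \<otimes>\<^bsub>R\<^esub> r i))"

lemma rdiff_closed: "(\<And>i. i < N (Suc n) \<Longrightarrow> r i \<in> carrier R) \<Longrightarrow> rdiff n r j \<in> carrier R"
  unfolding rdiff_def by (intro closed) auto

lemma rdiff_I: "(\<And>i. i < N (Suc n) \<Longrightarrow> r i \<in> I) \<Longrightarrow> rdiff n r j \<in> I"
  unfolding rdiff_def
  by (intro pm.subspace_sum[OF I_subspace] pm.subspace_scale[OF I_subspace] I.I_l_closed) (auto simp del: path_algebra_simps)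

text \<open>The differential of the right resolution comes from an inclusion of right ideals.
  Expanding each \<open>f (Suc n) i\<close> into products of some \<open>f n j\<close> with an arrow
  turns the inclusion into a formula for coordinates.\<close>

lemma sum_f_rdiff:
  assumes "\<And>i. i < N (Suc n) \<Longrightarrow> r i \<in> carrier R"
  shows "(\<Sum>i<N (Suc n). f (Suc n) i \<otimes>\<^bsub>R\<^esub> r i) = (\<Sum>j<N n. f n j \<otimes>\<^bsub>R\<^esub> rdiff n r j)"
proof -
  have "(\<Sum>i<N (Suc n). f (Suc n) i \<otimes>\<^bsub>R\<^esub> r i) =
      (\<Sum>i<N (Suc n). (\<Sum>j<N n. \<Sum>q<N 1. pm_scale (c (Suc n) i n j q) (f n j \<otimes>\<^bsub>R\<^esub> f 1 q)) \<otimes>\<^bsub>R\<^esub> r i)"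
    using comult_eq[of _ "Suc n" n] by simp
  also have "\<dots> = (\<Sum>i<N (Suc n). \<Sum>j<N n. \<Sum>q<N 1. pm_scale (c (Suc n) i n j q) (f n j \<otimes>\<^bsub>R\<^esub> (f 1 q \<otimes>\<^bsub>R\<^esub> r i)))"
    by (intro sum.cong refl)
      (auto simp: mult_sum_left mult_linear I.m_assoc assms simp del: path_algebra_simps intro!: sum.cong)
  also have "\<dots> = (\<Sum>j<N n. f n j \<otimes>\<^bsub>R\<^esub> rdiff n r j)"
    by (subst sum.swap) (simp add: rdiff_def mult_sum_right mult_linear)
  finally show ?thesis .
qed

text \<open>Exactness of the complex of cosets, unpacked: a coset is in the kernel when its
  representative lies in the sum of the \<open>f n i\<close> times \<open>I\<close>, and being in
  the image means agreeing with an element of the next right ideal up to multiples of the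
  \<open>f (Suc n) i\<close> by \<open>I\<close>.\<close>

lemma res_exact:
  assumes x: "x \<in> res_sum Q N f (carrier R) (Suc n)" "x \<in> res_sum Q N f I n"
  obtains y z where "y \<in> res_sum Q N f (carrier R) (Suc (Suc n))" "z \<in> res_sum Q N f I (Suc n)" "x = y + z"
proof -
  let ?B = "res_sum Q N f I"
  have B_zero: "0 \<in> ?B n" for n
    unfolding res_sum_def using pm.subspace_0[OF I_subspace] by (intro CollectI exI[of _ "\<lambda>_. 0"]) (simp add: mult_linear)
  have B_add: "x + y \<in> ?B n" if xy: "x \<in> ?B n" "y \<in> ?B n" for x y n
  proof -
    obtain r where r: "x = (\<Sum>i<N n. f n i \<otimes>\<^bsub>R\<^esub> r i)" "\<forall>i<N n. r i \<in> I" using xy(1) by (auto simp: res_sum_def)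
    obtain s where s: "y = (\<Sum>i<N n. f n i \<otimes>\<^bsub>R\<^esub> s i)" "\<forall>i<N n. s i \<in> I" using xy(2) by (auto simp: res_sum_def)
    show ?thesis unfolding res_sum_def using r s pm.subspace_add[OF I_subspace]
      by (intro CollectI exI[of _ "\<lambda>i. r i + s i"]) (simp add: mult_linear sum.distrib)
  qed
  have B_neg: "- x \<in> ?B n" if x: "x \<in> ?B n" for x n
  proof -
    obtain r where r: "x = (\<Sum>i<N n. f n i \<otimes>\<^bsub>R\<^esub> r i)" "\<forall>i<N n. r i \<in> I" using x by (auto simp: res_sum_def)
    have m: "f n i \<otimes>\<^bsub>R\<^esub> (- r i) = - (f n i \<otimes>\<^bsub>R\<^esub> r i)" for i using mult_linear(6)[where x = "f n i" and Q = Q and y = 0 and y' = "r i"] by (simp add: mult_linear)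
    show ?thesis unfolding res_sum_def using r pm.subspace_neg[OF I_subspace]
      by (intro CollectI exI[of _ "\<lambda>i. - r i"]) (simp add: m sum_negf)
  qed
  \<comment> \<open>The induced map adds the submodule of degree \<open>n\<close> to a coset of the
    one of degree \<open>Suc n\<close>, so the latter has to be contained in the former; this holds
    because \<open>rdiff\<close> preserves \<open>I\<close>.\<close>
  have B_mono: "?B (Suc n) \<subseteq> ?B n" for n
  proof
    fix x assume "x \<in> ?B (Suc n)"
    then obtain r where r: "x = (\<Sum>i<N (Suc n). f (Suc n) i \<otimes>\<^bsub>R\<^esub> r i)" "\<forall>i<N (Suc n). r i \<in> I" by (auto simp: res_sum_def)
    then have "x = (\<Sum>j<N n. f n j \<otimes>\<^bsub>R\<^esub> rdiff n r j)" using I_carrier by (subst sum_f_rdiff[symmetric]) auto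
    then show "x \<in> ?B n" unfolding res_sum_def using rdiff_I[of n r] r(2) by blast
  qed
  define X where "X = ?B (Suc n) +>\<^bsub>R\<^esub> x"
  have X: "X = {b + x | b. b \<in> ?B (Suc n)}" by (auto simp: X_def a_r_coset_def')
  have "res_diff Q I N f n X = ?B n"
  proof -
    have "res_diff Q I N f n X = {b + (b' + x) | b b'. b \<in> ?B n \<and> b' \<in> ?B (Suc n)}"
      by (auto simp: res_diff_def set_add_def' X)
    also have "\<dots> = ?B n"
    proof (intro equalityI subsetI)
      fix y assume "y \<in> {b + (b' + x) | b b'. b \<in> ?B n \<and> b' \<in> ?B (Suc n)}"
      then show "y \<in> ?B n" using B_add B_mono x(2) by blast
    next
      fix y assume "y \<in> ?B n"
      then have "y + - x \<in> ?B n" using x(2) B_add B_neg by blast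
      moreover have "y = (y + - x) + (0 + x)" by simp
      ultimately show "y \<in> {b + (b' + x) | b b'. b \<in> ?B n \<and> b' \<in> ?B (Suc n)}" using B_zero by blast
    qed
    finally show ?thesis .
  qed
  moreover have "X \<in> carrier (res_mod Q I N f (Suc n))" using x(1) by (auto simp: res_mod_def X_def Let_def)
  ultimately have "X \<in> {x \<in> carrier (res_mod Q I N f (Suc n)). res_diff Q I N f n x = \<zero>\<^bsub>res_mod Q I N f n\<^esub>}"
    by (simp add: res_mod_def Let_def)
  also have "\<dots> = res_diff Q I N f (Suc n) ` carrier (res_mod Q I N f (Suc (Suc n)))"
    using min_res unfolding minimal_projective_resolution_def projective_resolution_def by (elim conjE) (erule spec)
  finally obtain y where y: "y \<in> res_sum Q N f (carrier R) (Suc (Suc n))" "X = res_diff Q I N f (Suc n) (?B (Suc (Suc n)) +>\<^bsub>R\<^esub> y)"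
    by (auto simp: res_mod_def Let_def)
  have "x \<in> X" unfolding X using B_zero[of "Suc n"] by force
  then obtain b b' where b: "b \<in> ?B (Suc n)" "b' \<in> ?B (Suc (Suc n))" "x = b + (b' + y)"
    unfolding y(2) by (auto simp: res_diff_def set_add_def' a_r_coset_def')
  have "b + b' \<in> ?B (Suc n)" using B_add[OF b(1)] B_mono b(2) by blast
  moreover have "x = y + (b + b')" using b(3) by (simp add: algebra_simps)
  ultimately show thesis by (rule that[OF y(1)])
qed

text \<open>The degree bound is obtained by truncation, which preserves a homogeneous ideal.\<close>

lemma rdiff_exact:
  assumes r: "\<And>i. i < N (Suc n) \<Longrightarrow> r i \<in> carrier R" "\<And>i. i < N (Suc n) \<Longrightarrow> Poly_Mapping.keys (r i) \<subseteq> {w. length (snd w) < d}"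
    and cycle: "\<And>j. j < N n \<Longrightarrow> vertex (trm n j) \<otimes>\<^bsub>R\<^esub> rdiff n r j \<in> I"
  obtains s where "\<And>l. s l \<in> carrier R" "\<And>l. Poly_Mapping.keys (s l) \<subseteq> {w. length (snd w) < d - 1}"
    "\<And>i. i < N (Suc n) \<Longrightarrow> vertex (trm (Suc n) i) \<otimes>\<^bsub>R\<^esub> (r i - rdiff (Suc n) s i) \<in> I"
proof -
  let ?x = "\<Sum>i<N (Suc n). f (Suc n) i \<otimes>\<^bsub>R\<^esub> r i"
  \<comment> \<open>The terminus vertex can be inserted for free, so the hypothesis about the part
    of \<open>rdiff n r j\<close> at that vertex suffices.\<close>
  have "?x = (\<Sum>j<N n. f n j \<otimes>\<^bsub>R\<^esub> (vertex (trm n j) \<otimes>\<^bsub>R\<^esub> rdiff n r j))"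
    using r(1) by (subst sum_f_rdiff) (auto simp: f_mult_vertex rdiff_closed simp del: path_algebra_simps)
  then have x1: "?x \<in> res_sum Q N f I n" using cycle by (auto simp: res_sum_def)
  have x2: "?x \<in> res_sum Q N f (carrier R) (Suc n)" using r(1) by (auto simp: res_sum_def simp del: path_algebra_simps)
  obtain y z where yz: "y \<in> res_sum Q N f (carrier R) (Suc (Suc n))" "z \<in> res_sum Q N f I (Suc n)" "?x = y + z"
    by (rule res_exact[OF x2 x1])
  obtain s where s: "\<And>l. l < N (Suc (Suc n)) \<Longrightarrow> s l \<in> carrier R" "y = (\<Sum>l<N (Suc (Suc n)). f (Suc (Suc n)) l \<otimes>\<^bsub>R\<^esub> s l)"
    using yz(1) by (auto simp: res_sum_def simp del: path_algebra_simps)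
  obtain w where w: "\<And>i. i < N (Suc n) \<Longrightarrow> w i \<in> I" "z = (\<Sum>i<N (Suc n). f (Suc n) i \<otimes>\<^bsub>R\<^esub> w i)"
    using yz(2) by (auto simp: res_sum_def)
  have sum0: "(\<Sum>i<N (Suc n). f (Suc n) i \<otimes>\<^bsub>R\<^esub> (r i - rdiff (Suc n) s i - w i)) = 0"
    using yz(3) s(2) w(2) sum_f_rdiff[of "Suc n" s, OF s(1)] by (simp add: mult_linear sum_subtractf)
  have 0: "vertex (trm (Suc n) i) \<otimes>\<^bsub>R\<^esub> (r i - rdiff (Suc n) s i - w i) = 0" if "i < N (Suc n)" for i
    by (rule direct_vertex[OF _ sum0 that]) (use that in \<open>auto intro!: pm.subspace_diff[OF carrier_subspace] rdiff_closed r s I_carrier[OF w(1)] simp del: path_algebra_simps\<close>)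
  have ex: "vertex (trm (Suc n) i) \<otimes>\<^bsub>R\<^esub> (r i - rdiff (Suc n) s i) \<in> I" if "i < N (Suc n)" for i
  proof -
    have "vertex (trm (Suc n) i) \<otimes>\<^bsub>R\<^esub> (r i - rdiff (Suc n) s i) = vertex (trm (Suc n) i) \<otimes>\<^bsub>R\<^esub> w i"
      using 0[OF that] by (simp add: mult_linear)
    then show ?thesis using I.I_l_closed[OF w(1)[OF that] vertex_closed[OF trm_verts[OF that]]] by (simp only:)
  qed
  \<comment> \<open>The bound is \<open>d - 1\<close> because \<open>rdiff\<close> multiplies by an
    arrow and so raises lengths by one. For \<open>d = 0\<close> the difference is again 0 and both
    truncations vanish; indices out of range get 0 so that the bound holds for every
    \<open>l\<close>.\<close>
  define s' where "s' l = (if l < N (Suc (Suc n)) then truncate (d - 1) (s l) else 0)" for l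
  have f1: "truncate d (f 1 q \<otimes>\<^bsub>R\<^esub> s l) = f 1 q \<otimes>\<^bsub>R\<^esub> truncate (d - 1) (s l)" if "q < N 1" for q l
  proof (cases d)
    case 0
    have "truncate 0 x = 0" for x :: "('v, 'b, 'k) path_comb" by (simp add: truncate_def)
    then show ?thesis by (simp add: 0 mult_linear)
  next
    case (Suc d')
    then show ?thesis using truncate_homogeneous_mult[OF f_keys[OF that], of d' Q "s l"] by simp
  qed
  have "truncate d (rdiff (Suc n) s i) = rdiff (Suc n) s' i" for i
    unfolding rdiff_def truncate_sum truncate_linear
    by (intro sum.cong refl) (auto simp: f1 s'_def simp del: One_nat_def)
  moreover have "truncate d (r i) = r i" if "i < N (Suc n)" for i using r(2)[OF that] by (rule truncate_id)
  ultimately have "vertex (trm (Suc n) i) \<otimes>\<^bsub>R\<^esub> (r i - rdiff (Suc n) s' i) \<in> I" if "i < N (Suc n)" for i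
    using truncate_in_ideal[OF homogeneous I_subspace ex[OF that], of d] that
    by (simp add: truncate_vertex_mult truncate_linear)
  moreover have "s' l \<in> carrier R" "Poly_Mapping.keys (s' l) \<subseteq> {w. length (snd w) < d - 1}" for l
    using s(1)[of l] keys_truncate[of "d - 1" "s l"] by (auto simp: s'_def)
  ultimately show thesis by (intro that[of s']) auto
qed

end

section \<open>The bimodule resolution\<close>

context k_bimodule
begin

text \<open>The shape of every comultiplication formula: all coefficients sit in the inner sum, and
  the outer sum has coefficient 1.\<close>

definition lc2 :: "'i set \<Rightarrow> 'j set \<Rightarrow> ('i \<Rightarrow> 'j \<Rightarrow> 'k) \<Rightarrow> ('i \<Rightarrow> 'j \<Rightarrow> 'm) \<Rightarrow> 'm" where
  "lc2 X Y w B = lc X (\<lambda>_. 1) (\<lambda>x. lc Y (w x) (B x))"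

lemma lc2_closed [intro, simp]: "(\<And>x y. x \<in> X \<Longrightarrow> y \<in> Y \<Longrightarrow> B x y \<in> carrier M) \<Longrightarrow> lc2 X Y w B \<in> carrier M"
  unfolding lc2_def by (intro lc_closed) auto

lemma lc2_cong:
  "X = X' \<Longrightarrow> Y = Y' \<Longrightarrow> (\<And>x y. x \<in> X' \<Longrightarrow> y \<in> Y' \<Longrightarrow> B' x y \<in> carrier M) \<Longrightarrow>
   (\<And>x y. x \<in> X' \<Longrightarrow> y \<in> Y' \<Longrightarrow> \<kappa> (w x y) \<triangleright>\<^bsub>M\<^esub> B x y = \<kappa> (w' x y) \<triangleright>\<^bsub>M\<^esub> B' x y) \<Longrightarrow> lc2 X Y w B = lc2 X' Y' w' B'"
  unfolding lc2_def by (intro lc_cong refl arg_cong[where f = "\<lambda>x. _ \<triangleright>\<^bsub>M\<^esub> x"] lc_closed) auto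

lemma lc2_ls:
  assumes "a \<in> carrier A" "\<And>x y. x \<in> X \<Longrightarrow> y \<in> Y \<Longrightarrow> B x y \<in> carrier M"
  shows "a \<triangleright>\<^bsub>M\<^esub> lc2 X Y w B = lc2 X Y w (\<lambda>x y. a \<triangleright>\<^bsub>M\<^esub> B x y)"
  unfolding lc2_def using assms by (subst lc_ls) (auto intro!: lc_cong simp: lc_ls)

lemma lc2_rs:
  assumes "a \<in> carrier A" "\<And>x y. x \<in> X \<Longrightarrow> y \<in> Y \<Longrightarrow> B x y \<in> carrier M"
  shows "lc2 X Y w B \<triangleleft>\<^bsub>M\<^esub> a = lc2 X Y w (\<lambda>x y. B x y \<triangleleft>\<^bsub>M\<^esub> a)"
  unfolding lc2_def using assms by (subst lc_rs) (auto intro!: lc_cong simp: lc_rs)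

lemma lc2_zero:
  "(\<And>x y. x \<in> X \<Longrightarrow> y \<in> Y \<Longrightarrow> \<kappa> (w x y) \<triangleright>\<^bsub>M\<^esub> B x y = \<zero>\<^bsub>M\<^esub>) \<Longrightarrow> lc2 X Y w B = \<zero>\<^bsub>M\<^esub>"
  unfolding lc2_def by (intro lc_zero) (simp add: lc_zero)

lemma lc_add:
  assumes "\<And>x. x \<in> X \<Longrightarrow> B x \<in> carrier M" "\<And>x. x \<in> X \<Longrightarrow> C x \<in> carrier M"
  shows "lc X w (\<lambda>x. B x \<oplus>\<^bsub>M\<^esub> C x) = lc X w B \<oplus>\<^bsub>M\<^esub> lc X w C"
proof -
  have "lc X w B \<oplus>\<^bsub>M\<^esub> lc X w C = (\<Oplus>\<^bsub>M\<^esub>x\<in>X. \<kappa> (w x) \<triangleright>\<^bsub>M\<^esub> B x \<oplus>\<^bsub>M\<^esub> \<kappa> (w x) \<triangleright>\<^bsub>M\<^esub> C x)"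
    unfolding lc_def using assms by (intro M.finsum_addf[symmetric]) auto
  also have "\<dots> = lc X w (\<lambda>x. B x \<oplus>\<^bsub>M\<^esub> C x)"
    unfolding lc_def using assms by (intro M.finsum_cong') (auto simp: ls_add)
  finally show ?thesis by (rule sym)
qed

lemma \<kappa>_ls_ls: "x \<in> carrier M \<Longrightarrow> \<kappa> b \<triangleright>\<^bsub>M\<^esub> \<kappa> a \<triangleright>\<^bsub>M\<^esub> x = \<kappa> (a * b) \<triangleright>\<^bsub>M\<^esub> x"
  by (simp add: mult.commute[of a] \<kappa>_mult ls_assoc)

lemma lc2_add:
  assumes "\<And>x y. x \<in> X \<Longrightarrow> y \<in> Y \<Longrightarrow> B x y \<in> carrier M" "\<And>x y. x \<in> X \<Longrightarrow> y \<in> Y \<Longrightarrow> C x y \<in> carrier M"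
  shows "lc2 X Y w (\<lambda>x y. B x y \<oplus>\<^bsub>M\<^esub> C x y) = lc2 X Y w B \<oplus>\<^bsub>M\<^esub> lc2 X Y w C"
proof -
  have "lc2 X Y w B \<oplus>\<^bsub>M\<^esub> lc2 X Y w C = lc X (\<lambda>_. 1) (\<lambda>x. lc Y (w x) (B x) \<oplus>\<^bsub>M\<^esub> lc Y (w x) (C x))"
    unfolding lc2_def using assms by (intro lc_add[symmetric] lc_closed) auto
  also have "\<dots> = lc2 X Y w (\<lambda>x y. B x y \<oplus>\<^bsub>M\<^esub> C x y)"
    unfolding lc2_def using assms by (intro lc_cong refl) (auto simp: lc_add)
  finally show ?thesis by (rule sym)
qed

lemma lc_collapse:
  assumes "finite X" "finite Y" "\<And>y. y \<in> Y \<Longrightarrow> B y \<in> carrier M"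
  shows "lc X (\<lambda>_. 1) (\<lambda>x. lc Y (w x) B) = lc Y (\<lambda>y. \<Sum>x\<in>X. w x y) B"
  using assms by (subst lc_swap) (auto intro!: lc_cong simp: lc_sum_coeff)

lemma lc_one_commute:
  assumes "finite X" "finite Y" "\<And>x y. x \<in> X \<Longrightarrow> y \<in> Y \<Longrightarrow> B x y \<in> carrier M"
  shows "lc X (\<lambda>_. 1) (\<lambda>x. lc Y (\<lambda>_. 1) (B x)) = lc Y (\<lambda>_. 1) (\<lambda>y. lc X (\<lambda>_. 1) (\<lambda>x. B x y))"
  by (rule lc_swap[OF assms])

text \<open>Together with \<open>lc2_nested_right\<close> this brings the two bracketings of a
  triple comultiplication to one form, a sum over the three factors whose coefficient is a sum over
  the intermediate index; there \<open>coassoc\<close> applies.\<close>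

lemma lc2_nested_left:
  assumes fin: "finite X" "finite Y" "finite Z" "finite W"
    and B: "\<And>x z w. x \<in> X \<Longrightarrow> z \<in> Z \<Longrightarrow> w \<in> W \<Longrightarrow> B x z w \<in> carrier M"
  shows "lc2 X Y a (\<lambda>x y. lc2 Z W (b y) (B x)) =
    lc X (\<lambda>_. 1) (\<lambda>x. lc Z (\<lambda>_. 1) (\<lambda>z. lc W (\<lambda>w. \<Sum>y\<in>Y. a x y * b y z w) (B x z)))"
proof -
  have "lc Y (a x) (\<lambda>y. lc2 Z W (b y) (B x)) = lc Z (\<lambda>_. 1) (\<lambda>z. lc W (\<lambda>w. \<Sum>y\<in>Y. a x y * b y z w) (B x z))"
    if x: "x \<in> X" for x
  proof -
    have "lc Y (a x) (\<lambda>y. lc2 Z W (b y) (B x)) =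
        lc Y (\<lambda>_. 1) (\<lambda>y. lc Z (\<lambda>_. 1) (\<lambda>z. lc W (\<lambda>w. a x y * b y z w) (B x z)))"
      unfolding lc2_def using x B by (auto intro!: lc_cong lc_closed simp: lc_ls \<kappa>_ls_ls)
    also have "\<dots> = lc Z (\<lambda>_. 1) (\<lambda>z. lc Y (\<lambda>_. 1) (\<lambda>y. lc W (\<lambda>w. a x y * b y z w) (B x z)))"
      using x B fin by (intro lc_one_commute) auto
    also have "\<dots> = lc Z (\<lambda>_. 1) (\<lambda>z. lc W (\<lambda>w. \<Sum>y\<in>Y. a x y * b y z w) (B x z))"
      using x B fin by (auto intro!: lc_cong simp: lc_collapse)
    finally show ?thesis .
  qed
  then show ?thesis unfolding lc2_def[of X] using B by (intro lc_cong refl) auto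
qed

lemma lc2_nested_right:
  assumes fin: "finite X" "finite Y" "finite Z" "finite W"
    and B: "\<And>x z w. x \<in> X \<Longrightarrow> z \<in> Z \<Longrightarrow> w \<in> W \<Longrightarrow> B x z w \<in> carrier M"
  shows "lc2 Y W a (\<lambda>y w. lc2 X Z (b y) (\<lambda>x z. B x z w)) =
    lc X (\<lambda>_. 1) (\<lambda>x. lc Z (\<lambda>_. 1) (\<lambda>z. lc W (\<lambda>w. \<Sum>y\<in>Y. a y w * b y x z) (B x z)))"
proof -
  have "lc2 Y W a (\<lambda>y w. lc2 X Z (b y) (\<lambda>x z. B x z w)) =
      lc Y (\<lambda>_. 1) (\<lambda>y. lc W (\<lambda>_. 1) (\<lambda>w. lc X (\<lambda>_. 1) (\<lambda>x. lc Z (\<lambda>z. a y w * b y x z) (\<lambda>z. B x z w))))"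
    unfolding lc2_def using B by (auto intro!: lc_cong lc_closed simp: lc_ls \<kappa>_ls_ls)
  also have "\<dots> = lc Y (\<lambda>_. 1) (\<lambda>y. lc X (\<lambda>_. 1) (\<lambda>x. lc W (\<lambda>_. 1) (\<lambda>w. lc Z (\<lambda>z. a y w * b y x z) (\<lambda>z. B x z w))))"
    using B fin by (intro lc_cong refl arg_cong[where f = "\<lambda>x. _ \<triangleright>\<^bsub>M\<^esub> x"] lc_one_commute lc_closed) auto
  also have "\<dots> = lc Y (\<lambda>_. 1) (\<lambda>y. lc X (\<lambda>_. 1) (\<lambda>x. lc Z (\<lambda>_. 1) (\<lambda>z. lc W (\<lambda>w. a y w * b y x z) (B x z))))"
    using B fin by (intro lc_cong refl arg_cong[where f = "\<lambda>x. _ \<triangleright>\<^bsub>M\<^esub> x"] lc_swap lc_closed) auto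
  also have "\<dots> = lc X (\<lambda>_. 1) (\<lambda>x. lc Y (\<lambda>_. 1) (\<lambda>y. lc Z (\<lambda>_. 1) (\<lambda>z. lc W (\<lambda>w. a y w * b y x z) (B x z))))"
    using B fin by (intro lc_one_commute lc_closed) auto
  also have "\<dots> = lc X (\<lambda>_. 1) (\<lambda>x. lc Z (\<lambda>_. 1) (\<lambda>z. lc Y (\<lambda>_. 1) (\<lambda>y. lc W (\<lambda>w. a y w * b y x z) (B x z))))"
    using B fin by (intro lc_cong refl arg_cong[where f = "\<lambda>x. _ \<triangleright>\<^bsub>M\<^esub> x"] lc_one_commute lc_closed) auto
  also have "\<dots> = lc X (\<lambda>_. 1) (\<lambda>x. lc Z (\<lambda>_. 1) (\<lambda>z. lc W (\<lambda>w. \<Sum>y\<in>Y. a y w * b y x z) (B x z)))"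
    using B fin by (intro lc_cong refl arg_cong[where f = "\<lambda>x. _ \<triangleright>\<^bsub>M\<^esub> x"] lc_collapse lc_closed) auto
  finally show ?thesis .
qed

end

lemma bimod_hom_lc2:
  assumes "k_bimodule A \<kappa> M" "k_bimodule A \<kappa> M'" "h \<in> bimod_hom A M M'"
    "\<And>x y. x \<in> X \<Longrightarrow> y \<in> Y \<Longrightarrow> B x y \<in> carrier M"
  shows "h (k_bimodule.lc2 \<kappa> M X Y w B) = k_bimodule.lc2 \<kappa> M' X Y w (\<lambda>x y. h (B x y))"
proof -
  interpret M: k_bimodule A \<kappa> M by fact
  interpret M': k_bimodule A \<kappa> M' by fact
  show ?thesis unfolding M.lc2_def M'.lc2_def using assms(4)
    by (subst bimod_hom_lc[OF assms(1-3)]) (auto intro!: M'.lc_cong simp: bimod_hom_lc[OF assms(1-3)] bimod_homD[OF assms(3)])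
qed

section \<open>The terms of the bimodule resolution and their mapping property\<close>

context resolution_family
begin

abbreviation "E v \<equiv> \<pi> (vertex v)"
abbreviation "arr q \<equiv> \<pi> (f 1 q)"
abbreviation "P n \<equiv> bires Q I N f n"
abbreviation "\<epsilon> n i \<equiv> bires_gen Q I N f n i"
abbreviation "\<delta> n \<equiv> bires_diff Q I N f c n"
abbreviation "\<delta>0 \<equiv> bires_aug Q I N f"
abbreviation "reg \<equiv> regular_bimod \<Lambda>"

lemma E_mult: "u \<in> verts Q \<Longrightarrow> v \<in> verts Q \<Longrightarrow> E u \<otimes>\<^bsub>\<Lambda>\<^esub> E v = (if u = v then E u else \<zero>\<^bsub>\<Lambda>\<^esub>)"
proof -
  assume uv: "u \<in> verts Q" "v \<in> verts Q"
  have "vertex u \<otimes>\<^bsub>R\<^esub> vertex v = (if u = v then vertex u else 0)"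
    by (rule poly_mapping_eqI, simp only: lookup_vertex_mult) (auto simp: vertex_elt_def lookup_single when_def)
  then show ?thesis using \<pi>_mult[OF vertex_closed[OF uv(1)] vertex_closed[OF uv(2)]] by (simp split: if_splits)
qed

lemma pairs: "idempotent_pairs \<Lambda> \<kappa> {..<N n} (\<lambda>i. E (org n i)) (\<lambda>i. E (trm n i))"
  by unfold_locales (auto simp: E_mult simp del: path_algebra_simps)

lemma bires_eq: "P n = idempotent_pairs.D \<Lambda> \<kappa> {..<N n} (\<lambda>i. E (org n i)) (\<lambda>i. E (trm n i))"
  by (simp add: bires_def idempotent_pairs.D_def[OF pairs] bires_summand_def[abs_def] left_proj_def right_proj_def
      idempotent_pairs.LU_def[OF pairs] idempotent_pairs.RV_def[OF pairs])

lemma left_proj_eq: "left_proj Q I (org n i) = idempotent_pairs.LU \<Lambda> (\<lambda>i. E (org n i)) i"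
  and right_proj_eq: "right_proj Q I (trm n i) = idempotent_pairs.RV \<Lambda> (\<lambda>i. E (trm n i)) i"
  by (simp_all add: left_proj_def right_proj_def idempotent_pairs.LU_def[OF pairs] idempotent_pairs.RV_def[OF pairs])

lemma bires_tensor_eq:
  "bires_tensor Q I N f n i a b = idempotent_pairs.ten \<Lambda> \<kappa> {..<N n} (\<lambda>i. E (org n i)) (\<lambda>i. E (trm n i)) i a b"
  by (simp add: bires_tensor_def idempotent_pairs.ten_def[OF pairs] bires_summand_def[abs_def] left_proj_eq right_proj_eq)

lemma bires_gen_eq:
  "\<epsilon> n i = idempotent_pairs.gen \<Lambda> \<kappa> {..<N n} (\<lambda>i. E (org n i)) (\<lambda>i. E (trm n i)) i"
  by (simp add: bires_gen_def bires_tensor_eq idempotent_pairs.gen_def[OF pairs])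

lemma P_bimodule: "k_bimodule \<Lambda> \<kappa> (P n)"
  unfolding bires_eq by (rule idempotent_pairs.k_bimodule_D[OF pairs])

lemma reg_bimodule: "k_bimodule \<Lambda> \<kappa> reg"
  by (rule \<Lambda>.k_bimodule_regular)

sublocale P: k_bimodule \<Lambda> \<kappa> "bires Q I N f n" for n by (rule P_bimodule)
sublocale reg: k_bimodule \<Lambda> \<kappa> "regular_bimod (quot_alg Q I)" by (rule reg_bimodule)

lemma reg_simps [simp]: "carrier reg = carrier \<Lambda>" "\<zero>\<^bsub>reg\<^esub> = \<zero>\<^bsub>\<Lambda>\<^esub>" "x \<oplus>\<^bsub>reg\<^esub> y = x \<oplus>\<^bsub>\<Lambda>\<^esub> y"
  "x \<triangleleft>\<^bsub>reg\<^esub> y = x \<otimes>\<^bsub>\<Lambda>\<^esub> y" "x \<triangleright>\<^bsub>reg\<^esub> y = x \<otimes>\<^bsub>\<Lambda>\<^esub> y"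
  by (simp_all add: regular_bimod_def)

lemma \<epsilon>_closed [simp]: "i < N n \<Longrightarrow> \<epsilon> n i \<in> carrier (P n)"
  unfolding bires_eq bires_gen_eq by (rule idempotent_pairs.gen_closed[OF pairs]) simp

lemma E_closed [simp]: "v \<in> verts Q \<Longrightarrow> E v \<in> carrier \<Lambda>"
  by (intro \<pi>_closed vertex_closed)

lemma arr_closed [simp]: "q < N 1 \<Longrightarrow> arr q \<in> carrier \<Lambda>"
  by (intro \<pi>_closed f_closed)

lemma E_\<epsilon>: "i < N n \<Longrightarrow> E (org n i) \<triangleright>\<^bsub>P n\<^esub> \<epsilon> n i = \<epsilon> n i" and \<epsilon>_E: "i < N n \<Longrightarrow> \<epsilon> n i \<triangleleft>\<^bsub>P n\<^esub> E (trm n i) = \<epsilon> n i"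
  unfolding bires_eq bires_gen_eq by (auto intro: idempotent_pairs.l_gen[OF pairs] idempotent_pairs.gen_r[OF pairs])

lemma P_induct [consumes 1, case_names zero gen add]:
  assumes "x \<in> carrier (P n)" "\<Theta> \<zero>\<^bsub>P n\<^esub>"
    and "\<And>i a b. i < N n \<Longrightarrow> a \<in> carrier \<Lambda> \<Longrightarrow> b \<in> carrier \<Lambda> \<Longrightarrow> \<Theta> (a \<triangleright>\<^bsub>P n\<^esub> (\<epsilon> n i \<triangleleft>\<^bsub>P n\<^esub> b))"
    and "\<And>x y. x \<in> carrier (P n) \<Longrightarrow> y \<in> carrier (P n) \<Longrightarrow> \<Theta> x \<Longrightarrow> \<Theta> y \<Longrightarrow> \<Theta> (x \<oplus>\<^bsub>P n\<^esub> y)"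
  shows "\<Theta> x"
  by (rule idempotent_pairs.gen_induct[OF pairs[of n], folded bires_eq bires_gen_eq, of x \<Theta>]) (use assms in auto)

lemma P_hom_eqI:
  assumes "h \<in> bimod_hom \<Lambda> (P n) M" "h' \<in> bimod_hom \<Lambda> (P n) M" "k_bimodule \<Lambda> \<kappa> M"
    and "\<And>i. i < N n \<Longrightarrow> h (\<epsilon> n i) = h' (\<epsilon> n i)"
  shows "h = h'"
  by (rule idempotent_pairs.hom_eqI[OF pairs[of n], folded bires_eq bires_gen_eq, of h M h']) (use assms in auto)

lemma P_hom_exists:
  fixes M :: "(('v, 'b, 'k) path_comb set, 'm) bimod"
  assumes "k_bimodule \<Lambda> \<kappa> M" "\<And>i. i < N n \<Longrightarrow> m i \<in> carrier M"
    "\<And>i. i < N n \<Longrightarrow> E (org n i) \<triangleright>\<^bsub>M\<^esub> m i = m i" "\<And>i. i < N n \<Longrightarrow> m i \<triangleleft>\<^bsub>M\<^esub> E (trm n i) = m i"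
  obtains h where "h \<in> bimod_hom \<Lambda> (P n) M" "\<And>i. i < N n \<Longrightarrow> h (\<epsilon> n i) = m i"
proof (rule idempotent_pairs.hom_exists[OF pairs[of n], folded bires_eq bires_gen_eq, of M m])
  fix h assume "h \<in> bimod_hom \<Lambda> (P n) M" "\<And>i. i \<in> {..<N n} \<Longrightarrow> h (\<epsilon> n i) = m i"
  then show thesis using that[of h] by simp
qed (use assms in auto)

lemma P_coordinate_exists:
  assumes "\<And>a b. a \<in> carrier \<Lambda> \<Longrightarrow> b \<in> carrier \<Lambda> \<Longrightarrow> \<phi> (a \<oplus>\<^bsub>\<Lambda>\<^esub> b) = \<phi> a + \<phi> b"
    "\<And>a c. a \<in> carrier \<Lambda> \<Longrightarrow> \<phi> (\<kappa> c \<otimes>\<^bsub>\<Lambda>\<^esub> a) = c * \<phi> a" "i < N n"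
  obtains \<Phi> where "\<Phi> \<in> carrier (P n) \<rightarrow> carrier \<Lambda>"
    "\<And>x y. x \<in> carrier (P n) \<Longrightarrow> y \<in> carrier (P n) \<Longrightarrow> \<Phi> (x \<oplus>\<^bsub>P n\<^esub> y) = \<Phi> x \<oplus>\<^bsub>\<Lambda>\<^esub> \<Phi> y"
    "\<And>j a b. j < N n \<Longrightarrow> a \<in> carrier \<Lambda> \<Longrightarrow> b \<in> carrier \<Lambda> \<Longrightarrow>
      \<Phi> (a \<triangleright>\<^bsub>P n\<^esub> (\<epsilon> n j \<triangleleft>\<^bsub>P n\<^esub> b)) =
        (if j = i then \<kappa> (\<phi> (a \<otimes>\<^bsub>\<Lambda>\<^esub> E (org n i))) \<otimes>\<^bsub>\<Lambda>\<^esub> (E (trm n i) \<otimes>\<^bsub>\<Lambda>\<^esub> b) else \<zero>\<^bsub>\<Lambda>\<^esub>)"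
proof (rule idempotent_pairs.coordinate_exists[OF pairs[of n], folded bires_eq bires_gen_eq, of \<phi> i])
  fix \<Phi> assume "\<Phi> \<in> carrier (P n) \<rightarrow> carrier \<Lambda>"
    "\<And>x y. x \<in> carrier (P n) \<Longrightarrow> y \<in> carrier (P n) \<Longrightarrow> \<Phi> (x \<oplus>\<^bsub>P n\<^esub> y) = \<Phi> x \<oplus>\<^bsub>\<Lambda>\<^esub> \<Phi> y"
    "\<And>j a b. j \<in> {..<N n} \<Longrightarrow> a \<in> carrier \<Lambda> \<Longrightarrow> b \<in> carrier \<Lambda> \<Longrightarrow>
      \<Phi> (a \<triangleright>\<^bsub>P n\<^esub> (\<epsilon> n j \<triangleleft>\<^bsub>P n\<^esub> b)) =
        (if j = i then \<kappa> (\<phi> (a \<otimes>\<^bsub>\<Lambda>\<^esub> E (org n i))) \<otimes>\<^bsub>\<Lambda>\<^esub> (E (trm n i) \<otimes>\<^bsub>\<Lambda>\<^esub> b) else \<zero>\<^bsub>\<Lambda>\<^esub>)"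
  then show thesis using that[of \<Phi>] by simp
qed (use assms in auto)

text \<open>Projectivity of \<open>P n\<close>: preimages of the values at the generators are cut
  down by the two vertex idempotents, which does not change their images because the generators are
  fixed by these idempotents.\<close>

lemma P_lift:
  fixes M :: "(('v, 'b, 'k) path_comb set, 'm) bimod" and M' :: "(('v, 'b, 'k) path_comb set, 'n) bimod"
  assumes M: "k_bimodule \<Lambda> \<kappa> M" "k_bimodule \<Lambda> \<kappa> M'"
    and g: "g \<in> bimod_hom \<Lambda> (P n) M'" and d: "d \<in> bimod_hom \<Lambda> M M'"
    and sub: "g ` carrier (P n) \<subseteq> d ` carrier M"
  shows "\<exists>h\<in>bimod_hom \<Lambda> (P n) M. \<forall>x\<in>carrier (P n). d (h x) = g x"
proof -
  interpret M: k_bimodule \<Lambda> \<kappa> M by fact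
  interpret M': k_bimodule \<Lambda> \<kappa> M' by fact
  have "\<exists>y\<in>carrier M. g (\<epsilon> n i) = d y" if "i < N n" for i
    using subsetD[OF sub imageI[OF \<epsilon>_closed[OF that]]] by (simp only: image_iff)
  then obtain y where y: "\<And>i. i < N n \<Longrightarrow> y i \<in> carrier M" "\<And>i. i < N n \<Longrightarrow> g (\<epsilon> n i) = d (y i)" by metis
  let ?m = "\<lambda>i. (E (org n i) \<triangleright>\<^bsub>M\<^esub> y i) \<triangleleft>\<^bsub>M\<^esub> E (trm n i)"
  obtain h where h: "h \<in> bimod_hom \<Lambda> (P n) M" "\<And>i. i < N n \<Longrightarrow> h (\<epsilon> n i) = ?m i"
  proof (rule P_hom_exists[OF M(1), of n ?m])
    fix i assume i: "i < N n"
    note e = E_closed[OF org_verts[OF i]] E_closed[OF trm_verts[OF i]]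
    show "?m i \<in> carrier M" using e y(1)[OF i] by simp
    show "E (org n i) \<triangleright>\<^bsub>M\<^esub> ?m i = ?m i"
      using e y(1)[OF i] i by (simp add: E_mult flip: M.ls_rs M.ls_assoc)
    show "?m i \<triangleleft>\<^bsub>M\<^esub> E (trm n i) = ?m i"
      using e y(1)[OF i] i by (simp add: E_mult flip: M.rs_assoc)
  qed (rule that)
  have eq: "(\<lambda>x\<in>carrier (P n). d (h x)) = g"
  proof (rule P_hom_eqI[OF bimod_hom_compose[OF P_bimodule h(1) d] g M(2)])
    fix i assume i: "i < N n"
    have "d (?m i) = (E (org n i) \<triangleright>\<^bsub>M'\<^esub> g (\<epsilon> n i)) \<triangleleft>\<^bsub>M'\<^esub> E (trm n i)"
      using i y by (simp add: bimod_homD[OF d] del: path_algebra_simps)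
    also have "\<dots> = g ((E (org n i) \<triangleright>\<^bsub>P n\<^esub> \<epsilon> n i) \<triangleleft>\<^bsub>P n\<^esub> E (trm n i))"
      using i by (simp add: bimod_homD[OF g] del: path_algebra_simps)
    finally show "(\<lambda>x\<in>carrier (P n). d (h x)) (\<epsilon> n i) = g (\<epsilon> n i)" using i by (simp add: h E_\<epsilon> \<epsilon>_E)
  qed
  have "d (h x) = g x" if "x \<in> carrier (P n)" for x using fun_cong[OF eq, of x] that by simp
  with h(1) show ?thesis by blast
qed

text \<open>The products \<open>f\<^sup>a\<^sub>p f\<^sup>b\<^sub>s f\<^sup>d\<^sub>u\<close> over composable triples are linearly independent, so only these triples are determined.\<close>

lemma lc2_coassoc:
  fixes M :: "(('v, 'b, 'k) path_comb set, 'm) bimod"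
  assumes M: "k_bimodule \<Lambda> \<kappa> M" and n: "n = a + b + d" "i < N n" and bd: "bd = b + d" "ab = a + b"
    and B: "\<And>p s u. p < N a \<Longrightarrow> s < N b \<Longrightarrow> u < N d \<Longrightarrow> B p s u \<in> carrier M"
    and B0: "\<And>p s u. p < N a \<Longrightarrow> s < N b \<Longrightarrow> u < N d \<Longrightarrow> trm a p \<noteq> org b s \<or> trm b s \<noteq> org d u \<Longrightarrow> B p s u = \<zero>\<^bsub>M\<^esub>"
  shows "k_bimodule.lc2 \<kappa> M {..<N a} {..<N bd} (c n i a) (\<lambda>p q. k_bimodule.lc2 \<kappa> M {..<N b} {..<N d} (c bd q b) (B p)) =
    k_bimodule.lc2 \<kappa> M {..<N ab} {..<N d} (c n i ab) (\<lambda>q u. k_bimodule.lc2 \<kappa> M {..<N a} {..<N b} (c ab q a) (\<lambda>p s. B p s u))"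
proof -
  interpret M: k_bimodule \<Lambda> \<kappa> M by fact
  have "\<kappa> (\<Sum>q<N (b + d). c (a + b + d) i a p q * c (b + d) q b s u) \<triangleright>\<^bsub>M\<^esub> B p s u =
      \<kappa> (\<Sum>q<N (a + b). c (a + b + d) i (a + b) q u * c (a + b) q a p s) \<triangleright>\<^bsub>M\<^esub> B p s u"
    if "p < N a" "s < N b" "u < N d" for p s u
    using coassoc[of i a b d p s u] B0[OF that] that n by (cases "trm a p = org b s \<and> trm b s = org d u") auto
  then show ?thesis unfolding n(1) bd using B
    by (subst M.lc2_nested_left, simp_all, subst M.lc2_nested_right, simp_all)
      (intro M.lc_cong refl arg_cong[where f = "\<lambda>x. _ \<triangleright>\<^bsub>M\<^esub> x"] M.lc_closed, auto)
qed

text \<open>Certifies that a comultiplication sum is an admissible value at a generator: by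
  \<open>comult_support\<close> only terms with the right ends have a nonzero coefficient, except at
  non-composable pairs, where \<open>B0\<close> makes the term itself zero.\<close>

lemma lc2_support:
  fixes M :: "(('v, 'b, 'k) path_comb set, 'm) bimod"
  assumes M: "k_bimodule \<Lambda> \<kappa> M" and n: "n = r + s" "i < N n"
    and B: "\<And>p q. p < N r \<Longrightarrow> q < N s \<Longrightarrow> B p q \<in> carrier M"
    and B0: "\<And>p q. p < N r \<Longrightarrow> q < N s \<Longrightarrow> trm r p \<noteq> org s q \<Longrightarrow> B p q = \<zero>\<^bsub>M\<^esub>"
    and EB: "\<And>p q. p < N r \<Longrightarrow> q < N s \<Longrightarrow> E (org r p) \<triangleright>\<^bsub>M\<^esub> B p q = B p q"
    and BE: "\<And>p q. p < N r \<Longrightarrow> q < N s \<Longrightarrow> B p q \<triangleleft>\<^bsub>M\<^esub> E (trm s q) = B p q"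
  shows "E (org n i) \<triangleright>\<^bsub>M\<^esub> k_bimodule.lc2 \<kappa> M {..<N r} {..<N s} (c n i r) B = k_bimodule.lc2 \<kappa> M {..<N r} {..<N s} (c n i r) B"
    "k_bimodule.lc2 \<kappa> M {..<N r} {..<N s} (c n i r) B \<triangleleft>\<^bsub>M\<^esub> E (trm n i) = k_bimodule.lc2 \<kappa> M {..<N r} {..<N s} (c n i r) B"
proof -
  interpret M: k_bimodule \<Lambda> \<kappa> M by fact
  note e = E_closed[OF org_verts[OF n(2)]] E_closed[OF trm_verts[OF n(2)]]
  have supp: "c n i r p q = 0 \<or> B p q = \<zero>\<^bsub>M\<^esub> \<or> org r p = org n i \<and> trm s q = trm n i" if "p < N r" "q < N s" for p q
    using comult_support[of i n r p q] B0[OF that] that n by auto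
  have k: "\<kappa> (c n i r p q) \<triangleright>\<^bsub>M\<^esub> (E (org n i) \<triangleright>\<^bsub>M\<^esub> B p q) = \<kappa> (c n i r p q) \<triangleright>\<^bsub>M\<^esub> B p q"
    "\<kappa> (c n i r p q) \<triangleright>\<^bsub>M\<^esub> (B p q \<triangleleft>\<^bsub>M\<^esub> E (trm n i)) = \<kappa> (c n i r p q) \<triangleright>\<^bsub>M\<^esub> B p q" if "p < N r" "q < N s" for p q
    using supp[OF that] EB[OF that] BE[OF that] B[OF that] e by auto
  have "E (org n i) \<triangleright>\<^bsub>M\<^esub> M.lc2 {..<N r} {..<N s} (c n i r) B = M.lc2 {..<N r} {..<N s} (c n i r) (\<lambda>p q. E (org n i) \<triangleright>\<^bsub>M\<^esub> B p q)"
    by (rule M.lc2_ls[OF e(1)]) (use B in auto)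
  also have "\<dots> = M.lc2 {..<N r} {..<N s} (c n i r) B"
    by (rule M.lc2_cong[OF refl refl]) (use B k in auto)
  finally show "E (org n i) \<triangleright>\<^bsub>M\<^esub> M.lc2 {..<N r} {..<N s} (c n i r) B = M.lc2 {..<N r} {..<N s} (c n i r) B" .
  have "M.lc2 {..<N r} {..<N s} (c n i r) B \<triangleleft>\<^bsub>M\<^esub> E (trm n i) = M.lc2 {..<N r} {..<N s} (c n i r) (\<lambda>p q. B p q \<triangleleft>\<^bsub>M\<^esub> E (trm n i))"
    by (rule M.lc2_rs[OF e(2)]) (use B in auto)
  also have "\<dots> = M.lc2 {..<N r} {..<N s} (c n i r) B"
    by (rule M.lc2_cong[OF refl refl]) (use B k in auto)
  finally show "M.lc2 {..<N r} {..<N s} (c n i r) B \<triangleleft>\<^bsub>M\<^esub> E (trm n i) = M.lc2 {..<N r} {..<N s} (c n i r) B" .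
qed

lemma E_arr: "q < N 1 \<Longrightarrow> v \<in> verts Q \<Longrightarrow> E v \<otimes>\<^bsub>\<Lambda>\<^esub> arr q = (if v = org 1 q then arr q else \<zero>\<^bsub>\<Lambda>\<^esub>)"
  and arr_E: "q < N 1 \<Longrightarrow> v \<in> verts Q \<Longrightarrow> arr q \<otimes>\<^bsub>\<Lambda>\<^esub> E v = (if v = trm 1 q then arr q else \<zero>\<^bsub>\<Lambda>\<^esub>)"
  using \<pi>_mult[OF vertex_closed f_closed, of v q 1] \<pi>_mult[OF f_closed vertex_closed, of q 1 v]
  by (auto simp: vertex_f f_vertex simp del: path_algebra_simps)

text \<open>The generator equals its origin vertex times itself, so only the part of
  \<open>a\<close> ending at that vertex acts on it.\<close>

lemma ls_\<epsilon>_zero: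
  assumes "a \<in> carrier \<Lambda>" "a \<otimes>\<^bsub>\<Lambda>\<^esub> E (org n j) = \<zero>\<^bsub>\<Lambda>\<^esub>" "j < N n"
  shows "a \<triangleright>\<^bsub>P n\<^esub> \<epsilon> n j = \<zero>\<^bsub>P n\<^esub>"
  using P.ls_assoc[of "\<epsilon> n j" n a "E (org n j)"] assms E_closed[OF org_verts[OF assms(3)]] by (simp add: E_\<epsilon>)

lemma \<epsilon>_rs_zero:
  assumes "a \<in> carrier \<Lambda>" "E (trm n j) \<otimes>\<^bsub>\<Lambda>\<^esub> a = \<zero>\<^bsub>\<Lambda>\<^esub>" "j < N n"
  shows "\<epsilon> n j \<triangleleft>\<^bsub>P n\<^esub> a = \<zero>\<^bsub>P n\<^esub>"
  using P.rs_assoc[of "\<epsilon> n j" n "E (trm n j)" a] assms E_closed[OF trm_verts[OF assms(3)]] by (simp add: \<epsilon>_E)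

lemma arr_\<epsilon>_zero: "q < N 1 \<Longrightarrow> j < N n \<Longrightarrow> trm 1 q \<noteq> org n j \<Longrightarrow> arr q \<triangleright>\<^bsub>P n\<^esub> \<epsilon> n j = \<zero>\<^bsub>P n\<^esub>"
  by (rule ls_\<epsilon>_zero) (auto simp: arr_E simp del: One_nat_def)

lemma \<epsilon>_arr_zero: "q < N 1 \<Longrightarrow> j < N n \<Longrightarrow> trm n j \<noteq> org 1 q \<Longrightarrow> \<epsilon> n j \<triangleleft>\<^bsub>P n\<^esub> arr q = \<zero>\<^bsub>P n\<^esub>"
  by (rule \<epsilon>_rs_zero) (auto simp: E_arr simp del: One_nat_def)

text \<open>\<open>dl\<close> and \<open>dr\<close> are the halves of the differential that multiply
  by arrows from the left and from the right. They are kept apart because each squares to zero by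
  itself and because they affect the degree of the left factor differently.\<close>

definition dl :: "nat \<Rightarrow> nat \<Rightarrow> ('v, 'b, 'k) res_elt" where
  "dl n i = P.lc2 n {..<N 1} {..<N n} (c (Suc n) i 1) (\<lambda>p j. arr p \<triangleright>\<^bsub>P n\<^esub> \<epsilon> n j)"

definition dr :: "nat \<Rightarrow> nat \<Rightarrow> ('v, 'b, 'k) res_elt" where
  "dr n i = P.lc2 n {..<N n} {..<N 1} (c (Suc n) i n) (\<lambda>j q. \<epsilon> n j \<triangleleft>\<^bsub>P n\<^esub> arr q)"

lemma dl_closed [simp]: "dl n i \<in> carrier (P n)" and dr_closed [simp]: "dr n i \<in> carrier (P n)"
  unfolding dl_def dr_def by (auto simp del: One_nat_def intro!: P.lc2_closed)

lemma dl_E: "i < N (Suc n) \<Longrightarrow> E (org (Suc n) i) \<triangleright>\<^bsub>P n\<^esub> dl n i = dl n i" "i < N (Suc n) \<Longrightarrow> dl n i \<triangleleft>\<^bsub>P n\<^esub> E (trm (Suc n) i) = dl n i"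
  unfolding dl_def
  by (rule lc2_support[OF P_bimodule], simp_all add: arr_\<epsilon>_zero P.ls_rs \<epsilon>_E E_arr flip: P.ls_assoc del: One_nat_def; fail)+

lemma dr_E: "i < N (Suc n) \<Longrightarrow> E (org (Suc n) i) \<triangleright>\<^bsub>P n\<^esub> dr n i = dr n i" "i < N (Suc n) \<Longrightarrow> dr n i \<triangleleft>\<^bsub>P n\<^esub> E (trm (Suc n) i) = dr n i"
  unfolding dr_def
  by (rule lc2_support[OF P_bimodule], simp_all add: \<epsilon>_arr_zero E_\<epsilon> arr_E flip: P.ls_rs P.rs_assoc del: One_nat_def; fail)+

text \<open>Indexed by the target: it is the value of \<open>\<delta> (Suc n)\<close> at a
  generator, hence the exponent \<open>Suc n\<close> of the sign.\<close>

definition d :: "nat \<Rightarrow> nat \<Rightarrow> ('v, 'b, 'k) res_elt" where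
  "d n i = dl n i \<oplus>\<^bsub>P n\<^esub> \<kappa> ((- 1) ^ Suc n) \<triangleright>\<^bsub>P n\<^esub> dr n i"

lemma d_closed [simp]: "d n i \<in> carrier (P n)"
  by (simp add: d_def)

text \<open>The definition of the resolution groups both halves by the index \<open>j\<close> of the
  target generator; exchanging the sums separates them.\<close>

lemma d_eq:
  "d n i = (\<Oplus>\<^bsub>P n\<^esub>j\<in>{..<N n}.
      (\<Oplus>\<^bsub>P n\<^esub>p\<in>{..<N 1}. \<kappa> (c (Suc n) i 1 p j) \<triangleright>\<^bsub>P n\<^esub> (arr p \<triangleright>\<^bsub>P n\<^esub> \<epsilon> n j))
      \<oplus>\<^bsub>P n\<^esub> \<kappa> ((- 1) ^ Suc n) \<triangleright>\<^bsub>P n\<^esub>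
        (\<Oplus>\<^bsub>P n\<^esub>q\<in>{..<N 1}. \<kappa> (c (Suc n) i n j q) \<triangleright>\<^bsub>P n\<^esub> (\<epsilon> n j \<triangleleft>\<^bsub>P n\<^esub> arr q)))" (is "_ = finsum _ ?g _")
proof -
  let ?L = "\<lambda>j. P.lc n {..<N 1} (\<lambda>p. c (Suc n) i 1 p j) (\<lambda>p. arr p \<triangleright>\<^bsub>P n\<^esub> \<epsilon> n j)"
  let ?R = "\<lambda>j. P.lc n {..<N 1} (c (Suc n) i n j) (\<lambda>q. \<epsilon> n j \<triangleleft>\<^bsub>P n\<^esub> arr q)"
  have LR: "?L j \<in> carrier (P n)" "?R j \<in> carrier (P n)" if "j < N n" for j
    using that by (auto simp del: One_nat_def intro!: P.lc_closed)
  have "finsum (P n) ?g {..<N n} = P.lc n {..<N n} (\<lambda>_. 1) (\<lambda>j. ?L j \<oplus>\<^bsub>P n\<^esub> \<kappa> ((- 1) ^ Suc n) \<triangleright>\<^bsub>P n\<^esub> ?R j)"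
    unfolding P.lc_def[of n "{..<N n}"] using LR by (intro P.M.finsum_cong') (auto simp: P.lc_def simp del: One_nat_def)
  also have "\<dots> = P.lc n {..<N n} (\<lambda>_. 1) ?L \<oplus>\<^bsub>P n\<^esub> P.lc n {..<N n} (\<lambda>_. 1) (\<lambda>j. \<kappa> ((- 1) ^ Suc n) \<triangleright>\<^bsub>P n\<^esub> ?R j)"
    using LR by (intro P.lc_add) auto
  also have "P.lc n {..<N n} (\<lambda>_. 1) ?L = dl n i"
    unfolding dl_def P.lc2_def by (rule P.lc_swap[symmetric]) (auto simp del: One_nat_def)
  also have "P.lc n {..<N n} (\<lambda>_. 1) (\<lambda>j. \<kappa> ((- 1) ^ Suc n) \<triangleright>\<^bsub>P n\<^esub> ?R j) = \<kappa> ((- 1) ^ Suc n) \<triangleright>\<^bsub>P n\<^esub> dr n i"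
    unfolding dr_def P.lc2_def using LR by (subst P.lc_ls) auto
  finally show ?thesis by (simp only: d_def)
qed

lemma d_E:
  assumes "i < N (Suc n)"
  shows "E (org (Suc n) i) \<triangleright>\<^bsub>P n\<^esub> d n i = d n i" "d n i \<triangleleft>\<^bsub>P n\<^esub> E (trm (Suc n) i) = d n i"
  unfolding d_def using assms
  by (simp_all add: P.ls_add P.add_rs P.\<kappa>_ls_comm P.ls_rs dl_E dr_E del: power_Suc)

text \<open>The definite description denotes because the prescribed values are fixed by the
  idempotents of their generators, and a homomorphism is determined by its values there.\<close>

lemma \<delta>_hom: "\<delta> (Suc n) \<in> bimod_hom \<Lambda> (P (Suc n)) (P n)"
  and \<delta>_\<epsilon>: "i < N (Suc n) \<Longrightarrow> \<delta> (Suc n) (\<epsilon> (Suc n) i) = d n i"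
proof -
  obtain h where h: "h \<in> bimod_hom \<Lambda> (P (Suc n)) (P n)" "\<And>i. i < N (Suc n) \<Longrightarrow> h (\<epsilon> (Suc n) i) = d n i"
    using P_hom_exists[OF P_bimodule, of "Suc n" "d n" n] d_E by auto
  have "\<delta> (Suc n) = (THE h. h \<in> bimod_hom \<Lambda> (P (Suc n)) (P n) \<and> (\<forall>i<N (Suc n). h (\<epsilon> (Suc n) i) = d n i))"
    unfolding bires_diff_def Let_def d_eq by (simp only: diff_Suc_1)
  also have "\<dots> = h"
  proof (rule the_equality)
    show "h' = h" if "h' \<in> bimod_hom \<Lambda> (P (Suc n)) (P n) \<and> (\<forall>i<N (Suc n). h' (\<epsilon> (Suc n) i) = d n i)" for h'
      using that h by (intro P_hom_eqI[OF _ h(1) P_bimodule]) auto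
  qed (use h in auto)
  finally show "\<delta> (Suc n) \<in> bimod_hom \<Lambda> (P (Suc n)) (P n)" "i < N (Suc n) \<Longrightarrow> \<delta> (Suc n) (\<epsilon> (Suc n) i) = d n i"
    using h by auto
qed

end

lemma (in k_algebra) lc_regular:
  assumes "\<And>x. x \<in> X \<Longrightarrow> B x \<in> carrier A"
  shows "k_bimodule.lc \<kappa> (regular_bimod A) X w B = (\<Oplus>x\<in>X. \<kappa> (w x) \<otimes> B x)"
proof -
  have "(\<Oplus>x\<in>X. \<kappa> (w x) \<otimes> B x) = finsum (regular_bimod A) (\<lambda>x. \<kappa> (w x) \<otimes> B x) X"
    using assms k_bimodule_regular
    by (intro additive_map_finsum[where h = "\<lambda>x. x"])
      (auto simp: abelian_group_axioms k_bimodule_def regular_bimod_def)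
  then show ?thesis
    by (simp add: k_bimodule.lc_def[OF k_bimodule_regular]) (simp add: regular_bimod_def)
qed

context k_bimodule
begin

abbreviation "lc_reg \<equiv> k_bimodule.lc \<kappa> (regular_bimod A)"
abbreviation "lc2_reg \<equiv> k_bimodule.lc2 \<kappa> (regular_bimod A)"

lemma lc_reg_ls:
  assumes "\<And>x. x \<in> X \<Longrightarrow> B x \<in> carrier A" "m \<in> carrier M"
  shows "lc_reg X w B \<triangleright>\<^bsub>M\<^esub> m = lc X w (\<lambda>x. B x \<triangleright>\<^bsub>M\<^esub> m)"
proof -
  have "lc_reg X w B = (\<Oplus>x\<in>X. \<kappa> (w x) \<otimes> B x)"
    using assms(1) by (rule lc_regular)
  also have "\<dots> \<triangleright>\<^bsub>M\<^esub> m = (\<Oplus>\<^bsub>M\<^esub>x\<in>X. (\<kappa> (w x) \<otimes> B x) \<triangleright>\<^bsub>M\<^esub> m)"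
    using assms by (intro additive_map_finsum[where h = "\<lambda>a. a \<triangleright>\<^bsub>M\<^esub> m"])
      (auto simp: add_ls abelian_group_axioms M.abelian_group_axioms)
  also have "\<dots> = lc X w (\<lambda>x. B x \<triangleright>\<^bsub>M\<^esub> m)"
    unfolding lc_def using assms by (intro M.finsum_cong') (auto simp: ls_assoc)
  finally show ?thesis .
qed

lemma rs_lc_reg:
  assumes "\<And>x. x \<in> X \<Longrightarrow> B x \<in> carrier A" "m \<in> carrier M"
  shows "m \<triangleleft>\<^bsub>M\<^esub> lc_reg X w B = lc X w (\<lambda>x. m \<triangleleft>\<^bsub>M\<^esub> B x)"
proof -
  have "lc_reg X w B = (\<Oplus>x\<in>X. \<kappa> (w x) \<otimes> B x)"
    using assms(1) by (rule lc_regular)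
  also have "m \<triangleleft>\<^bsub>M\<^esub> \<dots> = (\<Oplus>\<^bsub>M\<^esub>x\<in>X. m \<triangleleft>\<^bsub>M\<^esub> (\<kappa> (w x) \<otimes> B x))"
    using assms by (intro additive_map_finsum[where h = "\<lambda>a. m \<triangleleft>\<^bsub>M\<^esub> a"])
      (auto simp: rs_add abelian_group_axioms M.abelian_group_axioms)
  also have "\<dots> = lc X w (\<lambda>x. m \<triangleleft>\<^bsub>M\<^esub> B x)"
    unfolding lc_def using assms by (intro M.finsum_cong') (auto simp: rs_assoc ls_rs simp flip: \<kappa>_central)
  finally show ?thesis .
qed

lemma lc2_cong_eq:
  "(\<And>x y. x \<in> X \<Longrightarrow> y \<in> Y \<Longrightarrow> B' x y \<in> carrier M) \<Longrightarrow> (\<And>x y. x \<in> X \<Longrightarrow> y \<in> Y \<Longrightarrow> B x y = B' x y) \<Longrightarrow>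
   lc2 X Y w B = lc2 X Y w B'"
  by (rule lc2_cong) auto

lemma lc_reg_closed: "(\<And>x. x \<in> X \<Longrightarrow> B x \<in> carrier A) \<Longrightarrow> lc_reg X w B \<in> carrier A"
  using k_bimodule.lc_closed[OF k_bimodule_regular, of X B w] by (simp add: regular_bimod_def)

lemma lc2_reg_ls:
  assumes "\<And>x y. x \<in> X \<Longrightarrow> y \<in> Y \<Longrightarrow> B x y \<in> carrier A" "m \<in> carrier M"
  shows "lc2_reg X Y w B \<triangleright>\<^bsub>M\<^esub> m = lc2 X Y w (\<lambda>x y. B x y \<triangleright>\<^bsub>M\<^esub> m)"
  unfolding lc2_def k_bimodule.lc2_def[OF k_bimodule_regular] using assms
  by (subst lc_reg_ls) (auto intro!: lc_reg_closed lc_cong simp: lc_reg_ls)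

lemma rs_lc2_reg:
  assumes "\<And>x y. x \<in> X \<Longrightarrow> y \<in> Y \<Longrightarrow> B x y \<in> carrier A" "m \<in> carrier M"
  shows "m \<triangleleft>\<^bsub>M\<^esub> lc2_reg X Y w B = lc2 X Y w (\<lambda>x y. m \<triangleleft>\<^bsub>M\<^esub> B x y)"
  unfolding lc2_def k_bimodule.lc2_def[OF k_bimodule_regular] using assms
  by (subst rs_lc_reg) (auto intro!: lc_reg_closed lc_cong simp: rs_lc_reg)

end

section \<open>The differential squares to zero; the augmentation\<close>

context resolution_family
begin

lemma \<pi>_f:
  assumes "n = r + s" "i < N n"
  shows "reg.lc2 {..<N r} {..<N s} (c n i r) (\<lambda>p q. \<pi> (f r p) \<otimes>\<^bsub>\<Lambda>\<^esub> \<pi> (f s q)) = \<pi> (f n i)"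
proof -
  let ?g = "\<lambda>p q. pm_scale (c n i r p q) (f r p \<otimes>\<^bsub>R\<^esub> f s q)"
  have g: "?g p q \<in> carrier R" "\<pi> (?g p q) = \<kappa> (c n i r p q) \<otimes>\<^bsub>\<Lambda>\<^esub> (\<pi> (f r p) \<otimes>\<^bsub>\<Lambda>\<^esub> \<pi> (f s q))" "(\<Sum>q<N s. ?g p q) \<in> carrier R"
    if "p < N r" "q < N s" for p q
    using that by (auto simp: \<pi>_mult \<kappa>_\<pi>[symmetric] simp del: path_algebra_simps intro!: closed)
  have g': "(\<Sum>q<N s. ?g p q) \<in> carrier R" if "p < N r" for p
    using that by (intro closed) auto
  have inner: "reg.lc {..<N s} (c n i r p) (\<lambda>q. \<pi> (f r p) \<otimes>\<^bsub>\<Lambda>\<^esub> \<pi> (f s q)) = \<pi> (\<Sum>q<N s. ?g p q)" if p: "p < N r" for p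
  proof -
    have "reg.lc {..<N s} (c n i r p) (\<lambda>q. \<pi> (f r p) \<otimes>\<^bsub>\<Lambda>\<^esub> \<pi> (f s q)) =
        (\<Oplus>\<^bsub>\<Lambda>\<^esub>q\<in>{..<N s}. \<kappa> (c n i r p q) \<otimes>\<^bsub>\<Lambda>\<^esub> (\<pi> (f r p) \<otimes>\<^bsub>\<Lambda>\<^esub> \<pi> (f s q)))"
      by (rule \<Lambda>.lc_regular) (use p in \<open>simp del: path_algebra_simps\<close>)
    also have "\<dots> = (\<Oplus>\<^bsub>\<Lambda>\<^esub>q\<in>{..<N s}. \<pi> (?g p q))"
      by (rule \<Lambda>.finsum_cong') (use p g in \<open>simp_all del: path_algebra_simps\<close>)
    also have "\<dots> = \<pi> (\<Sum>q<N s. ?g p q)"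
      by (rule \<pi>_sum[symmetric]) (use p g in \<open>simp del: path_algebra_simps\<close>)
    finally show ?thesis .
  qed
  have "f n i = (\<Sum>p<N r. \<Sum>q<N s. ?g p q)"
    using comult_eq[OF assms(2), of r] assms(1) by simp
  then have "\<pi> (f n i) = \<pi> (\<Sum>p<N r. \<Sum>q<N s. ?g p q)" by (rule arg_cong)
  also have "\<dots> = (\<Oplus>\<^bsub>\<Lambda>\<^esub>p\<in>{..<N r}. \<pi> (\<Sum>q<N s. ?g p q))"
    by (rule \<pi>_sum) (use g' in \<open>simp del: path_algebra_simps\<close>)
  also have "\<dots> = reg.lc2 {..<N r} {..<N s} (c n i r) (\<lambda>p q. \<pi> (f r p) \<otimes>\<^bsub>\<Lambda>\<^esub> \<pi> (f s q))"
  proof -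
    have "reg.lc2 {..<N r} {..<N s} (c n i r) (\<lambda>p q. \<pi> (f r p) \<otimes>\<^bsub>\<Lambda>\<^esub> \<pi> (f s q)) =
        (\<Oplus>\<^bsub>\<Lambda>\<^esub>p\<in>{..<N r}. \<kappa> 1 \<otimes>\<^bsub>\<Lambda>\<^esub> reg.lc {..<N s} (c n i r p) (\<lambda>q. \<pi> (f r p) \<otimes>\<^bsub>\<Lambda>\<^esub> \<pi> (f s q)))"
      unfolding reg.lc2_def by (rule \<Lambda>.lc_regular) (use g' inner in \<open>simp del: path_algebra_simps\<close>)
    also have "\<dots> = (\<Oplus>\<^bsub>\<Lambda>\<^esub>p\<in>{..<N r}. \<pi> (\<Sum>q<N s. ?g p q))"
      by (rule \<Lambda>.finsum_cong') (use g' inner in \<open>simp_all del: path_algebra_simps\<close>)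
    finally show ?thesis by (rule sym)
  qed
  finally show ?thesis by (rule sym)
qed

lemma f_2: "q < N 2 \<Longrightarrow> \<pi> (f 2 q) = \<zero>\<^bsub>\<Lambda>\<^esub>"
proof -
  assume q: "q < N 2"
  have "Idl\<^bsub>R\<^esub> (f 2 ` {..<N 2}) = I" using resolution_conjs by (elim conjE)
  moreover have "f 2 ` {..<N 2} \<subseteq> Idl\<^bsub>R\<^esub> (f 2 ` {..<N 2})"
    by (rule I.genideal_self) (use f_closed in \<open>auto simp del: path_algebra_simps\<close>)
  ultimately have "f 2 q \<in> I" using q by auto
  then show ?thesis using \<pi>_zero_iff[OF f_closed[OF q]] by blast
qed

text \<open>This is the quadratic relation \<open>f 2 q\<close>, expanded into arrows and read in
  the quotient.\<close>

lemma arr_arr: "q < N 2 \<Longrightarrow> reg.lc2 {..<N 1} {..<N 1} (c 2 q 1) (\<lambda>p s. arr p \<otimes>\<^bsub>\<Lambda>\<^esub> arr s) = \<zero>\<^bsub>\<Lambda>\<^esub>"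
  by (subst \<pi>_f) (auto simp: f_2 simp del: One_nat_def)

lemma arr_arr_zero:
  assumes "p < N 1" "s < N 1" "trm 1 p \<noteq> org 1 s"
  shows "arr p \<otimes>\<^bsub>\<Lambda>\<^esub> arr s = \<zero>\<^bsub>\<Lambda>\<^esub>"
  using \<Lambda>.m_assoc[of "arr p" "E (trm 1 p)" "arr s"] assms
  by (simp add: arr_E E_arr del: One_nat_def path_algebra_simps)

text \<open>Coassociativity for \<open>1 + 1 + n\<close> regroups two successive arrows into an
  element \<open>f 2 q\<close>, which is a relation.\<close>

lemma left_left_zero:
  assumes i: "i < N (Suc (Suc n))"
  shows "P.lc2 n {..<N 1} {..<N (Suc n)} (c (Suc (Suc n)) i 1) (\<lambda>p j. arr p \<triangleright>\<^bsub>P n\<^esub> dl n j) = \<zero>\<^bsub>P n\<^esub>"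
proof -
  have "P.lc2 n {..<N 1} {..<N (Suc n)} (c (Suc (Suc n)) i 1) (\<lambda>p j. arr p \<triangleright>\<^bsub>P n\<^esub> dl n j) =
      P.lc2 n {..<N 1} {..<N (Suc n)} (c (Suc (Suc n)) i 1)
        (\<lambda>p j. P.lc2 n {..<N 1} {..<N n} (c (Suc n) j 1) (\<lambda>s u. arr p \<triangleright>\<^bsub>P n\<^esub> (arr s \<triangleright>\<^bsub>P n\<^esub> \<epsilon> n u)))"
    unfolding dl_def by (rule P.lc2_cong_eq) (auto intro!: P.lc2_ls P.lc2_closed simp del: One_nat_def)
  also have "\<dots> = P.lc2 n {..<N 2} {..<N n} (c (Suc (Suc n)) i 2)
        (\<lambda>q u. P.lc2 n {..<N 1} {..<N 1} (c 2 q 1) (\<lambda>p s. arr p \<triangleright>\<^bsub>P n\<^esub> (arr s \<triangleright>\<^bsub>P n\<^esub> \<epsilon> n u)))"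
  proof (rule lc2_coassoc[OF P_bimodule])
    fix p s u assume *: "p < N 1" "s < N 1" "u < N n" and "trm 1 p \<noteq> org 1 s \<or> trm 1 s \<noteq> org n u"
    then have "arr p \<otimes>\<^bsub>\<Lambda>\<^esub> arr s = \<zero>\<^bsub>\<Lambda>\<^esub> \<or> arr s \<triangleright>\<^bsub>P n\<^esub> \<epsilon> n u = \<zero>\<^bsub>P n\<^esub>"
      using arr_arr_zero[OF *(1,2)] arr_\<epsilon>_zero[OF *(2,3)] by blast
    then show "arr p \<triangleright>\<^bsub>P n\<^esub> (arr s \<triangleright>\<^bsub>P n\<^esub> \<epsilon> n u) = \<zero>\<^bsub>P n\<^esub>"
      using * P.ls_assoc[of "\<epsilon> n u" n "arr p" "arr s"] by (auto simp del: One_nat_def)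
  qed (use i in \<open>auto simp del: One_nat_def\<close>)
  also have "\<dots> = \<zero>\<^bsub>P n\<^esub>"
  proof (rule P.lc2_zero)
    fix q u assume q: "q \<in> {..<N 2}" and u: "u \<in> {..<N n}"
    have "P.lc2 n {..<N 1} {..<N 1} (c 2 q 1) (\<lambda>p s. arr p \<triangleright>\<^bsub>P n\<^esub> (arr s \<triangleright>\<^bsub>P n\<^esub> \<epsilon> n u)) =
        P.lc2 n {..<N 1} {..<N 1} (c 2 q 1) (\<lambda>p s. (arr p \<otimes>\<^bsub>\<Lambda>\<^esub> arr s) \<triangleright>\<^bsub>P n\<^esub> \<epsilon> n u)"
      using u by (intro P.lc2_cong_eq) (auto simp: P.ls_assoc simp del: One_nat_def)
    also have "\<dots> = reg.lc2 {..<N 1} {..<N 1} (c 2 q 1) (\<lambda>p s. arr p \<otimes>\<^bsub>\<Lambda>\<^esub> arr s) \<triangleright>\<^bsub>P n\<^esub> \<epsilon> n u"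
      using u by (subst P.lc2_reg_ls) (auto simp del: One_nat_def)
    finally show "\<kappa> (c (Suc (Suc n)) i 2 q u) \<triangleright>\<^bsub>P n\<^esub> P.lc2 n {..<N 1} {..<N 1} (c 2 q 1) (\<lambda>p s. arr p \<triangleright>\<^bsub>P n\<^esub> (arr s \<triangleright>\<^bsub>P n\<^esub> \<epsilon> n u)) = \<zero>\<^bsub>P n\<^esub>"
      using q u arr_arr[of q] by simp
  qed
  finally show ?thesis .
qed

lemma right_right_zero:
  assumes i: "i < N (Suc (Suc n))"
  shows "P.lc2 n {..<N (Suc n)} {..<N 1} (c (Suc (Suc n)) i (Suc n)) (\<lambda>j q. dr n j \<triangleleft>\<^bsub>P n\<^esub> arr q) = \<zero>\<^bsub>P n\<^esub>"
proof -
  have "P.lc2 n {..<N (Suc n)} {..<N 1} (c (Suc (Suc n)) i (Suc n)) (\<lambda>j q. dr n j \<triangleleft>\<^bsub>P n\<^esub> arr q) =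
      P.lc2 n {..<N (Suc n)} {..<N 1} (c (Suc (Suc n)) i (Suc n))
        (\<lambda>j q. P.lc2 n {..<N n} {..<N 1} (c (Suc n) j n) (\<lambda>u s. (\<epsilon> n u \<triangleleft>\<^bsub>P n\<^esub> arr s) \<triangleleft>\<^bsub>P n\<^esub> arr q))"
    unfolding dr_def by (rule P.lc2_cong_eq) (auto intro!: P.lc2_rs P.lc2_closed simp del: One_nat_def)
  also have "\<dots> = P.lc2 n {..<N n} {..<N 2} (c (Suc (Suc n)) i n)
        (\<lambda>u q. P.lc2 n {..<N 1} {..<N 1} (c 2 q 1) (\<lambda>s t. (\<epsilon> n u \<triangleleft>\<^bsub>P n\<^esub> arr s) \<triangleleft>\<^bsub>P n\<^esub> arr t))"
  proof (rule lc2_coassoc[OF P_bimodule, symmetric])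
    fix u s t assume *: "u < N n" "s < N 1" "t < N 1" and "trm n u \<noteq> org 1 s \<or> trm 1 s \<noteq> org 1 t"
    then have "arr s \<otimes>\<^bsub>\<Lambda>\<^esub> arr t = \<zero>\<^bsub>\<Lambda>\<^esub> \<or> \<epsilon> n u \<triangleleft>\<^bsub>P n\<^esub> arr s = \<zero>\<^bsub>P n\<^esub>"
      using arr_arr_zero[OF *(2,3)] \<epsilon>_arr_zero[OF *(2,1)] by blast
    then show "(\<epsilon> n u \<triangleleft>\<^bsub>P n\<^esub> arr s) \<triangleleft>\<^bsub>P n\<^esub> arr t = \<zero>\<^bsub>P n\<^esub>"
      using * P.rs_assoc[of "\<epsilon> n u" n "arr s" "arr t"] by (auto simp del: One_nat_def)
  qed (use i in \<open>auto simp del: One_nat_def\<close>)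
  also have "\<dots> = \<zero>\<^bsub>P n\<^esub>"
  proof (rule P.lc2_zero)
    fix u q assume q: "q \<in> {..<N 2}" and u: "u \<in> {..<N n}"
    have "P.lc2 n {..<N 1} {..<N 1} (c 2 q 1) (\<lambda>s t. (\<epsilon> n u \<triangleleft>\<^bsub>P n\<^esub> arr s) \<triangleleft>\<^bsub>P n\<^esub> arr t) =
        P.lc2 n {..<N 1} {..<N 1} (c 2 q 1) (\<lambda>s t. \<epsilon> n u \<triangleleft>\<^bsub>P n\<^esub> (arr s \<otimes>\<^bsub>\<Lambda>\<^esub> arr t))"
      using u by (intro P.lc2_cong_eq) (auto simp: P.rs_assoc simp del: One_nat_def)
    also have "\<dots> = \<epsilon> n u \<triangleleft>\<^bsub>P n\<^esub> reg.lc2 {..<N 1} {..<N 1} (c 2 q 1) (\<lambda>s t. arr s \<otimes>\<^bsub>\<Lambda>\<^esub> arr t)"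
      using u by (subst P.rs_lc2_reg) (auto simp del: One_nat_def)
    finally show "\<kappa> (c (Suc (Suc n)) i n u q) \<triangleright>\<^bsub>P n\<^esub> P.lc2 n {..<N 1} {..<N 1} (c 2 q 1) (\<lambda>s t. (\<epsilon> n u \<triangleleft>\<^bsub>P n\<^esub> arr s) \<triangleleft>\<^bsub>P n\<^esub> arr t) = \<zero>\<^bsub>P n\<^esub>"
      using q u arr_arr[of q] by simp
  qed
  finally show ?thesis .
qed

text \<open>Both sides are the sum for the splitting \<open>1 + n + 1\<close>, bracketed
  differently; the two actions of the algebra commute.\<close>

lemma left_right_commute:
  assumes i: "i < N (Suc (Suc n))"
  shows "P.lc2 n {..<N 1} {..<N (Suc n)} (c (Suc (Suc n)) i 1) (\<lambda>p j. arr p \<triangleright>\<^bsub>P n\<^esub> dr n j) =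
    P.lc2 n {..<N (Suc n)} {..<N 1} (c (Suc (Suc n)) i (Suc n)) (\<lambda>j q. dl n j \<triangleleft>\<^bsub>P n\<^esub> arr q)"
proof -
  have "P.lc2 n {..<N 1} {..<N (Suc n)} (c (Suc (Suc n)) i 1) (\<lambda>p j. arr p \<triangleright>\<^bsub>P n\<^esub> dr n j) =
      P.lc2 n {..<N 1} {..<N (Suc n)} (c (Suc (Suc n)) i 1)
        (\<lambda>p j. P.lc2 n {..<N n} {..<N 1} (c (Suc n) j n) (\<lambda>s u. arr p \<triangleright>\<^bsub>P n\<^esub> (\<epsilon> n s \<triangleleft>\<^bsub>P n\<^esub> arr u)))"
    unfolding dr_def by (rule P.lc2_cong_eq) (auto intro!: P.lc2_ls P.lc2_closed simp del: One_nat_def)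
  also have "\<dots> = P.lc2 n {..<N (Suc n)} {..<N 1} (c (Suc (Suc n)) i (Suc n))
        (\<lambda>q u. P.lc2 n {..<N 1} {..<N n} (c (Suc n) q 1) (\<lambda>p s. arr p \<triangleright>\<^bsub>P n\<^esub> (\<epsilon> n s \<triangleleft>\<^bsub>P n\<^esub> arr u)))"
  proof (rule lc2_coassoc[OF P_bimodule])
    fix p s u assume *: "p < N 1" "s < N n" "u < N 1" and "trm 1 p \<noteq> org n s \<or> trm n s \<noteq> org 1 u"
    then have "arr p \<triangleright>\<^bsub>P n\<^esub> \<epsilon> n s = \<zero>\<^bsub>P n\<^esub> \<or> \<epsilon> n s \<triangleleft>\<^bsub>P n\<^esub> arr u = \<zero>\<^bsub>P n\<^esub>"
      using arr_\<epsilon>_zero[OF *(1,2)] \<epsilon>_arr_zero[OF *(3,2)] by blast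
    then show "arr p \<triangleright>\<^bsub>P n\<^esub> (\<epsilon> n s \<triangleleft>\<^bsub>P n\<^esub> arr u) = \<zero>\<^bsub>P n\<^esub>"
      using * P.ls_rs[of "\<epsilon> n s" n "arr p" "arr u"] by (auto simp del: One_nat_def)
  qed (use i in \<open>auto simp del: One_nat_def\<close>)
  also have "\<dots> = P.lc2 n {..<N (Suc n)} {..<N 1} (c (Suc (Suc n)) i (Suc n)) (\<lambda>j q. dl n j \<triangleleft>\<^bsub>P n\<^esub> arr q)"
  proof (rule P.lc2_cong_eq)
    fix q u assume "q \<in> {..<N (Suc n)}" "u \<in> {..<N 1}"
    then have "dl n q \<triangleleft>\<^bsub>P n\<^esub> arr u = P.lc2 n {..<N 1} {..<N n} (c (Suc n) q 1) (\<lambda>p s. (arr p \<triangleright>\<^bsub>P n\<^esub> \<epsilon> n s) \<triangleleft>\<^bsub>P n\<^esub> arr u)"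
      unfolding dl_def by (intro P.lc2_rs) (auto simp del: One_nat_def)
    also have "\<dots> = P.lc2 n {..<N 1} {..<N n} (c (Suc n) q 1) (\<lambda>p s. arr p \<triangleright>\<^bsub>P n\<^esub> (\<epsilon> n s \<triangleleft>\<^bsub>P n\<^esub> arr u))"
      using \<open>u \<in> {..<N 1}\<close> by (intro P.lc2_cong_eq) (auto simp: P.ls_rs simp del: One_nat_def)
    finally show "P.lc2 n {..<N 1} {..<N n} (c (Suc n) q 1) (\<lambda>p s. arr p \<triangleright>\<^bsub>P n\<^esub> (\<epsilon> n s \<triangleleft>\<^bsub>P n\<^esub> arr u)) = dl n q \<triangleleft>\<^bsub>P n\<^esub> arr u"
      by (rule sym)
  qed (auto simp del: One_nat_def)
  finally show ?thesis .
qed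

lemma hom_dl:
  assumes "k_bimodule \<Lambda> \<kappa> M" "h \<in> bimod_hom \<Lambda> (P n) M"
  shows "h (dl n i) = k_bimodule.lc2 \<kappa> M {..<N 1} {..<N n} (c (Suc n) i 1) (\<lambda>p j. arr p \<triangleright>\<^bsub>M\<^esub> h (\<epsilon> n j))"
    "h (dr n i) = k_bimodule.lc2 \<kappa> M {..<N n} {..<N 1} (c (Suc n) i n) (\<lambda>j q. h (\<epsilon> n j) \<triangleleft>\<^bsub>M\<^esub> arr q)"
proof -
  interpret M: k_bimodule \<Lambda> \<kappa> M by fact
  show "h (dl n i) = M.lc2 {..<N 1} {..<N n} (c (Suc n) i 1) (\<lambda>p j. arr p \<triangleright>\<^bsub>M\<^esub> h (\<epsilon> n j))"
    "h (dr n i) = M.lc2 {..<N n} {..<N 1} (c (Suc n) i n) (\<lambda>j q. h (\<epsilon> n j) \<triangleleft>\<^bsub>M\<^esub> arr q)"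
    unfolding dl_def dr_def
    by (subst bimod_hom_lc2[OF P_bimodule assms], auto simp: bimod_homD[OF assms(2)] simp del: One_nat_def intro!: M.lc2_cong)+
qed

lemma hom_d:
  assumes "k_bimodule \<Lambda> \<kappa> M" "h \<in> bimod_hom \<Lambda> (P n) M"
  shows "h (d n i) = h (dl n i) \<oplus>\<^bsub>M\<^esub> \<kappa> ((- 1) ^ Suc n) \<triangleright>\<^bsub>M\<^esub> h (dr n i)"
  unfolding d_def by (simp add: bimod_homD[OF assms(2)])

text \<open>Two left or two right multiplications give zero, and the two mixed terms agree up to the
  signs \<open>(-1)^(n+1)\<close> and \<open>(-1)^(n+2)\<close>, which are opposite.\<close>

lemma \<delta>_d_zero:
  assumes i: "i < N (Suc (Suc n))"
  shows "\<delta> (Suc n) (d (Suc n) i) = \<zero>\<^bsub>P n\<^esub>"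
proof -
  let ?l = "P.lc2 n {..<N 1} {..<N (Suc n)} (c (Suc (Suc n)) i 1)"
  let ?r = "P.lc2 n {..<N (Suc n)} {..<N 1} (c (Suc (Suc n)) i (Suc n))"
  let ?s = "(- 1) ^ Suc n :: 'k"
  have "\<delta> (Suc n) (dl (Suc n) i) = ?l (\<lambda>p j. arr p \<triangleright>\<^bsub>P n\<^esub> dl n j \<oplus>\<^bsub>P n\<^esub> \<kappa> ?s \<triangleright>\<^bsub>P n\<^esub> (arr p \<triangleright>\<^bsub>P n\<^esub> dr n j))"
    unfolding hom_dl[OF P_bimodule \<delta>_hom]
    by (rule P.lc2_cong_eq) (auto simp: \<delta>_\<epsilon> d_def P.ls_add P.\<kappa>_ls_comm[OF _ arr_closed] simp del: One_nat_def power_Suc)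
  also have "\<dots> = ?l (\<lambda>p j. arr p \<triangleright>\<^bsub>P n\<^esub> dl n j) \<oplus>\<^bsub>P n\<^esub> \<kappa> ?s \<triangleright>\<^bsub>P n\<^esub> ?l (\<lambda>p j. arr p \<triangleright>\<^bsub>P n\<^esub> dr n j)"
    by (subst P.lc2_add) (auto intro!: arg_cong[where f = "\<lambda>x. _ \<oplus>\<^bsub>P n\<^esub> x"] P.lc2_ls[symmetric] simp del: One_nat_def power_Suc)
  moreover have closed: "?l (\<lambda>p j. arr p \<triangleright>\<^bsub>P n\<^esub> dr n j) \<in> carrier (P n)"
    by (rule P.lc2_closed) (auto simp del: One_nat_def)
  ultimately have L: "\<delta> (Suc n) (dl (Suc n) i) = \<kappa> ?s \<triangleright>\<^bsub>P n\<^esub> ?l (\<lambda>p j. arr p \<triangleright>\<^bsub>P n\<^esub> dr n j)"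
    using left_left_zero[OF i] P.l_closed[OF closed] by (simp del: One_nat_def power_Suc)
  have "\<delta> (Suc n) (dr (Suc n) i) = ?r (\<lambda>j q. dl n j \<triangleleft>\<^bsub>P n\<^esub> arr q \<oplus>\<^bsub>P n\<^esub> \<kappa> ?s \<triangleright>\<^bsub>P n\<^esub> (dr n j \<triangleleft>\<^bsub>P n\<^esub> arr q))"
    unfolding hom_dl[OF P_bimodule \<delta>_hom]
    by (rule P.lc2_cong_eq) (auto simp: \<delta>_\<epsilon> d_def P.add_rs P.ls_rs simp del: One_nat_def power_Suc)
  also have "\<dots> = ?r (\<lambda>j q. dl n j \<triangleleft>\<^bsub>P n\<^esub> arr q) \<oplus>\<^bsub>P n\<^esub> \<kappa> ?s \<triangleright>\<^bsub>P n\<^esub> ?r (\<lambda>j q. dr n j \<triangleleft>\<^bsub>P n\<^esub> arr q)"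
    by (subst P.lc2_add) (auto intro!: arg_cong[where f = "\<lambda>x. _ \<oplus>\<^bsub>P n\<^esub> x"] P.lc2_ls[symmetric] simp del: One_nat_def power_Suc)
  finally have "\<delta> (Suc n) (dr (Suc n) i) = ?l (\<lambda>p j. arr p \<triangleright>\<^bsub>P n\<^esub> dr n j)"
    using right_right_zero[OF i] left_right_commute[OF i] closed by (simp del: One_nat_def power_Suc)
  with closed show ?thesis
    unfolding hom_d[OF P_bimodule \<delta>_hom] L
    by (simp add: \<Lambda>.\<kappa>_uminus P.minus_ls P.M.l_neg[OF P.l_closed[OF closed \<Lambda>.\<kappa>_closed]] del: One_nat_def)
qed

lemma \<delta>_\<delta>:
  assumes "x \<in> carrier (P (Suc (Suc n)))"
  shows "\<delta> (Suc n) (\<delta> (Suc (Suc n)) x) = \<zero>\<^bsub>P n\<^esub>"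
proof -
  have eq: "(\<lambda>x\<in>carrier (P (Suc (Suc n))). \<delta> (Suc n) (\<delta> (Suc (Suc n)) x)) = (\<lambda>x\<in>carrier (P (Suc (Suc n))). \<zero>\<^bsub>P n\<^esub>)"
    by (rule P_hom_eqI[OF bimod_hom_compose[OF P_bimodule \<delta>_hom \<delta>_hom] bimod_hom_zero_map[OF P_bimodule P_bimodule] P_bimodule])
      (simp add: \<delta>_\<epsilon> \<delta>_d_zero)
  show ?thesis using fun_cong[OF eq, of x] assms by simp
qed

text \<open>Inverts the enumeration of the vertices by \<open>f 0\<close>, so that generators of
  degree 0 can be addressed by vertices.\<close>

definition vertex_index :: "'v \<Rightarrow> nat" where
  "vertex_index v = (SOME p. p < N 0 \<and> org 0 p = v)"

lemma vertex_index: "v \<in> verts Q \<Longrightarrow> vertex_index v < N 0" "v \<in> verts Q \<Longrightarrow> org 0 (vertex_index v) = v"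
  and vertex_index_eq: "p < N 0 \<Longrightarrow> vertex_index (org 0 p) = p"
proof -
  have *: "vertex_index v < N 0 \<and> org 0 (vertex_index v) = v" if v: "v \<in> verts Q" for v
  proof -
    obtain p where "p < N 0" "org 0 p = v" using v by (rule vertex_idx)
    then show ?thesis unfolding vertex_index_def by (intro someI[of "\<lambda>p. p < N 0 \<and> org 0 p = v"]) simp
  qed
  then show "v \<in> verts Q \<Longrightarrow> vertex_index v < N 0" "v \<in> verts Q \<Longrightarrow> org 0 (vertex_index v) = v" by auto
  show "vertex_index (org 0 p) = p" if p: "p < N 0"
  proof -
    obtain p' where "\<And>q. q < N 0 \<Longrightarrow> org 0 q = org 0 p \<longleftrightarrow> q = p'" using vertex_idx[OF org_verts[OF p]] by blast
    then show ?thesis using *[OF org_verts[OF p]] p by blast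
  qed
qed

text \<open>The counit property: in the splitting with \<open>r = 0\<close> a single pair survives,
  the origin vertex together with \<open>i\<close> itself, with coefficient 1.\<close>

lemma lc2_comult_0:
  fixes M :: "(('v, 'b, 'k) path_comb set, 'm) bimod"
  assumes M: "k_bimodule \<Lambda> \<kappa> M" and i: "i < N n"
    and B: "\<And>p q. p < N 0 \<Longrightarrow> q < N n \<Longrightarrow> B p q \<in> carrier M"
    and B0: "\<And>p q. p < N 0 \<Longrightarrow> q < N n \<Longrightarrow> org 0 p \<noteq> org n q \<Longrightarrow> B p q = \<zero>\<^bsub>M\<^esub>"
  shows "k_bimodule.lc2 \<kappa> M {..<N 0} {..<N n} (c n i 0) B = B (vertex_index (org n i)) i"
proof -
  interpret M: k_bimodule \<Lambda> \<kappa> M by fact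
  let ?p = "vertex_index (org n i)"
  have p: "?p < N 0" "org 0 ?p = org n i" using i by (auto simp: vertex_index)
  have z: "\<kappa> (c n i 0 p q) \<triangleright>\<^bsub>M\<^esub> B p q = (if p = ?p \<and> q = i then B p q else \<zero>\<^bsub>M\<^esub>)" if "p < N 0" "q < N n" for p q
    using comult_0[OF i that] B0[OF that] B[OF that] vertex_index_eq[OF that(1)] p(2)
    by (cases "org 0 p = org n q") auto
  have "M.lc {..<N n} (c n i 0 x) (B x) = \<zero>\<^bsub>M\<^esub>" if "x < N 0" "x \<noteq> ?p" for x
    by (rule M.lc_zero) (use z that in auto)
  then have "M.lc2 {..<N 0} {..<N n} (c n i 0) B = \<kappa> 1 \<triangleright>\<^bsub>M\<^esub> M.lc {..<N n} (c n i 0 ?p) (B ?p)"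
    unfolding M.lc2_def using B p by (intro M.lc_delta) auto
  also have "M.lc {..<N n} (c n i 0 ?p) (B ?p) = \<kappa> (c n i 0 ?p i) \<triangleright>\<^bsub>M\<^esub> B ?p i"
    using B p z i by (intro M.lc_delta) auto
  also have "\<kappa> 1 \<triangleright>\<^bsub>M\<^esub> \<dots> = B ?p i" using z[OF p(1) i] B[OF p(1) i] by simp
  finally show ?thesis .
qed

lemma lc2_comult_n:
  fixes M :: "(('v, 'b, 'k) path_comb set, 'm) bimod"
  assumes M: "k_bimodule \<Lambda> \<kappa> M" and i: "i < N n"
    and B: "\<And>p q. p < N n \<Longrightarrow> q < N 0 \<Longrightarrow> B p q \<in> carrier M"
    and B0: "\<And>p q. p < N n \<Longrightarrow> q < N 0 \<Longrightarrow> trm n p \<noteq> org 0 q \<Longrightarrow> B p q = \<zero>\<^bsub>M\<^esub>"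
  shows "k_bimodule.lc2 \<kappa> M {..<N n} {..<N 0} (c n i n) B = B i (vertex_index (trm n i))"
proof -
  interpret M: k_bimodule \<Lambda> \<kappa> M by fact
  let ?q = "vertex_index (trm n i)"
  have q: "?q < N 0" "org 0 ?q = trm n i" using i by (auto simp: vertex_index)
  have z: "\<kappa> (c n i n p q) \<triangleright>\<^bsub>M\<^esub> B p q = (if p = i \<and> q = ?q then B p q else \<zero>\<^bsub>M\<^esub>)" if "p < N n" "q < N 0" for p q
    using comult_n[OF i that] B0[OF that] B[OF that] vertex_index_eq[OF that(2)] q(2)
    by (cases "trm n p = org 0 q") auto
  have "M.lc {..<N 0} (c n i n x) (B x) = \<zero>\<^bsub>M\<^esub>" if "x < N n" "x \<noteq> i" for x
    by (rule M.lc_zero) (use z that in auto)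
  then have "M.lc2 {..<N n} {..<N 0} (c n i n) B = \<kappa> 1 \<triangleright>\<^bsub>M\<^esub> M.lc {..<N 0} (c n i n i) (B i)"
    unfolding M.lc2_def using B i by (intro M.lc_delta) auto
  also have "M.lc {..<N 0} (c n i n i) (B i) = \<kappa> (c n i n i ?q) \<triangleright>\<^bsub>M\<^esub> B i ?q"
    using B q z i by (intro M.lc_delta) auto
  also have "\<kappa> 1 \<triangleright>\<^bsub>M\<^esub> \<dots> = B i ?q" using z[OF i q(1)] B[OF i q(1)] by simp
  finally show ?thesis .
qed

text \<open>Multiplication is the bimodule map that sends the generator belonging to a vertex to
  this vertex, and values at generators determine it; this resolves the definite
  description.\<close>

lemma \<delta>0_hom: "\<delta>0 \<in> bimod_hom \<Lambda> (P 0) reg"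
  and \<delta>0_\<epsilon>: "j < N 0 \<Longrightarrow> \<delta>0 (\<epsilon> 0 j) = E (org 0 j)"
proof -
  have EE: "E (org 0 j) \<otimes>\<^bsub>\<Lambda>\<^esub> E (trm 0 j) = E (org 0 j)" if "j < N 0" for j
    using that by (simp add: f_0_vertex(2) E_mult)
  obtain h where h: "h \<in> bimod_hom \<Lambda> (P 0) reg" "\<And>i. i < N 0 \<Longrightarrow> h (\<epsilon> 0 i) = E (org 0 i)"
  proof (rule P_hom_exists[OF reg_bimodule, of 0 "\<lambda>i. E (org 0 i)"])
    fix i assume i: "i < N 0"
    show "E (org 0 i) \<in> carrier reg" "E (org 0 i) \<triangleright>\<^bsub>reg\<^esub> E (org 0 i) = E (org 0 i)" "E (org 0 i) \<triangleleft>\<^bsub>reg\<^esub> E (trm 0 i) = E (org 0 i)"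
      using i EE[OF i] by (simp_all add: E_mult del: path_algebra_simps)
  qed (rule that)
  let ?p = "\<lambda>h. h \<in> bimod_hom \<Lambda> (P 0) reg \<and> (\<forall>i<N 0. \<forall>a\<in>left_proj Q I (org 0 i). \<forall>b\<in>right_proj Q I (trm 0 i).
      h (bires_tensor Q I N f 0 i a b) = a \<otimes>\<^bsub>\<Lambda>\<^esub> b)"
  have ten: "h' (bires_tensor Q I N f 0 i a b) = a \<otimes>\<^bsub>\<Lambda>\<^esub> (h' (\<epsilon> 0 i) \<otimes>\<^bsub>\<Lambda>\<^esub> b)"
    if "h' \<in> bimod_hom \<Lambda> (P 0) reg" "i < N 0" "a \<in> left_proj Q I (org 0 i)" "b \<in> right_proj Q I (trm 0 i)" for h' i a b
  proof -
    have ab: "a \<in> carrier \<Lambda>" "b \<in> carrier \<Lambda>"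
      using that by (auto simp: left_proj_def right_proj_def)
    have "bires_tensor Q I N f 0 i a b = a \<triangleright>\<^bsub>P 0\<^esub> (\<epsilon> 0 i \<triangleleft>\<^bsub>P 0\<^esub> b)"
      using that unfolding bires_tensor_eq bires_gen_eq bires_eq left_proj_eq right_proj_eq
      by (intro idempotent_pairs.ten_gen[OF pairs]) auto
    then show ?thesis using that(1,2) ab by (simp add: bimod_homD[OF that(1)])
  qed
  have "?p h"
  proof (intro conjI allI impI ballI h(1))
    fix i a b assume *: "i < N 0" "a \<in> left_proj Q I (org 0 i)" "b \<in> right_proj Q I (trm 0 i)"
    then obtain b' where b': "b = E (trm 0 i) \<otimes>\<^bsub>\<Lambda>\<^esub> b'" "b' \<in> carrier \<Lambda>" by (auto simp: right_proj_def)
    have "E (org 0 i) \<otimes>\<^bsub>\<Lambda>\<^esub> b = b" unfolding b'(1)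
      using EE[OF *(1)] b'(2) *(1) f_0_vertex(2)[OF *(1)] by (simp flip: \<Lambda>.m_assoc)
    then show "h (bires_tensor Q I N f 0 i a b) = a \<otimes>\<^bsub>\<Lambda>\<^esub> b" unfolding ten[OF h(1) *] h(2)[OF *(1)] by (simp only:)
  qed
  moreover have "h' = h" if h': "?p h'" for h'
  proof (rule P_hom_eqI[OF _ h(1) reg_bimodule])
    fix i assume i: "i < N 0"
    have "\<epsilon> 0 i = bires_tensor Q I N f 0 i (E (org 0 i)) (E (trm 0 i))" by (simp add: bires_gen_def)
    moreover have "E (org 0 i) \<in> left_proj Q I (org 0 i)" "E (trm 0 i) \<in> right_proj Q I (trm 0 i)"
      using i idempotent_pairs.l_LU[OF pairs, of i 0] idempotent_pairs.r_RV[OF pairs, of i 0] by (auto simp: left_proj_eq right_proj_eq)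
    ultimately show "h' (\<epsilon> 0 i) = h (\<epsilon> 0 i)" using h' \<open>?p h\<close> i by simp
  qed (use h' in blast)
  ultimately have "\<delta>0 = h"
    unfolding bires_aug_def by (rule the_equality)
  then show "\<delta>0 \<in> bimod_hom \<Lambda> (P 0) reg" "j < N 0 \<Longrightarrow> \<delta>0 (\<epsilon> 0 j) = E (org 0 j)" using h by auto
qed

text \<open>By the counit property on either side the first differential is the familiar one: arrow
  tensor terminus minus origin tensor arrow.\<close>

lemma d_0:
  assumes "i < N 1"
  shows "d 0 i = arr i \<triangleright>\<^bsub>P 0\<^esub> \<epsilon> 0 (vertex_index (trm 1 i)) \<oplus>\<^bsub>P 0\<^esub>
    \<ominus>\<^bsub>P 0\<^esub> (\<epsilon> 0 (vertex_index (org 1 i)) \<triangleleft>\<^bsub>P 0\<^esub> arr i)"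
proof -
  have "dl 0 i = arr i \<triangleright>\<^bsub>P 0\<^esub> \<epsilon> 0 (vertex_index (trm 1 i))"
    unfolding dl_def One_nat_def[symmetric]
    by (rule lc2_comult_n[OF P_bimodule assms]) (auto simp: arr_\<epsilon>_zero simp del: One_nat_def)
  moreover have "dr 0 i = \<epsilon> 0 (vertex_index (org 1 i)) \<triangleleft>\<^bsub>P 0\<^esub> arr i"
    unfolding dr_def One_nat_def[symmetric]
    by (rule lc2_comult_0[OF P_bimodule assms]) (auto simp: \<epsilon>_arr_zero f_0_vertex(2) simp del: One_nat_def)
  ultimately show ?thesis
    using dr_closed[of 0 i] by (simp add: d_def \<Lambda>.\<kappa>_uminus P.minus_ls)
qed

lemma \<delta>0_\<delta>:
  assumes "x \<in> carrier (P 1)"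
  shows "\<delta>0 (\<delta> 1 x) = \<zero>\<^bsub>\<Lambda>\<^esub>"
proof -
  have eq: "(\<lambda>x\<in>carrier (P 1). \<delta>0 (\<delta> 1 x)) = (\<lambda>x\<in>carrier (P 1). \<zero>\<^bsub>reg\<^esub>)"
  proof (rule P_hom_eqI[OF bimod_hom_compose[OF P_bimodule \<delta>_hom[of 0, folded One_nat_def] \<delta>0_hom]
        bimod_hom_zero_map[OF P_bimodule reg_bimodule] reg_bimodule])
    fix i assume i: "i < N 1"
    have j: "vertex_index (trm 1 i) < N 0" "vertex_index (org 1 i) < N 0"
      using i vertex_index by auto
    have m: "\<ominus>\<^bsub>reg\<^esub> a = \<ominus>\<^bsub>\<Lambda>\<^esub> a" if "a \<in> carrier \<Lambda>" for a
      using reg.M.minus_equality[of "\<ominus>\<^bsub>\<Lambda>\<^esub> a" a] that by (simp add: \<Lambda>.l_neg)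
    have "\<delta>0 (\<delta> 1 (\<epsilon> 1 i)) = \<delta>0 (d 0 i)" using \<delta>_\<epsilon>[of i 0] i by simp
    also have "\<dots> = \<zero>\<^bsub>\<Lambda>\<^esub>"
      unfolding d_0[OF i] using i j
      by (simp add: bimod_homD[OF \<delta>0_hom] bimod_hom_minus[OF P_bimodule reg_bimodule \<delta>0_hom] \<delta>0_\<epsilon> vertex_index
          arr_E E_arr m \<Lambda>.r_neg del: One_nat_def)
    finally show "(\<lambda>x\<in>carrier (P 1). \<delta>0 (\<delta> 1 x)) (\<epsilon> 1 i) = (\<lambda>x\<in>carrier (P 1). \<zero>\<^bsub>reg\<^esub>) (\<epsilon> 1 i)" using i by simp
  qed
  show ?thesis using fun_cong[OF eq, of x] assms by simp
qed

end

section \<open>Exactness of the bimodule resolution\<close>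

lemma (in abelian_group) add_minus_cancel: "s \<in> carrier G \<Longrightarrow> l \<in> carrier G \<Longrightarrow> s \<oplus> \<ominus> (s \<oplus> \<ominus> l) = l"
  by (simp add: minus_add a_assoc[symmetric] r_neg)

section \<open>Exactness in degree zero\<close>

context resolution_family
begin

lemma \<pi>_sum2:
  assumes "\<And>i q. i \<in> X \<Longrightarrow> q \<in> Y \<Longrightarrow> g i q \<in> carrier R"
  shows "\<pi> (\<Sum>i\<in>X. \<Sum>q\<in>Y. pm_scale (w i q) (g i q)) = reg.lc2 X Y w (\<lambda>i q. \<pi> (g i q))"
proof -
  let ?g = "\<lambda>i q. pm_scale (w i q) (g i q)"
  have g: "?g i q \<in> carrier R" "\<pi> (?g i q) = \<kappa> (w i q) \<otimes>\<^bsub>\<Lambda>\<^esub> \<pi> (g i q)" if "i \<in> X" "q \<in> Y" for i q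
    using assms[OF that] by (auto simp: \<kappa>_\<pi> simp del: path_algebra_simps intro!: closed)
  have g': "(\<Sum>q\<in>Y. ?g i q) \<in> carrier R" if "i \<in> X" for i
    by (rule closed_sum) (rule g(1)[OF that])
  have inner: "reg.lc Y (w i) (\<lambda>q. \<pi> (g i q)) = \<pi> (\<Sum>q\<in>Y. ?g i q)" if i: "i \<in> X" for i
  proof -
    have "reg.lc Y (w i) (\<lambda>q. \<pi> (g i q)) = (\<Oplus>\<^bsub>\<Lambda>\<^esub>q\<in>Y. \<kappa> (w i q) \<otimes>\<^bsub>\<Lambda>\<^esub> \<pi> (g i q))"
      by (rule \<Lambda>.lc_regular) (use i assms in \<open>simp del: path_algebra_simps\<close>)
    also have "\<dots> = (\<Oplus>\<^bsub>\<Lambda>\<^esub>q\<in>Y. \<pi> (?g i q))"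
      by (rule \<Lambda>.finsum_cong') (use i g assms in \<open>auto simp del: path_algebra_simps\<close>)
    also have "\<dots> = \<pi> (\<Sum>q\<in>Y. ?g i q)"
      by (rule \<pi>_sum[symmetric]) (use i g in \<open>simp del: path_algebra_simps\<close>)
    finally show ?thesis .
  qed
  have "reg.lc2 X Y w (\<lambda>i q. \<pi> (g i q)) = (\<Oplus>\<^bsub>\<Lambda>\<^esub>i\<in>X. \<kappa> 1 \<otimes>\<^bsub>\<Lambda>\<^esub> reg.lc Y (w i) (\<lambda>q. \<pi> (g i q)))"
    unfolding reg.lc2_def by (rule \<Lambda>.lc_regular) (use g' inner in \<open>simp del: path_algebra_simps\<close>)
  also have "\<dots> = (\<Oplus>\<^bsub>\<Lambda>\<^esub>i\<in>X. \<pi> (\<Sum>q\<in>Y. ?g i q))"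
    by (rule \<Lambda>.finsum_cong') (use g' inner in \<open>simp_all del: path_algebra_simps\<close>)
  also have "\<dots> = \<pi> (\<Sum>i\<in>X. \<Sum>q\<in>Y. ?g i q)"
    by (rule \<pi>_sum[symmetric]) (rule g')
  finally show ?thesis by (rule sym)
qed

lemma \<pi>_rdiff:
  assumes "\<And>i. i < N (Suc n) \<Longrightarrow> r i \<in> carrier R"
  shows "\<pi> (rdiff n r j) = reg.lc2 {..<N (Suc n)} {..<N 1} (\<lambda>i q. c (Suc n) i n j q) (\<lambda>i q. arr q \<otimes>\<^bsub>\<Lambda>\<^esub> \<pi> (r i))"
proof -
  have "\<pi> (rdiff n r j) = reg.lc2 {..<N (Suc n)} {..<N 1} (\<lambda>i q. c (Suc n) i n j q) (\<lambda>i q. \<pi> (f 1 q \<otimes>\<^bsub>R\<^esub> r i))"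
    unfolding rdiff_def by (rule \<pi>_sum2) (use assms in \<open>auto simp del: path_algebra_simps One_nat_def\<close>)
  also have "\<dots> = reg.lc2 {..<N (Suc n)} {..<N 1} (\<lambda>i q. c (Suc n) i n j q) (\<lambda>i q. arr q \<otimes>\<^bsub>\<Lambda>\<^esub> \<pi> (r i))"
    by (rule reg.lc2_cong_eq) (use assms in \<open>auto simp: \<pi>_mult simp del: path_algebra_simps One_nat_def\<close>)
  finally show ?thesis .
qed

lemma one_vertices: "\<one>\<^bsub>\<Lambda>\<^esub> = (\<Oplus>\<^bsub>\<Lambda>\<^esub>p\<in>{..<N 0}. E (org 0 p))"
proof -
  have "\<one>\<^bsub>R\<^esub> = (\<Sum>v\<in>verts Q. vertex v)" by (simp add: path_algebra_def)
  also have "\<dots> = (\<Sum>x\<in>vertex ` verts Q. x)"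
    by (rule sum.reindex_cong[symmetric, of vertex])
      (auto simp: inj_on_def vertex_elt_def, metis lookup_single_eq lookup_single_not_eq prod.inject zero_neq_one)
  also have "\<dots> = (\<Sum>p<N 0. f 0 p)"
    by (rule sum.reindex_bij_betw[OF f_0, symmetric])
  also have "\<dots> = (\<Sum>p<N 0. vertex (org 0 p))"
    by (rule sum.cong[OF refl]) (rule f_0_vertex(1), simp)
  finally show ?thesis unfolding \<pi>_one[symmetric]
    by (simp only:) (rule \<pi>_sum, rule vertex_closed, simp)
qed

lemma \<delta>0_surj: "\<delta>0 ` carrier (P 0) = carrier \<Lambda>"
proof (intro equalityI subsetI)
  fix a assume "a \<in> \<delta>0 ` carrier (P 0)"
  then show "a \<in> carrier \<Lambda>" using bimod_homD(2)[OF \<delta>0_hom] by auto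
next
  fix a assume a: "a \<in> carrier \<Lambda>"
  \<comment> \<open>Multiplying out this preimage gives \<open>a\<close> times the sum of all
    vertices, which is the unit.\<close>
  let ?x = "P.lc 0 {..<N 0} (\<lambda>_. 1) (\<lambda>p. a \<triangleright>\<^bsub>P 0\<^esub> \<epsilon> 0 p)"
  have "\<delta>0 ?x = reg.lc {..<N 0} (\<lambda>_. 1) (\<lambda>p. \<delta>0 (a \<triangleright>\<^bsub>P 0\<^esub> \<epsilon> 0 p))"
    by (rule bimod_hom_lc[OF P_bimodule reg_bimodule \<delta>0_hom]) (use a in auto)
  also have "\<dots> = reg.lc {..<N 0} (\<lambda>_. 1) (\<lambda>p. a \<otimes>\<^bsub>\<Lambda>\<^esub> E (org 0 p))"
    by (rule reg.lc_cong) (use a in \<open>auto simp: bimod_homD[OF \<delta>0_hom] \<delta>0_\<epsilon> simp del: path_algebra_simps\<close>)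
  also have "\<dots> = (\<Oplus>\<^bsub>\<Lambda>\<^esub>p\<in>{..<N 0}. \<kappa> 1 \<otimes>\<^bsub>\<Lambda>\<^esub> (a \<otimes>\<^bsub>\<Lambda>\<^esub> E (org 0 p)))"
    by (rule \<Lambda>.lc_regular) (use a in auto)
  also have "\<dots> = (\<Oplus>\<^bsub>\<Lambda>\<^esub>p\<in>{..<N 0}. a \<otimes>\<^bsub>\<Lambda>\<^esub> E (org 0 p))"
    by (rule \<Lambda>.finsum_cong') (use a in auto)
  also have "\<dots> = a \<otimes>\<^bsub>\<Lambda>\<^esub> (\<Oplus>\<^bsub>\<Lambda>\<^esub>p\<in>{..<N 0}. E (org 0 p))"
    by (rule \<Lambda>.finsum_rdistr[symmetric]) (use a in auto)
  also have "\<dots> = a" using a by (simp flip: one_vertices)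
  finally have "a = \<delta>0 ?x" by (rule sym)
  moreover have "?x \<in> carrier (P 0)" by (rule P.lc_closed) (use a in auto)
  ultimately show "a \<in> \<delta>0 ` carrier (P 0)" by (rule image_eqI)
qed

lemma \<delta>_1_hom: "\<delta> 1 \<in> bimod_hom \<Lambda> (P 1) (P 0)"
  using \<delta>_hom[of 0] by simp

lemma path_closed: "w \<in> qpaths Q \<Longrightarrow> Poly_Mapping.single w a \<in> carrier R"
  by (auto split: if_splits)

lemma qpath_vertices: "(u, p) \<in> qpaths Q \<Longrightarrow> u \<in> verts Q" "(u, p) \<in> qpaths Q \<Longrightarrow> qpath_end Q (u, p) \<in> verts Q"
proof -
  assume "(u, p) \<in> qpaths Q"
  then obtain v where v: "awalk u p v" by (auto simp: qpaths_def)
  then show "u \<in> verts Q" by (rule awalk_hd_in_verts)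
  have "cas u p v" using v by (simp add: awalk_def)
  then have "awlast u p = v" by (rule awlast_if_cas)
  then show "qpath_end Q (u, p) \<in> verts Q" using awalk_last_in_verts[OF v] by (simp add: qpath_end_def)
qed

text \<open>Moving the arrows of a path across the tensor sign one at a time.\<close>

lemma move_path:
  assumes "(u, p) \<in> qpaths Q" "a \<in> carrier \<Lambda>"
  shows "\<exists>z\<in>carrier (P 1). a \<triangleright>\<^bsub>P 0\<^esub> (\<epsilon> 0 (vertex_index u) \<triangleleft>\<^bsub>P 0\<^esub> \<pi> (Poly_Mapping.single (u, p) 1)) =
    (a \<otimes>\<^bsub>\<Lambda>\<^esub> \<pi> (Poly_Mapping.single (u, p) 1)) \<triangleright>\<^bsub>P 0\<^esub> \<epsilon> 0 (vertex_index (qpath_end Q (u, p))) \<oplus>\<^bsub>P 0\<^esub> \<delta> 1 z"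
  using assms
proof (induction p arbitrary: u a)
  case Nil
  then have u: "u \<in> verts Q" by (auto simp: qpaths_def awalk_Nil_iff)
  let ?u = "vertex_index u"
  have "\<epsilon> 0 ?u \<triangleleft>\<^bsub>P 0\<^esub> E u = \<epsilon> 0 ?u" "E u \<triangleright>\<^bsub>P 0\<^esub> \<epsilon> 0 ?u = \<epsilon> 0 ?u"
    using \<epsilon>_E[of ?u 0] E_\<epsilon>[of ?u 0] f_0_vertex(2)[of ?u] vertex_index[OF u] by simp_all
  then have "a \<triangleright>\<^bsub>P 0\<^esub> (\<epsilon> 0 ?u \<triangleleft>\<^bsub>P 0\<^esub> E u) = (a \<otimes>\<^bsub>\<Lambda>\<^esub> E u) \<triangleright>\<^bsub>P 0\<^esub> \<epsilon> 0 ?u \<oplus>\<^bsub>P 0\<^esub> \<delta> 1 \<zero>\<^bsub>P 1\<^esub>"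
    using Nil.prems(2) vertex_index[OF u] E_closed[OF u] bimod_hom_zero[OF P_bimodule P_bimodule \<delta>_1_hom]
    by (simp add: P.ls_assoc del: One_nat_def)
  moreover have "qpath_end Q (u, []) = u" by (simp add: qpath_end_def)
  ultimately show ?case by (auto simp: vertex_elt_def intro!: bexI[of _ "\<zero>\<^bsub>P 1\<^esub>"])
next
  case (Cons b p)
  then have b: "b \<in> arcs Q" "u = tail Q b" and p: "(head Q b, p) \<in> qpaths Q"
    by (auto simp: qpaths_def awalk_Cons_iff)
  define W where "W = \<pi> (Poly_Mapping.single (head Q b, p) 1)"
  have W: "W \<in> carrier \<Lambda>" unfolding W_def by (intro \<pi>_closed path_closed p)
  have "arrow_elt Q b \<in> f 1 ` {..<N 1}" using f_1 b(1) by (simp add: bij_betw_def)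
  then obtain q where q: "q < N 1" "f 1 q = Poly_Mapping.single (tail Q b, [b]) 1" by (auto simp: arrow_elt_def)
  have key: "(tail Q b, [b]) \<in> Poly_Mapping.keys (f 1 q)" using q(2) by simp
  have ends: "org 1 q = tail Q b" "trm 1 q = head Q b"
    using uniform_vertices(5,6)[OF f_uniform[OF q(1)] key] by (simp_all add: qpath_end_def)
  have "Poly_Mapping.single (u, b # p) 1 = f 1 q \<otimes>\<^bsub>R\<^esub> Poly_Mapping.single (head Q b, p) 1"
    by (simp add: q(2) mult_single b(2) qpath_end_def del: One_nat_def)
  then have w: "\<pi> (Poly_Mapping.single (u, b # p) 1) = arr q \<otimes>\<^bsub>\<Lambda>\<^esub> W"
    using \<pi>_mult[OF f_closed[OF q(1)] path_closed[OF p, of 1]] by (simp add: W_def)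
  have end_eq: "qpath_end Q (u, b # p) = qpath_end Q (head Q b, p)" by (simp add: qpath_end_def)
  have h: "vertex_index (head Q b) < N 0" "vertex_index u < N 0" "vertex_index (qpath_end Q (head Q b, p)) < N 0"
  proof -
    have "qpath_end Q (head Q b, p) \<in> verts Q" by (rule qpath_vertices(2)[OF p])
    then show "vertex_index (head Q b) < N 0" "vertex_index u < N 0" "vertex_index (qpath_end Q (head Q b, p)) < N 0"
      using b by (auto intro!: vertex_index(1))
  qed
  note q' = arr_closed[OF q(1)]
  obtain z where z: "z \<in> carrier (P 1)" "(a \<otimes>\<^bsub>\<Lambda>\<^esub> arr q) \<triangleright>\<^bsub>P 0\<^esub> (\<epsilon> 0 (vertex_index (head Q b)) \<triangleleft>\<^bsub>P 0\<^esub> W) =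
      ((a \<otimes>\<^bsub>\<Lambda>\<^esub> arr q) \<otimes>\<^bsub>\<Lambda>\<^esub> W) \<triangleright>\<^bsub>P 0\<^esub> \<epsilon> 0 (vertex_index (qpath_end Q (head Q b, p))) \<oplus>\<^bsub>P 0\<^esub> \<delta> 1 z"
    using Cons.IH[OF p, of "a \<otimes>\<^bsub>\<Lambda>\<^esub> arr q"] Cons.prems(2) q' unfolding W_def by (blast intro: \<Lambda>.m_closed)
  \<comment> \<open>Its boundary is the difference between having the first arrow on the left and on
    the right of the tensor sign.\<close>
  define y where "y = a \<triangleright>\<^bsub>P 1\<^esub> (\<epsilon> 1 q \<triangleleft>\<^bsub>P 1\<^esub> W)"
  have y: "y \<in> carrier (P 1)" unfolding y_def using q(1) Cons.prems(2) W by simp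
  let ?l = "a \<triangleright>\<^bsub>P 0\<^esub> (\<epsilon> 0 (vertex_index u) \<triangleleft>\<^bsub>P 0\<^esub> (arr q \<otimes>\<^bsub>\<Lambda>\<^esub> W))"
  let ?r = "((a \<otimes>\<^bsub>\<Lambda>\<^esub> arr q) \<otimes>\<^bsub>\<Lambda>\<^esub> W) \<triangleright>\<^bsub>P 0\<^esub> \<epsilon> 0 (vertex_index (qpath_end Q (head Q b, p)))"
  have lr: "?l \<in> carrier (P 0)" "?r \<in> carrier (P 0)" "\<delta> 1 z \<in> carrier (P 0)" "\<delta> 1 y \<in> carrier (P 0)"
    using h W q' Cons.prems(2) bimod_homD(2)[OF \<delta>_1_hom] z(1) y by (auto simp del: One_nat_def)
  have "\<delta> 1 y = a \<triangleright>\<^bsub>P 0\<^esub> (d 0 q \<triangleleft>\<^bsub>P 0\<^esub> W)"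
    unfolding y_def using q(1) Cons.prems(2) W \<delta>_\<epsilon>[of q 0] by (simp add: bimod_homD[OF \<delta>_1_hom, simplified])
  also have "\<dots> = (a \<otimes>\<^bsub>\<Lambda>\<^esub> arr q) \<triangleright>\<^bsub>P 0\<^esub> (\<epsilon> 0 (vertex_index (head Q b)) \<triangleleft>\<^bsub>P 0\<^esub> W) \<oplus>\<^bsub>P 0\<^esub> \<ominus>\<^bsub>P 0\<^esub> ?l"
    unfolding d_0[OF q(1)] ends b(2)[symmetric] using h W q' Cons.prems(2)
    by (simp add: P.add_rs P.ls_add P.minus_rs P.ls_minus P.ls_rs P.ls_assoc P.rs_assoc)
  also have "\<dots> = ?r \<oplus>\<^bsub>P 0\<^esub> \<delta> 1 z \<oplus>\<^bsub>P 0\<^esub> \<ominus>\<^bsub>P 0\<^esub> ?l" by (simp only: z(2))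
  finally have dy: "\<delta> 1 y = ?r \<oplus>\<^bsub>P 0\<^esub> \<delta> 1 z \<oplus>\<^bsub>P 0\<^esub> \<ominus>\<^bsub>P 0\<^esub> ?l" .
  have "?l = ?r \<oplus>\<^bsub>P 0\<^esub> \<delta> 1 z \<oplus>\<^bsub>P 0\<^esub> \<ominus>\<^bsub>P 0\<^esub> \<delta> 1 y"
    unfolding dy by (rule P.M.add_minus_cancel[symmetric]) (use lr in auto)
  also have "\<dots> = ?r \<oplus>\<^bsub>P 0\<^esub> \<delta> 1 (z \<oplus>\<^bsub>P 1\<^esub> \<ominus>\<^bsub>P 1\<^esub> y)"
    using lr z(1) y by (simp add: bimod_homD(3)[OF \<delta>_1_hom] bimod_hom_minus[OF P_bimodule P_bimodule \<delta>_1_hom] P.M.a_assoc del: One_nat_def)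
  finally have "?l = ?r \<oplus>\<^bsub>P 0\<^esub> \<delta> 1 (z \<oplus>\<^bsub>P 1\<^esub> \<ominus>\<^bsub>P 1\<^esub> y)" .
  moreover have "?r = (a \<otimes>\<^bsub>\<Lambda>\<^esub> (arr q \<otimes>\<^bsub>\<Lambda>\<^esub> W)) \<triangleright>\<^bsub>P 0\<^esub> \<epsilon> 0 (vertex_index (qpath_end Q (head Q b, p)))"
    using Cons.prems(2) q' W by (simp add: \<Lambda>.m_assoc)
  ultimately show ?case unfolding w end_eq using z(1) y by (intro bexI[of _ "z \<oplus>\<^bsub>P 1\<^esub> \<ominus>\<^bsub>P 1\<^esub> y"]) (auto simp del: One_nat_def)
qed

text \<open>Modulo boundaries every element is a sum of generators with coefficients
  \<open>a j\<close> on the left only. Multiplication sends it to the sum of the \<open>a j\<close>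
  times \<open>E (org 0 j)\<close>, whose terms end in different vertices; if this is zero, every
  term is zero.\<close>

lemma exact0:
  assumes "x \<in> carrier (P 0)" "\<delta>0 x = \<zero>\<^bsub>\<Lambda>\<^esub>"
  shows "x \<in> \<delta> 1 ` carrier (P 1)"
proof -
  define Z where "Z = {x \<in> carrier (P 0). \<exists>a. \<exists>z\<in>carrier (P 1). (\<forall>j<N 0. a j \<in> carrier \<Lambda>) \<and>
    x = (\<Oplus>\<^bsub>P 0\<^esub>j\<in>{..<N 0}. a j \<triangleright>\<^bsub>P 0\<^esub> \<epsilon> 0 j) \<oplus>\<^bsub>P 0\<^esub> \<delta> 1 z}"
  have Z_add: "x \<oplus>\<^bsub>P 0\<^esub> y \<in> Z" if xy: "x \<in> Z" "y \<in> Z" for x y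
  proof -
    obtain a z where a: "\<forall>j<N 0. a j \<in> carrier \<Lambda>" "z \<in> carrier (P 1)" "x = (\<Oplus>\<^bsub>P 0\<^esub>j\<in>{..<N 0}. a j \<triangleright>\<^bsub>P 0\<^esub> \<epsilon> 0 j) \<oplus>\<^bsub>P 0\<^esub> \<delta> 1 z"
      using xy(1) by (auto simp: Z_def)
    obtain b w where b: "\<forall>j<N 0. b j \<in> carrier \<Lambda>" "w \<in> carrier (P 1)" "y = (\<Oplus>\<^bsub>P 0\<^esub>j\<in>{..<N 0}. b j \<triangleright>\<^bsub>P 0\<^esub> \<epsilon> 0 j) \<oplus>\<^bsub>P 0\<^esub> \<delta> 1 w"
      using xy(2) by (auto simp: Z_def)
    have "(\<Oplus>\<^bsub>P 0\<^esub>j\<in>{..<N 0}. (a j \<oplus>\<^bsub>\<Lambda>\<^esub> b j) \<triangleright>\<^bsub>P 0\<^esub> \<epsilon> 0 j) =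
        (\<Oplus>\<^bsub>P 0\<^esub>j\<in>{..<N 0}. a j \<triangleright>\<^bsub>P 0\<^esub> \<epsilon> 0 j \<oplus>\<^bsub>P 0\<^esub> b j \<triangleright>\<^bsub>P 0\<^esub> \<epsilon> 0 j)"
      by (rule P.M.finsum_cong') (use a(1) b(1) in \<open>auto simp: P.add_ls\<close>)
    also have "\<dots> = (\<Oplus>\<^bsub>P 0\<^esub>j\<in>{..<N 0}. a j \<triangleright>\<^bsub>P 0\<^esub> \<epsilon> 0 j) \<oplus>\<^bsub>P 0\<^esub> (\<Oplus>\<^bsub>P 0\<^esub>j\<in>{..<N 0}. b j \<triangleright>\<^bsub>P 0\<^esub> \<epsilon> 0 j)"
      by (rule P.M.finsum_addf) (use a(1) b(1) in auto)
    finally have s: "(\<Oplus>\<^bsub>P 0\<^esub>j\<in>{..<N 0}. (a j \<oplus>\<^bsub>\<Lambda>\<^esub> b j) \<triangleright>\<^bsub>P 0\<^esub> \<epsilon> 0 j) = \<dots>" .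
    have cl: "(\<Oplus>\<^bsub>P 0\<^esub>j\<in>{..<N 0}. a j \<triangleright>\<^bsub>P 0\<^esub> \<epsilon> 0 j) \<in> carrier (P 0)" "(\<Oplus>\<^bsub>P 0\<^esub>j\<in>{..<N 0}. b j \<triangleright>\<^bsub>P 0\<^esub> \<epsilon> 0 j) \<in> carrier (P 0)"
      "\<delta> 1 z \<in> carrier (P 0)" "\<delta> 1 w \<in> carrier (P 0)"
      using a(1,2) b(1,2) bimod_homD(2)[OF \<delta>_1_hom] by (auto intro!: P.M.finsum_closed simp del: One_nat_def)
    have "x \<oplus>\<^bsub>P 0\<^esub> y = (\<Oplus>\<^bsub>P 0\<^esub>j\<in>{..<N 0}. (a j \<oplus>\<^bsub>\<Lambda>\<^esub> b j) \<triangleright>\<^bsub>P 0\<^esub> \<epsilon> 0 j) \<oplus>\<^bsub>P 0\<^esub> \<delta> 1 (z \<oplus>\<^bsub>P 1\<^esub> w)"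
      unfolding s a(3) b(3) using cl a(2) b(2) by (simp add: bimod_homD(3)[OF \<delta>_1_hom] P.M.a_ac del: One_nat_def)
    moreover have "x \<oplus>\<^bsub>P 0\<^esub> y \<in> carrier (P 0)" using xy by (auto simp: Z_def)
    ultimately show ?thesis unfolding Z_def using a(1,2) b(1,2)
      by (intro CollectI conjI exI[of _ "\<lambda>j. a j \<oplus>\<^bsub>\<Lambda>\<^esub> b j"] bexI[of _ "z \<oplus>\<^bsub>P 1\<^esub> w"]) auto
  qed
  have Z_zero: "\<zero>\<^bsub>P 0\<^esub> \<in> Z"
  proof -
    have "(\<Oplus>\<^bsub>P 0\<^esub>j\<in>{..<N 0}. \<zero>\<^bsub>\<Lambda>\<^esub> \<triangleright>\<^bsub>P 0\<^esub> \<epsilon> 0 j) = \<zero>\<^bsub>P 0\<^esub>"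
      by (rule P.M.finsum_all_zero) simp
    then show ?thesis unfolding Z_def using bimod_hom_zero[OF P_bimodule P_bimodule \<delta>_1_hom]
      by (intro CollectI conjI exI[of _ "\<lambda>j. \<zero>\<^bsub>\<Lambda>\<^esub>"] bexI[of _ "\<zero>\<^bsub>P 1\<^esub>"]) (auto simp del: One_nat_def)
  qed
  have Z_gen: "a \<triangleright>\<^bsub>P 0\<^esub> \<epsilon> 0 i \<oplus>\<^bsub>P 0\<^esub> \<delta> 1 z \<in> Z" if "i < N 0" "a \<in> carrier \<Lambda>" "z \<in> carrier (P 1)" for a i z
  proof -
    have "(\<Oplus>\<^bsub>P 0\<^esub>j\<in>{..<N 0}. (if j = i then a else \<zero>\<^bsub>\<Lambda>\<^esub>) \<triangleright>\<^bsub>P 0\<^esub> \<epsilon> 0 j) =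
        (\<Oplus>\<^bsub>P 0\<^esub>j\<in>{..<N 0}. if j = i then a \<triangleright>\<^bsub>P 0\<^esub> \<epsilon> 0 j else \<zero>\<^bsub>P 0\<^esub>)"
      by (rule P.M.finsum_cong') (use that in auto)
    also have "\<dots> = a \<triangleright>\<^bsub>P 0\<^esub> \<epsilon> 0 i" by (rule P.M.finsum_delta) (use that in auto)
    finally show ?thesis unfolding Z_def using that bimod_homD(2)[OF \<delta>_1_hom]
      by (intro CollectI conjI exI[of _ "\<lambda>j. if j = i then a else \<zero>\<^bsub>\<Lambda>\<^esub>"] bexI[of _ z]) (auto simp del: One_nat_def)
  qed
  have "x \<in> Z" using assms(1)
  proof (induction x rule: P_induct)
    case (gen i a b)
    obtain y where y: "y \<in> carrier R" "b = \<pi> y" using gen(3) by (rule \<pi>_surj)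
    show ?case unfolding y(2) using y(1)[simplified]
    proof (induction y rule: pm_induct)
      case zero
      then show ?case using Z_zero gen by simp
    next
      case (single w e)
      obtain u p where w: "w = (u, p)" by fastforce
      have up: "(u, p) \<in> qpaths Q" using single w by simp
      have u: "u \<in> verts Q" "qpath_end Q (u, p) \<in> verts Q"
        by (rule qpath_vertices[OF up])+
      let ?W = "\<pi> (Poly_Mapping.single (u, p) 1)"
      have W: "?W \<in> carrier \<Lambda>" by (intro \<pi>_closed path_closed up)
      have "\<pi> (Poly_Mapping.single w e) = \<kappa> e \<otimes>\<^bsub>\<Lambda>\<^esub> ?W" using \<kappa>_\<pi>[OF path_closed[OF up, of 1], of e] by (simp add: w)
      then have *: "a \<triangleright>\<^bsub>P 0\<^esub> (\<epsilon> 0 i \<triangleleft>\<^bsub>P 0\<^esub> \<pi> (Poly_Mapping.single w e)) = (\<kappa> e \<otimes>\<^bsub>\<Lambda>\<^esub> a) \<triangleright>\<^bsub>P 0\<^esub> (\<epsilon> 0 i \<triangleleft>\<^bsub>P 0\<^esub> ?W)"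
        using gen W by (simp add: P.rs_assoc P.ls_assoc flip: P.\<kappa>_central) (simp add: P.ls_rs P.\<kappa>_ls_comm)
      show ?case
      proof (cases "org 0 i = u")
        case True
        then have i: "i = vertex_index u" using vertex_index_eq[OF gen(1)] by simp
        obtain z where "z \<in> carrier (P 1)" "(\<kappa> e \<otimes>\<^bsub>\<Lambda>\<^esub> a) \<triangleright>\<^bsub>P 0\<^esub> (\<epsilon> 0 i \<triangleleft>\<^bsub>P 0\<^esub> ?W) =
            ((\<kappa> e \<otimes>\<^bsub>\<Lambda>\<^esub> a) \<otimes>\<^bsub>\<Lambda>\<^esub> ?W) \<triangleright>\<^bsub>P 0\<^esub> \<epsilon> 0 (vertex_index (qpath_end Q (u, p))) \<oplus>\<^bsub>P 0\<^esub> \<delta> 1 z"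
          using move_path[OF up, of "\<kappa> e \<otimes>\<^bsub>\<Lambda>\<^esub> a"] gen(2) unfolding i by auto
        then show ?thesis unfolding * using Z_gen vertex_index(1)[OF u(2)] gen(2) W by simp
      next
        case False
        \<comment> \<open>A right factor that starts at another vertex is killed by the
          generator.\<close>
        have "vertex (org 0 i) \<otimes>\<^bsub>R\<^esub> Poly_Mapping.single (u, p) 1 = 0"
          using False by (auto intro!: poly_mapping_eqI simp: lookup_vertex_mult lookup_single when_def)
        then have "E (trm 0 i) \<otimes>\<^bsub>\<Lambda>\<^esub> ?W = \<zero>\<^bsub>\<Lambda>\<^esub>"
          using \<pi>_mult[OF vertex_closed[OF org_verts[OF gen(1)]] path_closed[OF up, of 1]] f_0_vertex(2)[OF gen(1)] by simp
        then have "\<epsilon> 0 i \<triangleleft>\<^bsub>P 0\<^esub> ?W = \<zero>\<^bsub>P 0\<^esub>" using W gen(1) by (intro \<epsilon>_rs_zero) auto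
        then show ?thesis unfolding * using Z_zero gen(2) by simp
      qed
    next
      case (add y y')
      then have "a \<triangleright>\<^bsub>P 0\<^esub> (\<epsilon> 0 i \<triangleleft>\<^bsub>P 0\<^esub> \<pi> (y + y')) =
          a \<triangleright>\<^bsub>P 0\<^esub> (\<epsilon> 0 i \<triangleleft>\<^bsub>P 0\<^esub> \<pi> y) \<oplus>\<^bsub>P 0\<^esub> a \<triangleright>\<^bsub>P 0\<^esub> (\<epsilon> 0 i \<triangleleft>\<^bsub>P 0\<^esub> \<pi> y')"
        using gen by (simp add: \<pi>_add P.rs_add P.ls_add)
      then show ?case using Z_add add by simp
    qed
  qed (auto intro: Z_zero Z_add)
  then obtain a z where a: "\<forall>j<N 0. a j \<in> carrier \<Lambda>" "z \<in> carrier (P 1)" "x = (\<Oplus>\<^bsub>P 0\<^esub>j\<in>{..<N 0}. a j \<triangleright>\<^bsub>P 0\<^esub> \<epsilon> 0 j) \<oplus>\<^bsub>P 0\<^esub> \<delta> 1 z"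
    by (auto simp: Z_def)
  let ?y = "\<Oplus>\<^bsub>P 0\<^esub>j\<in>{..<N 0}. a j \<triangleright>\<^bsub>P 0\<^esub> \<epsilon> 0 j"
  have y: "?y \<in> carrier (P 0)" using a(1) by (auto intro!: P.M.finsum_closed)
  have dz: "\<delta> 1 z \<in> carrier (P 0)" using a(2) bimod_homD(2)[OF \<delta>_1_hom] by simp
  have "\<delta>0 x = \<delta>0 ?y" unfolding a(3) using y dz bimod_homD(2)[OF \<delta>0_hom y] by (simp add: bimod_homD(3)[OF \<delta>0_hom] \<delta>0_\<delta>[OF a(2)] del: One_nat_def)
  also have "\<dots> = finsum reg (\<lambda>j. \<delta>0 (a j \<triangleright>\<^bsub>P 0\<^esub> \<epsilon> 0 j)) {..<N 0}"
    by (rule bimod_hom_finsum[OF P_bimodule reg_bimodule \<delta>0_hom]) (use a(1) in auto)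
  also have "\<dots> = finsum reg (\<lambda>j. a j \<otimes>\<^bsub>\<Lambda>\<^esub> E (org 0 j)) {..<N 0}"
    by (rule reg.M.finsum_cong') (use a(1) in \<open>auto simp: bimod_homD[OF \<delta>0_hom] \<delta>0_\<epsilon> simp del: path_algebra_simps\<close>)
  finally have sum0: "finsum reg (\<lambda>j. a j \<otimes>\<^bsub>\<Lambda>\<^esub> E (org 0 j)) {..<N 0} = \<zero>\<^bsub>\<Lambda>\<^esub>" using assms(2) by simp
  have "a i \<triangleright>\<^bsub>P 0\<^esub> \<epsilon> 0 i = \<zero>\<^bsub>P 0\<^esub>" if i: "i < N 0" for i
  proof -
    \<comment> \<open>\<open>f 0\<close> enumerates each vertex once, so right multiplication by a
      vertex isolates one summand.\<close>
    have inj: "org 0 j = org 0 i \<longleftrightarrow> j = i" if "j < N 0" for j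
      using arg_cong[of "org 0 j" "org 0 i" vertex_index] unfolding vertex_index_eq[OF that] vertex_index_eq[OF i] by blast
    have "finsum reg (\<lambda>j. a j \<otimes>\<^bsub>\<Lambda>\<^esub> E (org 0 j)) {..<N 0} \<triangleleft>\<^bsub>reg\<^esub> E (org 0 i) =
        finsum reg (\<lambda>j. (a j \<otimes>\<^bsub>\<Lambda>\<^esub> E (org 0 j)) \<triangleleft>\<^bsub>reg\<^esub> E (org 0 i)) {..<N 0}"
      by (rule reg.rs_finsum) (use a(1) i in auto)
    also have "\<dots> = finsum reg (\<lambda>j. if j = i then a j \<otimes>\<^bsub>\<Lambda>\<^esub> E (org 0 j) else \<zero>\<^bsub>reg\<^esub>) {..<N 0}"
      by (rule reg.M.finsum_cong')
        (use a(1) i inj in \<open>auto simp: \<Lambda>.m_assoc E_mult simp del: path_algebra_simps\<close>)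
    also have "\<dots> = a i \<otimes>\<^bsub>\<Lambda>\<^esub> E (org 0 i)" by (rule reg.M.finsum_delta) (use a(1) i in auto)
    finally have "a i \<otimes>\<^bsub>\<Lambda>\<^esub> E (org 0 i) = \<zero>\<^bsub>\<Lambda>\<^esub>" using sum0 i by simp
    then show ?thesis using a(1) i by (intro ls_\<epsilon>_zero) auto
  qed
  then have "?y = \<zero>\<^bsub>P 0\<^esub>" by (intro P.M.finsum_all_zero) simp
  then have "x = \<delta> 1 z" using a(3) dz by simp
  then show ?thesis using a(2) by blast
qed

end

section \<open>Coordinates with respect to a basis of paths\<close>

locale resolution_coordinates = resolution_family Q I N f c
  for Q :: "('v, 'b) pre_digraph" and I :: "('v, 'b, 'k::field) path_comb set" and N f c +
  fixes S :: "('v \<times> 'b list) set" and \<phi> :: "'v \<times> 'b list \<Rightarrow> ('v, 'b, 'k) path_comb \<Rightarrow> 'k"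
  assumes S_qpaths: "S \<subseteq> qpaths Q"
    and \<phi>_add: "x \<in> carrier R \<Longrightarrow> y \<in> carrier R \<Longrightarrow> \<phi> s (x + y) = \<phi> s x + \<phi> s y"
    and \<phi>_scale: "x \<in> carrier R \<Longrightarrow> \<phi> s (pm_scale e x) = e * \<phi> s x"
    and \<phi>_I: "s \<in> S \<Longrightarrow> x \<in> I \<Longrightarrow> \<phi> s x = 0"
    and \<phi>_single: "s \<in> S \<Longrightarrow> s' \<in> S \<Longrightarrow> \<phi> s (Poly_Mapping.single s' 1) = (if s = s' then 1 else 0)"
    and \<phi>_finite: "x \<in> carrier R \<Longrightarrow> finite {s \<in> S. \<phi> s x \<noteq> 0}"
    and \<phi>_expand: "x \<in> carrier R \<Longrightarrow> x - (\<Sum>s\<in>{s \<in> S. \<phi> s x \<noteq> 0}. Poly_Mapping.single s (\<phi> s x)) \<in> I"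
    and \<phi>_graded: "s \<in> S \<Longrightarrow> x \<in> homogeneous_elts Q m \<Longrightarrow> length (snd s) \<noteq> m \<Longrightarrow> \<phi> s x = 0"
begin

abbreviation "path s \<equiv> \<pi> (Poly_Mapping.single s 1)"

lemma S_closed: "s \<in> S \<Longrightarrow> Poly_Mapping.single s e \<in> carrier R"
  using S_qpaths by (intro path_closed) auto

lemma path_in_\<Lambda> [simp]: "s \<in> S \<Longrightarrow> path s \<in> carrier \<Lambda>"
  by (intro \<pi>_closed S_closed)

definition \<psi> :: "'v \<times> 'b list \<Rightarrow> ('v, 'b, 'k) path_comb set \<Rightarrow> 'k" where
  "\<psi> s X = \<phi> s (SOME x. x \<in> carrier R \<and> \<pi> x = X)"

text \<open>The choice of a representative is harmless because \<open>\<phi> s\<close> is additive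
  and vanishes on \<open>I\<close>.\<close>

lemma \<psi>_\<pi>: "s \<in> S \<Longrightarrow> x \<in> carrier R \<Longrightarrow> \<psi> s (\<pi> x) = \<phi> s x"
proof -
  assume s: "s \<in> S" and x: "x \<in> carrier R"
  define y where "y = (SOME y. y \<in> carrier R \<and> \<pi> y = \<pi> x)"
  have y: "y \<in> carrier R" "\<pi> y = \<pi> x"
    using someI[of "\<lambda>y. y \<in> carrier R \<and> \<pi> y = \<pi> x" x] x unfolding y_def by blast+
  have d: "y - x \<in> I" using \<pi>_eq_iff[OF y(1) x] y(2) by blast
  have "\<phi> s y = \<phi> s ((y - x) + x)" by simp
  also have "\<dots> = \<phi> s (y - x) + \<phi> s x" by (rule \<phi>_add[OF I_carrier[OF d] x])
  finally show ?thesis using \<phi>_I[OF s d] by (simp add: \<psi>_def y_def)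
qed

lemma \<psi>_add: "s \<in> S \<Longrightarrow> a \<in> carrier \<Lambda> \<Longrightarrow> b \<in> carrier \<Lambda> \<Longrightarrow> \<psi> s (a \<oplus>\<^bsub>\<Lambda>\<^esub> b) = \<psi> s a + \<psi> s b"
proof -
  assume s: "s \<in> S" and "a \<in> carrier \<Lambda>" "b \<in> carrier \<Lambda>"
  then obtain x y where xy: "x \<in> carrier R" "a = \<pi> x" "y \<in> carrier R" "b = \<pi> y" by (metis \<pi>_surj)
  have "x + y \<in> carrier R" using xy by (intro pm.subspace_add[OF carrier_subspace])
  then show ?thesis using xy by (simp add: \<psi>_\<pi>[OF s] \<phi>_add flip: \<pi>_add del: path_algebra_simps)
qed

lemma \<psi>_scale: "s \<in> S \<Longrightarrow> a \<in> carrier \<Lambda> \<Longrightarrow> \<psi> s (\<kappa> e \<otimes>\<^bsub>\<Lambda>\<^esub> a) = e * \<psi> s a"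
proof -
  assume s: "s \<in> S" and "a \<in> carrier \<Lambda>"
  then obtain x where x: "x \<in> carrier R" "a = \<pi> x" by (metis \<pi>_surj)
  then show ?thesis by (simp add: \<kappa>_\<pi> \<psi>_\<pi>[OF s] closed_scale \<phi>_scale del: path_algebra_simps)
qed

lemma \<psi>_path: "s \<in> S \<Longrightarrow> s' \<in> S \<Longrightarrow> \<psi> s (path s') = (if s = s' then 1 else 0)"
  by (simp add: \<psi>_\<pi> S_closed \<phi>_single del: path_algebra_simps)

lemma \<psi>_zero: "s \<in> S \<Longrightarrow> \<psi> s \<zero>\<^bsub>\<Lambda>\<^esub> = 0"
  using \<psi>_scale[of s "\<zero>\<^bsub>\<Lambda>\<^esub>" 0] by simp

lemma \<psi>_sum:
  "s \<in> S \<Longrightarrow> (\<And>i. i \<in> X \<Longrightarrow> g i \<in> carrier \<Lambda>) \<Longrightarrow> \<psi> s (\<Oplus>\<^bsub>\<Lambda>\<^esub>i\<in>X. g i) = (\<Sum>i\<in>X. \<psi> s (g i))"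
proof (induction X rule: infinite_finite_induct)
  case (insert i X)
  then show ?case by (simp add: \<Lambda>.finsum_insert Pi_def \<psi>_add \<Lambda>.finsum_closed)
qed (simp_all add: \<psi>_zero)

text \<open>Stated for every finite set beyond \<open>F0\<close>, so that expansions of several
  elements can be compared over a common index set.\<close>

lemma expand_\<Lambda>:
  assumes "a \<in> carrier \<Lambda>"
  obtains F0 where "finite F0" "F0 \<subseteq> S" "\<And>s. s \<in> S - F0 \<Longrightarrow> \<psi> s a = 0"
    "\<And>F. finite F \<Longrightarrow> F0 \<subseteq> F \<Longrightarrow> F \<subseteq> S \<Longrightarrow> a = (\<Oplus>\<^bsub>\<Lambda>\<^esub>s\<in>F. \<kappa> (\<psi> s a) \<otimes>\<^bsub>\<Lambda>\<^esub> path s)"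
proof -
  obtain x where x: "x \<in> carrier R" "a = \<pi> x" using assms by (metis \<pi>_surj)
  let ?F0 = "{s \<in> S. \<phi> s x \<noteq> 0}"
  have g: "Poly_Mapping.single s (\<phi> s x) \<in> carrier R" if "s \<in> S" for s by (rule S_closed[OF that])
  have sum: "(\<Sum>s\<in>F. Poly_Mapping.single s (\<phi> s x)) \<in> carrier R" if "F \<subseteq> S" for F
    by (rule closed_sum) (use that g in blast)
  show thesis
  proof (rule that[of ?F0])
    show "finite ?F0" by (rule \<phi>_finite[OF x(1)])
    show "\<psi> s a = 0" if "s \<in> S - ?F0" for s using that by (simp add: x(2) \<psi>_\<pi>[OF _ x(1)])
    fix F assume F: "finite F" "?F0 \<subseteq> F" "F \<subseteq> S"
    have "(\<Sum>s\<in>?F0. Poly_Mapping.single s (\<phi> s x)) = (\<Sum>s\<in>F. Poly_Mapping.single s (\<phi> s x))"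
      by (rule sum.mono_neutral_left[OF F(1,2)]) (use F(3) in auto)
    then have "x - (\<Sum>s\<in>F. Poly_Mapping.single s (\<phi> s x)) \<in> I"
      using \<phi>_expand[OF x(1)] by (simp only:)
    then have "a = \<pi> (\<Sum>s\<in>F. Poly_Mapping.single s (\<phi> s x))"
      unfolding x(2) using \<pi>_eq_iff[OF x(1) sum[OF F(3)]] by blast
    also have "\<dots> = (\<Oplus>\<^bsub>\<Lambda>\<^esub>s\<in>F. \<pi> (Poly_Mapping.single s (\<phi> s x)))"
      by (rule \<pi>_sum) (use g F(3) in blast)
    also have "\<dots> = (\<Oplus>\<^bsub>\<Lambda>\<^esub>s\<in>F. \<kappa> (\<psi> s a) \<otimes>\<^bsub>\<Lambda>\<^esub> path s)"
    proof (rule \<Lambda>.finsum_cong'[OF refl])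
      fix s assume "s \<in> F"
      then have s: "s \<in> S" using F(3) by auto
      have "\<kappa> (\<phi> s x) \<otimes>\<^bsub>\<Lambda>\<^esub> path s = \<pi> (Poly_Mapping.single s (\<phi> s x))"
        using \<kappa>_\<pi>[OF S_closed[OF s, of 1], of "\<phi> s x"] by simp
      then show "\<pi> (Poly_Mapping.single s (\<phi> s x)) = \<kappa> (\<psi> s a) \<otimes>\<^bsub>\<Lambda>\<^esub> path s" by (simp add: x(2) \<psi>_\<pi>[OF s x(1)])
    qed (use F(3) in auto)
    finally show "a = (\<Oplus>\<^bsub>\<Lambda>\<^esub>s\<in>F. \<kappa> (\<psi> s a) \<otimes>\<^bsub>\<Lambda>\<^esub> path s)" .
  qed auto
qed

lemma path_E: "s \<in> S \<Longrightarrow> v \<in> verts Q \<Longrightarrow> path s \<otimes>\<^bsub>\<Lambda>\<^esub> E v = (if qpath_end Q s = v then path s else \<zero>\<^bsub>\<Lambda>\<^esub>)"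
proof -
  assume s: "s \<in> S" and v: "v \<in> verts Q"
  have "Poly_Mapping.single s 1 \<otimes>\<^bsub>R\<^esub> vertex v = (if qpath_end Q s = v then Poly_Mapping.single s 1 else 0)"
    by (rule poly_mapping_eqI, simp only: lookup_mult_vertex) (auto simp: lookup_single when_def)
  then show ?thesis using \<pi>_mult[OF S_closed[OF s, of 1] vertex_closed[OF v]] by (simp split: if_splits)
qed

text \<open>A basis path ends in one vertex, so right multiplication by a vertex acts diagonally on
  the basis.\<close>

lemma \<psi>_E:
  assumes "s \<in> S" "a \<in> carrier \<Lambda>" "v \<in> verts Q"
  shows "\<psi> s (a \<otimes>\<^bsub>\<Lambda>\<^esub> E v) = (if qpath_end Q s = v then \<psi> s a else 0)"
proof -
  obtain F0 where F0: "finite F0" "F0 \<subseteq> S" "\<And>s. s \<in> S - F0 \<Longrightarrow> \<psi> s a = 0"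
    "\<And>F. finite F \<Longrightarrow> F0 \<subseteq> F \<Longrightarrow> F \<subseteq> S \<Longrightarrow> a = (\<Oplus>\<^bsub>\<Lambda>\<^esub>s\<in>F. \<kappa> (\<psi> s a) \<otimes>\<^bsub>\<Lambda>\<^esub> path s)"
    by (rule expand_\<Lambda>[OF assms(2)]) (rule that)
  define F where "F = insert s F0"
  have F: "finite F" "F \<subseteq> S" "s \<in> F" using F0 assms(1) by (auto simp: F_def)
  have a: "a = (\<Oplus>\<^bsub>\<Lambda>\<^esub>s\<in>F. \<kappa> (\<psi> s a) \<otimes>\<^bsub>\<Lambda>\<^esub> path s)" by (rule F0(4)[OF F(1) _ F(2)]) (auto simp: F_def)
  have cl: "\<kappa> (\<psi> s' a) \<otimes>\<^bsub>\<Lambda>\<^esub> path s' \<in> carrier \<Lambda>" if "s' \<in> F" for s' using that F(2) by auto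
  have "\<psi> s (a \<otimes>\<^bsub>\<Lambda>\<^esub> E v) = \<psi> s ((\<Oplus>\<^bsub>\<Lambda>\<^esub>s\<in>F. \<kappa> (\<psi> s a) \<otimes>\<^bsub>\<Lambda>\<^esub> path s) \<otimes>\<^bsub>\<Lambda>\<^esub> E v)"
    using a by (rule arg_cong)
  also have "(\<Oplus>\<^bsub>\<Lambda>\<^esub>s\<in>F. \<kappa> (\<psi> s a) \<otimes>\<^bsub>\<Lambda>\<^esub> path s) \<otimes>\<^bsub>\<Lambda>\<^esub> E v = (\<Oplus>\<^bsub>\<Lambda>\<^esub>s\<in>F. (\<kappa> (\<psi> s a) \<otimes>\<^bsub>\<Lambda>\<^esub> path s) \<otimes>\<^bsub>\<Lambda>\<^esub> E v)"
    by (rule \<Lambda>.finsum_ldistr) (use F cl assms(3) in auto)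
  also have "\<psi> s \<dots> = (\<Sum>s'\<in>F. \<psi> s ((\<kappa> (\<psi> s' a) \<otimes>\<^bsub>\<Lambda>\<^esub> path s') \<otimes>\<^bsub>\<Lambda>\<^esub> E v))"
    by (rule \<psi>_sum[OF assms(1)]) (use cl assms(3) in auto)
  also have "\<dots> = (\<Sum>s'\<in>F. if s = s' then (if qpath_end Q s = v then \<psi> s a else 0) else 0)"
  proof (rule sum.cong[OF refl])
    fix s' assume "s' \<in> F"
    then have s': "s' \<in> S" using F(2) by auto
    show "\<psi> s ((\<kappa> (\<psi> s' a) \<otimes>\<^bsub>\<Lambda>\<^esub> path s') \<otimes>\<^bsub>\<Lambda>\<^esub> E v) = (if s = s' then (if qpath_end Q s = v then \<psi> s a else 0) else 0)"
      using s' assms(1,3) by (simp add: \<Lambda>.m_assoc path_E \<psi>_scale \<psi>_path \<psi>_zero)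
  qed
  also have "\<dots> = (if qpath_end Q s = v then \<psi> s a else 0)" using F by simp
  finally show ?thesis .
qed

text \<open>The right factor standing behind the basis path \<open>s\<close> in the summand
  \<open>i\<close>. The choice is made by prescribing values on products with generators, which span
  \<open>P n\<close> additively.\<close>

definition \<Phi> :: "nat \<Rightarrow> 'v \<times> 'b list \<Rightarrow> nat \<Rightarrow> ('v, 'b, 'k) res_elt \<Rightarrow> ('v, 'b, 'k) path_comb set" where
  "\<Phi> n s i = (SOME h. h \<in> carrier (P n) \<rightarrow> carrier \<Lambda> \<and>
    (\<forall>x\<in>carrier (P n). \<forall>y\<in>carrier (P n). h (x \<oplus>\<^bsub>P n\<^esub> y) = h x \<oplus>\<^bsub>\<Lambda>\<^esub> h y) \<and>
    (\<forall>j<N n. \<forall>a\<in>carrier \<Lambda>. \<forall>b\<in>carrier \<Lambda>. h (a \<triangleright>\<^bsub>P n\<^esub> (\<epsilon> n j \<triangleleft>\<^bsub>P n\<^esub> b)) =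
      (if j = i then \<kappa> (\<psi> s (a \<otimes>\<^bsub>\<Lambda>\<^esub> E (org n i))) \<otimes>\<^bsub>\<Lambda>\<^esub> (E (trm n i) \<otimes>\<^bsub>\<Lambda>\<^esub> b) else \<zero>\<^bsub>\<Lambda>\<^esub>)))"

context
  fixes n s i assumes s: "s \<in> S" and i: "i < N n"
begin

lemma \<Phi>_spec: "\<Phi> n s i \<in> carrier (P n) \<rightarrow> carrier \<Lambda> \<and>
    (\<forall>x\<in>carrier (P n). \<forall>y\<in>carrier (P n). \<Phi> n s i (x \<oplus>\<^bsub>P n\<^esub> y) = \<Phi> n s i x \<oplus>\<^bsub>\<Lambda>\<^esub> \<Phi> n s i y) \<and>
    (\<forall>j<N n. \<forall>a\<in>carrier \<Lambda>. \<forall>b\<in>carrier \<Lambda>. \<Phi> n s i (a \<triangleright>\<^bsub>P n\<^esub> (\<epsilon> n j \<triangleleft>\<^bsub>P n\<^esub> b)) =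
      (if j = i then \<kappa> (\<psi> s (a \<otimes>\<^bsub>\<Lambda>\<^esub> E (org n i))) \<otimes>\<^bsub>\<Lambda>\<^esub> (E (trm n i) \<otimes>\<^bsub>\<Lambda>\<^esub> b) else \<zero>\<^bsub>\<Lambda>\<^esub>))"
proof -
  obtain h where "h \<in> carrier (P n) \<rightarrow> carrier \<Lambda>"
    "\<And>x y. x \<in> carrier (P n) \<Longrightarrow> y \<in> carrier (P n) \<Longrightarrow> h (x \<oplus>\<^bsub>P n\<^esub> y) = h x \<oplus>\<^bsub>\<Lambda>\<^esub> h y"
    "\<And>j a b. j < N n \<Longrightarrow> a \<in> carrier \<Lambda> \<Longrightarrow> b \<in> carrier \<Lambda> \<Longrightarrow>
      h (a \<triangleright>\<^bsub>P n\<^esub> (\<epsilon> n j \<triangleleft>\<^bsub>P n\<^esub> b)) =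
        (if j = i then \<kappa> (\<psi> s (a \<otimes>\<^bsub>\<Lambda>\<^esub> E (org n i))) \<otimes>\<^bsub>\<Lambda>\<^esub> (E (trm n i) \<otimes>\<^bsub>\<Lambda>\<^esub> b) else \<zero>\<^bsub>\<Lambda>\<^esub>)"
    by (rule P_coordinate_exists[OF \<psi>_add[OF s] \<psi>_scale[OF s] i], assumption+) (rule that)
  then have "\<exists>h. h \<in> carrier (P n) \<rightarrow> carrier \<Lambda> \<and>
    (\<forall>x\<in>carrier (P n). \<forall>y\<in>carrier (P n). h (x \<oplus>\<^bsub>P n\<^esub> y) = h x \<oplus>\<^bsub>\<Lambda>\<^esub> h y) \<and>
    (\<forall>j<N n. \<forall>a\<in>carrier \<Lambda>. \<forall>b\<in>carrier \<Lambda>. h (a \<triangleright>\<^bsub>P n\<^esub> (\<epsilon> n j \<triangleleft>\<^bsub>P n\<^esub> b)) =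
      (if j = i then \<kappa> (\<psi> s (a \<otimes>\<^bsub>\<Lambda>\<^esub> E (org n i))) \<otimes>\<^bsub>\<Lambda>\<^esub> (E (trm n i) \<otimes>\<^bsub>\<Lambda>\<^esub> b) else \<zero>\<^bsub>\<Lambda>\<^esub>))"
    by (intro exI[of _ h] conjI ballI allI impI)
  then show ?thesis unfolding \<Phi>_def by (rule someI_ex)
qed

lemma \<Phi>_funcset: "\<Phi> n s i \<in> carrier (P n) \<rightarrow> carrier \<Lambda>"
  using \<Phi>_spec by (rule conjunct1)

lemma \<Phi>_closed [simp]: "x \<in> carrier (P n) \<Longrightarrow> \<Phi> n s i x \<in> carrier \<Lambda>"
  using \<Phi>_funcset by (rule funcset_mem)

lemma \<Phi>_add: "x \<in> carrier (P n) \<Longrightarrow> y \<in> carrier (P n) \<Longrightarrow> \<Phi> n s i (x \<oplus>\<^bsub>P n\<^esub> y) = \<Phi> n s i x \<oplus>\<^bsub>\<Lambda>\<^esub> \<Phi> n s i y"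
  using \<Phi>_spec by blast

lemma \<Phi>_zero: "\<Phi> n s i \<zero>\<^bsub>P n\<^esub> = \<zero>\<^bsub>\<Lambda>\<^esub>"
  by (intro additive_map_zero[OF P.M.abelian_group_axioms \<Lambda>.abelian_group_axioms \<Phi>_funcset] \<Phi>_add)

lemma \<Phi>_minus: "x \<in> carrier (P n) \<Longrightarrow> \<Phi> n s i (\<ominus>\<^bsub>P n\<^esub> x) = \<ominus>\<^bsub>\<Lambda>\<^esub> \<Phi> n s i x"
  by (intro additive_map_minus[OF P.M.abelian_group_axioms \<Lambda>.abelian_group_axioms \<Phi>_funcset] \<Phi>_add)

lemma \<Phi>_finsum: "g \<in> X \<rightarrow> carrier (P n) \<Longrightarrow> \<Phi> n s i (finsum (P n) g X) = (\<Oplus>\<^bsub>\<Lambda>\<^esub>x\<in>X. \<Phi> n s i (g x))"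
  by (intro additive_map_finsum[OF P.M.abelian_group_axioms \<Lambda>.abelian_group_axioms \<Phi>_funcset] \<Phi>_add)

lemma \<Phi>_gen:
  assumes "j < N n" "a \<in> carrier \<Lambda>" "b \<in> carrier \<Lambda>"
  shows "\<Phi> n s i (a \<triangleright>\<^bsub>P n\<^esub> (\<epsilon> n j \<triangleleft>\<^bsub>P n\<^esub> b)) =
    (if j = i \<and> qpath_end Q s = org n i then \<kappa> (\<psi> s a) \<otimes>\<^bsub>\<Lambda>\<^esub> (E (trm n i) \<otimes>\<^bsub>\<Lambda>\<^esub> b) else \<zero>\<^bsub>\<Lambda>\<^esub>)"
proof -
  have "\<Phi> n s i (a \<triangleright>\<^bsub>P n\<^esub> (\<epsilon> n j \<triangleleft>\<^bsub>P n\<^esub> b)) =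
      (if j = i then \<kappa> (\<psi> s (a \<otimes>\<^bsub>\<Lambda>\<^esub> E (org n i))) \<otimes>\<^bsub>\<Lambda>\<^esub> (E (trm n i) \<otimes>\<^bsub>\<Lambda>\<^esub> b) else \<zero>\<^bsub>\<Lambda>\<^esub>)"
    using \<Phi>_spec assms by blast
  then show ?thesis using \<psi>_E[OF s assms(2) org_verts[OF i]] E_closed[OF trm_verts[OF i]] assms(3) by simp
qed

lemma \<Phi>_\<kappa>: "x \<in> carrier (P n) \<Longrightarrow> \<Phi> n s i (\<kappa> e \<triangleright>\<^bsub>P n\<^esub> x) = \<kappa> e \<otimes>\<^bsub>\<Lambda>\<^esub> \<Phi> n s i x"
proof (induction x rule: P_induct)
  case (gen j a b)
  then show ?case using E_closed[OF trm_verts[OF i]]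
    by (simp add: \<Phi>_gen \<psi>_scale[OF s] \<Lambda>.\<kappa>_mult \<Lambda>.m_assoc flip: P.ls_assoc del: path_algebra_simps)
qed (simp_all add: \<Phi>_zero P.ls_add \<Phi>_add \<Lambda>.r_distr)

lemma E_\<Phi>: "x \<in> carrier (P n) \<Longrightarrow> E (trm n i) \<otimes>\<^bsub>\<Lambda>\<^esub> \<Phi> n s i x = \<Phi> n s i x"
proof (induction x rule: P_induct)
  case (gen j a b)
  note e = E_closed[OF trm_verts[OF i]]
  have "E (trm n i) \<otimes>\<^bsub>\<Lambda>\<^esub> (\<kappa> (\<psi> s a) \<otimes>\<^bsub>\<Lambda>\<^esub> (E (trm n i) \<otimes>\<^bsub>\<Lambda>\<^esub> b)) = (E (trm n i) \<otimes>\<^bsub>\<Lambda>\<^esub> \<kappa> (\<psi> s a)) \<otimes>\<^bsub>\<Lambda>\<^esub> (E (trm n i) \<otimes>\<^bsub>\<Lambda>\<^esub> b)"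
    using e gen by (simp add: \<Lambda>.m_assoc)
  also have "\<dots> = \<kappa> (\<psi> s a) \<otimes>\<^bsub>\<Lambda>\<^esub> ((E (trm n i) \<otimes>\<^bsub>\<Lambda>\<^esub> E (trm n i)) \<otimes>\<^bsub>\<Lambda>\<^esub> b)"
    unfolding \<Lambda>.\<kappa>_comm[OF e, symmetric] using e gen by (simp add: \<Lambda>.m_assoc)
  also have "\<dots> = \<kappa> (\<psi> s a) \<otimes>\<^bsub>\<Lambda>\<^esub> (E (trm n i) \<otimes>\<^bsub>\<Lambda>\<^esub> b)"
    using E_mult[OF trm_verts[OF i] trm_verts[OF i]] by simp
  finally show ?case using gen e by (simp add: \<Phi>_gen)
qed (use E_closed[OF trm_verts[OF i]] in \<open>simp_all add: \<Phi>_zero \<Phi>_add \<Lambda>.r_distr\<close>)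

lemma \<Phi>_end: "qpath_end Q s \<noteq> org n i \<Longrightarrow> x \<in> carrier (P n) \<Longrightarrow> \<Phi> n s i x = \<zero>\<^bsub>\<Lambda>\<^esub>"
proof -
  assume ne: "qpath_end Q s \<noteq> org n i" and x: "x \<in> carrier (P n)"
  show ?thesis using x by (induction x rule: P_induct) (use ne in \<open>simp_all add: \<Phi>_zero \<Phi>_gen \<Phi>_add\<close>)
qed

lemma \<Phi>_lc:
  assumes "\<And>z. z \<in> Z \<Longrightarrow> C z \<in> carrier (P n)"
  shows "\<Phi> n s i (P.lc n Z v C) = reg.lc Z v (\<lambda>z. \<Phi> n s i (C z))"
proof -
  have "\<Phi> n s i (P.lc n Z v C) = (\<Oplus>\<^bsub>\<Lambda>\<^esub>z\<in>Z. \<Phi> n s i (\<kappa> (v z) \<triangleright>\<^bsub>P n\<^esub> C z))"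
    unfolding P.lc_def by (rule \<Phi>_finsum) (use assms in auto)
  also have "\<dots> = (\<Oplus>\<^bsub>\<Lambda>\<^esub>z\<in>Z. \<kappa> (v z) \<otimes>\<^bsub>\<Lambda>\<^esub> \<Phi> n s i (C z))"
    by (rule \<Lambda>.finsum_cong') (use assms in \<open>auto simp: \<Phi>_\<kappa>\<close>)
  also have "\<dots> = reg.lc Z v (\<lambda>z. \<Phi> n s i (C z))"
    by (rule \<Lambda>.lc_regular[symmetric]) (use assms in auto)
  finally show ?thesis .
qed

lemma \<Phi>_lc2:
  assumes B: "\<And>x y. x \<in> X \<Longrightarrow> y \<in> Y \<Longrightarrow> B x y \<in> carrier (P n)"
  shows "\<Phi> n s i (P.lc2 n X Y w B) = reg.lc2 X Y w (\<lambda>x y. \<Phi> n s i (B x y))"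
proof -
  have "\<Phi> n s i (P.lc2 n X Y w B) = reg.lc X (\<lambda>_. 1) (\<lambda>x. \<Phi> n s i (P.lc n Y (w x) (B x)))"
    unfolding P.lc2_def by (rule \<Phi>_lc) (use B in auto)
  also have "\<dots> = reg.lc2 X Y w (\<lambda>x y. \<Phi> n s i (B x y))"
    unfolding reg.lc2_def
  proof (rule reg.lc_cong[OF refl])
    fix x assume x: "x \<in> X"
    show "reg.lc Y (w x) (\<lambda>y. \<Phi> n s i (B x y)) \<in> carrier reg"
      by (rule reg.lc_closed) (use x B in auto)
    show "\<kappa> 1 \<triangleright>\<^bsub>reg\<^esub> \<Phi> n s i (P.lc n Y (w x) (B x)) = \<kappa> 1 \<triangleright>\<^bsub>reg\<^esub> reg.lc Y (w x) (\<lambda>y. \<Phi> n s i (B x y))"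
      by (subst \<Phi>_lc) (use x B in auto)
  qed
  finally show ?thesis .
qed

end

text \<open>Coordinates come back only after the idempotents of the generator have acted: the path
  must end where \<open>f n i\<close> starts, and the right factor is projected to the terminus of
  \<open>f n i\<close>.\<close>

lemma \<Phi>_path_sum:
  assumes F: "finite F" "F \<subseteq> S" and s: "s \<in> S" and i: "i < N n" and b: "\<And>s j. s \<in> F \<Longrightarrow> j < N n \<Longrightarrow> b s j \<in> carrier \<Lambda>"
  shows "\<Phi> n s i (\<Oplus>\<^bsub>P n\<^esub>s'\<in>F. \<Oplus>\<^bsub>P n\<^esub>j\<in>{..<N n}. path s' \<triangleright>\<^bsub>P n\<^esub> (\<epsilon> n j \<triangleleft>\<^bsub>P n\<^esub> b s' j)) =
    (if s \<in> F \<and> qpath_end Q s = org n i then E (trm n i) \<otimes>\<^bsub>\<Lambda>\<^esub> b s i else \<zero>\<^bsub>\<Lambda>\<^esub>)"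
proof -
  have S: "s' \<in> S" if "s' \<in> F" for s' using F that by auto
  let ?v = "if s \<in> F \<and> qpath_end Q s = org n i then E (trm n i) \<otimes>\<^bsub>\<Lambda>\<^esub> b s i else \<zero>\<^bsub>\<Lambda>\<^esub>"
  have v: "?v \<in> carrier \<Lambda>" using i b E_closed by auto
  have in1: "path s' \<triangleright>\<^bsub>P n\<^esub> (\<epsilon> n j \<triangleleft>\<^bsub>P n\<^esub> b s' j) \<in> carrier (P n)" if "s' \<in> F" "j < N n" for s' j using that S b by simp
  then have in2: "(\<Oplus>\<^bsub>P n\<^esub>j\<in>{..<N n}. path s' \<triangleright>\<^bsub>P n\<^esub> (\<epsilon> n j \<triangleleft>\<^bsub>P n\<^esub> b s' j)) \<in> carrier (P n)" if "s' \<in> F" for s'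
    using that by (intro P.M.finsum_closed) auto
  have "\<Phi> n s i (\<Oplus>\<^bsub>P n\<^esub>s'\<in>F. \<Oplus>\<^bsub>P n\<^esub>j\<in>{..<N n}. path s' \<triangleright>\<^bsub>P n\<^esub> (\<epsilon> n j \<triangleleft>\<^bsub>P n\<^esub> b s' j)) =
      (\<Oplus>\<^bsub>\<Lambda>\<^esub>s'\<in>F. \<Phi> n s i (\<Oplus>\<^bsub>P n\<^esub>j\<in>{..<N n}. path s' \<triangleright>\<^bsub>P n\<^esub> (\<epsilon> n j \<triangleleft>\<^bsub>P n\<^esub> b s' j)))"
    by (rule \<Phi>_finsum[OF s i]) (use in2 in auto)
  also have "\<dots> = (\<Oplus>\<^bsub>\<Lambda>\<^esub>s'\<in>F. if s = s' then ?v else \<zero>\<^bsub>\<Lambda>\<^esub>)"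
  proof (rule \<Lambda>.finsum_cong'[OF refl])
    fix s' assume s': "s' \<in> F"
    have "\<Phi> n s i (\<Oplus>\<^bsub>P n\<^esub>j\<in>{..<N n}. path s' \<triangleright>\<^bsub>P n\<^esub> (\<epsilon> n j \<triangleleft>\<^bsub>P n\<^esub> b s' j)) =
        (\<Oplus>\<^bsub>\<Lambda>\<^esub>j\<in>{..<N n}. \<Phi> n s i (path s' \<triangleright>\<^bsub>P n\<^esub> (\<epsilon> n j \<triangleleft>\<^bsub>P n\<^esub> b s' j)))"
      by (rule \<Phi>_finsum[OF s i]) (use in1 s' in auto)
    also have "\<dots> = (\<Oplus>\<^bsub>\<Lambda>\<^esub>j\<in>{..<N n}. if i = j then (if s = s' then ?v else \<zero>\<^bsub>\<Lambda>\<^esub>) else \<zero>\<^bsub>\<Lambda>\<^esub>)"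
      by (rule \<Lambda>.finsum_cong'[OF refl])
        (use v b[OF s'] i s s' S[OF s'] in \<open>auto simp: \<Phi>_gen[OF s i] \<psi>_path simp del: path_algebra_simps\<close>)
    also have "\<dots> = (if s = s' then ?v else \<zero>\<^bsub>\<Lambda>\<^esub>)"
      by (rule \<Lambda>.finsum_singleton) (use i v in auto)
    finally show "\<Phi> n s i (\<Oplus>\<^bsub>P n\<^esub>j\<in>{..<N n}. path s' \<triangleright>\<^bsub>P n\<^esub> (\<epsilon> n j \<triangleleft>\<^bsub>P n\<^esub> b s' j)) = (if s = s' then ?v else \<zero>\<^bsub>\<Lambda>\<^esub>)" .
  qed (use v in auto)
  also have "\<dots> = ?v"
  proof (cases "s \<in> F")
    case True
    then show ?thesis using F v by (subst \<Lambda>.finsum_singleton) auto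
  next
    case False
    have "(if s = s' then ?v else \<zero>\<^bsub>\<Lambda>\<^esub>) = \<zero>\<^bsub>\<Lambda>\<^esub>" if "s' \<in> F" for s'
      by (rule if_not_P) (use False that in blast)
    then have "(\<Oplus>\<^bsub>\<Lambda>\<^esub>s'\<in>F. if s = s' then ?v else \<zero>\<^bsub>\<Lambda>\<^esub>) = \<zero>\<^bsub>\<Lambda>\<^esub>" by (rule \<Lambda>.finsum_all_zero)
    then show ?thesis using False by (simp only: simp_thms if_False)
  qed
  finally show ?thesis .
qed

text \<open>The freedom in \<open>F\<close> allows the expansions of two elements to be added over
  the union of their index sets.\<close>

lemma expand_P:
  assumes "x \<in> carrier (P n)"
  obtains F0 where "finite F0" "F0 \<subseteq> S" "\<And>F. finite F \<Longrightarrow> F0 \<subseteq> F \<Longrightarrow> F \<subseteq> S \<Longrightarrow>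
    x = (\<Oplus>\<^bsub>P n\<^esub>s\<in>F. \<Oplus>\<^bsub>P n\<^esub>i\<in>{..<N n}. path s \<triangleright>\<^bsub>P n\<^esub> (\<epsilon> n i \<triangleleft>\<^bsub>P n\<^esub> \<Phi> n s i x))"
proof -
  have cl: "(\<Oplus>\<^bsub>P n\<^esub>i\<in>{..<N n}. path s \<triangleright>\<^bsub>P n\<^esub> (\<epsilon> n i \<triangleleft>\<^bsub>P n\<^esub> \<Phi> n s i x)) \<in> carrier (P n)"
    if "s \<in> S" "x \<in> carrier (P n)" for s x
    using that by (intro P.M.finsum_closed) auto
  have "\<exists>F0. finite F0 \<and> F0 \<subseteq> S \<and> (\<forall>F. finite F \<longrightarrow> F0 \<subseteq> F \<longrightarrow> F \<subseteq> S \<longrightarrow>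
    x = (\<Oplus>\<^bsub>P n\<^esub>s\<in>F. \<Oplus>\<^bsub>P n\<^esub>i\<in>{..<N n}. path s \<triangleright>\<^bsub>P n\<^esub> (\<epsilon> n i \<triangleleft>\<^bsub>P n\<^esub> \<Phi> n s i x)))"
    using assms
  proof (induction x rule: P_induct)
    case zero
    have "(\<Oplus>\<^bsub>P n\<^esub>s\<in>F. \<Oplus>\<^bsub>P n\<^esub>i\<in>{..<N n}. path s \<triangleright>\<^bsub>P n\<^esub> (\<epsilon> n i \<triangleleft>\<^bsub>P n\<^esub> \<Phi> n s i \<zero>\<^bsub>P n\<^esub>)) = \<zero>\<^bsub>P n\<^esub>" if "F \<subseteq> S" for F
      by (intro P.M.finsum_all_zero) (use that in \<open>auto simp: \<Phi>_zero\<close>)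
    then show ?case by (intro exI[of _ "{}"]) auto
  next
    case (gen j a b)
    obtain F0 where F0: "finite F0" "F0 \<subseteq> S" "\<And>s. s \<in> S - F0 \<Longrightarrow> \<psi> s a = 0"
      "\<And>F. finite F \<Longrightarrow> F0 \<subseteq> F \<Longrightarrow> F \<subseteq> S \<Longrightarrow> a = (\<Oplus>\<^bsub>\<Lambda>\<^esub>s\<in>F. \<kappa> (\<psi> s a) \<otimes>\<^bsub>\<Lambda>\<^esub> path s)"
      by (rule expand_\<Lambda>[OF gen(2)]) (rule that)
    let ?x = "a \<triangleright>\<^bsub>P n\<^esub> (\<epsilon> n j \<triangleleft>\<^bsub>P n\<^esub> b)"
    have "?x = (\<Oplus>\<^bsub>P n\<^esub>s\<in>F. \<Oplus>\<^bsub>P n\<^esub>i\<in>{..<N n}. path s \<triangleright>\<^bsub>P n\<^esub> (\<epsilon> n i \<triangleleft>\<^bsub>P n\<^esub> \<Phi> n s i ?x))"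
      if F: "finite F" "F0 \<subseteq> F" "F \<subseteq> S" for F
    proof -
      have inner: "(\<Oplus>\<^bsub>P n\<^esub>i\<in>{..<N n}. path s \<triangleright>\<^bsub>P n\<^esub> (\<epsilon> n i \<triangleleft>\<^bsub>P n\<^esub> \<Phi> n s i ?x)) =
          (\<kappa> (\<psi> s a) \<otimes>\<^bsub>\<Lambda>\<^esub> path s) \<triangleright>\<^bsub>P n\<^esub> (\<epsilon> n j \<triangleleft>\<^bsub>P n\<^esub> b)" if s: "s \<in> S" for s
      proof -
        let ?y = "path s \<triangleright>\<^bsub>P n\<^esub> (\<epsilon> n j \<triangleleft>\<^bsub>P n\<^esub> \<Phi> n s j ?x)"
        have "(\<Oplus>\<^bsub>P n\<^esub>i\<in>{..<N n}. path s \<triangleright>\<^bsub>P n\<^esub> (\<epsilon> n i \<triangleleft>\<^bsub>P n\<^esub> \<Phi> n s i ?x)) =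
            (\<Oplus>\<^bsub>P n\<^esub>i\<in>{..<N n}. if j = i then ?y else \<zero>\<^bsub>P n\<^esub>)"
          by (rule P.M.finsum_cong'[OF refl]) (use gen s in \<open>auto simp: \<Phi>_gen[OF s]\<close>)
        also have "\<dots> = ?y" by (rule P.M.finsum_singleton) (use gen s in auto)
        also have "?y = (\<kappa> (\<psi> s a) \<otimes>\<^bsub>\<Lambda>\<^esub> path s) \<triangleright>\<^bsub>P n\<^esub> (\<epsilon> n j \<triangleleft>\<^bsub>P n\<^esub> b)"
        proof (cases "qpath_end Q s = org n j")
          case True
          note e = E_closed[OF trm_verts[OF gen(1)]]
          have "\<epsilon> n j \<triangleleft>\<^bsub>P n\<^esub> (\<kappa> (\<psi> s a) \<otimes>\<^bsub>\<Lambda>\<^esub> (E (trm n j) \<otimes>\<^bsub>\<Lambda>\<^esub> b)) = \<kappa> (\<psi> s a) \<triangleright>\<^bsub>P n\<^esub> (\<epsilon> n j \<triangleleft>\<^bsub>P n\<^esub> b)"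
            using gen e by (simp add: P.rs_assoc P.ls_rs \<epsilon>_E flip: P.\<kappa>_central)
          then show ?thesis using gen s True by (simp add: \<Phi>_gen[OF s] P.\<kappa>_ls_comm P.ls_assoc)
        next
          case False
          have "path s \<triangleright>\<^bsub>P n\<^esub> \<epsilon> n j = \<zero>\<^bsub>P n\<^esub>"
            by (rule ls_\<epsilon>_zero) (use gen s False path_E[OF s org_verts[OF gen(1)]] in auto)
          then have "path s \<triangleright>\<^bsub>P n\<^esub> (\<epsilon> n j \<triangleleft>\<^bsub>P n\<^esub> b) = \<zero>\<^bsub>P n\<^esub>" using gen s by (simp flip: P.ls_rs)
          then show ?thesis using gen s False by (simp add: \<Phi>_gen[OF s] P.ls_assoc)
        qed
        finally show ?thesis .
      qed
      have "(\<Oplus>\<^bsub>P n\<^esub>s\<in>F. \<Oplus>\<^bsub>P n\<^esub>i\<in>{..<N n}. path s \<triangleright>\<^bsub>P n\<^esub> (\<epsilon> n i \<triangleleft>\<^bsub>P n\<^esub> \<Phi> n s i ?x)) =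
          (\<Oplus>\<^bsub>P n\<^esub>s\<in>F. (\<kappa> (\<psi> s a) \<otimes>\<^bsub>\<Lambda>\<^esub> path s) \<triangleright>\<^bsub>P n\<^esub> (\<epsilon> n j \<triangleleft>\<^bsub>P n\<^esub> b))"
        by (rule P.M.finsum_cong'[OF refl]) (use F gen inner in auto)
      also have "\<dots> = (\<Oplus>\<^bsub>\<Lambda>\<^esub>s\<in>F. \<kappa> (\<psi> s a) \<otimes>\<^bsub>\<Lambda>\<^esub> path s) \<triangleright>\<^bsub>P n\<^esub> (\<epsilon> n j \<triangleleft>\<^bsub>P n\<^esub> b)"
        by (rule additive_map_finsum[where h = "\<lambda>a. a \<triangleright>\<^bsub>P n\<^esub> (\<epsilon> n j \<triangleleft>\<^bsub>P n\<^esub> b)", OF \<Lambda>.abelian_group_axioms P.M.abelian_group_axioms, symmetric])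
          (use F gen in \<open>auto simp: P.add_ls\<close>)
      also have "\<dots> = ?x"
        by (rule arg_cong[where f = "\<lambda>a. a \<triangleright>\<^bsub>P n\<^esub> (\<epsilon> n j \<triangleleft>\<^bsub>P n\<^esub> b)"]) (rule F0(4)[OF F, symmetric])
      finally show ?thesis by (rule sym)
    qed
    then show ?case using F0(1,2) by (intro exI[of _ F0]) blast
  next
    case (add x y)
    obtain F0 where F0: "finite F0" "F0 \<subseteq> S" "\<And>F. finite F \<Longrightarrow> F0 \<subseteq> F \<Longrightarrow> F \<subseteq> S \<Longrightarrow>
        x = (\<Oplus>\<^bsub>P n\<^esub>s\<in>F. \<Oplus>\<^bsub>P n\<^esub>i\<in>{..<N n}. path s \<triangleright>\<^bsub>P n\<^esub> (\<epsilon> n i \<triangleleft>\<^bsub>P n\<^esub> \<Phi> n s i x))" using add(3) by blast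
    obtain F1 where F1: "finite F1" "F1 \<subseteq> S" "\<And>F. finite F \<Longrightarrow> F1 \<subseteq> F \<Longrightarrow> F \<subseteq> S \<Longrightarrow>
        y = (\<Oplus>\<^bsub>P n\<^esub>s\<in>F. \<Oplus>\<^bsub>P n\<^esub>i\<in>{..<N n}. path s \<triangleright>\<^bsub>P n\<^esub> (\<epsilon> n i \<triangleleft>\<^bsub>P n\<^esub> \<Phi> n s i y))" using add(4) by blast
    have "x \<oplus>\<^bsub>P n\<^esub> y = (\<Oplus>\<^bsub>P n\<^esub>s\<in>F. \<Oplus>\<^bsub>P n\<^esub>i\<in>{..<N n}. path s \<triangleright>\<^bsub>P n\<^esub> (\<epsilon> n i \<triangleleft>\<^bsub>P n\<^esub> \<Phi> n s i (x \<oplus>\<^bsub>P n\<^esub> y)))"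
      if F: "finite F" "F0 \<union> F1 \<subseteq> F" "F \<subseteq> S" for F
    proof -
      let ?g = "\<lambda>x s. \<Oplus>\<^bsub>P n\<^esub>i\<in>{..<N n}. path s \<triangleright>\<^bsub>P n\<^esub> (\<epsilon> n i \<triangleleft>\<^bsub>P n\<^esub> \<Phi> n s i x)"
      have "?g (x \<oplus>\<^bsub>P n\<^esub> y) s = ?g x s \<oplus>\<^bsub>P n\<^esub> ?g y s" if s: "s \<in> F" for s
      proof -
        have s': "s \<in> S" using s F by auto
        have "?g (x \<oplus>\<^bsub>P n\<^esub> y) s = (\<Oplus>\<^bsub>P n\<^esub>i\<in>{..<N n}. path s \<triangleright>\<^bsub>P n\<^esub> (\<epsilon> n i \<triangleleft>\<^bsub>P n\<^esub> \<Phi> n s i x) \<oplus>\<^bsub>P n\<^esub> path s \<triangleright>\<^bsub>P n\<^esub> (\<epsilon> n i \<triangleleft>\<^bsub>P n\<^esub> \<Phi> n s i y))"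
          by (rule P.M.finsum_cong'[OF refl]) (use add s' in \<open>auto simp: \<Phi>_add P.rs_add P.ls_add\<close>)
        also have "\<dots> = ?g x s \<oplus>\<^bsub>P n\<^esub> ?g y s" by (rule P.M.finsum_addf) (use add s' in auto)
        finally show ?thesis .
      qed
      then have "finsum (P n) (?g (x \<oplus>\<^bsub>P n\<^esub> y)) F = (\<Oplus>\<^bsub>P n\<^esub>s\<in>F. ?g x s \<oplus>\<^bsub>P n\<^esub> ?g y s)"
        using add(1,2) F cl by (intro P.M.finsum_cong'[OF refl]) auto
      also have "\<dots> = finsum (P n) (?g x) F \<oplus>\<^bsub>P n\<^esub> finsum (P n) (?g y) F"
        by (rule P.M.finsum_addf) (use add(1,2) F cl in auto)
      also have "\<dots> = x \<oplus>\<^bsub>P n\<^esub> y"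
        by (rule arg_cong2[where f = "add (P n)"]; rule sym; rule F0(3)[OF F(1) _ F(3)] F1(3)[OF F(1) _ F(3)]; use F(2) in blast)
      finally show ?thesis by (rule sym)
    qed
    then show ?case using F0(1,2) F1(1,2) by (intro exI[of _ "F0 \<union> F1"]) blast
  qed
  then show thesis using that by blast
qed

section \<open>The degree filtration on right factors\<close>

definition Lt :: "nat \<Rightarrow> ('v, 'b, 'k) path_comb set set" where
  "Lt e = {\<pi> x | x. x \<in> carrier R \<and> Poly_Mapping.keys x \<subseteq> {w. length (snd w) < e}}"

lemma Lt_closed: "a \<in> Lt e \<Longrightarrow> a \<in> carrier \<Lambda>"
  unfolding Lt_def using \<pi>_closed by blast

lemma Lt_I: "x \<in> carrier R \<Longrightarrow> Poly_Mapping.keys x \<subseteq> {w. length (snd w) < e} \<Longrightarrow> \<pi> x \<in> Lt e"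
  unfolding Lt_def by blast

lemma Lt_zero [simp]: "\<zero>\<^bsub>\<Lambda>\<^esub> \<in> Lt e"
  using Lt_I[of 0 e] by simp

text \<open>No path is shorter than 0, so a right factor with exhausted degree bound vanishes. With
  the natural subtraction in \<open>T - length (snd s)\<close> this is what ends the induction for
  exactness.\<close>

lemma Lt_0: "a \<in> Lt 0 \<Longrightarrow> a = \<zero>\<^bsub>\<Lambda>\<^esub>"
proof -
  assume "a \<in> Lt 0"
  then obtain x :: "('v, 'b, 'k) path_comb" where x: "a = \<pi> x" "Poly_Mapping.keys x \<subseteq> {w. length (snd w) < 0}" by (auto simp: Lt_def)
  then have "x = 0" using keys_nonempty[of x] by auto
  then show ?thesis using x by simp
qed

lemma Lt_add: "a \<in> Lt e \<Longrightarrow> b \<in> Lt e \<Longrightarrow> a \<oplus>\<^bsub>\<Lambda>\<^esub> b \<in> Lt e"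
proof -
  assume "a \<in> Lt e" "b \<in> Lt e"
  then obtain x y :: "('v, 'b, 'k) path_comb" where xy: "x \<in> carrier R" "a = \<pi> x" "Poly_Mapping.keys x \<subseteq> {w. length (snd w) < e}"
    "y \<in> carrier R" "b = \<pi> y" "Poly_Mapping.keys y \<subseteq> {w. length (snd w) < e}" unfolding Lt_def by blast
  have "\<pi> (x + y) \<in> Lt e"
    using xy by (intro Lt_I pm.subspace_add[OF carrier_subspace] keys_add_subset)
  then show ?thesis using xy by (simp add: \<pi>_add del: path_algebra_simps)
qed

lemma Lt_mono: "e \<le> e' \<Longrightarrow> a \<in> Lt e \<Longrightarrow> a \<in> Lt e'"
  unfolding Lt_def by fastforce

lemma Lt_\<kappa>: "a \<in> Lt e \<Longrightarrow> \<kappa> t \<otimes>\<^bsub>\<Lambda>\<^esub> a \<in> Lt e"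
proof -
  assume "a \<in> Lt e"
  then obtain x :: "('v, 'b, 'k) path_comb" where x: "x \<in> carrier R" "a = \<pi> x" "Poly_Mapping.keys x \<subseteq> {w. length (snd w) < e}"
    unfolding Lt_def by blast
  have "\<pi> (pm_scale t x) \<in> Lt e"
    using x keys_pm_scale[of t x] by (intro Lt_I closed_scale) auto
  then show ?thesis using x by (simp add: \<kappa>_\<pi> del: path_algebra_simps)
qed

lemma Lt_E: "v \<in> verts Q \<Longrightarrow> a \<in> Lt e \<Longrightarrow> E v \<otimes>\<^bsub>\<Lambda>\<^esub> a \<in> Lt e"
proof -
  assume v: "v \<in> verts Q" and "a \<in> Lt e"
  then obtain x :: "('v, 'b, 'k) path_comb" where x: "x \<in> carrier R" "a = \<pi> x" "Poly_Mapping.keys x \<subseteq> {w. length (snd w) < e}"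
    unfolding Lt_def by blast
  have "Poly_Mapping.keys (vertex v \<otimes>\<^bsub>R\<^esub> x) \<subseteq> Poly_Mapping.keys x"
    by (auto simp: in_keys_iff lookup_vertex_mult split: if_splits)
  then have "\<pi> (vertex v \<otimes>\<^bsub>R\<^esub> x) \<in> Lt e"
    using x v by (intro Lt_I mult_closed vertex_closed) auto
  then show ?thesis using x v by (simp add: \<pi>_mult del: path_algebra_simps)
qed

lemma Lt_minus: "a \<in> Lt e \<Longrightarrow> \<ominus>\<^bsub>\<Lambda>\<^esub> a \<in> Lt e"
proof -
  assume a: "a \<in> Lt e"
  have "\<ominus>\<^bsub>\<Lambda>\<^esub> a = \<kappa> (- 1) \<otimes>\<^bsub>\<Lambda>\<^esub> a"
    using Lt_closed[OF a] by (simp add: \<Lambda>.\<kappa>_uminus \<Lambda>.l_minus)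
  then show ?thesis using Lt_\<kappa>[OF a] by simp
qed

lemma Lt_exists:
  assumes "a \<in> carrier \<Lambda>" obtains e where "a \<in> Lt e"
proof -
  obtain x where x: "x \<in> carrier R" "a = \<pi> x" using assms by (rule \<pi>_surj)
  have "finite ((\<lambda>w. length (snd w)) ` Poly_Mapping.keys x)" by simp
  then obtain e where "\<forall>k\<in>(\<lambda>w. length (snd w)) ` Poly_Mapping.keys x. k < e"
    using finite_nat_set_iff_bounded by blast
  then have "a \<in> Lt e" unfolding x(2) using x(1) by (intro Lt_I) auto
  then show thesis by (rule that)
qed

lemma Lt_finsum: "(\<And>i. i \<in> X \<Longrightarrow> g i \<in> Lt e) \<Longrightarrow> (\<Oplus>\<^bsub>\<Lambda>\<^esub>i\<in>X. g i) \<in> Lt e"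
proof (induction X rule: infinite_finite_induct)
  case (insert i X)
  then have "g \<in> X \<rightarrow> carrier \<Lambda>" "g i \<in> carrier \<Lambda>" using Lt_closed by blast+
  then show ?case using insert by (simp add: \<Lambda>.finsum_insert Lt_add)
qed simp_all

lemma Lt_lc: "(\<And>i. i \<in> X \<Longrightarrow> g i \<in> Lt e) \<Longrightarrow> reg.lc X w g \<in> Lt e"
  by (subst \<Lambda>.lc_regular) (auto intro: Lt_closed Lt_finsum Lt_\<kappa>)

lemma Lt_lc2: "(\<And>i j. i \<in> X \<Longrightarrow> j \<in> Y \<Longrightarrow> g i j \<in> Lt e) \<Longrightarrow> reg.lc2 X Y w g \<in> Lt e"
  unfolding reg.lc2_def by (intro Lt_lc)

section \<open>The two halves of the differential as bimodule maps\<close>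

definition "Lh n = (SOME h. h \<in> bimod_hom \<Lambda> (P (Suc n)) (P n) \<and> (\<forall>i<N (Suc n). h (\<epsilon> (Suc n) i) = dl n i))"
definition "Rh n = (SOME h. h \<in> bimod_hom \<Lambda> (P (Suc n)) (P n) \<and> (\<forall>i<N (Suc n). h (\<epsilon> (Suc n) i) = dr n i))"

lemma Lh_spec: "Lh n \<in> bimod_hom \<Lambda> (P (Suc n)) (P n) \<and> (\<forall>i<N (Suc n). Lh n (\<epsilon> (Suc n) i) = dl n i)"
proof -
  obtain h where "h \<in> bimod_hom \<Lambda> (P (Suc n)) (P n)" "\<And>i. i < N (Suc n) \<Longrightarrow> h (\<epsilon> (Suc n) i) = dl n i"
    using P_hom_exists[OF P_bimodule, of "Suc n" "dl n" n] dl_E by auto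
  then have "\<exists>h. h \<in> bimod_hom \<Lambda> (P (Suc n)) (P n) \<and> (\<forall>i<N (Suc n). h (\<epsilon> (Suc n) i) = dl n i)" by blast
  then show ?thesis unfolding Lh_def by (rule someI_ex)
qed

lemma Rh_spec: "Rh n \<in> bimod_hom \<Lambda> (P (Suc n)) (P n) \<and> (\<forall>i<N (Suc n). Rh n (\<epsilon> (Suc n) i) = dr n i)"
proof -
  obtain h where "h \<in> bimod_hom \<Lambda> (P (Suc n)) (P n)" "\<And>i. i < N (Suc n) \<Longrightarrow> h (\<epsilon> (Suc n) i) = dr n i"
    using P_hom_exists[OF P_bimodule, of "Suc n" "dr n" n] dr_E by auto
  then have "\<exists>h. h \<in> bimod_hom \<Lambda> (P (Suc n)) (P n) \<and> (\<forall>i<N (Suc n). h (\<epsilon> (Suc n) i) = dr n i)" by blast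
  then show ?thesis unfolding Rh_def by (rule someI_ex)
qed

lemmas Lh_hom = Lh_spec[THEN conjunct1] and Lh_\<epsilon> = Lh_spec[THEN conjunct2, rule_format]
lemmas Rh_hom = Rh_spec[THEN conjunct1] and Rh_\<epsilon> = Rh_spec[THEN conjunct2, rule_format]

lemma \<delta>_split: "x \<in> carrier (P (Suc n)) \<Longrightarrow> \<delta> (Suc n) x = Lh n x \<oplus>\<^bsub>P n\<^esub> \<kappa> ((- 1) ^ Suc n) \<triangleright>\<^bsub>P n\<^esub> Rh n x"
proof (induction x rule: P_induct)
  case zero
  then show ?case
    using bimod_hom_zero[OF P_bimodule P_bimodule \<delta>_hom[of n]] bimod_hom_zero[OF P_bimodule P_bimodule Lh_hom[of n]]
      bimod_hom_zero[OF P_bimodule P_bimodule Rh_hom[of n]] by (simp del: power_Suc)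
next
  case (gen i a b)
  then show ?case
    by (simp add: bimod_homD[OF \<delta>_hom] bimod_homD[OF Lh_hom] bimod_homD[OF Rh_hom] \<delta>_\<epsilon> Lh_\<epsilon> Rh_\<epsilon> d_def
        P.add_rs P.ls_add P.ls_rs P.\<kappa>_ls_comm[of _ _ a] del: power_Suc)
next
  case (add x y)
  then show ?case using bimod_homD(2)[OF Lh_hom[of n]] bimod_homD(2)[OF Rh_hom[of n]]
    by (simp add: bimod_homD(3)[OF \<delta>_hom] bimod_homD(3)[OF Lh_hom] bimod_homD(3)[OF Rh_hom] P.ls_add P.M.a_ac del: power_Suc)
qed

lemma \<Phi>_Lh_gen:
  assumes s: "s \<in> S" "s' \<in> S" and l: "l < N (Suc n)" and j: "j < N n" and b: "b \<in> carrier \<Lambda>"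
  shows "\<Phi> n s' j (Lh n (path s \<triangleright>\<^bsub>P (Suc n)\<^esub> (\<epsilon> (Suc n) l \<triangleleft>\<^bsub>P (Suc n)\<^esub> b))) =
    reg.lc2 {..<N 1} {..<N n} (c (Suc n) l 1) (\<lambda>p i. \<Phi> n s' j ((path s \<otimes>\<^bsub>\<Lambda>\<^esub> arr p) \<triangleright>\<^bsub>P n\<^esub> (\<epsilon> n i \<triangleleft>\<^bsub>P n\<^esub> b)))"
proof -
  let ?w = "c (Suc n) l 1"
  let ?g = "\<lambda>p i. (path s \<otimes>\<^bsub>\<Lambda>\<^esub> arr p) \<triangleright>\<^bsub>P n\<^esub> (\<epsilon> n i \<triangleleft>\<^bsub>P n\<^esub> b)"
  have 1: "Lh n (path s \<triangleright>\<^bsub>P (Suc n)\<^esub> (\<epsilon> (Suc n) l \<triangleleft>\<^bsub>P (Suc n)\<^esub> b)) = path s \<triangleright>\<^bsub>P n\<^esub> (dl n l \<triangleleft>\<^bsub>P n\<^esub> b)"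
    using s l b by (simp add: bimod_homD[OF Lh_hom] Lh_\<epsilon>)
  have 2: "dl n l \<triangleleft>\<^bsub>P n\<^esub> b = P.lc2 n {..<N 1} {..<N n} ?w (\<lambda>p i. (arr p \<triangleright>\<^bsub>P n\<^esub> \<epsilon> n i) \<triangleleft>\<^bsub>P n\<^esub> b)"
    unfolding dl_def by (rule P.lc2_rs) (use b in \<open>auto simp del: One_nat_def\<close>)
  have 3: "path s \<triangleright>\<^bsub>P n\<^esub> P.lc2 n {..<N 1} {..<N n} ?w (\<lambda>p i. (arr p \<triangleright>\<^bsub>P n\<^esub> \<epsilon> n i) \<triangleleft>\<^bsub>P n\<^esub> b) =
      P.lc2 n {..<N 1} {..<N n} ?w (\<lambda>p i. path s \<triangleright>\<^bsub>P n\<^esub> ((arr p \<triangleright>\<^bsub>P n\<^esub> \<epsilon> n i) \<triangleleft>\<^bsub>P n\<^esub> b))"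
    by (rule P.lc2_ls) (use b s in \<open>auto simp del: One_nat_def\<close>)
  have 4: "P.lc2 n {..<N 1} {..<N n} ?w (\<lambda>p i. path s \<triangleright>\<^bsub>P n\<^esub> ((arr p \<triangleright>\<^bsub>P n\<^esub> \<epsilon> n i) \<triangleleft>\<^bsub>P n\<^esub> b)) = P.lc2 n {..<N 1} {..<N n} ?w ?g"
    by (rule P.lc2_cong_eq) (use b s in \<open>auto simp: P.ls_rs P.ls_assoc simp del: One_nat_def\<close>)
  show ?thesis unfolding 1 2 3 4
    by (rule \<Phi>_lc2[OF s(2) j]) (use b s in \<open>auto simp del: One_nat_def\<close>)
qed

text \<open>A basis path followed by an arrow is homogeneous of length one more, and by
  \<open>\<phi>_graded\<close> its normal form involves basis paths of that length only.\<close>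

lemma \<psi>_path_arr:
  assumes "s \<in> S" "s' \<in> S" "p < N 1" "length (snd s') \<noteq> Suc (length (snd s))"
  shows "\<psi> s' (path s \<otimes>\<^bsub>\<Lambda>\<^esub> arr p) = 0"
proof -
  let ?x = "Poly_Mapping.single s 1 \<otimes>\<^bsub>R\<^esub> f 1 p"
  have x: "?x \<in> carrier R" using assms by (intro mult_closed S_closed f_closed)
  have "Poly_Mapping.keys ?x \<subseteq> {w. length (snd w) = length (snd s) + 1}"
    by (rule homogeneous_mult) (use assms f_keys in auto)
  then have "?x \<in> homogeneous_elts Q (length (snd s) + 1)" using x by (auto simp: homogeneous_elts_def)
  then have "\<phi> s' ?x = 0" using assms by (intro \<phi>_graded) auto
  then show ?thesis
    using \<psi>_\<pi>[OF assms(2) x] \<pi>_mult[OF S_closed[OF assms(1), of 1] f_closed[OF assms(3)]] by simp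
qed

lemma \<Phi>_Lh_degree:
  assumes "s \<in> S" "s' \<in> S" "l < N (Suc n)" "j < N n" "b \<in> carrier \<Lambda>" "length (snd s') \<noteq> Suc (length (snd s))"
  shows "\<Phi> n s' j (Lh n (path s \<triangleright>\<^bsub>P (Suc n)\<^esub> (\<epsilon> (Suc n) l \<triangleleft>\<^bsub>P (Suc n)\<^esub> b))) = \<zero>\<^bsub>\<Lambda>\<^esub>"
  unfolding \<Phi>_Lh_gen[OF assms(1-5)]
proof (rule reg.lc2_zero[simplified])
  fix p i assume pi: "p \<in> {..<N 1}" "i \<in> {..<N n}"
  have "\<Phi> n s' j ((path s \<otimes>\<^bsub>\<Lambda>\<^esub> arr p) \<triangleright>\<^bsub>P n\<^esub> (\<epsilon> n i \<triangleleft>\<^bsub>P n\<^esub> b)) = \<zero>\<^bsub>\<Lambda>\<^esub>"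
    using pi assms E_closed[OF trm_verts[OF assms(4)]] \<psi>_path_arr[OF assms(1,2) _ assms(6), of p]
    by (simp add: \<Phi>_gen[OF assms(2,4)] del: One_nat_def)
  then show "\<kappa> (c (Suc n) l 1 p i) \<otimes>\<^bsub>\<Lambda>\<^esub> \<Phi> n s' j ((path s \<otimes>\<^bsub>\<Lambda>\<^esub> arr p) \<triangleright>\<^bsub>P n\<^esub> (\<epsilon> n i \<triangleleft>\<^bsub>P n\<^esub> b)) = \<zero>\<^bsub>\<Lambda>\<^esub>" by simp
qed

text \<open>The left half changes right factors only by scalars and vertices, neither of which
  raises the degree.\<close>

lemma \<Phi>_Lh_Lt:
  assumes "s \<in> S" "s' \<in> S" "l < N (Suc n)" "j < N n" "b \<in> Lt e"
  shows "\<Phi> n s' j (Lh n (path s \<triangleright>\<^bsub>P (Suc n)\<^esub> (\<epsilon> (Suc n) l \<triangleleft>\<^bsub>P (Suc n)\<^esub> b))) \<in> Lt e"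
  unfolding \<Phi>_Lh_gen[OF assms(1-4) Lt_closed[OF assms(5)]]
  by (rule Lt_lc2) (use assms Lt_closed[OF assms(5)] in \<open>auto simp: \<Phi>_gen[OF assms(2,4)] intro!: Lt_\<kappa> Lt_E simp del: One_nat_def\<close>)

lemma \<Phi>_Lh_sum:
  assumes F: "F \<subseteq> S" and s: "s \<in> S" and j: "j < N n"
    and b: "\<And>s i. s \<in> F \<Longrightarrow> i < N (Suc n) \<Longrightarrow> b s i \<in> carrier \<Lambda>"
  shows "\<Phi> n s j (Lh n (\<Oplus>\<^bsub>P (Suc n)\<^esub>s'\<in>F. \<Oplus>\<^bsub>P (Suc n)\<^esub>i\<in>{..<N (Suc n)}. path s' \<triangleright>\<^bsub>P (Suc n)\<^esub> (\<epsilon> (Suc n) i \<triangleleft>\<^bsub>P (Suc n)\<^esub> b s' i))) =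
    (\<Oplus>\<^bsub>\<Lambda>\<^esub>s'\<in>F. \<Oplus>\<^bsub>\<Lambda>\<^esub>i\<in>{..<N (Suc n)}. \<Phi> n s j (Lh n (path s' \<triangleright>\<^bsub>P (Suc n)\<^esub> (\<epsilon> (Suc n) i \<triangleleft>\<^bsub>P (Suc n)\<^esub> b s' i))))"
proof -
  let ?h = "\<lambda>x. \<Phi> n s j (Lh n x)"
  have h: "?h \<in> carrier (P (Suc n)) \<rightarrow> carrier \<Lambda>"
    using \<Phi>_closed[OF s j] bimod_homD(2)[OF Lh_hom[of n]] by auto
  have h_add: "?h (x \<oplus>\<^bsub>P (Suc n)\<^esub> y) = ?h x \<oplus>\<^bsub>\<Lambda>\<^esub> ?h y" if "x \<in> carrier (P (Suc n))" "y \<in> carrier (P (Suc n))" for x y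
    using that bimod_homD(2)[OF Lh_hom[of n]] by (simp add: bimod_homD(3)[OF Lh_hom] \<Phi>_add[OF s j])
  note sum = additive_map_finsum[where h = ?h, OF P.M.abelian_group_axioms \<Lambda>.abelian_group_axioms h h_add]
  have in1: "path s' \<triangleright>\<^bsub>P (Suc n)\<^esub> (\<epsilon> (Suc n) i \<triangleleft>\<^bsub>P (Suc n)\<^esub> b s' i) \<in> carrier (P (Suc n))" if "s' \<in> F" "i < N (Suc n)" for s' i
    using that b[OF that] F by auto
  have in2: "(\<Oplus>\<^bsub>P (Suc n)\<^esub>i\<in>{..<N (Suc n)}. path s' \<triangleright>\<^bsub>P (Suc n)\<^esub> (\<epsilon> (Suc n) i \<triangleleft>\<^bsub>P (Suc n)\<^esub> b s' i)) \<in> carrier (P (Suc n))" if "s' \<in> F" for s'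
    using that in1 by (intro P.M.finsum_closed) auto
  have "?h (\<Oplus>\<^bsub>P (Suc n)\<^esub>s'\<in>F. \<Oplus>\<^bsub>P (Suc n)\<^esub>i\<in>{..<N (Suc n)}. path s' \<triangleright>\<^bsub>P (Suc n)\<^esub> (\<epsilon> (Suc n) i \<triangleleft>\<^bsub>P (Suc n)\<^esub> b s' i)) =
      (\<Oplus>\<^bsub>\<Lambda>\<^esub>s'\<in>F. ?h (\<Oplus>\<^bsub>P (Suc n)\<^esub>i\<in>{..<N (Suc n)}. path s' \<triangleright>\<^bsub>P (Suc n)\<^esub> (\<epsilon> (Suc n) i \<triangleleft>\<^bsub>P (Suc n)\<^esub> b s' i)))"
    by (rule sum) (use in2 in auto)
  also have "\<dots> = (\<Oplus>\<^bsub>\<Lambda>\<^esub>s'\<in>F. \<Oplus>\<^bsub>\<Lambda>\<^esub>i\<in>{..<N (Suc n)}. ?h (path s' \<triangleright>\<^bsub>P (Suc n)\<^esub> (\<epsilon> (Suc n) i \<triangleleft>\<^bsub>P (Suc n)\<^esub> b s' i)))"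
  proof (rule \<Lambda>.finsum_cong'[OF refl])
    fix s' assume s': "s' \<in> F"
    show "?h (\<Oplus>\<^bsub>P (Suc n)\<^esub>i\<in>{..<N (Suc n)}. path s' \<triangleright>\<^bsub>P (Suc n)\<^esub> (\<epsilon> (Suc n) i \<triangleleft>\<^bsub>P (Suc n)\<^esub> b s' i)) =
        (\<Oplus>\<^bsub>\<Lambda>\<^esub>i\<in>{..<N (Suc n)}. ?h (path s' \<triangleright>\<^bsub>P (Suc n)\<^esub> (\<epsilon> (Suc n) i \<triangleleft>\<^bsub>P (Suc n)\<^esub> b s' i)))"
      by (rule sum) (use in1 s' in auto)
  qed (use in1 h in \<open>auto intro!: \<Lambda>.finsum_closed\<close>)
  finally show ?thesis .
qed

lemma \<kappa>_left_comm: "a \<in> carrier \<Lambda> \<Longrightarrow> x \<in> carrier \<Lambda> \<Longrightarrow> a \<otimes>\<^bsub>\<Lambda>\<^esub> (\<kappa> t \<otimes>\<^bsub>\<Lambda>\<^esub> x) = \<kappa> t \<otimes>\<^bsub>\<Lambda>\<^esub> (a \<otimes>\<^bsub>\<Lambda>\<^esub> x)"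
  using \<Lambda>.m_assoc[of a "\<kappa> t" x] \<Lambda>.m_assoc[of "\<kappa> t" a x] \<Lambda>.\<kappa>_comm[of a t] by simp

lemma arr_E_mult: "q < N 1 \<Longrightarrow> x \<in> carrier \<Lambda> \<Longrightarrow> arr q \<otimes>\<^bsub>\<Lambda>\<^esub> (E (trm 1 q) \<otimes>\<^bsub>\<Lambda>\<^esub> x) = arr q \<otimes>\<^bsub>\<Lambda>\<^esub> x"
  using \<Lambda>.m_assoc[of "arr q" "E (trm 1 q)" x] by (simp add: arr_E del: path_algebra_simps One_nat_def)

lemma E_arr_zero:
  assumes "q < N 1" "j < N n" "x \<in> carrier \<Lambda>" "trm n j \<noteq> org 1 q"
  shows "E (trm n j) \<otimes>\<^bsub>\<Lambda>\<^esub> (arr q \<otimes>\<^bsub>\<Lambda>\<^esub> x) = \<zero>\<^bsub>\<Lambda>\<^esub>"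
  using \<Lambda>.m_assoc[of "E (trm n j)" "arr q" x] assms by (simp add: E_arr del: path_algebra_simps One_nat_def)

text \<open>The case split behind the coordinate formula of the right half: the structure constant
  is zero, the product with the arrow is zero, or the ends match.\<close>

lemma right_support:
  assumes "i < N (Suc n)" "j < N n" "q < N 1"
  obtains "c (Suc n) i n j q = 0" | "trm n j \<noteq> org 1 q" | "org n j = org (Suc n) i" "trm 1 q = trm (Suc n) i"
  using comult_support[of i "Suc n" n j q] assms by fastforce

text \<open>The right half leaves the left path \<open>s\<close> alone; on the family of right
  factors behind \<open>s\<close> it is the differential of the right resolution, in the form of
  \<open>rdiff\<close>.\<close>

lemma \<Phi>_Rh:
  assumes s: "s \<in> S" and j: "j < N n" and x: "x \<in> carrier (P (Suc n))"
  shows "\<Phi> n s j (Rh n x) = reg.lc2 {..<N (Suc n)} {..<N 1} (\<lambda>i q. c (Suc n) i n j q)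
    (\<lambda>i q. E (trm n j) \<otimes>\<^bsub>\<Lambda>\<^esub> (arr q \<otimes>\<^bsub>\<Lambda>\<^esub> \<Phi> (Suc n) s i x))"
  using x
proof (induction x rule: P_induct)
  note e = E_closed[OF trm_verts[OF j]]
  case zero
  have "reg.lc2 {..<N (Suc n)} {..<N 1} (\<lambda>i q. c (Suc n) i n j q)
    (\<lambda>i q. E (trm n j) \<otimes>\<^bsub>\<Lambda>\<^esub> (arr q \<otimes>\<^bsub>\<Lambda>\<^esub> \<Phi> (Suc n) s i \<zero>\<^bsub>P (Suc n)\<^esub>)) = \<zero>\<^bsub>reg\<^esub>"
    by (rule reg.lc2_zero) (use e in \<open>auto simp: \<Phi>_zero[OF s] simp del: One_nat_def\<close>)
  then show ?case using bimod_hom_zero[OF P_bimodule P_bimodule Rh_hom[of n]] \<Phi>_zero[OF s j] by (simp del: One_nat_def)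
next
  note e = E_closed[OF trm_verts[OF j]]
  case (add x y)
  have "reg.lc2 {..<N (Suc n)} {..<N 1} (\<lambda>i q. c (Suc n) i n j q) (\<lambda>i q. E (trm n j) \<otimes>\<^bsub>\<Lambda>\<^esub> (arr q \<otimes>\<^bsub>\<Lambda>\<^esub> \<Phi> (Suc n) s i (x \<oplus>\<^bsub>P (Suc n)\<^esub> y))) =
    reg.lc2 {..<N (Suc n)} {..<N 1} (\<lambda>i q. c (Suc n) i n j q) (\<lambda>i q. (E (trm n j) \<otimes>\<^bsub>\<Lambda>\<^esub> (arr q \<otimes>\<^bsub>\<Lambda>\<^esub> \<Phi> (Suc n) s i x)) \<oplus>\<^bsub>reg\<^esub>
      (E (trm n j) \<otimes>\<^bsub>\<Lambda>\<^esub> (arr q \<otimes>\<^bsub>\<Lambda>\<^esub> \<Phi> (Suc n) s i y)))"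
    by (rule reg.lc2_cong_eq) (use e add s in \<open>auto simp: \<Phi>_add \<Lambda>.r_distr simp del: One_nat_def\<close>)
  also have "\<dots> = \<Phi> n s j (Rh n x) \<oplus>\<^bsub>reg\<^esub> \<Phi> n s j (Rh n y)"
    unfolding add by (rule reg.lc2_add) (use e add(1,2) s in \<open>auto simp del: One_nat_def\<close>)
  finally show ?case using add bimod_homD(2)[OF Rh_hom[of n]] by (simp add: bimod_homD(3)[OF Rh_hom] \<Phi>_add[OF s j] del: One_nat_def)
next
  note e = E_closed[OF trm_verts[OF j]]
  case (gen i a b)
  let ?x = "a \<triangleright>\<^bsub>P (Suc n)\<^esub> (\<epsilon> (Suc n) i \<triangleleft>\<^bsub>P (Suc n)\<^esub> b)"
  let ?g = "\<lambda>j' q. a \<triangleright>\<^bsub>P n\<^esub> (\<epsilon> n j' \<triangleleft>\<^bsub>P n\<^esub> (arr q \<otimes>\<^bsub>\<Lambda>\<^esub> b))"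
  let ?w = "c (Suc n) i n"
  note ei = E_closed[OF trm_verts[OF gen(1)]]
  have g: "?g j' q \<in> carrier (P n)" if "j' < N n" "q < N 1" for j' q using gen that by (simp del: One_nat_def)
  have 1: "Rh n ?x = a \<triangleright>\<^bsub>P n\<^esub> (dr n i \<triangleleft>\<^bsub>P n\<^esub> b)" using gen by (simp add: bimod_homD[OF Rh_hom] Rh_\<epsilon>)
  have 2: "dr n i \<triangleleft>\<^bsub>P n\<^esub> b = P.lc2 n {..<N n} {..<N 1} ?w (\<lambda>j q. (\<epsilon> n j \<triangleleft>\<^bsub>P n\<^esub> arr q) \<triangleleft>\<^bsub>P n\<^esub> b)"
    unfolding dr_def by (rule P.lc2_rs) (use gen in \<open>auto simp del: One_nat_def\<close>)
  have 3: "a \<triangleright>\<^bsub>P n\<^esub> P.lc2 n {..<N n} {..<N 1} ?w (\<lambda>j q. (\<epsilon> n j \<triangleleft>\<^bsub>P n\<^esub> arr q) \<triangleleft>\<^bsub>P n\<^esub> b) = P.lc2 n {..<N n} {..<N 1} ?w (\<lambda>j q. a \<triangleright>\<^bsub>P n\<^esub> ((\<epsilon> n j \<triangleleft>\<^bsub>P n\<^esub> arr q) \<triangleleft>\<^bsub>P n\<^esub> b))"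
    by (rule P.lc2_ls) (use gen in \<open>auto simp del: One_nat_def\<close>)
  have 4: "P.lc2 n {..<N n} {..<N 1} ?w (\<lambda>j q. a \<triangleright>\<^bsub>P n\<^esub> ((\<epsilon> n j \<triangleleft>\<^bsub>P n\<^esub> arr q) \<triangleleft>\<^bsub>P n\<^esub> b)) = P.lc2 n {..<N n} {..<N 1} ?w ?g"
    by (rule P.lc2_cong_eq) (use gen in \<open>auto simp: P.rs_assoc simp del: One_nat_def\<close>)
  have 5: "\<Phi> n s j (P.lc2 n {..<N n} {..<N 1} ?w ?g) = reg.lc2 {..<N n} {..<N 1} ?w (\<lambda>j' q. \<Phi> n s j (?g j' q))"
    by (rule \<Phi>_lc2[OF s j]) (use g in auto)
  have 6: "reg.lc2 {..<N n} {..<N 1} ?w (\<lambda>j' q. \<Phi> n s j (?g j' q)) = \<kappa> 1 \<triangleright>\<^bsub>reg\<^esub> reg.lc {..<N 1} (?w j) (\<lambda>q. \<Phi> n s j (?g j q))"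
    unfolding reg.lc2_def
  proof (rule reg.lc_delta[where i = j and w = "\<lambda>_. 1" and B = "\<lambda>j'. reg.lc {..<N 1} (?w j') (\<lambda>q. \<Phi> n s j (?g j' q))"])
    fix j' assume j': "j' \<in> {..<N n}" "j' \<noteq> j"
    have "reg.lc {..<N 1} (?w j') (\<lambda>q. \<Phi> n s j (?g j' q)) = \<zero>\<^bsub>reg\<^esub>"
      by (rule reg.lc_zero) (use j' gen in \<open>auto simp: \<Phi>_gen[OF s j] simp del: One_nat_def\<close>)
    then show "\<kappa> 1 \<triangleright>\<^bsub>reg\<^esub> reg.lc {..<N 1} (?w j') (\<lambda>q. \<Phi> n s j (?g j' q)) = \<zero>\<^bsub>reg\<^esub>" by (simp del: One_nat_def)
  next
    show "reg.lc {..<N 1} (?w j) (\<lambda>q. \<Phi> n s j (?g j q)) \<in> carrier reg"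
      by (rule reg.lc_closed) (use g j s in auto)
  qed (use j in auto)
  have 7: "reg.lc {..<N 1} (?w j) (\<lambda>q. \<Phi> n s j (?g j q)) =
      reg.lc {..<N 1} (\<lambda>q. c (Suc n) i n j q) (\<lambda>q. E (trm n j) \<otimes>\<^bsub>\<Lambda>\<^esub> (arr q \<otimes>\<^bsub>\<Lambda>\<^esub> \<Phi> (Suc n) s i ?x))"
  proof (rule reg.lc_cong[OF refl])
    fix q assume q: "q \<in> {..<N 1}"
    then have q': "q < N 1" by simp
    have xc: "\<Phi> (Suc n) s i ?x \<in> carrier \<Lambda>" using gen s by simp
    then show "E (trm n j) \<otimes>\<^bsub>\<Lambda>\<^esub> (arr q \<otimes>\<^bsub>\<Lambda>\<^esub> \<Phi> (Suc n) s i ?x) \<in> carrier reg"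
      using e arr_closed[OF q'] by simp
    \<comment> \<open>The coordinate in degree \<open>n\<close> requires \<open>s\<close> to end at
      \<open>org n j\<close>, the one in degree \<open>Suc n\<close> requires it to end at
      \<open>org (Suc n) i\<close>. In the one case where nothing vanishes these vertices
      agree.\<close>
    have "\<kappa> (c (Suc n) i n j q) \<otimes>\<^bsub>\<Lambda>\<^esub> \<Phi> n s j (?g j q) = \<kappa> (c (Suc n) i n j q) \<otimes>\<^bsub>\<Lambda>\<^esub> (E (trm n j) \<otimes>\<^bsub>\<Lambda>\<^esub> (arr q \<otimes>\<^bsub>\<Lambda>\<^esub> \<Phi> (Suc n) s i ?x))"
      using gen(1) j q'
    proof (cases rule: right_support)
      case 1
      then show ?thesis using e arr_closed[OF q'] xc \<Phi>_closed[OF s j g[OF j q']] by (simp del: One_nat_def)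
    next
      case 2
      then show ?thesis using E_arr_zero[OF q' j _ 2] xc gen j arr_closed[OF q'] by (simp add: \<Phi>_gen[OF s j] del: One_nat_def)
    next
      case 3
      have "E (trm n j) \<otimes>\<^bsub>\<Lambda>\<^esub> (arr q \<otimes>\<^bsub>\<Lambda>\<^esub> (\<kappa> (\<psi> s a) \<otimes>\<^bsub>\<Lambda>\<^esub> (E (trm (Suc n) i) \<otimes>\<^bsub>\<Lambda>\<^esub> b))) =
          \<kappa> (\<psi> s a) \<otimes>\<^bsub>\<Lambda>\<^esub> (E (trm n j) \<otimes>\<^bsub>\<Lambda>\<^esub> (arr q \<otimes>\<^bsub>\<Lambda>\<^esub> (E (trm (Suc n) i) \<otimes>\<^bsub>\<Lambda>\<^esub> b)))"
        using e ei arr_closed[OF q'] gen(3) by (simp add: \<kappa>_left_comm)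
      then have "E (trm n j) \<otimes>\<^bsub>\<Lambda>\<^esub> (arr q \<otimes>\<^bsub>\<Lambda>\<^esub> (\<kappa> (\<psi> s a) \<otimes>\<^bsub>\<Lambda>\<^esub> (E (trm (Suc n) i) \<otimes>\<^bsub>\<Lambda>\<^esub> b))) =
          \<kappa> (\<psi> s a) \<otimes>\<^bsub>\<Lambda>\<^esub> (E (trm n j) \<otimes>\<^bsub>\<Lambda>\<^esub> (arr q \<otimes>\<^bsub>\<Lambda>\<^esub> b))"
        using arr_E_mult[OF q' gen(3)] 3(2) by simp
      then show ?thesis using gen j arr_closed[OF q'] 3(1) e by (simp add: \<Phi>_gen[OF s j] \<Phi>_gen[OF s gen(1)] del: One_nat_def)
    qed
    then show "\<kappa> (?w j q) \<triangleright>\<^bsub>reg\<^esub> \<Phi> n s j (?g j q) = \<kappa> (c (Suc n) i n j q) \<triangleright>\<^bsub>reg\<^esub> (E (trm n j) \<otimes>\<^bsub>\<Lambda>\<^esub> (arr q \<otimes>\<^bsub>\<Lambda>\<^esub> \<Phi> (Suc n) s i ?x))"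
      by simp
  qed
  have 8: "\<kappa> 1 \<triangleright>\<^bsub>reg\<^esub> reg.lc {..<N 1} (\<lambda>q. c (Suc n) i n j q) (\<lambda>q. E (trm n j) \<otimes>\<^bsub>\<Lambda>\<^esub> (arr q \<otimes>\<^bsub>\<Lambda>\<^esub> \<Phi> (Suc n) s i ?x)) = reg.lc2 {..<N (Suc n)} {..<N 1} (\<lambda>i q. c (Suc n) i n j q) (\<lambda>i q. E (trm n j) \<otimes>\<^bsub>\<Lambda>\<^esub> (arr q \<otimes>\<^bsub>\<Lambda>\<^esub> \<Phi> (Suc n) s i ?x))"
    unfolding reg.lc2_def
  proof (rule reg.lc_delta[where i = i and w = "\<lambda>_. 1" and B = "\<lambda>i. reg.lc {..<N 1} (c (Suc n) i n j) (\<lambda>q. E (trm n j) \<otimes>\<^bsub>\<Lambda>\<^esub> (arr q \<otimes>\<^bsub>\<Lambda>\<^esub> \<Phi> (Suc n) s i ?x))", symmetric])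
    fix i' assume i': "i' \<in> {..<N (Suc n)}" "i' \<noteq> i"
    have "reg.lc {..<N 1} (\<lambda>q. c (Suc n) i' n j q) (\<lambda>q. E (trm n j) \<otimes>\<^bsub>\<Lambda>\<^esub> (arr q \<otimes>\<^bsub>\<Lambda>\<^esub> \<Phi> (Suc n) s i' ?x)) = \<zero>\<^bsub>reg\<^esub>"
      by (rule reg.lc_zero) (use i' gen e in \<open>auto simp: \<Phi>_gen[OF s] simp del: One_nat_def\<close>)
    then show "\<kappa> 1 \<triangleright>\<^bsub>reg\<^esub> reg.lc {..<N 1} (\<lambda>q. c (Suc n) i' n j q) (\<lambda>q. E (trm n j) \<otimes>\<^bsub>\<Lambda>\<^esub> (arr q \<otimes>\<^bsub>\<Lambda>\<^esub> \<Phi> (Suc n) s i' ?x)) = \<zero>\<^bsub>reg\<^esub>"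
      by (simp del: One_nat_def)
  next
    show "reg.lc {..<N 1} (\<lambda>q. c (Suc n) i n j q) (\<lambda>q. E (trm n j) \<otimes>\<^bsub>\<Lambda>\<^esub> (arr q \<otimes>\<^bsub>\<Lambda>\<^esub> \<Phi> (Suc n) s i ?x)) \<in> carrier reg"
      by (rule reg.lc_closed) (use gen e s in \<open>auto simp del: One_nat_def\<close>)
  qed (use gen in auto)
  show ?case unfolding 1 2 3 4 5 6 7 8 ..
qed

text \<open>In a product of \<open>a\<close>, a generator and \<open>b\<close>, finitely many basis
  paths occur in \<open>a\<close> and \<open>b\<close> has bounded degree, so a length bound plus a
  degree bound serves as \<open>T\<close>; for a sum the maximum does.\<close>

lemma degree_bound_exists:
  "x \<in> carrier (P n) \<Longrightarrow> \<exists>T. \<forall>s\<in>S. \<forall>i<N n. \<Phi> n s i x \<in> Lt (T - length (snd s))"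
proof (induction x rule: P_induct)
  case zero
  then show ?case by (simp add: \<Phi>_zero)
next
  case (add x y)
  then obtain T T' where "\<forall>s\<in>S. \<forall>i<N n. \<Phi> n s i x \<in> Lt (T - length (snd s))" "\<forall>s\<in>S. \<forall>i<N n. \<Phi> n s i y \<in> Lt (T' - length (snd s))"
    by blast
  then have "\<forall>s\<in>S. \<forall>i<N n. \<Phi> n s i (x \<oplus>\<^bsub>P n\<^esub> y) \<in> Lt (max T T' - length (snd s))"
    using add(1,2) Lt_mono[OF diff_le_mono[OF max.cobounded1]] Lt_mono[OF diff_le_mono[OF max.cobounded2]]
    by (auto simp: \<Phi>_add intro!: Lt_add)
  then show ?case by blast
next
  case (gen j a b)
  obtain e where e: "b \<in> Lt e" using gen(3) by (rule Lt_exists)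
  obtain F0 where F0: "finite F0" "F0 \<subseteq> S" "\<And>s. s \<in> S - F0 \<Longrightarrow> \<psi> s a = 0"
    "\<And>F. finite F \<Longrightarrow> F0 \<subseteq> F \<Longrightarrow> F \<subseteq> S \<Longrightarrow> a = (\<Oplus>\<^bsub>\<Lambda>\<^esub>s\<in>F. \<kappa> (\<psi> s a) \<otimes>\<^bsub>\<Lambda>\<^esub> path s)"
    by (rule expand_\<Lambda>[OF gen(2)]) (rule that)
  have "finite ((\<lambda>s. length (snd s)) ` F0)" using F0(1) by simp
  then obtain m where m: "\<forall>k\<in>(\<lambda>s. length (snd s)) ` F0. k < m" using finite_nat_set_iff_bounded by blast
  \<comment> \<open>\<open>m\<close> bounds the lengths of the paths in \<open>F0\<close>, so for
    such \<open>s\<close> the subtraction leaves at least \<open>e\<close>, the bound for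
    \<open>b\<close>; for the others the coefficient in \<open>a\<close> is zero.\<close>
  have "\<Phi> n s i (a \<triangleright>\<^bsub>P n\<^esub> (\<epsilon> n j \<triangleleft>\<^bsub>P n\<^esub> b)) \<in> Lt ((e + m) - length (snd s))" if s: "s \<in> S" and i: "i < N n" for s i
  proof (cases "s \<in> F0")
    case True
    then have "e \<le> (e + m) - length (snd s)" using m by fastforce
    then have "b \<in> Lt ((e + m) - length (snd s))" using e by (rule Lt_mono)
    then show ?thesis using i gen by (simp add: \<Phi>_gen[OF s i] Lt_\<kappa> Lt_E)
  next
    case False
    then have "\<psi> s a = 0" using F0(3) s by blast
    then show ?thesis using i gen E_closed[OF trm_verts[OF i]] by (simp add: \<Phi>_gen[OF s i])
  qed
  then show ?case by blast
qed

section \<open>Exactness in positive degrees\<close>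

abbreviation path_sum where
  "path_sum n F b \<equiv> \<Oplus>\<^bsub>P n\<^esub>s\<in>F. \<Oplus>\<^bsub>P n\<^esub>i\<in>{..<N n}. path s \<triangleright>\<^bsub>P n\<^esub> (\<epsilon> n i \<triangleleft>\<^bsub>P n\<^esub> b s i)"

lemma path_sum_closed:
  assumes "F \<subseteq> S" "\<And>s i. s \<in> F \<Longrightarrow> i < N n \<Longrightarrow> b s i \<in> carrier \<Lambda>"
  shows "path_sum n F b \<in> carrier (P n)"
proof -
  have "s \<in> S" if "s \<in> F" for s using assms(1) that by blast
  then show ?thesis using assms(2) by (intro P.M.finsum_closed funcsetI P.l_closed P.r_closed) simp_all
qed

lemma P_zeroI:
  assumes x: "x \<in> carrier (P n)" and 0: "\<And>s i. s \<in> S \<Longrightarrow> i < N n \<Longrightarrow> \<Phi> n s i x = \<zero>\<^bsub>\<Lambda>\<^esub>"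
  shows "x = \<zero>\<^bsub>P n\<^esub>"
proof -
  obtain F0 where F0: "finite F0" "F0 \<subseteq> S" "\<And>F. finite F \<Longrightarrow> F0 \<subseteq> F \<Longrightarrow> F \<subseteq> S \<Longrightarrow> x = path_sum n F (\<lambda>s i. \<Phi> n s i x)"
    by (rule expand_P[OF x]) (rule that)
  have "path_sum n F0 (\<lambda>s i. \<Phi> n s i x) = \<zero>\<^bsub>P n\<^esub>"
  proof (intro P.M.finsum_all_zero)
    fix s i assume "s \<in> F0" "i \<in> {..<N n}"
    then have "s \<in> S" "i < N n" using F0(2) by auto
    then show "path s \<triangleright>\<^bsub>P n\<^esub> (\<epsilon> n i \<triangleleft>\<^bsub>P n\<^esub> \<Phi> n s i x) = \<zero>\<^bsub>P n\<^esub>" by (simp add: 0)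
  qed
  then show ?thesis using F0(3)[OF F0(1) subset_refl F0(2)] by (rule trans[rotated])
qed

text \<open>The left half raises left length by exactly one, so a component of length at most
  \<open>a\<close> could only come from one of length below \<open>a\<close>.\<close>

lemma \<Phi>_Lh_zero:
  assumes x: "x \<in> carrier (P (Suc n))"
    and low: "\<And>s i. s \<in> S \<Longrightarrow> i < N (Suc n) \<Longrightarrow> length (snd s) < a \<Longrightarrow> \<Phi> (Suc n) s i x = \<zero>\<^bsub>\<Lambda>\<^esub>"
    and s: "s \<in> S" "length (snd s) \<le> a" and j: "j < N n"
  shows "\<Phi> n s j (Lh n x) = \<zero>\<^bsub>\<Lambda>\<^esub>"
proof -
  obtain F0 where F0: "finite F0" "F0 \<subseteq> S" "\<And>F. finite F \<Longrightarrow> F0 \<subseteq> F \<Longrightarrow> F \<subseteq> S \<Longrightarrow> x = path_sum (Suc n) F (\<lambda>s i. \<Phi> (Suc n) s i x)"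
    by (rule expand_P[OF x]) (rule that)
  note e = F0(3)[OF F0(1) subset_refl F0(2)]
  have S: "t \<in> S" if "t \<in> F0" for t using F0(2) that by blast
  have "\<Phi> n s j (Lh n x) = \<Phi> n s j (Lh n (path_sum (Suc n) F0 (\<lambda>s i. \<Phi> (Suc n) s i x)))"
    by (rule arg_cong[where f = "\<lambda>x. \<Phi> n s j (Lh n x)", OF e])
  also have "\<dots> = (\<Oplus>\<^bsub>\<Lambda>\<^esub>s'\<in>F0. \<Oplus>\<^bsub>\<Lambda>\<^esub>i\<in>{..<N (Suc n)}. \<Phi> n s j (Lh n (path s' \<triangleright>\<^bsub>P (Suc n)\<^esub> (\<epsilon> (Suc n) i \<triangleleft>\<^bsub>P (Suc n)\<^esub> \<Phi> (Suc n) s' i x))))"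
    by (rule \<Phi>_Lh_sum[OF F0(2) s(1) j]) (use S x \<Phi>_closed in blast)
  also have "\<dots> = \<zero>\<^bsub>\<Lambda>\<^esub>"
  proof (intro \<Lambda>.finsum_all_zero)
    fix s' i assume "s' \<in> F0" "i \<in> {..<N (Suc n)}"
    then have s': "s' \<in> S" and i: "i < N (Suc n)" using S by auto
    show "\<Phi> n s j (Lh n (path s' \<triangleright>\<^bsub>P (Suc n)\<^esub> (\<epsilon> (Suc n) i \<triangleleft>\<^bsub>P (Suc n)\<^esub> \<Phi> (Suc n) s' i x))) = \<zero>\<^bsub>\<Lambda>\<^esub>"
    proof (cases "length (snd s) = Suc (length (snd s'))")
      case True
      then have "length (snd s') < a" using s(2) by simp
      then have "path s' \<triangleright>\<^bsub>P (Suc n)\<^esub> (\<epsilon> (Suc n) i \<triangleleft>\<^bsub>P (Suc n)\<^esub> \<Phi> (Suc n) s' i x) = \<zero>\<^bsub>P (Suc n)\<^esub>"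
        using low[OF s' i] s' i by simp
      then show ?thesis using bimod_hom_zero[OF P_bimodule P_bimodule Lh_hom[of n]] \<Phi>_zero[OF s(1) j] by (simp only:)
    next
      case False
      then show ?thesis by (intro \<Phi>_Lh_degree[OF s' s(1) i j] \<Phi>_closed[OF s' i x])
    qed
  qed
  finally show ?thesis .
qed

lemma \<kappa>_sign_sign: "z \<in> carrier \<Lambda> \<Longrightarrow> \<kappa> ((- 1) ^ n) \<otimes>\<^bsub>\<Lambda>\<^esub> (\<kappa> ((- 1) ^ n) \<otimes>\<^bsub>\<Lambda>\<^esub> z) = z"
proof -
  assume z: "z \<in> carrier \<Lambda>"
  have "\<kappa> ((- 1) ^ n) \<otimes>\<^bsub>\<Lambda>\<^esub> \<kappa> ((- 1) ^ n) = \<one>\<^bsub>\<Lambda>\<^esub>"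
    unfolding \<Lambda>.\<kappa>_mult[symmetric] by (simp flip: power_mult_distrib)
  then show ?thesis using z \<Lambda>.m_assoc[of "\<kappa> ((- 1) ^ n)" "\<kappa> ((- 1) ^ n)" z] by simp
qed

text \<open>In the lowest left length \<open>a\<close> the left half contributes nothing, so there
  the cycle condition concerns the right half alone.\<close>

lemma \<Phi>_Rh_zero:
  assumes x: "x \<in> carrier (P (Suc n))" "\<delta> (Suc n) x = \<zero>\<^bsub>P n\<^esub>"
    and low: "\<And>s i. s \<in> S \<Longrightarrow> i < N (Suc n) \<Longrightarrow> length (snd s) < a \<Longrightarrow> \<Phi> (Suc n) s i x = \<zero>\<^bsub>\<Lambda>\<^esub>"
    and s: "s \<in> S" "length (snd s) = a" and j: "j < N n"
  shows "\<Phi> n s j (Rh n x) = \<zero>\<^bsub>\<Lambda>\<^esub>"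
proof -
  let ?u = "\<kappa> ((- 1) ^ Suc n)"
  have cl: "Lh n x \<in> carrier (P n)" "Rh n x \<in> carrier (P n)" using bimod_homD(2)[OF Lh_hom] bimod_homD(2)[OF Rh_hom] x(1) by auto
  have "\<zero>\<^bsub>P n\<^esub> = Lh n x \<oplus>\<^bsub>P n\<^esub> ?u \<triangleright>\<^bsub>P n\<^esub> Rh n x" using \<delta>_split[OF x(1)] x(2) by simp
  then have "\<Phi> n s j \<zero>\<^bsub>P n\<^esub> = \<Phi> n s j (Lh n x \<oplus>\<^bsub>P n\<^esub> ?u \<triangleright>\<^bsub>P n\<^esub> Rh n x)" by (rule arg_cong)
  then have "\<zero>\<^bsub>\<Lambda>\<^esub> = ?u \<otimes>\<^bsub>\<Lambda>\<^esub> \<Phi> n s j (Rh n x)"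
    using cl \<Phi>_Lh_zero[OF x(1) low s(1) _ j, of a] s
    by (simp add: \<Phi>_zero[OF s(1) j] \<Phi>_add[OF s(1) j] \<Phi>_\<kappa>[OF s(1) j] \<Phi>_closed[OF s(1) j] del: power_Suc)
  then have "?u \<otimes>\<^bsub>\<Lambda>\<^esub> \<zero>\<^bsub>\<Lambda>\<^esub> = ?u \<otimes>\<^bsub>\<Lambda>\<^esub> (?u \<otimes>\<^bsub>\<Lambda>\<^esub> \<Phi> n s j (Rh n x))" by (rule arg_cong)
  then show ?thesis using \<kappa>_sign_sign[OF \<Phi>_closed[OF s(1) j cl(2)], of "Suc n"] by (simp del: power_Suc)
qed

text \<open>The right factors behind one left path are represented in the path algebra within the
  degree bound, where they form a cycle of the right resolution; \<open>rdiff_exact\<close> returns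
  a preimage whose bound is one lower.\<close>

lemma right_cycle:
  assumes x: "x \<in> carrier (P (Suc n))" and s: "s \<in> S"
    and cycle: "\<And>j. j < N n \<Longrightarrow> \<Phi> n s j (Rh n x) = \<zero>\<^bsub>\<Lambda>\<^esub>"
    and deg: "\<And>i. i < N (Suc n) \<Longrightarrow> \<Phi> (Suc n) s i x \<in> Lt e"
  shows "\<exists>\<sigma>. (\<forall>l. \<sigma> l \<in> Lt (e - 1)) \<and> (\<forall>i<N (Suc n). \<Phi> (Suc n) s i x =
    reg.lc2 {..<N (Suc (Suc n))} {..<N 1} (\<lambda>l q. c (Suc (Suc n)) l (Suc n) i q) (\<lambda>l q. E (trm (Suc n) i) \<otimes>\<^bsub>\<Lambda>\<^esub> (arr q \<otimes>\<^bsub>\<Lambda>\<^esub> \<sigma> l)))"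
proof -
  have "\<forall>i\<in>{..<N (Suc n)}. \<exists>y. y \<in> carrier R \<and> Poly_Mapping.keys y \<subseteq> {w. length (snd w) < e} \<and> \<Phi> (Suc n) s i x = \<pi> y"
    using deg unfolding Lt_def by blast
  from bchoice[OF this] obtain r where r': "\<forall>i\<in>{..<N (Suc n)}. r i \<in> carrier R \<and>
    Poly_Mapping.keys (r i) \<subseteq> {w. length (snd w) < e} \<and> \<Phi> (Suc n) s i x = \<pi> (r i)" ..
  have r: "r i \<in> carrier R" "Poly_Mapping.keys (r i) \<subseteq> {w. length (snd w) < e}" "\<Phi> (Suc n) s i x = \<pi> (r i)"
    if "i < N (Suc n)" for i using r' that by blast+
  have cyc: "vertex (trm n j) \<otimes>\<^bsub>R\<^esub> rdiff n r j \<in> I" if j: "j < N n" for j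
  proof -
    note v = trm_verts[OF j]
    have rc: "rdiff n r j \<in> carrier R" using r(1) by (rule rdiff_closed)
    have "\<pi> (vertex (trm n j) \<otimes>\<^bsub>R\<^esub> rdiff n r j) = E (trm n j) \<otimes>\<^bsub>\<Lambda>\<^esub> \<pi> (rdiff n r j)"
      by (rule \<pi>_mult[OF vertex_closed[OF v] rc])
    also have "\<dots> = E (trm n j) \<otimes>\<^bsub>\<Lambda>\<^esub> reg.lc2 {..<N (Suc n)} {..<N 1} (\<lambda>i q. c (Suc n) i n j q) (\<lambda>i q. arr q \<otimes>\<^bsub>\<Lambda>\<^esub> \<pi> (r i))"
      by (rule arg_cong[where f = "\<lambda>z. E (trm n j) \<otimes>\<^bsub>\<Lambda>\<^esub> z"]) (rule \<pi>_rdiff, rule r(1))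
    also have "\<dots> = reg.lc2 {..<N (Suc n)} {..<N 1} (\<lambda>i q. c (Suc n) i n j q) (\<lambda>i q. E (trm n j) \<otimes>\<^bsub>\<Lambda>\<^esub> (arr q \<otimes>\<^bsub>\<Lambda>\<^esub> \<pi> (r i)))"
      by (rule reg.lc2_ls[simplified reg_simps]) (use E_closed[OF v] r(1) in \<open>auto simp del: One_nat_def path_algebra_simps\<close>)
    also have "\<dots> = reg.lc2 {..<N (Suc n)} {..<N 1} (\<lambda>i q. c (Suc n) i n j q) (\<lambda>i q. E (trm n j) \<otimes>\<^bsub>\<Lambda>\<^esub> (arr q \<otimes>\<^bsub>\<Lambda>\<^esub> \<Phi> (Suc n) s i x))"
      by (rule reg.lc2_cong_eq) (use E_closed[OF v] r x s in \<open>auto simp del: One_nat_def path_algebra_simps\<close>)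
    also have "\<dots> = \<zero>\<^bsub>\<Lambda>\<^esub>" using \<Phi>_Rh[OF s j x] cycle[OF j] by (simp only:)
    finally show ?thesis using \<pi>_zero_iff[OF mult_closed[OF vertex_closed[OF v] rc]] by blast
  qed
  obtain t where t: "\<And>l. t l \<in> carrier R" "\<And>l. Poly_Mapping.keys (t l) \<subseteq> {w. length (snd w) < e - 1}"
    "\<And>i. i < N (Suc n) \<Longrightarrow> vertex (trm (Suc n) i) \<otimes>\<^bsub>R\<^esub> (r i - rdiff (Suc n) t i) \<in> I"
    by (rule rdiff_exact[OF r(1,2) cyc]) (assumption+, rule that)
  have "\<Phi> (Suc n) s i x = reg.lc2 {..<N (Suc (Suc n))} {..<N 1} (\<lambda>l q. c (Suc (Suc n)) l (Suc n) i q)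
      (\<lambda>l q. E (trm (Suc n) i) \<otimes>\<^bsub>\<Lambda>\<^esub> (arr q \<otimes>\<^bsub>\<Lambda>\<^esub> \<pi> (t l)))" if i: "i < N (Suc n)" for i
  proof -
    note v = trm_verts[OF i]
    have rc: "rdiff (Suc n) t i \<in> carrier R" using t(1) by (rule rdiff_closed)
    \<comment> \<open>The coordinate already starts at the terminus vertex, so inserting this vertex
      costs nothing, and after it has been inserted exactness becomes an equality in the
      quotient.\<close>
    have "\<Phi> (Suc n) s i x = E (trm (Suc n) i) \<otimes>\<^bsub>\<Lambda>\<^esub> \<pi> (r i)" using E_\<Phi>[OF s i x] r(3)[OF i] by simp
    also have "\<dots> = \<pi> (vertex (trm (Suc n) i) \<otimes>\<^bsub>R\<^esub> r i)"
      by (rule \<pi>_mult[OF vertex_closed[OF v] r(1)[OF i], symmetric])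
    also have "\<dots> = \<pi> (vertex (trm (Suc n) i) \<otimes>\<^bsub>R\<^esub> rdiff (Suc n) t i)"
      using t(3)[OF i] \<pi>_eq_iff[OF mult_closed[OF vertex_closed[OF v] r(1)[OF i]] mult_closed[OF vertex_closed[OF v] rc]]
      by (simp add: mult_linear(6) del: path_algebra_simps)
    also have "\<dots> = E (trm (Suc n) i) \<otimes>\<^bsub>\<Lambda>\<^esub> \<pi> (rdiff (Suc n) t i)" by (rule \<pi>_mult[OF vertex_closed[OF v] rc])
    also have "\<dots> = E (trm (Suc n) i) \<otimes>\<^bsub>\<Lambda>\<^esub> reg.lc2 {..<N (Suc (Suc n))} {..<N 1} (\<lambda>l q. c (Suc (Suc n)) l (Suc n) i q) (\<lambda>l q. arr q \<otimes>\<^bsub>\<Lambda>\<^esub> \<pi> (t l))"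
      by (rule arg_cong[where f = "\<lambda>z. E (trm (Suc n) i) \<otimes>\<^bsub>\<Lambda>\<^esub> z"]) (rule \<pi>_rdiff, rule t(1))
    also have "\<dots> = reg.lc2 {..<N (Suc (Suc n))} {..<N 1} (\<lambda>l q. c (Suc (Suc n)) l (Suc n) i q) (\<lambda>l q. E (trm (Suc n) i) \<otimes>\<^bsub>\<Lambda>\<^esub> (arr q \<otimes>\<^bsub>\<Lambda>\<^esub> \<pi> (t l)))"
      by (rule reg.lc2_ls[simplified reg_simps]) (use E_closed[OF v] t(1) in \<open>auto simp del: One_nat_def path_algebra_simps\<close>)
    finally show ?thesis .
  qed
  moreover have "\<pi> (t l) \<in> Lt (e - 1)" for l using t(1,2) by (rule Lt_I)
  ultimately show ?thesis by (intro exI[of _ "\<lambda>l. \<pi> (t l)"]) blast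
qed

text \<open>The components of lowest left degree are killed by the exactness of the right resolution. The right factors
  they contribute in the next left degree have smaller degree, so that the total degree bound \<open>T\<close> is kept.\<close>

lemma exact_step:
  assumes x: "x \<in> carrier (P (Suc n))" "\<delta> (Suc n) x = \<zero>\<^bsub>P n\<^esub>"
    and low: "\<And>s i. s \<in> S \<Longrightarrow> i < N (Suc n) \<Longrightarrow> length (snd s) < a \<Longrightarrow> \<Phi> (Suc n) s i x = \<zero>\<^bsub>\<Lambda>\<^esub>"
    and deg: "\<And>s i. s \<in> S \<Longrightarrow> i < N (Suc n) \<Longrightarrow> \<Phi> (Suc n) s i x \<in> Lt (T - length (snd s))"
  obtains y where "y \<in> carrier (P (Suc (Suc n)))"
    "\<And>s i. s \<in> S \<Longrightarrow> i < N (Suc n) \<Longrightarrow> length (snd s) < Suc a \<Longrightarrow>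
      \<Phi> (Suc n) s i (x \<oplus>\<^bsub>P (Suc n)\<^esub> \<ominus>\<^bsub>P (Suc n)\<^esub> \<delta> (Suc (Suc n)) y) = \<zero>\<^bsub>\<Lambda>\<^esub>"
    "\<And>s i. s \<in> S \<Longrightarrow> i < N (Suc n) \<Longrightarrow>
      \<Phi> (Suc n) s i (x \<oplus>\<^bsub>P (Suc n)\<^esub> \<ominus>\<^bsub>P (Suc n)\<^esub> \<delta> (Suc (Suc n)) y) \<in> Lt (T - length (snd s))"
proof -
  let ?m = "Suc (Suc n)"
  let ?v = "\<lambda>i l q. c ?m l (Suc n) i q"
  have "\<exists>\<sigma>. (\<forall>l. \<sigma> l \<in> Lt (T - a - 1)) \<and> (\<forall>i<N (Suc n). \<Phi> (Suc n) s i x =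
      reg.lc2 {..<N ?m} {..<N 1} (?v i) (\<lambda>l q. E (trm (Suc n) i) \<otimes>\<^bsub>\<Lambda>\<^esub> (arr q \<otimes>\<^bsub>\<Lambda>\<^esub> \<sigma> l)))" if s: "s \<in> {s \<in> S. length (snd s) = a}" for s
  proof (rule right_cycle[OF x(1)])
    show "s \<in> S" using s by simp
    show "\<Phi> n s j (Rh n x) = \<zero>\<^bsub>\<Lambda>\<^esub>" if "j < N n" for j
      by (rule \<Phi>_Rh_zero[OF x low _ _ that]) (use s in auto)
    show "\<Phi> (Suc n) s i x \<in> Lt (T - a)" if "i < N (Suc n)" for i
      using deg[OF _ that, of s] s by auto
  qed
  then have "\<forall>s\<in>{s \<in> S. length (snd s) = a}. \<exists>\<sigma>. (\<forall>l. \<sigma> l \<in> Lt (T - a - 1)) \<and> (\<forall>i<N (Suc n). \<Phi> (Suc n) s i x =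
      reg.lc2 {..<N ?m} {..<N 1} (?v i) (\<lambda>l q. E (trm (Suc n) i) \<otimes>\<^bsub>\<Lambda>\<^esub> (arr q \<otimes>\<^bsub>\<Lambda>\<^esub> \<sigma> l)))" by (rule ballI)
  from bchoice[OF this] obtain \<sigma> where \<sigma>': "\<forall>s\<in>{s \<in> S. length (snd s) = a}. (\<forall>l. \<sigma> s l \<in> Lt (T - a - 1)) \<and> (\<forall>i<N (Suc n). \<Phi> (Suc n) s i x =
      reg.lc2 {..<N ?m} {..<N 1} (?v i) (\<lambda>l q. E (trm (Suc n) i) \<otimes>\<^bsub>\<Lambda>\<^esub> (arr q \<otimes>\<^bsub>\<Lambda>\<^esub> \<sigma> s l)))" ..
  have \<sigma>: "\<sigma> s l \<in> Lt (T - a - 1)" "i < N (Suc n) \<Longrightarrow> \<Phi> (Suc n) s i x =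
      reg.lc2 {..<N ?m} {..<N 1} (?v i) (\<lambda>l q. E (trm (Suc n) i) \<otimes>\<^bsub>\<Lambda>\<^esub> (arr q \<otimes>\<^bsub>\<Lambda>\<^esub> \<sigma> s l))" if "s \<in> S" "length (snd s) = a" for s l i
    using \<sigma>' that by blast+
  obtain F0 where F0: "finite F0" "F0 \<subseteq> S" "\<And>F. finite F \<Longrightarrow> F0 \<subseteq> F \<Longrightarrow> F \<subseteq> S \<Longrightarrow> x = path_sum (Suc n) F (\<lambda>s i. \<Phi> (Suc n) s i x)"
    by (rule expand_P[OF x(1)]) (rule that)
  \<comment> \<open>Only finitely many paths of length \<open>a\<close> occur in \<open>x\<close>,
    so the correcting element is a finite sum.\<close>
  define Fa where "Fa = {s \<in> F0. length (snd s) = a}"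
  have Fa: "finite Fa" "Fa \<subseteq> S" "\<And>s. s \<in> Fa \<Longrightarrow> s \<in> S \<and> length (snd s) = a" using F0 by (auto simp: Fa_def)
  have \<sigma>_closed: "\<sigma> s l \<in> carrier \<Lambda>" if "s \<in> Fa" for s l using Fa(3)[OF that] \<sigma>(1) Lt_closed by blast
  define y' where "y' = path_sum ?m Fa \<sigma>"
  have y': "y' \<in> carrier (P ?m)" unfolding y'_def by (rule path_sum_closed[OF Fa(2)]) (rule \<sigma>_closed)
  let ?u = "\<kappa> ((- 1) ^ ?m)"
  \<comment> \<open>The sign makes the right half enter the boundary of \<open>y\<close> with
    coefficient 1, since \<open>?u\<close> squares to the unit.\<close>
  define y where "y = ?u \<triangleright>\<^bsub>P ?m\<^esub> y'"
  have y: "y \<in> carrier (P ?m)" using y' by (simp add: y_def)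
  have cl: "Lh (Suc n) y' \<in> carrier (P (Suc n))" "Rh (Suc n) y' \<in> carrier (P (Suc n))"
    using bimod_homD(2)[OF Lh_hom] bimod_homD(2)[OF Rh_hom] y' by auto
  have uu: "?u \<otimes>\<^bsub>\<Lambda>\<^esub> ?u = \<one>\<^bsub>\<Lambda>\<^esub>" using \<kappa>_sign_sign[of "\<one>\<^bsub>\<Lambda>\<^esub>" ?m] by (simp del: power_Suc)
  have "\<delta> ?m y = ?u \<triangleright>\<^bsub>P (Suc n)\<^esub> \<delta> ?m y'" unfolding y_def using y' by (simp add: bimod_homD[OF \<delta>_hom] del: power_Suc)
  also have "\<dots> = ?u \<triangleright>\<^bsub>P (Suc n)\<^esub> (Lh (Suc n) y' \<oplus>\<^bsub>P (Suc n)\<^esub> ?u \<triangleright>\<^bsub>P (Suc n)\<^esub> Rh (Suc n) y')"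
    by (rule arg_cong[where f = "\<lambda>z. ?u \<triangleright>\<^bsub>P (Suc n)\<^esub> z", OF \<delta>_split[OF y']])
  also have "\<dots> = ?u \<triangleright>\<^bsub>P (Suc n)\<^esub> Lh (Suc n) y' \<oplus>\<^bsub>P (Suc n)\<^esub> Rh (Suc n) y'"
    using cl uu by (simp add: P.ls_add del: power_Suc flip: P.ls_assoc)
  finally have \<delta>y: "\<delta> ?m y = ?u \<triangleright>\<^bsub>P (Suc n)\<^esub> Lh (Suc n) y' \<oplus>\<^bsub>P (Suc n)\<^esub> Rh (Suc n) y'" .
  have L0: "\<Phi> (Suc n) s i (Lh (Suc n) y') = \<zero>\<^bsub>\<Lambda>\<^esub>" if s: "s \<in> S" "length (snd s) \<noteq> Suc a" and i: "i < N (Suc n)" for s i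
  proof -
    have "\<Phi> (Suc n) s i (Lh (Suc n) y') = (\<Oplus>\<^bsub>\<Lambda>\<^esub>s'\<in>Fa. \<Oplus>\<^bsub>\<Lambda>\<^esub>l\<in>{..<N ?m}. \<Phi> (Suc n) s i (Lh (Suc n) (path s' \<triangleright>\<^bsub>P ?m\<^esub> (\<epsilon> ?m l \<triangleleft>\<^bsub>P ?m\<^esub> \<sigma> s' l))))"
      unfolding y'_def by (rule \<Phi>_Lh_sum[OF Fa(2) s(1) i]) (rule \<sigma>_closed)
    also have "\<dots> = \<zero>\<^bsub>\<Lambda>\<^esub>"
    proof (intro \<Lambda>.finsum_all_zero)
      fix s' l assume "s' \<in> Fa" "l \<in> {..<N ?m}"
      then show "\<Phi> (Suc n) s i (Lh (Suc n) (path s' \<triangleright>\<^bsub>P ?m\<^esub> (\<epsilon> ?m l \<triangleleft>\<^bsub>P ?m\<^esub> \<sigma> s' l))) = \<zero>\<^bsub>\<Lambda>\<^esub>"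
        using Fa(3)[of s'] s \<sigma>_closed i by (intro \<Phi>_Lh_degree) auto
    qed
    finally show ?thesis .
  qed
  have L1: "\<Phi> (Suc n) s i (Lh (Suc n) y') \<in> Lt (T - length (snd s))" if s: "s \<in> S" and i: "i < N (Suc n)" for s i
  proof (cases "length (snd s) = Suc a")
    case True
    have "\<Phi> (Suc n) s i (Lh (Suc n) y') = (\<Oplus>\<^bsub>\<Lambda>\<^esub>s'\<in>Fa. \<Oplus>\<^bsub>\<Lambda>\<^esub>l\<in>{..<N ?m}. \<Phi> (Suc n) s i (Lh (Suc n) (path s' \<triangleright>\<^bsub>P ?m\<^esub> (\<epsilon> ?m l \<triangleleft>\<^bsub>P ?m\<^esub> \<sigma> s' l))))"
      unfolding y'_def by (rule \<Phi>_Lh_sum[OF Fa(2) s i]) (rule \<sigma>_closed)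
    \<comment> \<open>This bound is \<open>T - Suc a\<close>: the left length has grown by one while
      the degree bound of the preimage has dropped by one, so \<open>T\<close> is kept.\<close>
    also have "\<dots> \<in> Lt (T - a - 1)"
    proof (intro Lt_finsum)
      fix s' l assume "s' \<in> Fa" "l \<in> {..<N ?m}"
      then show "\<Phi> (Suc n) s i (Lh (Suc n) (path s' \<triangleright>\<^bsub>P ?m\<^esub> (\<epsilon> ?m l \<triangleleft>\<^bsub>P ?m\<^esub> \<sigma> s' l))) \<in> Lt (T - a - 1)"
        using Fa(3)[of s'] s \<sigma>(1) i by (intro \<Phi>_Lh_Lt) auto
    qed
    finally show ?thesis using True by simp
  next
    case False
    then show ?thesis using L0[OF s _ i] by simp
  qed
  \<comment> \<open>The right half of \<open>y'\<close> reproduces exactly the components of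
    \<open>x\<close> of left length \<open>a\<close>; the left half, by \<open>L0\<close> and
    \<open>L1\<close>, affects length \<open>Suc a\<close> only and stays within the bound
    \<open>T\<close>.\<close>
  have R0: "\<Phi> (Suc n) s i (Rh (Suc n) y') = (if length (snd s) = a then \<Phi> (Suc n) s i x else \<zero>\<^bsub>\<Lambda>\<^esub>)"
    if s: "s \<in> S" and i: "i < N (Suc n)" for s i
  proof -
    note e = E_closed[OF trm_verts[OF i]]
    \<comment> \<open>The coordinates of \<open>y'\<close> are the \<open>\<sigma> s l\<close> only
      up to idempotents; the support of the structure constants makes this cut invisible in the sum
      below.\<close>
    let ?z = "\<lambda>l. if s \<in> Fa \<and> qpath_end Q s = org ?m l then E (trm ?m l) \<otimes>\<^bsub>\<Lambda>\<^esub> \<sigma> s l else \<zero>\<^bsub>\<Lambda>\<^esub>"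
    have \<Phi>y': "\<Phi> ?m s l y' = ?z l" if "l < N ?m" for l
      unfolding y'_def by (rule \<Phi>_path_sum[OF Fa(1,2) s that]) (rule \<sigma>_closed)
    have z_closed: "?z l \<in> carrier \<Lambda>" if "l < N ?m" for l
      using \<Phi>_closed[OF s that y'] \<Phi>y'[OF that] by (simp only:)
    have R: "\<Phi> (Suc n) s i (Rh (Suc n) y') = reg.lc2 {..<N ?m} {..<N 1} (?v i) (\<lambda>l q. E (trm (Suc n) i) \<otimes>\<^bsub>\<Lambda>\<^esub> (arr q \<otimes>\<^bsub>\<Lambda>\<^esub> ?z l))"
      unfolding \<Phi>_Rh[OF s i y'] by (rule reg.lc2_cong_eq) (use e z_closed \<Phi>y' in \<open>auto simp del: One_nat_def\<close>)
    show ?thesis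
    proof (cases "s \<in> Fa")
      case False
      have "reg.lc2 {..<N ?m} {..<N 1} (?v i) (\<lambda>l q. E (trm (Suc n) i) \<otimes>\<^bsub>\<Lambda>\<^esub> (arr q \<otimes>\<^bsub>\<Lambda>\<^esub> ?z l)) = \<zero>\<^bsub>reg\<^esub>"
        by (rule reg.lc2_zero) (use e False in \<open>auto simp del: One_nat_def\<close>)
      then have 0: "\<Phi> (Suc n) s i (Rh (Suc n) y') = \<zero>\<^bsub>\<Lambda>\<^esub>" using R by simp
      \<comment> \<open>A path of length \<open>a\<close> outside \<open>Fa\<close> does not occur
        in \<open>x\<close> at all.\<close>
      have "\<Phi> (Suc n) s i x = \<zero>\<^bsub>\<Lambda>\<^esub>" if "length (snd s) = a"
      proof -
        have "s \<notin> F0" using False that by (simp add: Fa_def)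
        have xc: "\<Phi> (Suc n) t j x \<in> carrier \<Lambda>" if "t \<in> F0" "j < N (Suc n)" for t j
          using F0(2) that x(1) by auto
        have "\<Phi> (Suc n) s i x = \<Phi> (Suc n) s i (path_sum (Suc n) F0 (\<lambda>s i. \<Phi> (Suc n) s i x))"
          by (rule arg_cong[where f = "\<Phi> (Suc n) s i", OF F0(3)[OF F0(1) subset_refl F0(2)]])
        also have "\<dots> = (if s \<in> F0 \<and> qpath_end Q s = org (Suc n) i then E (trm (Suc n) i) \<otimes>\<^bsub>\<Lambda>\<^esub> \<Phi> (Suc n) s i x else \<zero>\<^bsub>\<Lambda>\<^esub>)"
          by (rule \<Phi>_path_sum[OF F0(1,2) s i]) (rule xc)
        finally show ?thesis using \<open>s \<notin> F0\<close> by (simp only: simp_thms if_False)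
      qed
      then show ?thesis using 0 by (simp only: split: if_split) blast
    next
      case True
      then have a: "length (snd s) = a" by (simp add: Fa_def)
      have "\<Phi> (Suc n) s i (Rh (Suc n) y') = \<Phi> (Suc n) s i x"
      proof (cases "qpath_end Q s = org (Suc n) i")
        case False
        then show ?thesis using \<Phi>_end[OF s i False] cl(2) x(1) by simp
      next
        case match: True
        show ?thesis unfolding R \<sigma>(2)[OF s a i]
        proof (rule reg.lc2_cong[OF refl refl])
          fix l q assume "l \<in> {..<N ?m}" "q \<in> {..<N 1}"
          then have l: "l < N ?m" and q: "q < N 1" by auto
          note \<sigma>c = \<sigma>_closed[OF True, of l]
          show "E (trm (Suc n) i) \<otimes>\<^bsub>\<Lambda>\<^esub> (arr q \<otimes>\<^bsub>\<Lambda>\<^esub> \<sigma> s l) \<in> carrier reg" using e \<sigma>c arr_closed[OF q] by simp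
          have "\<kappa> (?v i l q) \<otimes>\<^bsub>\<Lambda>\<^esub> (E (trm (Suc n) i) \<otimes>\<^bsub>\<Lambda>\<^esub> (arr q \<otimes>\<^bsub>\<Lambda>\<^esub> ?z l)) = \<kappa> (?v i l q) \<otimes>\<^bsub>\<Lambda>\<^esub> (E (trm (Suc n) i) \<otimes>\<^bsub>\<Lambda>\<^esub> (arr q \<otimes>\<^bsub>\<Lambda>\<^esub> \<sigma> s l))"
            using l i q
          proof (cases rule: right_support)
            case 1
            then show ?thesis using e \<sigma>c z_closed[OF l] arr_closed[OF q] by (simp del: One_nat_def)
          next
            case 2
            show ?thesis using E_arr_zero[OF q i z_closed[OF l] 2] E_arr_zero[OF q i \<sigma>c 2] by (simp only:)
          next
            case 3
            have "arr q \<otimes>\<^bsub>\<Lambda>\<^esub> ?z l = arr q \<otimes>\<^bsub>\<Lambda>\<^esub> \<sigma> s l"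
              using arr_E_mult[OF q \<sigma>c] 3 match True by (simp del: One_nat_def)
            then show ?thesis by (simp only:)
          qed
          then show "\<kappa> (?v i l q) \<triangleright>\<^bsub>reg\<^esub> (E (trm (Suc n) i) \<otimes>\<^bsub>\<Lambda>\<^esub> (arr q \<otimes>\<^bsub>\<Lambda>\<^esub> ?z l)) = \<kappa> (?v i l q) \<triangleright>\<^bsub>reg\<^esub> (E (trm (Suc n) i) \<otimes>\<^bsub>\<Lambda>\<^esub> (arr q \<otimes>\<^bsub>\<Lambda>\<^esub> \<sigma> s l))"
            unfolding reg_simps .
        qed
      qed
      then show ?thesis using a by (simp only: simp_thms if_True)
    qed
  qed
  have \<Phi>x': "\<Phi> (Suc n) s i (x \<oplus>\<^bsub>P (Suc n)\<^esub> \<ominus>\<^bsub>P (Suc n)\<^esub> \<delta> ?m y) = \<Phi> (Suc n) s i x \<oplus>\<^bsub>\<Lambda>\<^esub>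
      \<ominus>\<^bsub>\<Lambda>\<^esub> (?u \<otimes>\<^bsub>\<Lambda>\<^esub> \<Phi> (Suc n) s i (Lh (Suc n) y') \<oplus>\<^bsub>\<Lambda>\<^esub> (if length (snd s) = a then \<Phi> (Suc n) s i x else \<zero>\<^bsub>\<Lambda>\<^esub>))"
    if s: "s \<in> S" and i: "i < N (Suc n)" for s i
    unfolding \<delta>y R0[OF s i, symmetric] using x(1) cl
    by (simp add: \<Phi>_add[OF s i] \<Phi>_minus[OF s i] \<Phi>_\<kappa>[OF s i] del: power_Suc)
  show thesis
  proof (rule that[OF y])
    fix s i assume s: "s \<in> S" and i: "i < N (Suc n)"
    have xc: "\<Phi> (Suc n) s i x \<in> carrier \<Lambda>" by (rule \<Phi>_closed[OF s i x(1)])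
    show "\<Phi> (Suc n) s i (x \<oplus>\<^bsub>P (Suc n)\<^esub> \<ominus>\<^bsub>P (Suc n)\<^esub> \<delta> ?m y) \<in> Lt (T - length (snd s))"
      unfolding \<Phi>x'[OF s i] using deg[OF s i] by (cases "length (snd s) = a") (auto intro!: Lt_add Lt_minus Lt_\<kappa> L1[OF s i] simp del: power_Suc)
    assume len: "length (snd s) < Suc a"
    show "\<Phi> (Suc n) s i (x \<oplus>\<^bsub>P (Suc n)\<^esub> \<ominus>\<^bsub>P (Suc n)\<^esub> \<delta> ?m y) = \<zero>\<^bsub>\<Lambda>\<^esub>"
    proof (cases "length (snd s) = a")
      case True
      then show ?thesis unfolding \<Phi>x'[OF s i] using xc L0[OF s _ i] by (simp add: \<Lambda>.r_neg del: power_Suc)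
    next
      case False
      then show ?thesis unfolding \<Phi>x'[OF s i] using low[OF s i] len L0[OF s _ i] by (simp del: power_Suc)
    qed
  qed
qed

text \<open>Each step raises the lowest left length \<open>a\<close> by one and keeps
  \<open>T\<close>; \<open>k\<close> counts the steps that remain. Once \<open>T \<le> a\<close>,
  components shorter than \<open>a\<close> vanish by construction and all others because their
  degree bound is zero.\<close>

lemma exact:
  assumes x: "x \<in> carrier (P (Suc n))" "\<delta> (Suc n) x = \<zero>\<^bsub>P n\<^esub>"
  shows "x \<in> \<delta> (Suc (Suc n)) ` carrier (P (Suc (Suc n)))"
proof -
  obtain T where T: "\<forall>s\<in>S. \<forall>i<N (Suc n). \<Phi> (Suc n) s i x \<in> Lt (T - length (snd s))"
    using degree_bound_exists[OF x(1)] by blast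
  have "x \<in> \<delta> (Suc (Suc n)) ` carrier (P (Suc (Suc n)))"
    if "x \<in> carrier (P (Suc n))" "\<delta> (Suc n) x = \<zero>\<^bsub>P n\<^esub>"
      "\<And>s i. s \<in> S \<Longrightarrow> i < N (Suc n) \<Longrightarrow> length (snd s) < a \<Longrightarrow> \<Phi> (Suc n) s i x = \<zero>\<^bsub>\<Lambda>\<^esub>"
      "\<And>s i. s \<in> S \<Longrightarrow> i < N (Suc n) \<Longrightarrow> \<Phi> (Suc n) s i x \<in> Lt (T - length (snd s))" "T \<le> a + k" for x a k
    using that
  proof (induction k arbitrary: a x)
    case 0
    have "x = \<zero>\<^bsub>P (Suc n)\<^esub>"
    proof (rule P_zeroI[OF 0(1)])
      fix s i assume s: "s \<in> S" and i: "i < N (Suc n)"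
      show "\<Phi> (Suc n) s i x = \<zero>\<^bsub>\<Lambda>\<^esub>"
      proof (cases "length (snd s) < a")
        case False
        then have "T - length (snd s) = 0" using 0(5) by simp
        then show ?thesis using 0(4)[OF s i] Lt_0 by simp
      qed (rule 0(3)[OF s i])
    qed
    then show ?case using bimod_hom_zero[OF P_bimodule P_bimodule \<delta>_hom[of "Suc n"]] by (intro image_eqI[of _ _ "\<zero>\<^bsub>P (Suc (Suc n))\<^esub>"]) simp_all
  next
    case (Suc k)
    obtain y where y: "y \<in> carrier (P (Suc (Suc n)))"
      "\<And>s i. s \<in> S \<Longrightarrow> i < N (Suc n) \<Longrightarrow> length (snd s) < Suc a \<Longrightarrow>
        \<Phi> (Suc n) s i (x \<oplus>\<^bsub>P (Suc n)\<^esub> \<ominus>\<^bsub>P (Suc n)\<^esub> \<delta> (Suc (Suc n)) y) = \<zero>\<^bsub>\<Lambda>\<^esub>"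
      "\<And>s i. s \<in> S \<Longrightarrow> i < N (Suc n) \<Longrightarrow>
        \<Phi> (Suc n) s i (x \<oplus>\<^bsub>P (Suc n)\<^esub> \<ominus>\<^bsub>P (Suc n)\<^esub> \<delta> (Suc (Suc n)) y) \<in> Lt (T - length (snd s))"
      by (rule exact_step[OF Suc.prems(1-4)]) (assumption+, rule that)
    let ?x' = "x \<oplus>\<^bsub>P (Suc n)\<^esub> \<ominus>\<^bsub>P (Suc n)\<^esub> \<delta> (Suc (Suc n)) y"
    have \<delta>y: "\<delta> (Suc (Suc n)) y \<in> carrier (P (Suc n))" using bimod_homD(2)[OF \<delta>_hom] y(1) .
    have "?x' \<in> \<delta> (Suc (Suc n)) ` carrier (P (Suc (Suc n)))"
    proof (rule Suc.IH[of ?x' "Suc a"])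
      show "?x' \<in> carrier (P (Suc n))" using Suc.prems(1) \<delta>y by simp
      show "\<delta> (Suc n) ?x' = \<zero>\<^bsub>P n\<^esub>"
        using Suc.prems(1,2) \<delta>y \<delta>_\<delta>[OF y(1)]
          bimod_hom_minus[OF P_bimodule P_bimodule \<delta>_hom[of n] \<delta>y] by (simp add: bimod_homD[OF \<delta>_hom])
    qed (use y(2,3) Suc.prems(5) in auto)
    then obtain z where z: "z \<in> carrier (P (Suc (Suc n)))" "?x' = \<delta> (Suc (Suc n)) z" by blast
    have "x = ?x' \<oplus>\<^bsub>P (Suc n)\<^esub> \<delta> (Suc (Suc n)) y" using Suc.prems(1) \<delta>y by (simp add: P.M.a_assoc P.M.l_neg)
    also have "\<dots> = \<delta> (Suc (Suc n)) (z \<oplus>\<^bsub>P (Suc (Suc n))\<^esub> y)" unfolding z(2) using z(1) y(1) by (simp add: bimod_homD[OF \<delta>_hom])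
    finally show ?case using z(1) y(1) by (intro image_eqI[of _ _ "z \<oplus>\<^bsub>P (Suc (Suc n))\<^esub> y"]) simp_all
  qed
  from this[OF x, of 0 T] show ?thesis using T by simp
qed

end

section \<open>The lifting given by the comultiplication\<close>

context resolution_family
begin

text \<open>The basis of paths is auxiliary: exactness is proved with it, and its choice disappears
  from the conclusion.\<close>

lemma projective_resolution: "projective_bimod_resolution \<Lambda> \<kappa> (bires Q I N f) (bires_diff Q I N f c) \<delta>0"
proof -
  obtain S and \<phi> :: "'v \<times> 'b list \<Rightarrow> ('v, 'b, 'k) path_comb \<Rightarrow> 'k" where "resolution_coordinates Q I N f c S \<phi>"
  proof (rule path_basis_exists[OF homogeneous])
    fix S and \<phi> :: "'v \<times> 'b list \<Rightarrow> ('v, 'b, 'k) path_comb \<Rightarrow> 'k"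
    assume 1: "S \<subseteq> qpaths Q"
      and 2: "\<And>s x y. x \<in> carrier R \<Longrightarrow> y \<in> carrier R \<Longrightarrow> \<phi> s (x + y) = \<phi> s x + \<phi> s y"
      and 3: "\<And>s x c. x \<in> carrier R \<Longrightarrow> \<phi> s (pm_scale c x) = c * \<phi> s x"
      and 4: "\<And>s x. s \<in> S \<Longrightarrow> x \<in> I \<Longrightarrow> \<phi> s x = 0"
      and 5: "\<And>s s'. s \<in> S \<Longrightarrow> s' \<in> S \<Longrightarrow> \<phi> s (Poly_Mapping.single s' 1) = (if s = s' then 1 else 0)"
      and 6: "\<And>x. x \<in> carrier R \<Longrightarrow> finite {s \<in> S. \<phi> s x \<noteq> 0}"
      and 7: "\<And>x. x \<in> carrier R \<Longrightarrow> x - (\<Sum>s\<in>{s \<in> S. \<phi> s x \<noteq> 0}. Poly_Mapping.single s (\<phi> s x)) \<in> I"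
      and 8: "\<And>s x d. s \<in> S \<Longrightarrow> x \<in> homogeneous_elts Q d \<Longrightarrow> length (snd s) \<noteq> d \<Longrightarrow> \<phi> s x = 0"
    have "resolution_coordinates Q I N f c S \<phi>"
      by (intro resolution_coordinates.intro resolution_family_axioms resolution_coordinates_axioms.intro)
        (rule 1, rule 2, assumption+, rule 3, assumption, rule 4, assumption+, rule 5, assumption+, rule 6, assumption,
          rule 7, assumption, rule 8)
    then show thesis by (rule that)
  qed
  then interpret resolution_coordinates Q I N f c S \<phi> .
  show ?thesis
  proof (intro projective_bimod_resolution.intro projective_bimod_resolution_axioms.intro)
    show "k_algebra \<Lambda> \<kappa>" by (rule \<Lambda>.k_algebra_axioms)
    show "k_bimodule \<Lambda> \<kappa> (P n)" for n by (rule P_bimodule)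
    show "\<delta> (Suc n) \<in> bimod_hom \<Lambda> (P (Suc n)) (P n)" for n by (rule \<delta>_hom)
    show "\<delta>0 \<in> bimod_hom \<Lambda> (P 0) reg" by (rule \<delta>0_hom)
    show "\<delta> (Suc n) (\<delta> (Suc (Suc n)) x) = \<zero>\<^bsub>P n\<^esub>" if "x \<in> carrier (P (Suc (Suc n)))" for n x using that by (rule \<delta>_\<delta>)
    show "\<delta>0 (\<delta> 1 x) = \<zero>\<^bsub>\<Lambda>\<^esub>" if "x \<in> carrier (P 1)" for x using that by (rule \<delta>0_\<delta>)
    show "x \<in> \<delta> (Suc (Suc n)) ` carrier (P (Suc (Suc n)))"
      if "x \<in> carrier (P (Suc n))" "\<delta> (Suc n) x = \<zero>\<^bsub>P n\<^esub>" for n x using that by (rule exact)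
    show "x \<in> \<delta> 1 ` carrier (P 1)" if "x \<in> carrier (P 0)" "\<delta>0 x = \<zero>\<^bsub>\<Lambda>\<^esub>" for x using that by (rule exact0)
    show "\<delta>0 ` carrier (P 0) = carrier \<Lambda>" by (rule \<delta>0_surj)
    show "\<exists>h\<in>bimod_hom \<Lambda> (P n) (P i). \<forall>x\<in>carrier (P n). d (h x) = g x"
      if "g \<in> bimod_hom \<Lambda> (P n) (P j)" "d \<in> bimod_hom \<Lambda> (P i) (P j)" "g ` carrier (P n) \<subseteq> d ` carrier (P i)" for g d n i j
      by (rule P_lift[OF P_bimodule P_bimodule that])
    show "\<exists>h\<in>bimod_hom \<Lambda> (P n) (P i). \<forall>x\<in>carrier (P n). d (h x) = g x"
      if "g \<in> bimod_hom \<Lambda> (P n) reg" "d \<in> bimod_hom \<Lambda> (P i) reg" "g ` carrier (P n) \<subseteq> d ` carrier (P i)" for g d n i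
      by (rule P_lift[OF P_bimodule reg_bimodule that])
  qed
qed

context
  fixes \<theta> :: "('v, 'b, 'k) res_elt \<Rightarrow> ('v, 'b, 'k) path_comb set" and m :: nat
  assumes \<theta>: "\<theta> \<in> HH_cocycles \<Lambda> (bires Q I N f) (bires_diff Q I N f c) m"
begin

abbreviation "z t \<equiv> \<theta> (\<epsilon> m t)"

lemma \<theta>_hom: "\<theta> \<in> bimod_hom \<Lambda> (P m) reg"
  using \<theta> by (simp add: HH_cocycles_def)

lemma z_closed [simp]: "t < N m \<Longrightarrow> z t \<in> carrier \<Lambda>"
  using bimod_homD(2)[OF \<theta>_hom] by simp

lemma E_z: "t < N m \<Longrightarrow> E (org m t) \<otimes>\<^bsub>\<Lambda>\<^esub> z t = z t" and z_E: "t < N m \<Longrightarrow> z t \<otimes>\<^bsub>\<Lambda>\<^esub> E (trm m t) = z t"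
  using bimod_homD(4)[OF \<theta>_hom, of "\<epsilon> m t" "E (trm m t)"] bimod_homD(5)[OF \<theta>_hom, of "\<epsilon> m t" "E (org m t)"]
  by (simp_all add: E_\<epsilon> \<epsilon>_E)

lemma \<epsilon>_z_zero: "p < N i \<Longrightarrow> t < N m \<Longrightarrow> trm i p \<noteq> org m t \<Longrightarrow> \<epsilon> i p \<triangleleft>\<^bsub>P i\<^esub> z t = \<zero>\<^bsub>P i\<^esub>"
  using \<Lambda>.m_assoc[of "E (trm i p)" "E (org m t)" "z t"] by (intro \<epsilon>_rs_zero) (simp_all add: E_mult E_z)

lemma arr_z_zero: "q < N 1 \<Longrightarrow> t < N m \<Longrightarrow> trm 1 q \<noteq> org m t \<Longrightarrow> arr q \<otimes>\<^bsub>\<Lambda>\<^esub> z t = \<zero>\<^bsub>\<Lambda>\<^esub>"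
  using \<Lambda>.m_assoc[of "arr q" "E (org m t)" "z t"] by (simp add: arr_E E_z del: One_nat_def path_algebra_simps)

lemma z_arr_zero: "q < N 1 \<Longrightarrow> t < N m \<Longrightarrow> trm m t \<noteq> org 1 q \<Longrightarrow> z t \<otimes>\<^bsub>\<Lambda>\<^esub> arr q = \<zero>\<^bsub>\<Lambda>\<^esub>"
  using \<Lambda>.m_assoc[of "z t" "E (trm m t)" "arr q"] by (simp add: E_arr z_E del: One_nat_def path_algebra_simps)

text \<open>Heuristically the diagonal, which sends a generator to the sum of the tensors of
  \<open>\<epsilon> i p\<close> and \<open>\<epsilon> m t\<close> over the algebra, weighted by the
  structure constants, followed by \<open>\<theta>\<close> on the second factor.\<close>

definition lift_gen :: "nat \<Rightarrow> nat \<Rightarrow> ('v, 'b, 'k) res_elt" where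
  "lift_gen i l = P.lc2 i {..<N i} {..<N m} (c (m + i) l i) (\<lambda>p t. \<epsilon> i p \<triangleleft>\<^bsub>P i\<^esub> z t)"

lemma lift_gen_closed: "lift_gen i l \<in> carrier (P i)"
  unfolding lift_gen_def by (rule P.lc2_closed) simp

lemma lift_gen_E:
  assumes "l < N (m + i)"
  shows "E (org (m + i) l) \<triangleright>\<^bsub>P i\<^esub> lift_gen i l = lift_gen i l" "lift_gen i l \<triangleleft>\<^bsub>P i\<^esub> E (trm (m + i) l) = lift_gen i l"
proof -
  let ?B = "\<lambda>p t. \<epsilon> i p \<triangleleft>\<^bsub>P i\<^esub> z t"
  have B: "?B p t \<in> carrier (P i)" if "p < N i" "t < N m" for p t using that by simp
  have EB: "E (org i p) \<triangleright>\<^bsub>P i\<^esub> ?B p t = ?B p t" if "p < N i" "t < N m" for p t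
    using that P.ls_rs[of "\<epsilon> i p" i "E (org i p)" "z t"] by (simp add: E_\<epsilon> del: path_algebra_simps)
  have BE: "?B p t \<triangleleft>\<^bsub>P i\<^esub> E (trm m t) = ?B p t" if "p < N i" "t < N m" for p t
    using that P.rs_assoc[of "\<epsilon> i p" i "z t" "E (trm m t)"] by (simp add: z_E del: path_algebra_simps)
  note support = lc2_support[OF P_bimodule add.commute assms, of ?B, OF B \<epsilon>_z_zero EB BE, folded lift_gen_def]
  show "E (org (m + i) l) \<triangleright>\<^bsub>P i\<^esub> lift_gen i l = lift_gen i l" "lift_gen i l \<triangleleft>\<^bsub>P i\<^esub> E (trm (m + i) l) = lift_gen i l"
    by (rule support; assumption)+
qed

lemma \<theta>_dl: "\<theta> (dl m q) = reg.lc2 {..<N 1} {..<N m} (c (Suc m) q 1) (\<lambda>s u. arr s \<otimes>\<^bsub>\<Lambda>\<^esub> z u)"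
  and \<theta>_dr: "\<theta> (dr m q) = reg.lc2 {..<N m} {..<N 1} (c (Suc m) q m) (\<lambda>t u. z t \<otimes>\<^bsub>\<Lambda>\<^esub> arr u)"
  using hom_dl[OF reg_bimodule \<theta>_hom, of q] by (simp_all only: reg_simps)

lemma \<theta>_d_closed: "\<theta> (dl m q) \<in> carrier \<Lambda>" "\<theta> (dr m q) \<in> carrier \<Lambda>"
  using bimod_homD(2)[OF \<theta>_hom] by simp_all

text \<open>The cocycle condition at a generator of degree \<open>Suc m\<close>: the differential
  has the sign \<open>(-1)^(m+1)\<close> there, and moving the term to the other side leaves
  \<open>(-1)^m\<close>.\<close>

lemma \<theta>_dl_dr:
  assumes "q < N (Suc m)"
  shows "\<theta> (dl m q) = \<kappa> ((- 1) ^ m) \<otimes>\<^bsub>\<Lambda>\<^esub> \<theta> (dr m q)"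
proof -
  have "\<theta> (d m q) = \<zero>\<^bsub>\<Lambda>\<^esub>"
    using \<theta> \<epsilon>_closed[OF assms] unfolding HH_cocycles_def \<delta>_\<epsilon>[OF assms, symmetric] by simp
  then have "\<theta> (dl m q) \<oplus>\<^bsub>\<Lambda>\<^esub> \<kappa> ((- 1) ^ Suc m) \<otimes>\<^bsub>\<Lambda>\<^esub> \<theta> (dr m q) = \<zero>\<^bsub>\<Lambda>\<^esub>"
    using hom_d[OF reg_bimodule \<theta>_hom, of q] by (simp del: power_Suc)
  then have "\<theta> (dl m q) = \<ominus>\<^bsub>\<Lambda>\<^esub> (\<kappa> ((- 1) ^ Suc m) \<otimes>\<^bsub>\<Lambda>\<^esub> \<theta> (dr m q))"
    using \<theta>_d_closed by (intro \<Lambda>.minus_equality[symmetric]) simp_all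
  then show ?thesis using \<theta>_d_closed by (simp add: \<Lambda>.\<kappa>_uminus \<Lambda>.l_minus)
qed

text \<open>Coassociativity for \<open>1 + i + m\<close>: the arrow on the far left becomes part of
  the left half of the differential of degree \<open>Suc i\<close>.\<close>

lemma left_part:
  assumes l: "l < N (Suc (m + i))"
  shows "P.lc2 i {..<N 1} {..<N (m + i)} (c (Suc (m + i)) l 1) (\<lambda>p j. arr p \<triangleright>\<^bsub>P i\<^esub> lift_gen i j) =
    P.lc2 i {..<N (Suc i)} {..<N m} (c (Suc (m + i)) l (Suc i)) (\<lambda>q u. dl i q \<triangleleft>\<^bsub>P i\<^esub> z u)"
proof -
  let ?B = "\<lambda>p s u. arr p \<triangleright>\<^bsub>P i\<^esub> (\<epsilon> i s \<triangleleft>\<^bsub>P i\<^esub> z u)"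
  have B: "?B p s u \<in> carrier (P i)" if "p < N 1" "s < N i" "u < N m" for p s u
    using that by (simp del: One_nat_def)
  have B0: "?B p s u = \<zero>\<^bsub>P i\<^esub>" if psu: "p < N 1" "s < N i" "u < N m" and ne: "trm 1 p \<noteq> org i s \<or> trm i s \<noteq> org m u" for p s u
    using ne
  proof
    assume "trm 1 p \<noteq> org i s"
    then show ?thesis using psu by (simp add: arr_\<epsilon>_zero del: One_nat_def flip: P.ls_rs)
  next
    assume "trm i s \<noteq> org m u"
    then show ?thesis using psu by (simp add: \<epsilon>_z_zero del: One_nat_def)
  qed
  have 1: "P.lc2 i {..<N 1} {..<N (m + i)} (c (Suc (m + i)) l 1) (\<lambda>p j. arr p \<triangleright>\<^bsub>P i\<^esub> lift_gen i j) =
      P.lc2 i {..<N 1} {..<N (m + i)} (c (Suc (m + i)) l 1) (\<lambda>p j. P.lc2 i {..<N i} {..<N m} (c (m + i) j i) (?B p))"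
    unfolding lift_gen_def by (intro P.lc2_cong_eq P.lc2_closed P.lc2_ls) (simp_all del: One_nat_def)
  have 2: "P.lc2 i {..<N 1} {..<N (m + i)} (c (Suc (m + i)) l 1) (\<lambda>p j. P.lc2 i {..<N i} {..<N m} (c (m + i) j i) (?B p)) =
      P.lc2 i {..<N (Suc i)} {..<N m} (c (Suc (m + i)) l (Suc i)) (\<lambda>q u. P.lc2 i {..<N 1} {..<N i} (c (Suc i) q 1) (\<lambda>p s. ?B p s u))"
    by (rule lc2_coassoc[OF P_bimodule _ l]) (use B B0 in \<open>auto simp del: One_nat_def\<close>)
  have 3: "\<dots> = P.lc2 i {..<N (Suc i)} {..<N m} (c (Suc (m + i)) l (Suc i)) (\<lambda>q u. dl i q \<triangleleft>\<^bsub>P i\<^esub> z u)"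
  proof (rule P.lc2_cong_eq)
    fix q u assume "q \<in> {..<N (Suc i)}" "u \<in> {..<N m}"
    then have u: "u < N m" by simp
    show "dl i q \<triangleleft>\<^bsub>P i\<^esub> z u \<in> carrier (P i)" using u by simp
    have "dl i q \<triangleleft>\<^bsub>P i\<^esub> z u = P.lc2 i {..<N 1} {..<N i} (c (Suc i) q 1) (\<lambda>p s. (arr p \<triangleright>\<^bsub>P i\<^esub> \<epsilon> i s) \<triangleleft>\<^bsub>P i\<^esub> z u)"
      unfolding dl_def by (rule P.lc2_rs) (use u in \<open>simp_all del: One_nat_def\<close>)
    also have "\<dots> = P.lc2 i {..<N 1} {..<N i} (c (Suc i) q 1) (\<lambda>p s. ?B p s u)"
      by (rule P.lc2_cong_eq) (use u in \<open>simp_all add: P.ls_rs del: One_nat_def\<close>)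
    finally show "P.lc2 i {..<N 1} {..<N i} (c (Suc i) q 1) (\<lambda>p s. ?B p s u) = dl i q \<triangleleft>\<^bsub>P i\<^esub> z u" by (rule sym)
  qed
  show ?thesis unfolding 1 2 3 ..
qed

text \<open>Coassociativity for \<open>i + 1 + m\<close>: the arrow in the middle belongs to the
  right half of the differential in one bracketing and to the cocycle condition of
  \<open>\<theta>\<close> in the other.\<close>

lemma middle_part:
  assumes l: "l < N (Suc (m + i))"
  shows "P.lc2 i {..<N (Suc i)} {..<N m} (c (Suc (m + i)) l (Suc i)) (\<lambda>q u. dr i q \<triangleleft>\<^bsub>P i\<^esub> z u) =
    P.lc2 i {..<N i} {..<N (Suc m)} (c (Suc (m + i)) l i) (\<lambda>p q. \<epsilon> i p \<triangleleft>\<^bsub>P i\<^esub> \<theta> (dl m q))"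
proof -
  let ?B = "\<lambda>p s u. \<epsilon> i p \<triangleleft>\<^bsub>P i\<^esub> (arr s \<otimes>\<^bsub>\<Lambda>\<^esub> z u)"
  have B: "?B p s u \<in> carrier (P i)" if "p < N i" "s < N 1" "u < N m" for p s u
    using that by (simp del: One_nat_def)
  have B0: "?B p s u = \<zero>\<^bsub>P i\<^esub>" if psu: "p < N i" "s < N 1" "u < N m" and ne: "trm i p \<noteq> org 1 s \<or> trm 1 s \<noteq> org m u" for p s u
    using ne
  proof
    assume "trm i p \<noteq> org 1 s"
    then show ?thesis using psu P.rs_assoc[of "\<epsilon> i p" i "arr s" "z u"] by (simp add: \<epsilon>_arr_zero del: One_nat_def)
  next
    assume "trm 1 s \<noteq> org m u"
    then show ?thesis using psu by (simp add: arr_z_zero del: One_nat_def)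
  qed
  have 1: "P.lc2 i {..<N i} {..<N (Suc m)} (c (Suc (m + i)) l i) (\<lambda>p q. \<epsilon> i p \<triangleleft>\<^bsub>P i\<^esub> \<theta> (dl m q)) =
      P.lc2 i {..<N i} {..<N (Suc m)} (c (Suc (m + i)) l i) (\<lambda>p q. P.lc2 i {..<N 1} {..<N m} (c (Suc m) q 1) (?B p))"
    unfolding \<theta>_dl by (intro P.lc2_cong_eq P.lc2_closed P.rs_lc2_reg) (simp_all del: One_nat_def)
  have 2: "P.lc2 i {..<N i} {..<N (Suc m)} (c (Suc (m + i)) l i) (\<lambda>p q. P.lc2 i {..<N 1} {..<N m} (c (Suc m) q 1) (?B p)) =
      P.lc2 i {..<N (Suc i)} {..<N m} (c (Suc (m + i)) l (Suc i)) (\<lambda>q u. P.lc2 i {..<N i} {..<N 1} (c (Suc i) q i) (\<lambda>p s. ?B p s u))"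
    by (rule lc2_coassoc[OF P_bimodule _ l]) (use B B0 in \<open>auto simp del: One_nat_def\<close>)
  have 3: "\<dots> = P.lc2 i {..<N (Suc i)} {..<N m} (c (Suc (m + i)) l (Suc i)) (\<lambda>q u. dr i q \<triangleleft>\<^bsub>P i\<^esub> z u)"
  proof (rule P.lc2_cong_eq)
    fix q u assume "q \<in> {..<N (Suc i)}" "u \<in> {..<N m}"
    then have u: "u < N m" by simp
    show "dr i q \<triangleleft>\<^bsub>P i\<^esub> z u \<in> carrier (P i)" using u by simp
    have "dr i q \<triangleleft>\<^bsub>P i\<^esub> z u = P.lc2 i {..<N i} {..<N 1} (c (Suc i) q i) (\<lambda>p s. (\<epsilon> i p \<triangleleft>\<^bsub>P i\<^esub> arr s) \<triangleleft>\<^bsub>P i\<^esub> z u)"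
      unfolding dr_def by (rule P.lc2_rs) (use u in \<open>simp_all del: One_nat_def\<close>)
    also have "\<dots> = P.lc2 i {..<N i} {..<N 1} (c (Suc i) q i) (\<lambda>p s. ?B p s u)"
      by (rule P.lc2_cong_eq) (use u in \<open>simp_all add: P.rs_assoc del: One_nat_def\<close>)
    finally show "P.lc2 i {..<N i} {..<N 1} (c (Suc i) q i) (\<lambda>p s. ?B p s u) = dr i q \<triangleleft>\<^bsub>P i\<^esub> z u" by (rule sym)
  qed
  show ?thesis unfolding 1 2 3 ..
qed

text \<open>Coassociativity for \<open>i + m + 1\<close>: the arrow on the far right is joined to
  the value of \<open>\<theta>\<close>.\<close>

lemma right_part:
  assumes l: "l < N (Suc (m + i))"
  shows "P.lc2 i {..<N (m + i)} {..<N 1} (c (Suc (m + i)) l (m + i)) (\<lambda>j q. lift_gen i j \<triangleleft>\<^bsub>P i\<^esub> arr q) =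
    P.lc2 i {..<N i} {..<N (Suc m)} (c (Suc (m + i)) l i) (\<lambda>p q. \<epsilon> i p \<triangleleft>\<^bsub>P i\<^esub> \<theta> (dr m q))"
proof -
  let ?B = "\<lambda>p s u. \<epsilon> i p \<triangleleft>\<^bsub>P i\<^esub> (z s \<otimes>\<^bsub>\<Lambda>\<^esub> arr u)"
  have B: "?B p s u \<in> carrier (P i)" if "p < N i" "s < N m" "u < N 1" for p s u
    using that by (simp del: One_nat_def)
  have B0: "?B p s u = \<zero>\<^bsub>P i\<^esub>" if psu: "p < N i" "s < N m" "u < N 1" and ne: "trm i p \<noteq> org m s \<or> trm m s \<noteq> org 1 u" for p s u
    using ne
  proof
    assume "trm i p \<noteq> org m s"
    then show ?thesis using psu P.rs_assoc[of "\<epsilon> i p" i "z s" "arr u"] by (simp add: \<epsilon>_z_zero del: One_nat_def)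
  next
    assume "trm m s \<noteq> org 1 u"
    then show ?thesis using psu by (simp add: z_arr_zero del: One_nat_def)
  qed
  have 1: "P.lc2 i {..<N i} {..<N (Suc m)} (c (Suc (m + i)) l i) (\<lambda>p q. \<epsilon> i p \<triangleleft>\<^bsub>P i\<^esub> \<theta> (dr m q)) =
      P.lc2 i {..<N i} {..<N (Suc m)} (c (Suc (m + i)) l i) (\<lambda>p q. P.lc2 i {..<N m} {..<N 1} (c (Suc m) q m) (?B p))"
    unfolding \<theta>_dr by (intro P.lc2_cong_eq P.lc2_closed P.rs_lc2_reg) (simp_all del: One_nat_def)
  have 2: "P.lc2 i {..<N i} {..<N (Suc m)} (c (Suc (m + i)) l i) (\<lambda>p q. P.lc2 i {..<N m} {..<N 1} (c (Suc m) q m) (?B p)) =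
      P.lc2 i {..<N (m + i)} {..<N 1} (c (Suc (m + i)) l (m + i)) (\<lambda>q u. P.lc2 i {..<N i} {..<N m} (c (m + i) q i) (\<lambda>p s. ?B p s u))"
    by (rule lc2_coassoc[OF P_bimodule _ l]) (use B B0 in \<open>auto simp del: One_nat_def\<close>)
  have 3: "\<dots> = P.lc2 i {..<N (m + i)} {..<N 1} (c (Suc (m + i)) l (m + i)) (\<lambda>j q. lift_gen i j \<triangleleft>\<^bsub>P i\<^esub> arr q)"
  proof (rule P.lc2_cong_eq)
    fix j u assume "j \<in> {..<N (m + i)}" "u \<in> {..<N 1}"
    then have u: "u < N 1" by simp
    show "lift_gen i j \<triangleleft>\<^bsub>P i\<^esub> arr u \<in> carrier (P i)" using u lift_gen_closed by (simp del: One_nat_def)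
    have "lift_gen i j \<triangleleft>\<^bsub>P i\<^esub> arr u = P.lc2 i {..<N i} {..<N m} (c (m + i) j i) (\<lambda>p s. (\<epsilon> i p \<triangleleft>\<^bsub>P i\<^esub> z s) \<triangleleft>\<^bsub>P i\<^esub> arr u)"
      unfolding lift_gen_def by (rule P.lc2_rs) (use u in \<open>simp_all del: One_nat_def\<close>)
    also have "\<dots> = P.lc2 i {..<N i} {..<N m} (c (m + i) j i) (\<lambda>p s. ?B p s u)"
      by (rule P.lc2_cong_eq) (use u in \<open>simp_all add: P.rs_assoc del: One_nat_def\<close>)
    finally show "P.lc2 i {..<N i} {..<N m} (c (m + i) j i) (\<lambda>p s. ?B p s u) = lift_gen i j \<triangleleft>\<^bsub>P i\<^esub> arr u" by (rule sym)
  qed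
  show ?thesis unfolding 1 2 3 ..
qed

text \<open>The left parts agree by \<open>left_part\<close>. The right part has the sign
  \<open>(-1)^(m+i+1)\<close> in the source and \<open>(-1)^(i+1)\<close> in the target;
  \<open>middle_part\<close>, \<open>\<theta>_dl_dr\<close> and \<open>right_part\<close> compensate
  with \<open>(-1)^m\<close>, hence the lifting carries no sign of its own.\<close>

lemma lifting_generator:
  assumes h: "h \<in> bimod_hom \<Lambda> (P (m + i)) (P i)" "\<And>l. l < N (m + i) \<Longrightarrow> h (\<epsilon> (m + i) l) = lift_gen i l"
    and l: "l < N (Suc (m + i))"
  shows "h (d (m + i) l) = \<delta> (Suc i) (lift_gen (Suc i) l)"
proof -
  let ?n = "Suc (m + i)"
  let ?C = "P.lc2 i {..<N i} {..<N (Suc m)} (c ?n l i) (\<lambda>p q. \<epsilon> i p \<triangleleft>\<^bsub>P i\<^esub> \<theta> (dr m q))"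
  let ?D = "P.lc2 i {..<N (Suc i)} {..<N m} (c ?n l (Suc i)) (\<lambda>q u. dr i q \<triangleleft>\<^bsub>P i\<^esub> z u)"
  let ?L = "P.lc2 i {..<N (Suc i)} {..<N m} (c ?n l (Suc i)) (\<lambda>q u. dl i q \<triangleleft>\<^bsub>P i\<^esub> z u)"
  have C: "?C \<in> carrier (P i)" by (rule P.lc2_closed) (use \<theta>_d_closed in simp)
  have h_dl: "h (dl (m + i) l) = ?L"
  proof -
    have "h (dl (m + i) l) = P.lc2 i {..<N 1} {..<N (m + i)} (c ?n l 1) (\<lambda>p j. arr p \<triangleright>\<^bsub>P i\<^esub> lift_gen i j)"
      unfolding hom_dl(1)[OF P_bimodule h(1)] by (rule P.lc2_cong_eq) (use lift_gen_closed h(2) in \<open>simp_all del: One_nat_def\<close>)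
    then show ?thesis using left_part[OF l] by (rule trans)
  qed
  have h_dr: "h (dr (m + i) l) = ?C"
  proof -
    have "h (dr (m + i) l) = P.lc2 i {..<N (m + i)} {..<N 1} (c ?n l (m + i)) (\<lambda>j q. lift_gen i j \<triangleleft>\<^bsub>P i\<^esub> arr q)"
      unfolding hom_dl(2)[OF P_bimodule h(1)] by (rule P.lc2_cong_eq) (use lift_gen_closed h(2) in \<open>simp_all del: One_nat_def\<close>)
    then show ?thesis using right_part[OF l] by (rule trans)
  qed
  have D: "?D = \<kappa> ((- 1) ^ m) \<triangleright>\<^bsub>P i\<^esub> ?C"
  proof -
    have "?D = P.lc2 i {..<N i} {..<N (Suc m)} (c ?n l i) (\<lambda>p q. \<epsilon> i p \<triangleleft>\<^bsub>P i\<^esub> \<theta> (dl m q))" by (rule middle_part[OF l])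
    also have "\<dots> = P.lc2 i {..<N i} {..<N (Suc m)} (c ?n l i) (\<lambda>p q. \<kappa> ((- 1) ^ m) \<triangleright>\<^bsub>P i\<^esub> (\<epsilon> i p \<triangleleft>\<^bsub>P i\<^esub> \<theta> (dr m q)))"
    proof (rule P.lc2_cong_eq)
      fix p q assume "p \<in> {..<N i}" "q \<in> {..<N (Suc m)}"
      then have pq: "p < N i" "q < N (Suc m)" by auto
      show "\<kappa> ((- 1) ^ m) \<triangleright>\<^bsub>P i\<^esub> (\<epsilon> i p \<triangleleft>\<^bsub>P i\<^esub> \<theta> (dr m q)) \<in> carrier (P i)" using pq \<theta>_d_closed by simp
      show "\<epsilon> i p \<triangleleft>\<^bsub>P i\<^esub> \<theta> (dl m q) = \<kappa> ((- 1) ^ m) \<triangleright>\<^bsub>P i\<^esub> (\<epsilon> i p \<triangleleft>\<^bsub>P i\<^esub> \<theta> (dr m q))"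
        unfolding \<theta>_dl_dr[OF pq(2)] using pq(1) \<theta>_d_closed(2)[of q] by (simp add: P.\<kappa>_central flip: P.rs_assoc P.ls_rs)
    qed
    also have "\<dots> = \<kappa> ((- 1) ^ m) \<triangleright>\<^bsub>P i\<^esub> ?C" by (rule P.lc2_ls[symmetric]) (use \<theta>_d_closed in simp_all)
    finally show ?thesis .
  qed
  have "h (d (m + i) l) = ?L \<oplus>\<^bsub>P i\<^esub> \<kappa> ((- 1) ^ ?n) \<triangleright>\<^bsub>P i\<^esub> ?C"
    unfolding hom_d[OF P_bimodule h(1)] h_dl h_dr ..
  also have "\<dots> = ?L \<oplus>\<^bsub>P i\<^esub> \<kappa> ((- 1) ^ Suc i) \<triangleright>\<^bsub>P i\<^esub> ?D"
  proof -
    have "\<kappa> ((- 1) ^ Suc i) \<triangleright>\<^bsub>P i\<^esub> (\<kappa> ((- 1) ^ m) \<triangleright>\<^bsub>P i\<^esub> ?C) = \<kappa> ((- 1) ^ Suc i * (- 1) ^ m) \<triangleright>\<^bsub>P i\<^esub> ?C"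
      unfolding \<Lambda>.\<kappa>_mult using C by (intro P.ls_assoc[symmetric]) simp_all
    moreover have "(- 1 :: 'k) ^ Suc i * (- 1) ^ m = (- 1) ^ ?n" by (simp add: power_add mult.commute)
    ultimately show ?thesis unfolding D by (simp only:)
  qed
  also have "\<dots> = P.lc2 i {..<N (Suc i)} {..<N m} (c ?n l (Suc i)) (\<lambda>q u. dl i q \<triangleleft>\<^bsub>P i\<^esub> z u \<oplus>\<^bsub>P i\<^esub> \<kappa> ((- 1) ^ Suc i) \<triangleright>\<^bsub>P i\<^esub> (dr i q \<triangleleft>\<^bsub>P i\<^esub> z u))"
  proof -
    have "\<kappa> ((- 1) ^ Suc i) \<triangleright>\<^bsub>P i\<^esub> ?D = P.lc2 i {..<N (Suc i)} {..<N m} (c ?n l (Suc i)) (\<lambda>q u. \<kappa> ((- 1) ^ Suc i) \<triangleright>\<^bsub>P i\<^esub> (dr i q \<triangleleft>\<^bsub>P i\<^esub> z u))"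
      by (rule P.lc2_ls) simp_all
    then show ?thesis by (simp only:) (rule P.lc2_add[symmetric]; simp del: power_Suc)
  qed
  also have "\<dots> = P.lc2 i {..<N (Suc i)} {..<N m} (c ?n l (Suc i)) (\<lambda>q u. \<delta> (Suc i) (\<epsilon> (Suc i) q \<triangleleft>\<^bsub>P (Suc i)\<^esub> z u))"
    by (rule P.lc2_cong_eq[symmetric])
      (simp_all add: bimod_homD[OF \<delta>_hom] \<delta>_\<epsilon> d_def P.add_rs P.ls_rs del: power_Suc)
  also have "\<dots> = \<delta> (Suc i) (lift_gen (Suc i) l)"
    unfolding lift_gen_def add_Suc_right by (rule bimod_hom_lc2[OF P_bimodule P_bimodule \<delta>_hom, symmetric]) simp
  finally show ?thesis .
qed

lemma lifting_exists:
  obtains \<Theta> where "chain_lifting \<Lambda> (bires Q I N f) (bires_diff Q I N f c) \<delta>0 m \<theta> \<Theta>"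
    "\<And>i l. l < N (m + i) \<Longrightarrow> \<Theta> i (\<epsilon> (m + i) l) = lift_gen i l"
proof -
  have "\<exists>h. h \<in> bimod_hom \<Lambda> (P (m + i)) (P i) \<and> (\<forall>l<N (m + i). h (\<epsilon> (m + i) l) = lift_gen i l)" for i
  proof -
    obtain h where "h \<in> bimod_hom \<Lambda> (P (m + i)) (P i)" "\<And>l. l < N (m + i) \<Longrightarrow> h (\<epsilon> (m + i) l) = lift_gen i l"
      by (rule P_hom_exists[OF P_bimodule lift_gen_closed lift_gen_E]) (assumption+, rule that)
    then show ?thesis by blast
  qed
  then obtain \<Theta> where \<Theta>': "\<forall>i. \<Theta> i \<in> bimod_hom \<Lambda> (P (m + i)) (P i) \<and> (\<forall>l<N (m + i). \<Theta> i (\<epsilon> (m + i) l) = lift_gen i l)"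
    using choice[of "\<lambda>i h. h \<in> bimod_hom \<Lambda> (P (m + i)) (P i) \<and> (\<forall>l<N (m + i). h (\<epsilon> (m + i) l) = lift_gen i l)"] by blast
  have \<Theta>: "\<Theta> i \<in> bimod_hom \<Lambda> (P (m + i)) (P i)" "l < N (m + i) \<Longrightarrow> \<Theta> i (\<epsilon> (m + i) l) = lift_gen i l" for i l
    using \<Theta>' by blast+
  have step: "\<Theta> i (\<delta> (Suc (m + i)) x) = \<delta> (Suc i) (\<Theta> (Suc i) x)" if x: "x \<in> carrier (P (Suc (m + i)))" for i x
  proof -
    have \<Theta>S: "\<Theta> (Suc i) \<in> bimod_hom \<Lambda> (P (Suc (m + i))) (P (Suc i))" using \<Theta>(1)[of "Suc i"] by simp
    have eq: "(\<lambda>x\<in>carrier (P (Suc (m + i))). \<Theta> i (\<delta> (Suc (m + i)) x)) = (\<lambda>x\<in>carrier (P (Suc (m + i))). \<delta> (Suc i) (\<Theta> (Suc i) x))"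
    proof (rule P_hom_eqI[OF bimod_hom_compose[OF P_bimodule \<delta>_hom \<Theta>(1)] bimod_hom_compose[OF P_bimodule \<Theta>S \<delta>_hom] P_bimodule])
      fix l assume l: "l < N (Suc (m + i))"
      have "\<Theta> (Suc i) (\<epsilon> (Suc (m + i)) l) = lift_gen (Suc i) l" using \<Theta>(2)[of l "Suc i"] l by simp
      then show "(\<lambda>x\<in>carrier (P (Suc (m + i))). \<Theta> i (\<delta> (Suc (m + i)) x)) (\<epsilon> (Suc (m + i)) l) =
          (\<lambda>x\<in>carrier (P (Suc (m + i))). \<delta> (Suc i) (\<Theta> (Suc i) x)) (\<epsilon> (Suc (m + i)) l)"
        using l lifting_generator[OF \<Theta> l] by (simp add: \<delta>_\<epsilon>)
    qed
    show ?thesis using fun_cong[OF eq, of x] x by simp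
  qed
  \<comment> \<open>By the counit property \<open>lift_gen 0 l\<close> is the generator of the
    origin vertex times \<open>z l\<close>, and this vertex fixes \<open>z l\<close>.\<close>
  have aug: "\<delta>0 (\<Theta> 0 x) = \<theta> x" if x: "x \<in> carrier (P m)" for x
  proof -
    have \<Theta>0: "\<Theta> 0 \<in> bimod_hom \<Lambda> (P m) (P 0)" using \<Theta>(1)[of 0] by simp
    have eq: "(\<lambda>x\<in>carrier (P m). \<delta>0 (\<Theta> 0 x)) = \<theta>"
    proof (rule P_hom_eqI[OF bimod_hom_compose[OF P_bimodule \<Theta>0 \<delta>0_hom] \<theta>_hom reg_bimodule])
      fix l assume l: "l < N m"
      let ?v = "vertex_index (org m l)"
      have v: "?v < N 0" "org 0 ?v = org m l" using l by (auto simp: vertex_index)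
      have "lift_gen 0 l = P.lc2 0 {..<N 0} {..<N m} (c m l 0) (\<lambda>p t. \<epsilon> 0 p \<triangleleft>\<^bsub>P 0\<^esub> z t)" by (simp add: lift_gen_def)
      also have "\<dots> = \<epsilon> 0 ?v \<triangleleft>\<^bsub>P 0\<^esub> z l"
        by (rule lc2_comult_0[OF P_bimodule l]) (simp_all add: \<epsilon>_z_zero f_0_vertex(2))
      finally have "\<Theta> 0 (\<epsilon> m l) = \<epsilon> 0 ?v \<triangleleft>\<^bsub>P 0\<^esub> z l" using \<Theta>(2)[of l 0] l by simp
      then have "\<delta>0 (\<Theta> 0 (\<epsilon> m l)) = z l" using v l by (simp add: bimod_homD[OF \<delta>0_hom] \<delta>0_\<epsilon> E_z)
      then show "(\<lambda>x\<in>carrier (P m). \<delta>0 (\<Theta> 0 x)) (\<epsilon> m l) = \<theta> (\<epsilon> m l)" using l by simp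
    qed
    show ?thesis using fun_cong[OF eq, of x] x by simp
  qed
  show thesis
  proof (rule that[OF _ \<Theta>(2)])
    show "chain_lifting \<Lambda> (bires Q I N f) (bires_diff Q I N f c) \<delta>0 m \<theta> \<Theta>"
      unfolding chain_lifting_def
    proof (intro conjI allI impI ballI)
      fix i :: nat and x assume "1 \<le> i" and x: "x \<in> carrier (P (m + i))"
      then obtain k where "i = Suc k" by (cases i) auto
      then show "\<Theta> (i - 1) (\<delta> (m + i) x) = \<delta> i (\<Theta> i x)" using step[of x k] x by simp
    qed (use \<Theta>(1) aug in auto)
  qed
qed

end

text \<open>\<open>\<eta>\<close> is right linear, so it sends \<open>\<epsilon> n p\<close> times
  \<open>lam' q\<close> to \<open>lam p\<close> times \<open>lam' q\<close> and the values of the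
  lifting to the asserted sums; by \<open>yoneda_product_eq\<close> this lifting computes the
  product.\<close>

lemma cup_product_formula:
  assumes \<eta>: "\<eta> \<in> HH_cocycles \<Lambda> (bires Q I N f) (bires_diff Q I N f c) n"
    and \<theta>: "\<theta> \<in> HH_cocycles \<Lambda> (bires Q I N f) (bires_diff Q I N f c) m"
    and lam: "\<forall>p<N n. \<eta> (\<epsilon> n p) = lam p" and lam': "\<forall>q<N m. \<theta> (\<epsilon> m q) = lam' q"
  shows "\<exists>\<zeta>\<in>HH_cocycles \<Lambda> (bires Q I N f) (bires_diff Q I N f c) (m + n).
    (\<forall>i<N (m + n). \<zeta> (\<epsilon> (m + n) i) =
      (\<Oplus>\<^bsub>\<Lambda>\<^esub>p\<in>{..<N n}. \<Oplus>\<^bsub>\<Lambda>\<^esub>q\<in>{..<N m}. \<kappa> (c (n + m) i n p q) \<otimes>\<^bsub>\<Lambda>\<^esub> (lam p \<otimes>\<^bsub>\<Lambda>\<^esub> lam' q))) \<and>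
    HH_class \<Lambda> (bires Q I N f) (bires_diff Q I N f c) (m + n) \<zeta> =
      yoneda_product \<Lambda> (bires Q I N f) (bires_diff Q I N f c) \<delta>0 n m
        (HH_class \<Lambda> (bires Q I N f) (bires_diff Q I N f c) n \<eta>) (HH_class \<Lambda> (bires Q I N f) (bires_diff Q I N f c) m \<theta>)"
proof -
  interpret res: projective_bimod_resolution \<Lambda> \<kappa> "bires Q I N f" "bires_diff Q I N f c" \<delta>0
    by (rule projective_resolution)
  have \<eta>_hom: "\<eta> \<in> bimod_hom \<Lambda> (P n) reg" using \<eta> by (simp add: HH_cocycles_def)
  have \<theta>_closed: "lam' t \<in> carrier \<Lambda>" if "t < N m" for t using z_closed[OF \<theta> that] lam' that by simp
  have \<eta>_closed: "lam p \<in> carrier \<Lambda>" if "p < N n" for p using z_closed[OF \<eta> that] lam that by simp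
  obtain \<Theta> where \<Theta>: "chain_lifting \<Lambda> (bires Q I N f) (bires_diff Q I N f c) \<delta>0 m \<theta> \<Theta>"
    "\<And>i l. l < N (m + i) \<Longrightarrow> \<Theta> i (\<epsilon> (m + i) l) = lift_gen \<theta> m i l"
    by (rule lifting_exists[OF \<theta>]) (rule that)
  show ?thesis
  proof (rule bexI[OF _ res.cocycle_compose[OF \<eta> \<Theta>(1)]], intro conjI allI impI)
    fix i assume i: "i < N (m + n)"
    let ?g = "\<lambda>p q. lam p \<otimes>\<^bsub>\<Lambda>\<^esub> lam' q"
    have g: "?g p q \<in> carrier \<Lambda>" if "p < N n" "q < N m" for p q using that \<theta>_closed \<eta>_closed by simp
    have "\<eta> (lift_gen \<theta> m n i) = reg.lc2 {..<N n} {..<N m} (c (m + n) i n) (\<lambda>p t. \<eta> (\<epsilon> n p \<triangleleft>\<^bsub>P n\<^esub> \<theta> (\<epsilon> m t)))"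
      unfolding lift_gen_def[OF \<theta>] by (rule bimod_hom_lc2[OF P_bimodule reg_bimodule \<eta>_hom]) (use z_closed[OF \<theta>] in simp)
    also have "\<dots> = reg.lc2 {..<N n} {..<N m} (c (m + n) i n) ?g"
      by (rule reg.lc2_cong_eq) (use \<theta>_closed \<eta>_closed lam lam' in \<open>simp_all add: bimod_homD[OF \<eta>_hom]\<close>)
    also have "\<dots> = (\<Oplus>\<^bsub>\<Lambda>\<^esub>p\<in>{..<N n}. \<kappa> 1 \<otimes>\<^bsub>\<Lambda>\<^esub> reg.lc {..<N m} (c (m + n) i n p) (?g p))"
      unfolding reg.lc2_def by (rule \<Lambda>.lc_regular) (use g in \<open>auto intro!: reg.lc_closed[unfolded reg_simps]\<close>)
    also have "\<dots> = (\<Oplus>\<^bsub>\<Lambda>\<^esub>p\<in>{..<N n}. \<Oplus>\<^bsub>\<Lambda>\<^esub>q\<in>{..<N m}. \<kappa> (c (n + m) i n p q) \<otimes>\<^bsub>\<Lambda>\<^esub> ?g p q)"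
    proof (rule \<Lambda>.finsum_cong'[OF refl])
      fix p assume "p \<in> {..<N n}"
      then have p: "p < N n" by simp
      have "reg.lc {..<N m} (c (m + n) i n p) (?g p) = (\<Oplus>\<^bsub>\<Lambda>\<^esub>q\<in>{..<N m}. \<kappa> (c (m + n) i n p q) \<otimes>\<^bsub>\<Lambda>\<^esub> ?g p q)"
        by (rule \<Lambda>.lc_regular) (use g p in auto)
      moreover have "(\<Oplus>\<^bsub>\<Lambda>\<^esub>q\<in>{..<N m}. \<kappa> (c (m + n) i n p q) \<otimes>\<^bsub>\<Lambda>\<^esub> ?g p q) \<in> carrier \<Lambda>"
        by (rule \<Lambda>.finsum_closed) (use g p in auto)
      ultimately show "\<kappa> 1 \<otimes>\<^bsub>\<Lambda>\<^esub> reg.lc {..<N m} (c (m + n) i n p) (?g p) = (\<Oplus>\<^bsub>\<Lambda>\<^esub>q\<in>{..<N m}. \<kappa> (c (n + m) i n p q) \<otimes>\<^bsub>\<Lambda>\<^esub> ?g p q)"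
        by (simp only: \<Lambda>.\<kappa>_one \<Lambda>.l_one add.commute[of m n])
    qed (use g in \<open>auto intro!: \<Lambda>.finsum_closed\<close>)
    finally show "compose (carrier (P (m + n))) \<eta> (\<Theta> n) (\<epsilon> (m + n) i) =
        (\<Oplus>\<^bsub>\<Lambda>\<^esub>p\<in>{..<N n}. \<Oplus>\<^bsub>\<Lambda>\<^esub>q\<in>{..<N m}. \<kappa> (c (n + m) i n p q) \<otimes>\<^bsub>\<Lambda>\<^esub> ?g p q)"
      using i by (simp only: compose_eq[OF \<epsilon>_closed[OF i]] \<Theta>(2)[OF i])
  qed (rule res.yoneda_product_eq[OF \<eta> \<theta> \<Theta>(1), symmetric])
qed

end

theorem theorem2p3:
  fixes Q :: "('v, 'b) pre_digraph"
    and I :: "('v, 'b, 'k::field) path_comb set"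
    and N :: "nat \<Rightarrow> nat"
    and f :: "nat \<Rightarrow> nat \<Rightarrow> ('v, 'b, 'k) path_comb"
    and c :: "nat \<Rightarrow> nat \<Rightarrow> nat \<Rightarrow> nat \<Rightarrow> nat \<Rightarrow> 'k"
    and \<Lambda> :: "('v, 'b, 'k) path_comb set ring"
    and P :: "nat \<Rightarrow> (('v, 'b, 'k) path_comb set, ('v, 'b, 'k) res_elt) bimod"
    and \<epsilon> :: "nat \<Rightarrow> nat \<Rightarrow> ('v, 'b, 'k) res_elt"
    and \<delta> :: "nat \<Rightarrow> ('v, 'b, 'k) res_elt \<Rightarrow> ('v, 'b, 'k) res_elt"
    and \<delta>0 :: "('v, 'b, 'k) res_elt \<Rightarrow> ('v, 'b, 'k) path_comb set"
    and \<eta> \<theta> :: "('v, 'b, 'k) res_elt \<Rightarrow> ('v, 'b, 'k) path_comb set"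
    and lam lam' :: "nat \<Rightarrow> ('v, 'b, 'k) path_comb set"
    and n m :: nat
  assumes "fin_digraph Q"
    and "ideal I (path_algebra Q)"
    and "I \<subseteq> arrow_ideal Q \<cdot>\<^bsub>path_algebra Q\<^esub> arrow_ideal Q"
    and "koszul Q I"
    and "defines_minimal_resolution Q I N f"
    and "comultiplicative_structure Q N f c"
    and "\<Lambda> = quot_alg Q I"
    and "P = bires Q I N f"
    and "\<epsilon> = bires_gen Q I N f"
    and "\<delta> = bires_diff Q I N f c"
    and "\<delta>0 = bires_aug Q I N f"
    and "\<eta> \<in> HH_cocycles \<Lambda> P \<delta> n"
    and "\<theta> \<in> HH_cocycles \<Lambda> P \<delta> m"
    and "\<forall>i<N n. \<eta> (\<epsilon> n i) = lam i"
    and "\<forall>i<N m. \<theta> (\<epsilon> m i) = lam' i"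
  shows "\<exists>\<zeta>\<in>HH_cocycles \<Lambda> P \<delta> (m + n).
           (\<forall>i<N (m + n). \<zeta> (\<epsilon> (m + n) i) =
              (\<Oplus>\<^bsub>\<Lambda>\<^esub>p\<in>{..<N n}. \<Oplus>\<^bsub>\<Lambda>\<^esub>q\<in>{..<N m}.
                 quot_scalar Q I (c (n + m) i n p q) \<otimes>\<^bsub>\<Lambda>\<^esub> (lam p \<otimes>\<^bsub>\<Lambda>\<^esub> lam' q))) \<and>
           HH_class \<Lambda> P \<delta> (m + n) \<zeta> =
             yoneda_product \<Lambda> P \<delta> \<delta>0 n m (HH_class \<Lambda> P \<delta> n \<eta>) (HH_class \<Lambda> P \<delta> m \<theta>)"
proof -
  \<comment> \<open>Koszulness supplies the homogeneity of \<open>I\<close>, on which truncation and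
    the graded normal forms rest.\<close>
  have "resolution_family Q I N f c"
    using assms(1,2,4,5,6) by (intro resolution_family.intro quiver_quotient.intro resolution_family_axioms.intro) (simp_all add: koszul_def)
  from resolution_family.cup_product_formula[OF this] show ?thesis using assms(12-15) unfolding assms(7-11) .
qed

end
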